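(* Let $\Bbbk$ be an algebraically closed field of characteristic zero. Let $A$ be a graded Poisson algebra $\Bbbk[x_1,x_2,x_3]$ with $\deg(x_i)=1$ for $i=1,2,3$. Let $Z$ be the Poisson center of $A$. Then the following are equivalent. (1) $rgt(A)=0$. (2) Any graded twist of $A$ is isomorphic to $A$. (3) The Hilbert series of the graded vector space of Poisson derivations of $A$ is $\frac{1}{(1-t)^3}$. (4) $h_{PH^1(A)}(t)$ is $\frac{1}{1-t^3}$. (5) $h_{PH^1(A)}(t)$ is equal to $h_Z(t)$. (6) Every Poisson derivation $\phi$ of $A$ has a decomposition $\phi=zE+H_a$ where $z\in Z$ and $a\in A$. Here $z$ is unique and $a$ is unique up to a central element. (7) Every ozone derivation of $A$ is Hamiltonian. (8) $A$ is unimodular and the potential is irreducible. (9) $h_{PH^3(A)}(t)-h_{PH^2(A)}(t)=t^{-3}$.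
   Context: The bracket of a graded Poisson algebra satisfies $\deg\{a,b\}=\deg a+\deg b$ for homogeneous $a,b$ (so here it is quadratic). For homogeneous $a$, $|a|=\deg a$; the Euler derivation is $E(a)=|a|\,a$. The Poisson center is $Z=\{z\in A:\{z,A\}=0\}$. $H_a=\{a,-\}$ is the Hamiltonian derivation of $a$. A Poisson derivation is a derivation $\phi$ with $\phi(\{a,b\})=\{\phi(a),b\}+\{a,\phi(b)\}$; it is ozone if $\phi(z)=0$ for all $z\in Z$. Semi-Poisson: a derivation $\delta$ is semi-Poisson if, with $D(b,c)=\delta(\{b,c\})-\{\delta(b),c\}-\{b,\delta(c)\}$, one has $|a|a\,D(b,c)-|b|b\,D(a,c)+|c|c\,D(a,b)=0$ for all homogeneous $a,b,c$. $Gspd(A)$ is the $\Bbbk$-vector space of graded semi-Poisson derivations of degree $0$. The rigidity of graded twisting is $rgt(A)=1-\dim_\Bbbk Gspd(A)$. A graded twist of $A$ is $A^{\delta}$ for some $\delta\in Gspd(A)$: the same graded commutative algebra with the Poisson bracket $\{a,b\}_{new}=\{a,b\}+E(a)\delta(b)-\delta(a)E(b)$. Unimodular: for a derivation $\delta$ put $\operatorname{div}(\delta)=\sum_i\frac{\partial\delta(x_i)}{\partial x_i}$; the modular derivation is ${\mathbf m}(a)=-\operatorname{div}(H_a)$, and $A$ is unimodular if ${\mathbf m}=0$. If $A$ is unimodular there is a homogeneous $\Omega\in A$ of degree $3$ (possibly zero), called the potential, with $\{x_1,x_2\}=\frac{\partial\Omega}{\partial x_3}$, $\{x_2,x_3\}=\frac{\partial\Omega}{\partial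 x_1}$, $\{x_3,x_1\}=\frac{\partial\Omega}{\partial x_2}$. Poisson cohomology: ${\mathfrak X}^q(A)$ is the space of skew-symmetric $q$-derivations of $A$, i.e. skew-symmetric $\Bbbk$-multilinear maps $A^q\to A$ that are derivations in each argument (${\mathfrak X}^0(A)=A$), graded so that $Q$ has degree $d$ if $\deg Q[F_1,\ldots,F_q]=\sum|F_i|+d$ for homogeneous $F_i$. The differential $d_\pi^q:{\mathfrak X}^q(A)\to{\mathfrak X}^{q+1}(A)$ is $$d_\pi^q(Q)[F_0,\ldots,F_q]=\sum_{i=0}^q(-1)^i\{F_i,Q[F_0,\ldots,\widehat{F_i},\ldots,F_q]\}+\sum_{0\le i<j\le q}(-1)^{i+j}Q[\{F_i,F_j\},F_0,\ldots,\widehat{F_i},\ldots,\widehat{F_j},\ldots,F_q],$$ and $PH^q(A)=\ker d_\pi^q/\operatorname{im} d_\pi^{q-1}$, a graded vector space. In particular $PH^1(A)$ is the space of Poisson derivations modulo Hamiltonian derivations. The Hilbert series of a $\mathbb{Z}$-graded vector space $M$ is $h_M(t)=\sum_{i\in\mathbb{Z}}(\dim M_i)t^i$.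
   Formalization: The equivalence with (7) is stated only for a nonzero Poisson bracket: for the zero bracket Z = A, so the only ozone derivation is 0, which is Hamiltonian and (7) holds, while rgt(A) = 1 - 9 = -8; all other equivalences are stated for every bracket. *)

theory Defs
  imports
    "HOL-Library.Poly_Mapping"
    "HOL-Library.Numeral_Type"
    "HOL-Library.Function_Algebras"
    "HOL-Computational_Algebra.Computational_Algebra"
begin

section \<open>The graded polynomial ring in three variables\<close>

text \<open>
  A monomial is an exponent vector indexed by the three-element type \<open>3\<close>, whose elements are
  written \<open>1\<close>, \<open>2\<close>, \<open>3\<close> (with \<open>3 = 0\<close>). Multiplication of \<open>Poly_Mapping\<close>s is convolution,
  so \<open>'k poly3\<close> is the polynomial ring as a type in class \<^class>\<open>comm_ring_1\<close>.
\<close>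

type_synonym 'k poly3 = "(3 \<Rightarrow>\<^sub>0 nat) \<Rightarrow>\<^sub>0 'k"

definition X :: "3 \<Rightarrow> 'k::field poly3" where
  "X i = Poly_Mapping.single (Poly_Mapping.single i 1) 1"

definition smult3 :: "'k::field \<Rightarrow> 'k poly3 \<Rightarrow> 'k poly3" where
  "smult3 c p = Poly_Mapping.single 0 c * p"

definition mon_deg :: "(3 \<Rightarrow>\<^sub>0 nat) \<Rightarrow> nat" where
  "mon_deg m = (\<Sum>i\<in>UNIV. Poly_Mapping.lookup m i)"

text \<open>Zero is homogeneous of every degree; the component of negative degree is \<open>{0}\<close>.\<close>

definition homog :: "int \<Rightarrow> 'k::field poly3 \<Rightarrow> bool" where
  "homog d p \<longleftrightarrow> (\<forall>m\<in>Poly_Mapping.keys p. int (mon_deg m) = d)"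

text \<open>The truncated subtraction of exponents only matters where the coefficient vanishes.\<close>

definition pd :: "3 \<Rightarrow> 'k::field poly3 \<Rightarrow> 'k poly3" where
  "pd i p = (\<Sum>m\<in>Poly_Mapping.keys p.
     Poly_Mapping.single (m - Poly_Mapping.single i 1) (of_nat (Poly_Mapping.lookup m i) * Poly_Mapping.lookup p m))"

definition euler :: "'k::field poly3 \<Rightarrow> 'k poly3" where
  "euler p = (\<Sum>m\<in>Poly_Mapping.keys p. Poly_Mapping.single m (of_nat (mon_deg m) * Poly_Mapping.lookup p m))"

definition smult_fun :: "'k::field \<Rightarrow> ('b \<Rightarrow> 'k poly3) \<Rightarrow> 'b \<Rightarrow> 'k poly3" where
  "smult_fun c f = (\<lambda>x. smult3 c (f x))"

lemma single_zero_mult_single_zero: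
  "Poly_Mapping.single 0 a * Poly_Mapping.single 0 b =
     (Poly_Mapping.single 0 (a * b) :: 'k::field poly3)"
  by (simp add: mult_single)

lemma vector_space_smult3: "vector_space (smult3 :: 'k::field \<Rightarrow> _)"
  by unfold_locales
    (simp_all add: smult3_def algebra_simps single_add
      flip: single_zero_mult_single_zero)

lemma vector_space_smult_fun:
  "vector_space (smult_fun :: 'k::field \<Rightarrow> ('b \<Rightarrow> 'k poly3) \<Rightarrow> _)"
proof -
  interpret vector_space "smult3 :: 'k \<Rightarrow> _" by (rule vector_space_smult3)
  show ?thesis
    by unfold_locales
      (simp_all add: smult_fun_def fun_eq_iff scale_right_distrib scale_left_distrib)
qed


section \<open>Dimensions and Hilbert series\<close>

text \<open>
  A finite basis of the quotient \<open>V / W\<close>, given by representatives: every element of \<open>V\<close> is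
  congruent modulo \<open>W\<close> to exactly one linear combination of \<open>B\<close>.
\<close>

definition quotient_basis ::
  "('k::field \<Rightarrow> 'v::ab_group_add \<Rightarrow> 'v) \<Rightarrow> 'v set \<Rightarrow> 'v set \<Rightarrow> 'v set \<Rightarrow> bool" where
  "quotient_basis scale V W B \<longleftrightarrow> finite B \<and> B \<subseteq> V \<and>
     (\<forall>v\<in>V. \<exists>!c. (\<forall>b. b \<notin> B \<longrightarrow> c b = 0) \<and> v - (\<Sum>b\<in>B. scale (c b) b) \<in> W)"

text \<open>As for the library's \<open>dim\<close>, the value is \<open>0\<close> if the space has no finite basis.\<close>

definition quotient_dim ::
  "('k::field \<Rightarrow> 'v::ab_group_add \<Rightarrow> 'v) \<Rightarrow> 'v set \<Rightarrow> 'v set \<Rightarrow> nat" where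
  "quotient_dim scale V W =
     (if \<exists>B. quotient_basis scale V W B then card (SOME B. quotient_basis scale V W B) else 0)"

text \<open>
  The Hilbert series as a formal Laurent series, from the dimensions of the homogeneous
  components. It is used only for graded spaces bounded below with finite-dimensional
  components, for which \<open>Abs_fls\<close> and \<open>dim\<close> have their intended values.
\<close>

definition hilbert_series :: "(int \<Rightarrow> nat) \<Rightarrow> rat fls" where
  "hilbert_series d = Abs_fls (\<lambda>n. of_nat (d n))"


section \<open>Derivations and graded Poisson brackets\<close>

definition derivation :: "('k::field poly3 \<Rightarrow> 'k poly3) \<Rightarrow> bool" where
  "derivation \<delta> \<longleftrightarrow> Vector_Spaces.linear smult3 smult3 \<delta> \<and>
     (\<forall>a b. \<delta> (a * b) = \<delta> a * b + a * \<delta> b)"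

definition map_degree :: "int \<Rightarrow> ('k::field poly3 \<Rightarrow> 'k poly3) \<Rightarrow> bool" where
  "map_degree n \<phi> \<longleftrightarrow> (\<forall>i a. homog i a \<longrightarrow> homog (i + n) (\<phi> a))"

type_synonym 'k bracket = "'k poly3 \<Rightarrow> 'k poly3 \<Rightarrow> 'k poly3"

definition graded_poisson :: "'k::field bracket \<Rightarrow> bool" where
  "graded_poisson br \<longleftrightarrow>
     (\<forall>a. derivation (\<lambda>b. br a b)) \<and>
     (\<forall>b. derivation (\<lambda>a. br a b)) \<and>
     (\<forall>a. br a a = 0) \<and>
     (\<forall>a b c. br a (br b c) + br b (br c a) + br c (br a b) = 0) \<and>
     (\<forall>i j a b. homog i a \<longrightarrow> homog j b \<longrightarrow> homog (i + j) (br a b))"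

definition poisson_center :: "'k::field bracket \<Rightarrow> 'k poly3 set" where
  "poisson_center br = {z. \<forall>a. br z a = 0}"

definition hamiltonian :: "'k::field bracket \<Rightarrow> 'k poly3 \<Rightarrow> 'k poly3 \<Rightarrow> 'k poly3" where
  "hamiltonian br a = (\<lambda>b. br a b)"

definition poisson_derivation :: "'k::field bracket \<Rightarrow> ('k poly3 \<Rightarrow> 'k poly3) \<Rightarrow> bool" where
  "poisson_derivation br \<phi> \<longleftrightarrow> derivation \<phi> \<and>
     (\<forall>a b. \<phi> (br a b) = br (\<phi> a) b + br a (\<phi> b))"

definition ozone_derivation :: "'k::field bracket \<Rightarrow> ('k poly3 \<Rightarrow> 'k poly3) \<Rightarrow> bool" where
  "ozone_derivation br \<phi> \<longleftrightarrow> poisson_derivation br \<phi> \<and> (\<forall>z\<in>poisson_center br. \<phi> z = 0)"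

definition poisson_isomorphic :: "'k::field bracket \<Rightarrow> 'k bracket \<Rightarrow> bool" where
  "poisson_isomorphic br br' \<longleftrightarrow> (\<exists>f. bij f \<and> Vector_Spaces.linear smult3 smult3 f \<and>
     f 1 = 1 \<and> (\<forall>a b. f (a * b) = f a * f b) \<and> (\<forall>a b. f (br a b) = br' (f a) (f b)))"


section \<open>Graded twists and their rigidity\<close>

definition semi_poisson :: "'k::field bracket \<Rightarrow> ('k poly3 \<Rightarrow> 'k poly3) \<Rightarrow> bool" where
  "semi_poisson br \<delta> \<longleftrightarrow> derivation \<delta> \<and>
     (let D = (\<lambda>b c. \<delta> (br b c) - br (\<delta> b) c - br b (\<delta> c)) in
      \<forall>i j k a b c. homog i a \<longrightarrow> homog j b \<longrightarrow> homog k c \<longrightarrow>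
        of_int i * a * D b c - of_int j * b * D a c + of_int k * c * D a b = 0)"

definition Gspd :: "'k::field bracket \<Rightarrow> ('k poly3 \<Rightarrow> 'k poly3) set" where
  "Gspd br = {\<delta>. semi_poisson br \<delta> \<and> map_degree 0 \<delta>}"

definition rgt :: "'k::field bracket \<Rightarrow> int" where
  "rgt br = 1 - int (vector_space.dim smult_fun (Gspd br))"

definition graded_twist :: "'k::field bracket \<Rightarrow> ('k poly3 \<Rightarrow> 'k poly3) \<Rightarrow> 'k bracket" where
  "graded_twist br \<delta> = (\<lambda>a b. br a b + euler a * \<delta> b - \<delta> a * euler b)"


section \<open>Unimodularity\<close>

definition divergence :: "('k::field poly3 \<Rightarrow> 'k poly3) \<Rightarrow> 'k poly3" where
  "divergence \<delta> = (\<Sum>i\<in>UNIV. pd i (\<delta> (X i)))"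

definition modular_derivation :: "'k::field bracket \<Rightarrow> 'k poly3 \<Rightarrow> 'k poly3" where
  "modular_derivation br a = - divergence (hamiltonian br a)"

definition unimodular :: "'k::field bracket \<Rightarrow> bool" where
  "unimodular br \<longleftrightarrow> (\<forall>a. modular_derivation br a = 0)"

definition is_potential :: "'k::field bracket \<Rightarrow> 'k poly3 \<Rightarrow> bool" where
  "is_potential br \<Omega> \<longleftrightarrow> homog 3 \<Omega> \<and>
     br (X 1) (X 2) = pd 3 \<Omega> \<and> br (X 2) (X 3) = pd 1 \<Omega> \<and> br (X 3) (X 1) = pd 2 \<Omega>"


section \<open>Poisson cohomology\<close>

text \<open>
  A \<open>q\<close>-ary map is encoded as a function on lists that vanishes on lists of length other
  than \<open>q\<close>, so that cochains of different arities live in one vector space of functions. A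
  \<open>0\<close>-cochain \<open>Q\<close> is the element \<open>Q []\<close>.
\<close>

definition multiderivation :: "nat \<Rightarrow> ('k::field poly3 list \<Rightarrow> 'k poly3) \<Rightarrow> bool" where
  "multiderivation q Q \<longleftrightarrow>
     (\<forall>xs. length xs \<noteq> q \<longrightarrow> Q xs = 0) \<and>
     (\<forall>xs i. length xs = q \<longrightarrow> i < q \<longrightarrow> derivation (\<lambda>a. Q (xs[i := a]))) \<and>
     (\<forall>xs i j. length xs = q \<longrightarrow> i < j \<longrightarrow> j < q \<longrightarrow> Q (xs[i := xs ! j, j := xs ! i]) = - Q xs)"

definition multi_degree :: "int \<Rightarrow> ('k::field poly3 list \<Rightarrow> 'k poly3) \<Rightarrow> bool" where
  "multi_degree d Q \<longleftrightarrow> (\<forall>ds xs. list_all2 homog ds xs \<longrightarrow> homog (sum_list ds + d) (Q xs))"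

text \<open>\<open>nths Fs (- {i, j})\<close> is the list \<open>Fs\<close> with the entries at positions \<open>i\<close>, \<open>j\<close> removed.\<close>

definition poisson_diff ::
  "'k::field bracket \<Rightarrow> nat \<Rightarrow> ('k poly3 list \<Rightarrow> 'k poly3) \<Rightarrow> 'k poly3 list \<Rightarrow> 'k poly3" where
  "poisson_diff br q Q = (\<lambda>Fs. if length Fs = Suc q then
       (\<Sum>i\<le>q. (-1) ^ i * br (Fs ! i) (Q (nths Fs (- {i})))) +
       (\<Sum>j\<le>q. \<Sum>i<j. (-1) ^ (i + j) * Q (br (Fs ! i) (Fs ! j) # nths Fs (- {i, j})))
     else 0)"

definition cocycles ::
  "'k::field bracket \<Rightarrow> nat \<Rightarrow> int \<Rightarrow> ('k poly3 list \<Rightarrow> 'k poly3) set" where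
  "cocycles br q n = {Q. multiderivation q Q \<and> multi_degree n Q \<and> poisson_diff br q Q = 0}"

fun coboundaries ::
  "'k::field bracket \<Rightarrow> nat \<Rightarrow> int \<Rightarrow> ('k poly3 list \<Rightarrow> 'k poly3) set" where
  "coboundaries br 0 n = {0}"
| "coboundaries br (Suc q) n =
     {poisson_diff br q R | R. multiderivation q R} \<inter> {Q. multi_degree n Q}"

definition hilbert_PH :: "'k::field bracket \<Rightarrow> nat \<Rightarrow> rat fls" where
  "hilbert_PH br q =
     hilbert_series (\<lambda>n. quotient_dim smult_fun (cocycles br q n) (coboundaries br q n))"

definition hilbert_center :: "'k::field bracket \<Rightarrow> rat fls" where
  "hilbert_center br =
     hilbert_series (\<lambda>n. vector_space.dim smult3 {z \<in> poisson_center br. homog n z})"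

definition hilbert_poisson_derivations :: "'k::field bracket \<Rightarrow> rat fls" where
  "hilbert_poisson_derivations br =
     hilbert_series (\<lambda>n. vector_space.dim smult_fun
       {\<phi>. poisson_derivation br \<phi> \<and> map_degree n \<phi>})"

end

theory Submission
  imports Defs
begin

text \<open>
  A quadratic bracket is a vector \<open>P\<close> of quadratic forms with \<open>P \<cdot> curl P = 0\<close>. With
  \<open>3 \<Omega> = X \<cdot> P\<close>, a linear vector field \<open>v\<close> is semi-Poisson iff \<open>v(\<Omega>) = div(v) \<Omega>\<close>, so modulo the
  Euler field \<open>rgt = 0\<close> says that no nonzero divergence-free linear field annihilates \<open>\<Omega>\<close>. The
  field \<open>curl P\<close> is such a field, hence \<open>rgt = 0\<close> forces \<open>P = \<nabla>\<Omega>\<close>, and a reducible \<open>\<Omega>\<close> is excluded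
  by an explicit linear field.

  Conversely, an irreducible cubic has a flex and so a normal form that degenerates to the cuspidal
  cubic \<open>z y\<^sup>2 + x\<^sup>3\<close>. For the latter a torus action shows that every divergence-free field
  annihilating \<open>\<Omega>\<close> is Hamiltonian, which lifts to the normal form by induction on leading terms;
  leading terms also show that the center is generated by \<open>\<Omega>\<close>. These facts yield the decomposition
  \<open>z E + H\<^sub>a\<close> and the Hilbert series of \<open>PH\<^sup>1\<close>. The remaining series follow from the Euler
  characteristic of the cochain complex, \<open>h(PH\<^sup>3) - h(PH\<^sup>2) = t\<^sup>-\<^sup>3 + h(Z) - h(PH\<^sup>1)\<close>.
\<close>

text \<open>The usual tool, exactness of the Koszul complex of the partials of \<Omega>, covers only
  smooth cubics; nodal and cuspidal potentials are irreducible too, and their partials have common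
  zeros off the origin. A flex normal form treats all three kinds at once: the weights
  \<open>w_cusp\<close> single out a cuspidal leading form, and exactness passes from a leading form
  to the whole form. So only the most degenerate curve has to be computed, and it is the one with a
  torus symmetry. Algebraic closure enters through the flex, a common zero of cubic and Hessian
  found by eliminating one variable.

  Rigidity is mostly detected in degree 0: the modular field and, once that vanishes, the
  divergence-free linear fields that kill \<Omega> are Poisson derivations of degree 0, whereas no
  nonzero Hamiltonian derivation has degree 0. Hence one coefficient of the series of
  \<open>PH 1\<close> recovers rigidity, while its full value needs the structure of the center.
  Twists are different: there the invariant is the curl, which a twist by a divergence-free linear
  \<open>v\<close> shifts by \<open>- 3 * v\<close>.\<close>

lemma exhaust_3: fixes i :: 3 shows "i = 1 \<or> i = 2 \<or> i = 3"
proof (induct i)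
  case (of_int z)
  then have "z = 0 \<or> z = 1 \<or> z = 2" by auto
  then show ?case by auto
qed

lemma forall_3: "(\<forall>i::3. P i) \<longleftrightarrow> P 1 \<and> P 2 \<and> P 3"
  by (metis exhaust_3)

lemma UNIV_3: "UNIV = {1, 2, 3::3}"
  using exhaust_3 by auto

lemma distinct_3 [simp]:
  "(1::3) \<noteq> 2" "(1::3) \<noteq> 3" "(2::3) \<noteq> 1" "(2::3) \<noteq> 3" "(3::3) \<noteq> 1" "(3::3) \<noteq> 2"
  "(0::3) = 3"
  by auto

lemma sum_3: "sum f (UNIV::3 set) = f 1 + f 2 + f 3"
  unfolding UNIV_3 by (simp add: ac_simps)

lemma fun_eq_3: "(f::3 \<Rightarrow> 'a) = g \<longleftrightarrow> f 1 = g 1 \<and> f 2 = g 2 \<and> f 3 = g 3"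
  by (simp add: fun_eq_iff forall_3)

section \<open>Constants and induction principles for polynomials\<close>

definition cst :: "'k::field \<Rightarrow> 'k poly3" where
  "cst c = Poly_Mapping.single 0 c"

lemma cst_simps [simp]:
  fixes a b :: "'k::field"
  shows "cst (0::'k) = 0" "cst (1::'k) = 1" "cst (a + b) = cst a + cst b" "cst (a - b) = cst a - cst b"
  "cst (- a) = - cst a" "cst (a * b) = cst a * cst b" "cst (a ^ n) = cst a ^ n"
  "cst (of_nat n :: 'k) = of_nat n" "cst (of_int k :: 'k) = of_int k" "cst (numeral u :: 'k) = numeral u"
  "cst a = cst b \<longleftrightarrow> a = b" "cst a = 0 \<longleftrightarrow> a = 0" "cst a = 1 \<longleftrightarrow> a = 1"
proof -
  show *: "cst (a * b) = cst a * cst b" for a b :: 'k by (simp add: cst_def mult_single)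
  show **: "cst (1::'k) = 1" by (simp add: cst_def)
  show "cst (a ^ n) = cst a ^ n" by (induction n) (simp_all add: * **)
  show "cst a = cst b \<longleftrightarrow> a = b" by (metis cst_def lookup_single_eq)
  show "cst a = 0 \<longleftrightarrow> a = 0" by (metis cst_def lookup_single_eq lookup_zero single_zero)
  show "cst a = 1 \<longleftrightarrow> a = 1" by (metis cst_def lookup_single_eq single_one)
qed (simp_all add: cst_def single_add single_diff single_uminus)

lemma smult3_cst: "smult3 c p = cst c * p"
  by (simp add: smult3_def cst_def)

lemma cst_inverse: "c \<noteq> 0 \<Longrightarrow> cst c * cst (inverse c) = 1" "c \<noteq> 0 \<Longrightarrow> cst (inverse c) * cst c = 1"
  by (simp_all flip: cst_simps(6))

lemma single_cst: "Poly_Mapping.single m c = cst c * Poly_Mapping.single m 1"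
  by (simp add: cst_def mult_single)

lemma lookup_cst_mult: "Poly_Mapping.lookup (cst c * p) m = c * Poly_Mapping.lookup p m"
  unfolding cst_def mult_map_scale_conv_mult[symmetric]
  by (simp add: Poly_Mapping.map.rep_eq when_def)

lemma poly_mapping_expand:
  "p = (\<Sum>m\<in>Poly_Mapping.keys p. Poly_Mapping.single m (Poly_Mapping.lookup p m))"
  by (rule poly_mapping_eqI)
    (simp add: lookup_sum lookup_single when_def in_keys_iff)

lemma poly_mapping_additive_induct [case_names single add]:
  fixes p :: "'a \<Rightarrow>\<^sub>0 'b::comm_monoid_add"
  assumes s: "\<And>m c. P (Poly_Mapping.single m c)"
    and a: "\<And>p q. P p \<Longrightarrow> P q \<Longrightarrow> P (p + q)"
  shows "P p"
proof -
  have "P (\<Sum>m\<in>S. Poly_Mapping.single m (Poly_Mapping.lookup p m))" if "finite S" for S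
    using that
  proof (induction S)
    case empty
    show ?case using s[of undefined 0] by simp
  qed (simp add: s a)
  from this[of "Poly_Mapping.keys p"] show ?thesis
    by (simp flip: poly_mapping_expand)
qed

lemma single_induct_3:
  fixes m :: "3 \<Rightarrow>\<^sub>0 nat"
  assumes "P 0" "\<And>m i. P m \<Longrightarrow> P (m + Poly_Mapping.single i 1)"
  shows "P m"
proof -
  have *: "P (q + Poly_Mapping.single i n)" if "P q" for q i n
  proof (induction n)
    case (Suc n)
    have "q + Poly_Mapping.single i (Suc n) = q + Poly_Mapping.single i n + Poly_Mapping.single i 1"
      by (simp add: add.assoc flip: single_add)
    then show ?case using assms(2)[OF Suc] by simp
  qed (use that in simp)
  show ?thesis
  proof (induction m rule: update_induct)
    case (update f a b)
    have "Poly_Mapping.update a b f = f + Poly_Mapping.single a b"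
      using update by (intro poly_mapping_eqI) (auto simp: lookup_update lookup_add lookup_single when_def in_keys_iff)
    then show ?case using update * by simp
  qed (use assms in simp)
qed

text \<open>Monomials are products of variables, so statements stable under sums and products need
  checking on constants and variables only. Derivations, algebra homomorphisms and brackets are all
  compared this way.\<close>

lemma poly3_induct [case_names const var add mult]:
  fixes p :: "'k::field poly3"
  assumes c: "\<And>c. P (cst c)" and X: "\<And>i. P (X i)"
    and a: "\<And>p q. P p \<Longrightarrow> P q \<Longrightarrow> P (p + q)" and m: "\<And>p q. P p \<Longrightarrow> P q \<Longrightarrow> P (p * q)"
  shows "P p"
proof (induction p rule: poly_mapping_additive_induct)
  case (single k d)
  have "P (Poly_Mapping.single k 1)"
  proof (induction k rule: single_induct_3)
    case 1
    show ?case using c[of 1] by simp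
  next
    case (2 k i)
    have "Poly_Mapping.single (k + Poly_Mapping.single i 1) (1::'k) = Poly_Mapping.single k 1 * X i"
      by (simp add: X_def mult_single)
    then show ?case using 2 X m by metis
  qed
  then show ?case using c m by (metis single_cst)
qed (rule a)

section \<open>Partial derivatives\<close>

text \<open>The definition sums over the support of \<open>p\<close>, which is not visibly additive
  and uses truncated subtraction. This coefficient formula has neither defect; linearity,
  commutation and the behaviour under gradings are read off from it.\<close>

lemma lookup_pd:
  "Poly_Mapping.lookup (pd i p) m
     = of_nat (Suc (Poly_Mapping.lookup m i)) * Poly_Mapping.lookup p (m + Poly_Mapping.single i 1)"
proof -
  have "Poly_Mapping.lookup (pd i p) m = (\<Sum>k\<in>Poly_Mapping.keys p.
    (of_nat (Poly_Mapping.lookup k i) * Poly_Mapping.lookup p k when k - Poly_Mapping.single i 1 = m))"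
    by (simp add: pd_def lookup_sum lookup_single)
  also have "\<dots> = (\<Sum>k\<in>Poly_Mapping.keys p.
    (of_nat (Poly_Mapping.lookup k i) * Poly_Mapping.lookup p k when k = m + Poly_Mapping.single i 1))"
  proof (rule sum.cong[OF refl])
    fix k
    have "k - Poly_Mapping.single i 1 = m \<longleftrightarrow> k = m + Poly_Mapping.single i 1"
      if "Poly_Mapping.lookup k i \<noteq> 0"
    proof
      assume h: "k - Poly_Mapping.single i 1 = m"
      show "k = m + Poly_Mapping.single i 1"
        using that unfolding h[symmetric]
        by (intro poly_mapping_eqI) (auto simp: lookup_add lookup_minus lookup_single when_def)
    qed simp
    \<comment> \<open>If the exponent is 0, both summands vanish because of the factor, whatever the
      truncated subtraction returns.\<close>
    then show "(of_nat (Poly_Mapping.lookup k i) * Poly_Mapping.lookup p k when k - Poly_Mapping.single i 1 = m)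
      = (of_nat (Poly_Mapping.lookup k i) * Poly_Mapping.lookup p k when k = m + Poly_Mapping.single i 1)"
      by (cases "Poly_Mapping.lookup k i = 0") auto
  qed
  also have "\<dots> = of_nat (Suc (Poly_Mapping.lookup m i)) * Poly_Mapping.lookup p (m + Poly_Mapping.single i 1)"
    by (auto simp: when_def sum.delta lookup_add in_keys_iff)
  finally show ?thesis .
qed

lemma pd_add [simp]: "pd i (p + q) = pd i p + pd i q"
  by (rule poly_mapping_eqI) (simp add: lookup_pd lookup_add algebra_simps)

lemma pd_0 [simp]: "pd i 0 = 0"
  by (rule poly_mapping_eqI) (simp add: lookup_pd)

lemma pd_uminus [simp]: "pd i (- p) = - pd i p"
  using pd_add[of i p "- p"] by (simp add: eq_neg_iff_add_eq_0 add.commute)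

lemma pd_diff [simp]: "pd i (p - q) = pd i p - pd i q"
  using pd_add[of i p "- q"] by simp

lemma pd_sum: "pd i (sum f S) = (\<Sum>x\<in>S. pd i (f x))"
  by (induction S rule: infinite_finite_induct) auto

lemma pd_cst [simp]: "pd i (cst c) = 0"
proof (rule poly_mapping_eqI)
  fix m :: "3 \<Rightarrow>\<^sub>0 nat"
  have "m + Poly_Mapping.single i 1 \<noteq> 0"
    by (metis add_is_0 lookup_add lookup_single_eq lookup_zero one_neq_zero)
  then show "Poly_Mapping.lookup (pd i (cst c)) m = Poly_Mapping.lookup 0 m"
    by (simp add: lookup_pd cst_def lookup_single_not_eq)
qed

lemma pd_const_simps [simp]: "pd i 1 = 0" "pd i (numeral u) = 0" "pd i (of_nat n) = 0" "pd i (of_int k) = 0"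
  using pd_cst[of i 1] pd_cst[of i "numeral u"] pd_cst[of i "of_nat n"] pd_cst[of i "of_int k"]
  by (simp_all del: pd_cst)

lemma pd_cst_mult [simp]: "pd i (cst c * p) = cst c * pd i p"
  by (rule poly_mapping_eqI) (simp add: lookup_pd lookup_cst_mult)

lemma pd_single:
  "pd i (Poly_Mapping.single m c) = Poly_Mapping.single (m - Poly_Mapping.single i 1) (of_nat (Poly_Mapping.lookup m i) * c)"
  by (simp add: pd_def)

lemma X_mult_single: "X i * Poly_Mapping.single m c = Poly_Mapping.single (m + Poly_Mapping.single i 1) c"
  by (simp add: X_def mult_single add.commute)

lemma pd_X: "pd i (X j) = (if i = j then 1 else 0)"
  by (simp add: X_def pd_single lookup_single)

text \<open>The case distinctions keep truncated subtraction honest: lowering an exponent can be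
  undone only when it is positive, and otherwise the coefficient vanishes.\<close>

lemma pd_X_mult_single:
  "pd i (X j * Poly_Mapping.single m c) = pd i (X j) * Poly_Mapping.single m c + X j * pd i (Poly_Mapping.single m c)"
proof (cases "i = j")
  case True
  have "Poly_Mapping.single (m + Poly_Mapping.single j 1 - Poly_Mapping.single j 1)
        (of_nat (Poly_Mapping.lookup (m + Poly_Mapping.single j 1) j) * c) =
      Poly_Mapping.single m c + X j * Poly_Mapping.single (m - Poly_Mapping.single j 1) (of_nat (Poly_Mapping.lookup m j) * c)"
  proof (cases "Poly_Mapping.lookup m j = 0")
    case False
    then have "m - Poly_Mapping.single j 1 + Poly_Mapping.single j 1 = m"
      by (intro poly_mapping_eqI) (auto simp: lookup_add lookup_minus lookup_single when_def)
    then show ?thesis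
      by (simp add: X_mult_single lookup_add algebra_simps single_add)
  qed (simp add: lookup_add)
  then show ?thesis using True by (simp add: X_mult_single pd_single pd_X)
next
  case False
  show ?thesis
  proof (cases "Poly_Mapping.lookup m i = 0")
    case True
    then show ?thesis using False
      by (simp add: X_mult_single pd_single pd_X lookup_add lookup_single)
  next
    case nz: False
    then have "m + Poly_Mapping.single j 1 - Poly_Mapping.single i 1 = m - Poly_Mapping.single i 1 + Poly_Mapping.single j 1"
      using False by (intro poly_mapping_eqI) (auto simp: lookup_add lookup_minus lookup_single when_def)
    then show ?thesis using False
      by (simp add: X_mult_single pd_single pd_X lookup_add lookup_single)
  qed
qed

lemma pd_X_mult: "pd i (X j * q) = pd i (X j) * q + X j * pd i q"
  by (induction q rule: poly_mapping_additive_induct)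
    (simp_all add: pd_X_mult_single algebra_simps)

lemma pd_mult [simp]: "pd i (p * q) = pd i p * q + p * pd i q"
proof (induction p arbitrary: q rule: poly3_induct)
  case (mult p r)
  then show ?case by (simp only: mult.assoc mult.IH) (simp add: algebra_simps)
qed (simp_all add: pd_X_mult distrib_right)

lemma pd_power: "pd i (p ^ Suc n) = of_nat (Suc n) * p ^ n * pd i p"
  by (induction n) (simp_all add: algebra_simps)

lemma pd_power2 [simp]: "pd i (p\<^sup>2) = 2 * p * pd i p"
  by (simp add: power2_eq_square algebra_simps)

lemma pd_power3 [simp]: "pd i (p ^ 3) = 3 * p ^ 2 * pd i p"
  using pd_power[of i p 2] by (simp add: numeral_3_eq_3)

lemma pd_X_simps [simp]:
  "pd 1 (X 1) = 1" "pd 1 (X 2) = 0" "pd 1 (X 3) = 0"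
  "pd 2 (X 1) = 0" "pd 2 (X 2) = 1" "pd 2 (X 3) = 0"
  "pd 3 (X 1) = 0" "pd 3 (X 2) = 0" "pd 3 (X 3) = 1"
  by (simp_all add: pd_X)

lemma pd_commute: "pd i (pd j p) = pd j (pd i p)"
proof (rule poly_mapping_eqI)
  fix m show "Poly_Mapping.lookup (pd i (pd j p)) m = Poly_Mapping.lookup (pd j (pd i p)) m"
    by (cases "i = j") (simp_all add: lookup_pd lookup_add lookup_single add_ac)
qed

lemma pd_commute_simps: "pd 2 (pd 1 p) = pd 1 (pd 2 p)" "pd 3 (pd 1 p) = pd 1 (pd 3 p)" "pd 3 (pd 2 p) = pd 2 (pd 3 p)"
  by (simp_all add: pd_commute)

section \<open>Gradings by weights\<close>

text \<open>Weights are integers since the torus weights \<open>w_tor\<close> include -2; constant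
  weight 1 gives the ordinary degree.\<close>

definition wdeg :: "(3 \<Rightarrow> int) \<Rightarrow> (3 \<Rightarrow>\<^sub>0 nat) \<Rightarrow> int" where
  "wdeg w m = (\<Sum>i\<in>UNIV. w i * int (Poly_Mapping.lookup m i))"

definition whomog :: "(3 \<Rightarrow> int) \<Rightarrow> int \<Rightarrow> 'k::field poly3 \<Rightarrow> bool" where
  "whomog w d p \<longleftrightarrow> (\<forall>m\<in>Poly_Mapping.keys p. wdeg w m = d)"

definition wcomp :: "(3 \<Rightarrow> int) \<Rightarrow> int \<Rightarrow> 'k::field poly3 \<Rightarrow> 'k poly3" where
  "wcomp w d p = Poly_Mapping.mapp (\<lambda>m c. c when wdeg w m = d) p"

lemma homog_whomog: "homog d p \<longleftrightarrow> whomog (\<lambda>_. 1) d p"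
  by (simp add: homog_def whomog_def wdeg_def mon_deg_def)

lemma lookup_wcomp: "Poly_Mapping.lookup (wcomp w d p) m = (if wdeg w m = d then Poly_Mapping.lookup p m else 0)"
  by (simp add: wcomp_def lookup_mapp when_def in_keys_iff)

lemma whomog_lookup: "whomog w d p \<longleftrightarrow> (\<forall>m. Poly_Mapping.lookup p m \<noteq> 0 \<longrightarrow> wdeg w m = d)"
  by (simp add: whomog_def in_keys_iff Ball_def)

lemma wdeg_add: "wdeg w (a + b) = wdeg w a + wdeg w b"
  by (simp add: wdeg_def lookup_add algebra_simps sum.distrib)

lemma wdeg_single: "wdeg w (Poly_Mapping.single i n) = w i * int n"
  by (simp add: wdeg_def lookup_single when_def if_distrib sum.delta cong: if_cong)

lemma wdeg_0 [simp]: "wdeg w 0 = 0"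
  by (simp add: wdeg_def)

lemma whomog_0 [simp]: "whomog w d 0"
  by (simp add: whomog_def)

lemma whomog_add: "whomog w d p \<Longrightarrow> whomog w d q \<Longrightarrow> whomog w d (p + q)"
  unfolding whomog_lookup by (metis add.right_neutral lookup_add add.left_neutral)

lemma whomog_uminus: "whomog w d p \<Longrightarrow> whomog w d (- p)"
  unfolding whomog_lookup by simp

lemma whomog_diff: "whomog w d p \<Longrightarrow> whomog w d q \<Longrightarrow> whomog w d (p - q)"
  using whomog_add[of w d p "- q"] whomog_uminus[of w d q] by simp

lemma whomog_sum: "(\<And>x. x \<in> S \<Longrightarrow> whomog w d (f x)) \<Longrightarrow> whomog w d (sum f S)"
  by (induction S rule: infinite_finite_induct) (auto simp: whomog_add)

lemma whomog_mult: "whomog w a p \<Longrightarrow> whomog w b q \<Longrightarrow> whomog w (a + b) (p * q)"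
  using keys_mult[of p q] by (fastforce simp: whomog_def wdeg_add)

lemma whomog_cst [simp]: "whomog w 0 (cst c)"
  by (simp add: whomog_def cst_def)

lemma whomog_1 [simp]: "whomog w 0 1"
  using whomog_cst[of w 1] by (simp del: whomog_cst)

lemma whomog_cst_mult: "whomog w d p \<Longrightarrow> whomog w d (cst c * p)"
  using whomog_mult[of w 0 "cst c" d p] by simp

lemma whomog_X [simp]: "whomog w (w i) (X i)"
  by (simp add: whomog_def X_def wdeg_single)

lemma whomog_power: "whomog w a p \<Longrightarrow> whomog w (int n * a) (p ^ n)"
proof (induction n)
  case (Suc n)
  then show ?case using whomog_mult[of w a p "int n * a" "p ^ n"] by (simp add: algebra_simps)
qed simp

lemma whomog_pd: "whomog w d p \<Longrightarrow> whomog w (d - w i) (pd i p)"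
  unfolding whomog_lookup lookup_pd using wdeg_add wdeg_single
  by (metis (no_types, lifting) add_diff_cancel_right' mult.right_neutral mult_zero_right of_nat_1)

lemma whomog_wcomp [simp]: "whomog w d (wcomp w d p)"
  by (simp add: whomog_lookup lookup_wcomp)

lemma wcomp_whomog: "whomog w d p \<Longrightarrow> wcomp w e p = (if e = d then p else 0)"
  by (rule poly_mapping_eqI) (auto simp: whomog_lookup lookup_wcomp)

lemma wcomp_add [simp]: "wcomp w d (p + q) = wcomp w d p + wcomp w d q"
  by (rule poly_mapping_eqI) (auto simp: lookup_add lookup_wcomp)

lemma wcomp_0 [simp]: "wcomp w d 0 = 0"
  by (rule poly_mapping_eqI) (auto simp: lookup_wcomp)

lemma wcomp_uminus [simp]: "wcomp w d (- p) = - wcomp w d p"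
  by (rule poly_mapping_eqI) (auto simp: lookup_wcomp)

lemma wcomp_diff [simp]: "wcomp w d (p - q) = wcomp w d p - wcomp w d q"
  by (rule poly_mapping_eqI) (auto simp: lookup_minus lookup_wcomp)

lemma wcomp_sum: "wcomp w d (sum f S) = (\<Sum>x\<in>S. wcomp w d (f x))"
  by (induction S rule: infinite_finite_induct) auto

lemma wcomp_wcomp: "wcomp w d (wcomp w e p) = (if d = e then wcomp w d p else 0)"
  by (rule poly_mapping_eqI) (auto simp: lookup_wcomp)

lemma wcomp_expand:
  assumes "finite D" "\<And>m. m \<in> Poly_Mapping.keys p \<Longrightarrow> wdeg w m \<in> D"
  shows "p = (\<Sum>d\<in>D. wcomp w d p)"
proof (rule poly_mapping_eqI)
  fix m
  show "Poly_Mapping.lookup p m = Poly_Mapping.lookup (\<Sum>d\<in>D. wcomp w d p) m"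
    using assms by (auto simp: lookup_sum lookup_wcomp in_keys_iff sum.delta)
qed

lemma wcomp_expand_keys: "p = (\<Sum>d\<in>wdeg w ` Poly_Mapping.keys p. wcomp w d p)"
  by (rule wcomp_expand) auto

text \<open>Expanding \<open>q\<close> into components makes every summand of the product
  homogeneous for the weight, and only one of them has weight \<open>e\<close>.\<close>

lemma wcomp_mult:
  assumes "whomog w d p"
  shows "wcomp w e (p * q) = p * wcomp w (e - d) q"
proof -
  let ?D = "wdeg w ` Poly_Mapping.keys q"
  have "wcomp w e (p * q) = wcomp w e (p * (\<Sum>a\<in>?D. wcomp w a q))"
    using wcomp_expand_keys[of q w] by simp
  also have "\<dots> = (\<Sum>a\<in>?D. wcomp w e (p * wcomp w a q))"
    by (simp add: sum_distrib_left wcomp_sum)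
  also have "\<dots> = (\<Sum>a\<in>?D. p * wcomp w (e - d) (wcomp w a q))"
  proof (rule sum.cong[OF refl])
    fix a
    have "whomog w (d + a) (p * wcomp w a q)" by (rule whomog_mult) (simp_all add: assms)
    then show "wcomp w e (p * wcomp w a q) = p * wcomp w (e - d) (wcomp w a q)"
      by (auto simp: wcomp_whomog wcomp_wcomp)
  qed
  also have "\<dots> = p * wcomp w (e - d) (\<Sum>a\<in>?D. wcomp w a q)"
    by (simp add: sum_distrib_left wcomp_sum)
  also have "\<dots> = p * wcomp w (e - d) q"
    using wcomp_expand_keys[of q w] by simp
  finally show ?thesis .
qed

lemma wcomp_cst_mult [simp]: "wcomp w d (cst c * p) = cst c * wcomp w d p"
  using wcomp_mult[of w 0 "cst c" d p] by simp

lemma wcomp_pd: "wcomp w d (pd i p) = pd i (wcomp w (d + w i) p)"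
  by (rule poly_mapping_eqI) (auto simp: lookup_wcomp lookup_pd wdeg_add wdeg_single)

text \<open>A monomial is an eigenvector of each \<open>X i * pd i\<close>, with its exponent as
  eigenvalue; the rest is additivity.\<close>

lemma weighted_euler:
  assumes "whomog w d p"
  shows "of_int (w 1) * X 1 * pd 1 p + of_int (w 2) * X 2 * pd 2 p + of_int (w 3) * X 3 * pd 3 p = of_int d * p"
proof -
  have X: "X i * pd i (Poly_Mapping.single m c) = of_nat (Poly_Mapping.lookup m i) * Poly_Mapping.single m c" for i m and c :: 'a
  proof (cases "Poly_Mapping.lookup m i = 0")
    case False
    then have "m - Poly_Mapping.single i 1 + Poly_Mapping.single i 1 = m"
      by (intro poly_mapping_eqI) (auto simp: lookup_add lookup_minus lookup_single when_def)
    then show ?thesis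
      by (simp add: pd_single X_mult_single mult_single flip: single_of_nat)
  qed (simp add: pd_single)
  have s: "of_int (w 1) * X 1 * pd 1 q + of_int (w 2) * X 2 * pd 2 q + of_int (w 3) * X 3 * pd 3 q = of_int (wdeg w m) * q"
    if "q = Poly_Mapping.single m c" for q m and c :: 'a
    by (simp add: that mult.assoc X) (simp add: wdeg_def sum_3 algebra_simps)
  let ?f = "\<lambda>m. Poly_Mapping.single m (Poly_Mapping.lookup p m)"
  let ?E = "\<lambda>p. of_int (w 1) * X 1 * pd 1 p + of_int (w 2) * X 2 * pd 2 p + of_int (w 3) * X 3 * pd 3 p"
  have "?E p = ?E (\<Sum>m\<in>Poly_Mapping.keys p. ?f m)"
    by (simp flip: poly_mapping_expand)
  also have "\<dots> = (\<Sum>m\<in>Poly_Mapping.keys p. ?E (?f m))"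
    by (simp add: pd_sum sum_distrib_left sum.distrib)
  also have "\<dots> = (\<Sum>m\<in>Poly_Mapping.keys p. of_int d * ?f m)"
    by (rule sum.cong[OF refl], subst s[OF refl]) (use assms in \<open>auto simp: whomog_def\<close>)
  also have "\<dots> = of_int d * p"
    by (simp flip: poly_mapping_expand sum_distrib_left)
  finally show ?thesis .
qed

lemmas homog_simps [simp] = whomog_0[of "\<lambda>_. 1", folded homog_whomog] whomog_1[of "\<lambda>_. 1", folded homog_whomog]
  whomog_cst[of "\<lambda>_. 1", folded homog_whomog]
lemmas homog_X [simp] = whomog_X[of "\<lambda>_. 1", folded homog_whomog]
lemmas homog_add = whomog_add[of "\<lambda>_. 1", folded homog_whomog]
lemmas homog_diff = whomog_diff[of "\<lambda>_. 1", folded homog_whomog]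
lemmas homog_mult = whomog_mult[of "\<lambda>_. 1", folded homog_whomog]
lemmas homog_power = whomog_power[of "\<lambda>_. 1", folded homog_whomog]
lemmas homog_cst_mult = whomog_cst_mult[of "\<lambda>_. 1", folded homog_whomog]
lemmas homog_pd = whomog_pd[of "\<lambda>_. 1", folded homog_whomog]
lemmas homog_sum = whomog_sum[of _ "\<lambda>_. 1", folded homog_whomog]

abbreviation hcomp :: "int \<Rightarrow> 'k::field poly3 \<Rightarrow> 'k poly3" where
  "hcomp \<equiv> wcomp (\<lambda>_. 1)"

lemmas homog_hcomp [simp] = whomog_wcomp[of "\<lambda>_. 1", folded homog_whomog]
lemmas hcomp_homog = wcomp_whomog[of "\<lambda>_. 1", folded homog_whomog]
lemmas hcomp_mult = wcomp_mult[of "\<lambda>_. 1", folded homog_whomog]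
lemmas hcomp_pd = wcomp_pd[of "\<lambda>_. 1", simplified]

lemma euler_homog: "homog d p \<Longrightarrow> X 1 * pd 1 p + X 2 * pd 2 p + X 3 * pd 3 p = of_int d * p"
  using weighted_euler[of "\<lambda>_. 1" d p] by (simp add: homog_whomog)

lemma homog_neg: "homog d p \<Longrightarrow> d < 0 \<Longrightarrow> p = 0"
  unfolding homog_def by (metis all_not_in_conv keys_eq_empty not_less of_nat_0_le_iff)

lemma homog_0_cst: "homog 0 p \<Longrightarrow> p = cst (Poly_Mapping.lookup p 0)"
proof (rule poly_mapping_eqI)
  fix m assume "homog 0 p"
  then have "Poly_Mapping.lookup p m \<noteq> 0 \<Longrightarrow> m = 0"
    by (metis homog_def in_keys_iff mon_deg_def of_nat_eq_0_iff sum_eq_0_iff finite UNIV_I poly_mapping_eqI lookup_zero)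
  then show "Poly_Mapping.lookup p m = Poly_Mapping.lookup (cst (Poly_Mapping.lookup p 0)) m"
    by (auto simp: cst_def lookup_single when_def)
qed

section \<open>Derivations and biderivations\<close>

lemma linear_smult3_iff:
  "Vector_Spaces.linear smult3 smult3 f \<longleftrightarrow> (\<forall>p q. f (p + q) = f p + f q) \<and> (\<forall>c p. f (cst c * p) = cst c * f p)"
  by (simp add: Vector_Spaces.linear_iff vector_space_smult3 smult3_cst)

lemma derivation_iff:
  "derivation \<delta> \<longleftrightarrow> (\<forall>p q. \<delta> (p + q) = \<delta> p + \<delta> q) \<and> (\<forall>c p. \<delta> (cst c * p) = cst c * \<delta> p) \<and>
     (\<forall>p q. \<delta> (p * q) = \<delta> p * q + p * \<delta> q)"
  by (auto simp: derivation_def linear_smult3_iff)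

lemma derivationI:
  assumes "\<And>p q. \<delta> (p + q) = \<delta> p + \<delta> q" "\<And>c p. \<delta> (cst c * p) = cst c * \<delta> p"
    "\<And>p q. \<delta> (p * q) = \<delta> p * q + p * \<delta> q"
  shows "derivation \<delta>"
  using assms by (simp add: derivation_iff)

lemma
  assumes "derivation \<delta>"
  shows derivation_add: "\<delta> (p + q) = \<delta> p + \<delta> q"
    and derivation_cst_mult: "\<delta> (cst c * p) = cst c * \<delta> p"
    and derivation_mult: "\<delta> (p * q) = \<delta> p * q + p * \<delta> q"
    and derivation_0: "\<delta> 0 = 0"
    and derivation_cst: "\<delta> (cst c) = 0"
    and derivation_uminus: "\<delta> (- p) = - \<delta> p"
    and derivation_diff: "\<delta> (p - q) = \<delta> p - \<delta> q"
    and derivation_sum: "\<delta> (sum f S) = (\<Sum>x\<in>S. \<delta> (f x))"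
proof -
  show a: "\<delta> (p + q) = \<delta> p + \<delta> q" for p q using assms by (simp add: derivation_iff)
  show c: "\<delta> (cst c * p) = cst c * \<delta> p" for c p using assms unfolding derivation_iff by blast
  show m: "\<delta> (p * q) = \<delta> p * q + p * \<delta> q" for p q using assms unfolding derivation_iff by blast
  show z: "\<delta> 0 = 0" by (metis a add.right_neutral add_left_cancel)
  have "\<delta> 1 = 0" using m[of 1 1] by (metis add_left_cancel add.right_neutral mult_1 mult.right_neutral)
  then show "\<delta> (cst c) = 0" using c[of c 1] by simp
  show u: "\<delta> (- p) = - \<delta> p" for p using a[of p "- p"] z by (simp add: eq_neg_iff_add_eq_0 add.commute)
  show "\<delta> (p - q) = \<delta> p - \<delta> q" using a[of p "- q"] u by simp
  show "\<delta> (sum f S) = (\<Sum>x\<in>S. \<delta> (f x))"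
    by (induction S rule: infinite_finite_induct) (auto simp: a z)
qed

definition vf :: "(3 \<Rightarrow> 'k::field poly3) \<Rightarrow> 'k poly3 \<Rightarrow> 'k poly3" where
  "vf v f = v 1 * pd 1 f + v 2 * pd 2 f + v 3 * pd 3 f"

lemma derivation_vf: "derivation (vf v)"
  by (rule derivationI) (simp_all add: vf_def algebra_simps)

lemma vf_X [simp]: "vf v (X i) = v i"
  using exhaust_3[of i] by (auto simp: vf_def)

lemma derivation_eq_vf:
  assumes "derivation \<delta>"
  shows "\<delta> f = vf (\<lambda>i. \<delta> (X i)) f"
proof (induction f rule: poly3_induct)
  case (const c)
  show ?case using derivation_cst[OF assms] derivation_cst[OF derivation_vf] by metis
next
  case (add p q)
  then show ?case by (simp add: derivation_add[OF assms] derivation_add[OF derivation_vf])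
next
  case (mult p q)
  then show ?case by (simp add: derivation_mult[OF assms] derivation_mult[OF derivation_vf])
qed simp

lemma euler_eq_vf: "euler p = vf X p"
proof -
  let ?f = "\<lambda>m. Poly_Mapping.single m (Poly_Mapping.lookup p m)"
  have s: "Poly_Mapping.single m (of_nat (mon_deg m) * c) = vf X (Poly_Mapping.single m c)" for m and c :: 'a
  proof -
    have "homog (int (mon_deg m)) (Poly_Mapping.single m c)"
      by (simp add: homog_def)
    then show ?thesis
      by (simp add: vf_def euler_homog mult_single flip: single_of_nat)
  qed
  have "euler p = (\<Sum>m\<in>Poly_Mapping.keys p. vf X (?f m))"
    by (simp add: euler_def s)
  also have "\<dots> = vf X (\<Sum>m\<in>Poly_Mapping.keys p. ?f m)"
    by (simp add: derivation_sum[OF derivation_vf])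
  also have "\<dots> = vf X p"
    by (simp flip: poly_mapping_expand)
  finally show ?thesis .
qed

lemma euler_of_homog: "homog d p \<Longrightarrow> euler p = of_int d * p"
  by (simp add: euler_eq_vf vf_def euler_homog)

section \<open>Vector calculus in three variables\<close>

definition dv :: "(3 \<Rightarrow> 'k::field poly3) \<Rightarrow> 'k poly3" where
  "dv v = pd 1 (v 1) + pd 2 (v 2) + pd 3 (v 3)"

lemma divergence_dv: "divergence \<delta> = dv (\<lambda>i. \<delta> (X i))"
  by (simp add: divergence_def sum_3 dv_def)

definition curl :: "(3 \<Rightarrow> 'k::field poly3) \<Rightarrow> 3 \<Rightarrow> 'k poly3" where
  "curl v i = (if i = 1 then pd 2 (v 3) - pd 3 (v 2)
     else if i = 2 then pd 3 (v 1) - pd 1 (v 3) else pd 1 (v 2) - pd 2 (v 1))"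

definition cross :: "(3 \<Rightarrow> 'k::field poly3) \<Rightarrow> (3 \<Rightarrow> 'k poly3) \<Rightarrow> 3 \<Rightarrow> 'k poly3" where
  "cross u v i = (if i = 1 then u 2 * v 3 - u 3 * v 2
     else if i = 2 then u 3 * v 1 - u 1 * v 3 else u 1 * v 2 - u 2 * v 1)"

definition dot :: "(3 \<Rightarrow> 'k::field poly3) \<Rightarrow> (3 \<Rightarrow> 'k poly3) \<Rightarrow> 'k poly3" where
  "dot u v = u 1 * v 1 + u 2 * v 2 + u 3 * v 3"

definition grad :: "'k::field poly3 \<Rightarrow> 3 \<Rightarrow> 'k poly3" where
  "grad f i = pd i f"

lemmas vec_defs = vf_def dv_def curl_def cross_def dot_def grad_def

text \<open>In dimension three a biderivation is the contraction of a vector field \<open>P\<close> with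
  \<open>\<nabla>a \<times> \<nabla>b\<close>; the Jacobi identity becomes \<open>P \<cdot> curl P = 0\<close>.\<close>

definition biv :: "(3 \<Rightarrow> 'k::field poly3) \<Rightarrow> 'k bracket" where
  "biv P a b = dot P (cross (grad a) (grad b))"

definition bvec :: "'k::field bracket \<Rightarrow> 3 \<Rightarrow> 'k poly3" where
  "bvec br i = (if i = 1 then br (X 2) (X 3) else if i = 2 then br (X 3) (X 1) else br (X 1) (X 2))"

definition biderivation :: "'k::field bracket \<Rightarrow> bool" where
  "biderivation br \<longleftrightarrow> (\<forall>a. derivation (br a)) \<and> (\<forall>b. derivation (\<lambda>a. br a b)) \<and> (\<forall>a. br a a = 0)"

lemma biv_expand:
  "biv P a b = P 1 * (pd 2 a * pd 3 b - pd 3 a * pd 2 b) + P 2 * (pd 3 a * pd 1 b - pd 1 a * pd 3 b)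
     + P 3 * (pd 1 a * pd 2 b - pd 2 a * pd 1 b)"
  by (simp add: biv_def vec_defs)

lemma biderivation_biv: "biderivation (biv P)"
  unfolding biderivation_def
  by (intro conjI allI derivationI) (simp_all add: biv_expand algebra_simps)

lemma biderivation_skew:
  assumes "biderivation br"
  shows "br b a = - br a b"
proof -
  have l: "derivation (br u)" "derivation (\<lambda>a. br a u)" "br u u = 0" for u
    using assms by (auto simp: biderivation_def)
  have "br (a + b) (a + b) = br a a + br a b + br b a + br b b"
    using derivation_add[OF l(1)] derivation_add[OF l(2)] by (simp add: add.assoc)
  then have "br a b + br b a = 0" by (simp add: l(3))
  then show ?thesis by (simp add: eq_neg_iff_add_eq_0 add.commute)
qed

lemma biderivation_eq_biv:
  assumes "biderivation br"
  shows "br = biv (bvec br)"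
proof (intro ext)
  fix a b
  have l: "derivation (br u)" "derivation (\<lambda>a. br a u)" "br u u = 0" for u
    using assms by (auto simp: biderivation_def)
  have "br a b = vf (\<lambda>j. br a (X j)) b"
    using derivation_eq_vf[OF l(1)] .
  moreover have "br a (X j) = vf (\<lambda>i. br (X i) (X j)) a" for j
    using derivation_eq_vf[OF l(2)] .
  ultimately show "br a b = biv (bvec br) a b"
    using biderivation_skew[OF assms, of "X 1" "X 2"] biderivation_skew[OF assms, of "X 1" "X 3"]
      biderivation_skew[OF assms, of "X 2" "X 3"]
    by (simp add: vf_def biv_expand bvec_def l(3) algebra_simps)
qed

lemma bvec_biv [simp]: "bvec (biv P) i = P i"
  using exhaust_3[of i] by (auto simp: bvec_def biv_expand)

lemma biv_eq_0_iff: "(\<forall>a b. biv P a b = 0) \<longleftrightarrow> (\<forall>i. P i = 0)"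
proof
  assume "\<forall>a b. biv P a b = 0"
  then have "bvec (biv P) i = 0" for i by (simp add: bvec_def)
  then show "\<forall>i. P i = 0" by simp
qed (simp add: biv_expand)

lemma hamiltonian_biv: "biv P a f = vf (cross P (grad a)) f"
  by (simp add: biv_expand vec_defs algebra_simps)

lemma divergence_hamiltonian: "divergence (hamiltonian (biv P) a) = vf (curl P) a"
  by (simp add: divergence_dv hamiltonian_def biv_expand vec_defs pd_commute_simps algebra_simps)

lemma modular_derivation_biv: "modular_derivation (biv P) a = - vf (curl P) a"
  by (simp add: modular_derivation_def divergence_hamiltonian)

lemma unimodular_biv: "unimodular (biv P) \<longleftrightarrow> (\<forall>i. curl P i = 0)"
proof
  assume "unimodular (biv P)"
  then have "vf (curl P) (X i) = 0" for i by (simp add: unimodular_def modular_derivation_biv del: vf_X)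
  then show "\<forall>i. curl P i = 0" by simp
qed (simp add: unimodular_def modular_derivation_biv vf_def)

text \<open>The Lie derivative of a bivector read through the volume form: \<open>P\<close> is
  treated as a 1-form, and the divergence term accounts for the change of volume along
  \<open>v\<close>.\<close>

definition lie :: "(3 \<Rightarrow> 'k::field poly3) \<Rightarrow> (3 \<Rightarrow> 'k poly3) \<Rightarrow> 3 \<Rightarrow> 'k poly3" where
  "lie v P k = vf v (P k) + dot P (\<lambda>j. pd k (v j)) - dv v * P k"

lemma lie_biv:
  "vf v (biv P a b) - biv P (vf v a) b - biv P a (vf v b) = biv (lie v P) a b"
  by (simp add: biv_expand lie_def vec_defs pd_commute_simps algebra_simps)

text \<open>Cartan's formula for the 1-form \<open>P\<close>: the differential of the contraction
  plus the contraction of the differential.\<close>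

lemma lie_alt:
  "lie v P k = pd k (dot v P) + cross (curl P) v k - dv v * P k"
  using exhaust_3[of k] by (auto simp: lie_def vec_defs algebra_simps)

lemma poisson_derivation_vf:
  "poisson_derivation (biv P) (vf v) \<longleftrightarrow> (\<forall>k. lie v P k = 0)"
proof -
  have "vf v (biv P a b) = biv P (vf v a) b + biv P a (vf v b) \<longleftrightarrow> biv (lie v P) a b = 0" for a b
    unfolding lie_biv[symmetric] by (simp add: algebra_simps)
  then show ?thesis
    by (simp add: poisson_derivation_def derivation_vf biv_eq_0_iff)
qed

text \<open>By Euler's identity this recovers \<Omega> from \<open>P = grad \<Omega>\<close> in
  degree 3. It is defined for every \<open>P\<close>, so that rigidity can be formulated before
  unimodularity is known.\<close>

definition pot :: "(3 \<Rightarrow> 'k::field poly3) \<Rightarrow> 'k poly3" where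
  "pot P = cst (1 / 3) * dot X P"

lemma graded_poisson_biv:
  fixes br :: "'k::field bracket"
  assumes "graded_poisson br"
  obtains P where "br = biv P" "\<And>i. homog 2 (P i)" "dot P (curl P) = 0"
proof
  have "biderivation br"
    using assms by (simp add: graded_poisson_def biderivation_def)
  then show br: "br = biv (bvec br)" by (rule biderivation_eq_biv)
  have "homog (1 + 1) (br (X i) (X j))" for i j
    using assms unfolding graded_poisson_def by (meson homog_X)
  then show "homog 2 (bvec br i)" for i
    by (simp add: bvec_def)
  let ?P = "bvec br"
  have "biv ?P (X 1) (biv ?P (X 2) (X 3)) + biv ?P (X 2) (biv ?P (X 3) (X 1)) + biv ?P (X 3) (biv ?P (X 1) (X 2)) = 0"
    using assms br unfolding graded_poisson_def by metis
  then have "- dot ?P (curl ?P) = 0"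
    by (simp add: biv_expand vec_defs algebra_simps)
  then show "dot ?P (curl ?P) = 0" by simp
qed

section \<open>The potential and rigidity\<close>

lemma pd_homog_zero:
  fixes p :: "'k::field_char_0 poly3"
  assumes "homog d p" "d > 0" "\<And>i. pd i p = 0"
  shows "p = 0"
  using euler_homog[OF assms(1)] assms(2,3) by simp

lemma third: "3 * cst (1 / 3 :: 'k::field_char_0) = 1" "cst (1 / 3 :: 'k::field_char_0) * 3 = 1"
proof -
  have "(3::'k) * (1 / 3) = 1" by simp
  then show "3 * cst (1 / 3 :: 'k::field_char_0) = 1" by (metis cst_simps(2,6,10))
  then show "cst (1 / 3 :: 'k::field_char_0) * 3 = 1" by (simp add: mult.commute)
qed

lemma mult3_eq_iff: "3 * p = 3 * q \<longleftrightarrow> p = (q :: 'k::field_char_0 poly3)"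
  by simp

lemma pot3: "3 * pot P = dot X (P :: 3 \<Rightarrow> 'k::field_char_0 poly3)"
  unfolding pot_def mult.assoc[symmetric] third by simp

lemma homog_pot:
  assumes "\<And>i. homog 2 (P i)"
  shows "homog 3 (pot P)"
proof -
  have "homog (1 + 2) (X i * P i)" for i
    by (intro homog_mult assms) simp
  then show ?thesis unfolding pot_def dot_def
    by (intro homog_cst_mult homog_add) simp_all
qed

text \<open>The homotopy formula of the Poincare lemma. Differentiating \<open>dot X P\<close> and
  using Euler's identity for the quadratic entries yields three copies of \<open>P i\<close> and a
  curl term.\<close>

lemma pd_pot:
  fixes P :: "3 \<Rightarrow> 'k::field_char_0 poly3"
  assumes "\<And>i. homog 2 (P i)"
  shows "3 * P i = 3 * pd i (pot P) - cross X (curl P) i"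
proof -
  have "3 * pd i (pot P) = pd i (dot X P)"
    unfolding pot3[symmetric] by simp
  moreover have "X 1 * pd 1 (P i) + X 2 * pd 2 (P i) + X 3 * pd 3 (P i) = 2 * P i"
    using euler_homog[OF assms[of i]] by simp
  ultimately show ?thesis
    using exhaust_3[of i] by (auto simp: vec_defs algebra_simps)
qed

lemma pot_unimodular:
  fixes P :: "3 \<Rightarrow> 'k::field_char_0 poly3"
  assumes "\<And>i. homog 2 (P i)" "\<And>i. curl P i = 0"
  shows "P i = pd i (pot P)"
proof -
  have "3 * P i = 3 * pd i (pot P)"
    using pd_pot[of P i] assms by (simp add: cross_def)
  then show ?thesis by simp
qed

lemma curl_grad: "curl (grad \<Omega>) i = 0"
  by (simp add: vec_defs pd_commute_simps)

lemma map_degree_vf: "map_degree n (vf v) \<longleftrightarrow> (\<forall>i. homog (n + 1) (v i))"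
proof
  assume "map_degree n (vf v)"
  then have "homog (1 + n) (vf v (X i))" for i
    unfolding map_degree_def using homog_X by blast
  then show "\<forall>i. homog (n + 1) (v i)" by (simp add: add.commute)
next
  assume v: "\<forall>i. homog (n + 1) (v i)"
  show "map_degree n (vf v)"
    unfolding map_degree_def
  proof (intro allI impI)
    fix i and a :: "'a poly3" assume "homog i a"
    then have "homog (n + 1 + (i - 1)) (v j * pd j a)" for j
      using v by (intro homog_mult homog_pd) auto
    then show "homog (i + n) (vf v a)"
      unfolding vf_def by (intro homog_add) (simp_all add: add.commute)
  qed
qed

lemma homog_dv:
  assumes "\<And>i. homog (n + 1) (v i)" shows "homog n (dv v)"
proof -
  have "homog (n + 1 - 1) (pd i (v i))" for i using assms by (intro homog_pd)
  then show ?thesis unfolding dv_def by (intro homog_add) simp_all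
qed

lemma homog_curl:
  assumes "\<And>i. homog (n + 1) (v i)" shows "homog n (curl v i)"
proof -
  have "homog (n + 1 - 1) (pd j (v i))" for i j using assms by (intro homog_pd)
  then show ?thesis unfolding curl_def by (auto intro!: homog_diff)
qed

text \<open>The Euler field commutes with linear fields, so contraction with it passes through the
  Lie derivative. The three brackets in the proof are Euler's identity for the entries of
  \<open>v\<close>.\<close>

lemma dot_X_lie:
  assumes "\<And>i. homog 1 (v i)"
  shows "dot X (lie v P) = vf v (dot X P) - dv v * dot X P"
proof -
  have e: "v i = X 1 * pd 1 (v i) + X 2 * pd 2 (v i) + X 3 * pd 3 (v i)" for i
    using euler_homog[OF assms[of i]] by simp
  have "dot X (lie v P) - (vf v (dot X P) - dv v * dot X P) =
      P 1 * (X 1 * pd 1 (v 1) + X 2 * pd 2 (v 1) + X 3 * pd 3 (v 1) - v 1)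
    + P 2 * (X 1 * pd 1 (v 2) + X 2 * pd 2 (v 2) + X 3 * pd 3 (v 2) - v 2)
    + P 3 * (X 1 * pd 1 (v 3) + X 2 * pd 2 (v 3) + X 3 * pd 3 (v 3) - v 3)"
    by (simp add: lie_def vec_defs algebra_simps)
  also have "\<dots> = 0" unfolding e[symmetric] by simp
  finally show ?thesis by simp
qed

text \<open>The left side is the trivector that the Euler field and \<open>Q\<close> span by
  wedging. In three variables a trivector is a function times the Jacobian determinant, so the
  semi-Poisson condition shrinks to one scalar equation.\<close>

lemma euler_wedge_biv:
  "vf X a * biv Q b c - vf X b * biv Q a c + vf X c * biv Q a b
     = dot X Q * dot (grad a) (cross (grad b) (grad c))"
  by (simp add: biv_expand vec_defs algebra_simps)

lemma semi_poisson_vf: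
  fixes P :: "3 \<Rightarrow> 'k::field_char_0 poly3"
  assumes "\<And>i. homog 1 (v i)"
  shows "semi_poisson (biv P) (vf v) \<longleftrightarrow> vf v (pot P) = dv v * pot P"
proof -
  have D: "vf v (biv P b c) - biv P (vf v b) c - biv P b (vf v c) = biv (lie v P) b c" for b c
    by (rule lie_biv)
  have e: "of_int i * a = vf X a" if "homog i a" for i and a :: "'k poly3"
    using euler_of_homog[OF that] by (simp add: euler_eq_vf)
  have "semi_poisson (biv P) (vf v) \<longleftrightarrow> dot X (lie v P) = 0"
  proof
    assume "semi_poisson (biv P) (vf v)"
    then have "of_int 1 * X 1 * biv (lie v P) (X 2) (X 3) - of_int 1 * X 2 * biv (lie v P) (X 1) (X 3)
       + of_int 1 * X 3 * biv (lie v P) (X 1) (X 2) = 0"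
      unfolding semi_poisson_def Let_def D using homog_X by blast
    then show "dot X (lie v P) = 0" by (simp add: biv_expand dot_def)
  next
    assume z: "dot X (lie v P) = 0"
    have "of_int i * a * biv (lie v P) b c - of_int j * b * biv (lie v P) a c + of_int k * c * biv (lie v P) a b = 0"
      if "homog i a" "homog j b" "homog k c" for i j k a b c
      using euler_wedge_biv[of a "lie v P" b c] z e[OF that(1)] e[OF that(2)] e[OF that(3)] by simp
    then show "semi_poisson (biv P) (vf v)"
      unfolding semi_poisson_def Let_def D by (simp add: derivation_vf)
  qed
  also have "dot X (lie v P) = 3 * (vf v (pot P) - dv v * pot P)"
    unfolding dot_X_lie[OF assms] pot3[of P, symmetric]
    by (simp add: vf_def algebra_simps)
  finally show ?thesis by simp
qed

lemma Gspd_biv: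
  fixes P :: "3 \<Rightarrow> 'k::field_char_0 poly3"
  shows "\<delta> \<in> Gspd (biv P) \<longleftrightarrow> (\<exists>v. \<delta> = vf v \<and> (\<forall>i. homog 1 (v i)) \<and> vf v (pot P) = dv v * pot P)"
proof
  assume d: "\<delta> \<in> Gspd (biv P)"
  define v where "v = (\<lambda>i. \<delta> (X i))"
  have "derivation \<delta>" using d by (simp add: Gspd_def semi_poisson_def)
  then have \<delta>: "\<delta> = vf v" unfolding v_def using derivation_eq_vf by blast
  have h: "\<forall>i. homog 1 (v i)" using d unfolding \<delta> Gspd_def by (simp add: map_degree_vf)
  moreover have "vf v (pot P) = dv v * pot P"
    using d h unfolding \<delta> Gspd_def by (simp add: semi_poisson_vf)
  ultimately show "\<exists>v. \<delta> = vf v \<and> (\<forall>i. homog 1 (v i)) \<and> vf v (pot P) = dv v * pot P"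
    using \<delta> by blast
next
  assume "\<exists>v. \<delta> = vf v \<and> (\<forall>i. homog 1 (v i)) \<and> vf v (pot P) = dv v * pot P"
  then show "\<delta> \<in> Gspd (biv P)"
    by (auto simp: Gspd_def semi_poisson_vf map_degree_vf)
qed

lemma vf_eq_iff: "vf v = vf u \<longleftrightarrow> (\<forall>i. v i = u i)"
proof
  assume "vf v = vf u"
  then show "\<forall>i. v i = u i" by (metis vf_X)
qed (auto simp: vf_def fun_eq_iff)

definition rigid :: "(3 \<Rightarrow> 'k::field poly3) \<Rightarrow> bool" where
  "rigid P \<longleftrightarrow> (\<forall>v. (\<forall>i. homog 1 (v i)) \<longrightarrow> dv v = 0 \<longrightarrow> vf v (pot P) = 0 \<longrightarrow> (\<forall>i. v i = 0))"

lemma smult_fun_cst: "smult_fun c f = (\<lambda>x. cst c * f x)"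
  by (simp add: smult_fun_def smult3_cst)

lemma X_neq_0 [simp]: "X i \<noteq> (0::'k::field poly3)"
  by (metis pd_X pd_0 zero_neq_one)

text \<open>The divergence of a linear field is a constant, and the Euler field has divergence 3 and
  multiplies \<open>pot P\<close> by 3. Subtracting a third of the divergence times the Euler field
  leaves a field to which rigidity applies.\<close>

lemma rigid_Gspd:
  fixes P :: "3 \<Rightarrow> 'k::field_char_0 poly3"
  assumes h: "\<And>i. homog 2 (P i)" and "rigid P" and v: "\<And>i. homog 1 (v i)" "vf v (pot P) = dv v * pot P"
  shows "\<exists>c. \<forall>i. v i = cst c * X i"
proof -
  have "homog 0 (dv v)" using v(1) by (intro homog_dv) simp
  then obtain t where t: "dv v = cst t" using homog_0_cst by blast
  define u where "u i = v i - cst (t / 3) * X i" for i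
  have c: "3 * cst (t / 3) = cst t"
  proof -
    have "3 * cst (t / 3) = cst (3 * (t / 3))" by (simp only: cst_simps)
    then show ?thesis by simp
  qed
  have "dv u = 0" using t c by (simp add: u_def dv_def algebra_simps)
  moreover have "\<forall>i. homog 1 (u i)" unfolding u_def using v(1) by (auto intro!: homog_diff homog_cst_mult)
  moreover have "vf u (pot P) = 0"
  proof -
    have "vf u (pot P) = vf v (pot P) - cst (t / 3) * vf X (pot P)"
      by (simp add: vf_def u_def algebra_simps)
    also have "vf X (pot P) = 3 * pot P"
      using euler_of_homog[OF homog_pot[of P, OF h]] by (simp add: euler_eq_vf)
    also have "cst (t / 3) * (3 * pot P) = cst t * pot P" using c by (metis mult.assoc mult.commute)
    finally show ?thesis using v(2) t by simp
  qed
  ultimately have "\<forall>i. u i = 0" using assms(2) by (auto simp: rigid_def)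
  then show ?thesis by (intro exI[of _ "t / 3"]) (simp add: u_def)
qed

text \<open>The Euler field is a nonzero member of \<open>Gspd\<close>, so dimension 1 means that
  every member is a multiple of it; a multiple without divergence is 0.\<close>

lemma rgt_0_iff_rigid:
  fixes P :: "3 \<Rightarrow> 'k::field_char_0 poly3"
  assumes h: "\<And>i. homog 2 (P i)"
  shows "rgt (biv P) = 0 \<longleftrightarrow> rigid P"
proof -
  interpret V: vector_space "smult_fun :: 'k \<Rightarrow> ('k poly3 \<Rightarrow> 'k poly3) \<Rightarrow> _"
    by (rule vector_space_smult_fun)
  let ?G = "Gspd (biv P)"
  have E: "vf X \<in> ?G"
    unfolding Gspd_biv using euler_of_homog[OF homog_pot[of P, OF h]]
    by (intro exI[of _ X]) (simp add: euler_eq_vf dv_def)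
  have E0: "vf X \<noteq> (0 :: 'k poly3 \<Rightarrow> _)"
    by (metis X_neq_0 vf_X zero_fun_apply)
  have "V.dim ?G = 1 \<longleftrightarrow> rigid P"
  proof
    assume "V.dim ?G = 1"
    then obtain B where B: "B \<subseteq> ?G" "?G \<subseteq> V.span B" "card B = 1"
      using V.basis_exists[of ?G] by metis
    then obtain b where b: "B = {b}" by (metis card_1_singletonE)
    have sp: "\<exists>c. \<delta> = smult_fun c b" if "\<delta> \<in> ?G" for \<delta>
      using that B(2) b by (auto simp: V.span_singleton)
    obtain c where c: "vf X = smult_fun c b" using sp[OF E] by blast
    have "c \<noteq> 0" using c E0 by auto
    show "rigid P"
      unfolding rigid_def
    proof (intro allI impI)
      fix v i assume v: "\<forall>i. homog 1 (v i)" "dv v = 0" "vf v (pot P) = 0"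
      have "vf v \<in> ?G" unfolding Gspd_biv using v by auto
      then obtain c' where "vf v = smult_fun c' b" using sp by blast
      then have "vf v = smult_fun (c' / c) (vf X)"
        using \<open>c \<noteq> 0\<close> by (simp add: c)
      then have vi: "v i = cst (c' / c) * X i" for i
        by (metis smult_fun_cst vf_X)
      then have "3 * cst (c' / c) = 0" using v(2) by (simp add: dv_def)
      then show "v i = 0" by (simp add: vi)
    qed
  next
    assume r: "rigid P"
    have "?G \<subseteq> V.span {vf X}"
    proof
      fix \<delta> assume "\<delta> \<in> ?G"
      then obtain v where v: "\<delta> = vf v" "\<forall>i. homog 1 (v i)" "vf v (pot P) = dv v * pot P"
        unfolding Gspd_biv by blast
      then obtain c where "\<forall>i. v i = cst c * X i" using rigid_Gspd[OF h r] by blast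
      then have "\<delta> = smult_fun c (vf X)"
        by (simp add: v(1) vf_def smult_fun_cst fun_eq_iff algebra_simps)
      then show "\<delta> \<in> V.span {vf X}" by (auto simp: V.span_singleton)
    qed
    then show "V.dim ?G = 1"
      using E E0 V.dim_unique[of "{vf X}" ?G 1] by simp
  qed
  then show ?thesis by (simp add: rgt_def)
qed

text \<open>Every Poisson derivation of degree 0 is a multiple of the Euler field. This is what the
  decomposition and the series of \<open>PH 1\<close> say in degree 0, and it is the bridge from
  them back to rigidity.\<close>

definition deg0_scalar :: "(3 \<Rightarrow> 'k::field poly3) \<Rightarrow> bool" where
  "deg0_scalar P \<longleftrightarrow> (\<forall>v. (\<forall>i. homog 1 (v i)) \<longrightarrow> (\<forall>k. lie v P k = 0) \<longrightarrow> (\<exists>c. \<forall>i. v i = cst c * X i))"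

lemma dv_curl: "dv (curl P) = 0"
  by (simp add: vec_defs pd_commute_simps)

text \<open>\<open>curl P\<close> is the modular field up to sign. In \<open>lie_alt\<close> all
  three terms vanish: by the Jacobi identity, since a curl is parallel to itself, and since it has
  no divergence.\<close>

lemma lie_curl:
  assumes "dot P (curl P) = 0"
  shows "lie (curl P) P k = 0"
proof -
  have "dot (curl P) P = 0" using assms by (simp add: dot_def algebra_simps)
  then show ?thesis by (simp add: lie_alt dv_curl) (simp add: cross_def)
qed

lemma lie_grad: "lie v (grad \<Omega>) k = pd k (vf v \<Omega>) - dv v * pd k \<Omega>"
proof -
  have "dot v (grad \<Omega>) = vf v \<Omega>" by (simp add: vec_defs)
  then show ?thesis
    unfolding lie_alt by (simp add: curl_grad cross_def grad_def)
qed

text \<open>Pairing \<open>curl P\<close> with \<open>pd_pot\<close> removes the term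
  \<open>cross X (curl P)\<close>, which is orthogonal to it, so that the Jacobi identity
  remains.\<close>

lemma vf_curl_pot:
  fixes P :: "3 \<Rightarrow> 'k::field_char_0 poly3"
  assumes h: "\<And>i. homog 2 (P i)" and j: "dot P (curl P) = 0"
  shows "vf (curl P) (pot P) = 0"
proof -
  have "3 * dot P (curl P) = (3 * P 1) * curl P 1 + (3 * P 2) * curl P 2 + (3 * P 3) * curl P 3"
    by (simp add: dot_def algebra_simps)
  also have "\<dots> = 3 * vf (curl P) (pot P)"
    unfolding pd_pot[of P, OF h] by (simp add: cross_def vf_def algebra_simps)
  finally show ?thesis using j by simp
qed

lemma rigid_curl:
  fixes P :: "3 \<Rightarrow> 'k::field_char_0 poly3"
  assumes h: "\<And>i. homog 2 (P i)" and j: "dot P (curl P) = 0" and "rigid P"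
  shows "curl P i = 0"
  using assms(3) vf_curl_pot[of P, OF h j] dv_curl homog_curl[of 1 P] h
  by (auto simp: rigid_def)

text \<open>If degree 0 is scalar, the divergence-free field \<open>curl P\<close> must be 0; then
  \<open>P\<close> is the gradient of \<open>pot P\<close>, and each linear field tested by rigidity
  is a Poisson derivation. Conversely, contracting \<open>lie v P = 0\<close> with \<open>X\<close>
  gives the equation of \<open>rigid_Gspd\<close>.\<close>

lemma deg0_scalar_iff_rigid:
  fixes P :: "3 \<Rightarrow> 'k::field_char_0 poly3"
  assumes h: "\<And>i. homog 2 (P i)" and j: "dot P (curl P) = 0"
  shows "deg0_scalar P \<longleftrightarrow> rigid P"
proof
  assume p: "deg0_scalar P"
  have hc: "\<forall>i. homog 1 (curl P i)" using h homog_curl[of 1 P] by simp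
  then obtain c where c: "\<forall>i. curl P i = cst c * X i"
    using p lie_curl[OF j] unfolding deg0_scalar_def by blast
  then have "3 * cst c = 0" using dv_curl[of P] by (simp add: dv_def)
  then have curl: "curl P i = 0" for i using c by simp
  have P: "P = grad (pot P)" using pot_unimodular[of P, OF h curl] by (simp add: grad_def fun_eq_iff)
  show "rigid P"
    unfolding rigid_def
  proof (intro allI impI)
    fix v i assume v: "\<forall>i. homog 1 (v i)" "dv v = 0" "vf v (pot P) = 0"
    have "lie v P k = 0" for k
      by (subst P) (simp add: lie_grad v)
    then obtain c where c: "\<forall>i. v i = cst c * X i" using p v(1) unfolding deg0_scalar_def by blast
    then have "3 * cst c = 0" using v(2) by (simp add: dv_def)
    then show "v i = 0" using c by simp
  qed
next
  assume r: "rigid P"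
  show "deg0_scalar P"
    unfolding deg0_scalar_def
  proof (intro allI impI)
    fix v assume v: "\<forall>i. homog 1 (v i)" "\<forall>k. lie v P k = 0"
    then have "dot X (lie v P) = 0" by (simp add: dot_def)
    then have "3 * (vf v (pot P) - dv v * pot P) = 0"
      using v(1) unfolding dot_X_lie[OF v(1)[rule_format]] pot3[of P, symmetric] by (simp add: vf_def algebra_simps)
    then show "\<exists>c. \<forall>i. v i = cst c * X i"
      using rigid_Gspd[OF h r] v(1) by simp
  qed
qed

text \<open>The entries of \<open>P\<close> are quadratic, so the linear part of
  \<open>cross P (grad a)\<close> would have to come from a component of \<open>grad a\<close> in
  degree -1.\<close>

lemma linear_hamiltonian_0:
  assumes h: "\<And>i. homog 2 (P i)" and v: "\<And>i. homog 1 (v i)" and "vf v = hamiltonian (biv P) a"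
  shows "v i = 0"
proof -
  have "v i = cross P (grad a) i"
    using fun_cong[OF assms(3), of "X i"] by (simp add: hamiltonian_def hamiltonian_biv)
  then have "hcomp 1 (v i) = hcomp 1 (cross P (grad a) i)" by simp
  also have "\<dots> = 0"
    unfolding cross_def grad_def
    by (simp add: hcomp_mult[OF h] homog_neg[OF homog_hcomp[of "-1"]])
  finally show ?thesis by (simp add: hcomp_homog[OF v])
qed

lemma poisson_center_biv: "z \<in> poisson_center (biv P) \<longleftrightarrow> (\<forall>i. cross P (grad z) i = 0)"
proof
  assume "z \<in> poisson_center (biv P)"
  then have "vf (cross P (grad z)) (X i) = 0" for i
    by (simp add: poisson_center_def hamiltonian_biv del: vf_X)
  then show "\<forall>i. cross P (grad z) i = 0" by simp
qed (simp add: poisson_center_def hamiltonian_biv vf_def)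

text \<open>A central element has zero Hamiltonian field, whose divergence is its derivative along
  \<open>curl P\<close>; hence \<open>curl P\<close> is ozone, so Hamiltonian, so 0. Afterwards the
  gradient of a central element is parallel to that of \<open>pot P\<close>, so a field annihilating
  \<open>pot P\<close> is ozone as well. The entry \<open>P l\<close> is what gets
  cancelled.\<close>

lemma ozone_rigid:
  fixes P :: "3 \<Rightarrow> 'k::field_char_0 poly3"
  assumes h: "\<And>i. homog 2 (P i)" and j: "dot P (curl P) = 0"
    and P0: "P l \<noteq> 0"
    and oz: "\<And>\<phi>. ozone_derivation (biv P) \<phi> \<Longrightarrow> \<exists>a. \<phi> = hamiltonian (biv P) a"
  shows "rigid P"
proof -
  have hc: "homog 1 (curl P i)" for i using h homog_curl[of 1 P] by simp
  have "ozone_derivation (biv P) (vf (curl P))"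
    unfolding ozone_derivation_def poisson_derivation_vf
  proof (intro conjI allI ballI)
    fix z assume "z \<in> poisson_center (biv P)"
    then have "hamiltonian (biv P) z = (\<lambda>_. 0)" by (simp add: poisson_center_def hamiltonian_def)
    then show "vf (curl P) z = 0" unfolding divergence_hamiltonian[symmetric]
      by (simp add: divergence_def)
  qed (rule lie_curl[OF j])
  then have curl: "curl P i = 0" for i using linear_hamiltonian_0[of P "curl P", OF h hc] oz by blast
  have P: "P i = pd i (pot P)" for i using pot_unimodular[of P, OF h curl] .
  show ?thesis
    unfolding rigid_def
  proof (intro allI impI)
    fix v i assume v: "\<forall>i. homog 1 (v i)" "dv v = 0" "vf v (pot P) = 0"
    have "P = grad (pot P)" using P by (simp add: grad_def fun_eq_iff)
    then have L: "lie v P k = 0" for k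
      using lie_grad[of v "pot P" k] by (simp add: v)
    have "vf v z = 0" if "z \<in> poisson_center (biv P)" for z
    proof -
      have "cross P (grad z) i = 0" for i using that by (simp add: poisson_center_biv)
      from this[of 1] this[of 2] this[of 3] have c: "P 2 * pd 3 z = P 3 * pd 2 z"
        "P 3 * pd 1 z = P 1 * pd 3 z" "P 1 * pd 2 z = P 2 * pd 1 z"
        by (simp_all add: cross_def grad_def)
      have e: "P l * pd i z = P i * pd l z" for i
        using c exhaust_3[of i] exhaust_3[of l] by (auto simp: algebra_simps)
      have "P l * vf v z = v 1 * (P l * pd 1 z) + v 2 * (P l * pd 2 z) + v 3 * (P l * pd 3 z)"
        by (simp add: vf_def algebra_simps)
      also have "\<dots> = pd l z * vf v (pot P)"
        unfolding e by (simp add: vf_def P[symmetric] algebra_simps)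
      finally show ?thesis using P0 v(3) by simp
    qed
    then have "ozone_derivation (biv P) (vf v)"
      by (simp add: ozone_derivation_def poisson_derivation_vf L)
    then show "v i = 0" using linear_hamiltonian_0[of P v, OF h] v(1) oz by blast
  qed
qed

section \<open>Linear changes of coordinates\<close>

definition alg_hom :: "('k::field poly3 \<Rightarrow> 'k poly3) \<Rightarrow> bool" where
  "alg_hom f \<longleftrightarrow> (\<forall>p q. f (p + q) = f p + f q) \<and> (\<forall>p q. f (p * q) = f p * f q) \<and> (\<forall>c. f (cst c) = cst c)"

definition subst :: "(3 \<Rightarrow> 'k::field poly3) \<Rightarrow> 'k poly3 \<Rightarrow> 'k poly3" where
  "subst l p = (\<Sum>m\<in>Poly_Mapping.keys p. cst (Poly_Mapping.lookup p m) * (\<Prod>i\<in>UNIV. l i ^ Poly_Mapping.lookup m i))"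

lemma subst_add: "subst l (p + q) = subst l p + subst l q"
  unfolding subst_def by (rule setsum_keys_plus_distrib) (simp_all add: algebra_simps)

lemma subst_single: "subst l (Poly_Mapping.single m c) = cst c * (\<Prod>i\<in>UNIV. l i ^ Poly_Mapping.lookup m i)"
  by (simp add: subst_def)

lemma alg_hom_subst: "alg_hom (subst l)"
  unfolding alg_hom_def
proof (intro conjI allI)
  show "subst l (p * q) = subst l p * subst l q" for p q
  proof (induction p rule: poly_mapping_additive_induct)
    case (single m c)
    show ?case
    proof (induction q rule: poly_mapping_additive_induct)
      case (single m' c')
      show ?case
        by (simp only: mult_single subst_single lookup_add power_add prod.distrib cst_simps mult_ac)
    qed (simp add: distrib_left subst_add)
  qed (simp add: distrib_right subst_add)
  show "subst l (cst c) = cst c" for c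
    unfolding cst_def[of c] subst_single by (simp add: cst_def)
qed (rule subst_add)

lemma subst_X [simp]: "subst l (X i) = l i"
  using exhaust_3[of i] unfolding X_def subst_single UNIV_3
  by (auto simp: lookup_single when_def)

lemma
  assumes "alg_hom f"
  shows alg_hom_add: "f (p + q) = f p + f q"
    and alg_hom_mult: "f (p * q) = f p * f q"
    and alg_hom_cst: "f (cst c) = cst c"
    and alg_hom_0: "f 0 = 0"
    and alg_hom_1: "f 1 = 1"
    and alg_hom_numeral: "f (numeral u) = numeral u"
    and alg_hom_uminus: "f (- p) = - f p"
    and alg_hom_diff: "f (p - q) = f p - f q"
    and alg_hom_power: "f (p ^ n) = f p ^ n"
proof -
  show a: "f (p + q) = f p + f q" for p q using assms unfolding alg_hom_def by blast
  show m: "f (p * q) = f p * f q" for p q using assms unfolding alg_hom_def by blast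
  show c: "f (cst c) = cst c" for c using assms unfolding alg_hom_def by blast
  show "f 0 = 0" using c[of 0] by simp
  show o: "f 1 = 1" using c[of 1] by simp
  show "f (numeral u) = numeral u" using c[of "numeral u"] by simp
  show u: "f (- p) = - f p" for p
    using a[of p "- p"] \<open>f 0 = 0\<close> by (simp add: eq_neg_iff_add_eq_0 add.commute)
  show "f (p - q) = f p - f q" using a[of p "- q"] u by simp
  show "f (p ^ n) = f p ^ n" by (induction n) (simp_all add: o m)
qed

lemmas alg_hom_simps = alg_hom_add alg_hom_mult alg_hom_cst alg_hom_0 alg_hom_1 alg_hom_numeral
  alg_hom_uminus alg_hom_diff alg_hom_power

lemma alg_hom_sum: "alg_hom f \<Longrightarrow> f (sum h S) = (\<Sum>x\<in>S. f (h x))"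
  by (induction S rule: infinite_finite_induct) (auto simp: alg_hom_simps)

lemma alg_hom_comp: "alg_hom f \<Longrightarrow> alg_hom g \<Longrightarrow> alg_hom (\<lambda>p. f (g p))"
  by (auto simp: alg_hom_def)

lemma alg_hom_ext:
  assumes "alg_hom f" "alg_hom g" "\<And>i. f (X i) = g (X i)"
  shows "f p = g p"
  by (induction p rule: poly3_induct) (simp_all add: assms alg_hom_simps[OF assms(1)] alg_hom_simps[OF assms(2)])

lemma alg_hom_chain:
  assumes "alg_hom f"
  shows "pd i (f p) = pd i (f (X 1)) * f (pd 1 p) + pd i (f (X 2)) * f (pd 2 p) + pd i (f (X 3)) * f (pd 3 p)"
proof (induction p rule: poly3_induct)
  case (var j)
  then show ?case using exhaust_3[of j] by (auto simp: alg_hom_simps[OF assms])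
qed (simp_all add: alg_hom_simps[OF assms] algebra_simps)

definition lin_auto :: "('k::field poly3 \<Rightarrow> 'k poly3) \<Rightarrow> ('k poly3 \<Rightarrow> 'k poly3) \<Rightarrow> bool" where
  "lin_auto f g \<longleftrightarrow> alg_hom f \<and> alg_hom g \<and> (\<forall>i. homog 1 (f (X i)) \<and> homog 1 (g (X i)) \<and>
     f (g (X i)) = X i \<and> g (f (X i)) = X i)"

lemma lin_auto_sym: "lin_auto f g \<Longrightarrow> lin_auto g f"
  by (auto simp: lin_auto_def)

lemma lin_auto_inverse:
  assumes "lin_auto f g" shows "f (g p) = p" "g (f p) = p"
proof -
  have h: "alg_hom f" "alg_hom g" and x: "\<And>i. f (g (X i)) = X i" "\<And>i. g (f (X i)) = X i"
    using assms by (auto simp: lin_auto_def)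
  have "alg_hom (\<lambda>p. p)" by (simp add: alg_hom_def)
  then show "f (g p) = p" "g (f p) = p"
    using alg_hom_ext[OF alg_hom_comp[OF h] _ x(1)] alg_hom_ext[OF alg_hom_comp[OF h(2,1)] _ x(2)] by auto
qed

lemma lin_auto_homog:
  assumes "lin_auto f g" "homog d p" shows "homog d (f p)"
proof -
  have h: "alg_hom f" and x: "homog 1 (f (X i))" for i
    using assms by (auto simp: lin_auto_def)
  have m: "homog (wdeg (\<lambda>_. 1) m) (f (Poly_Mapping.single m 1))" for m
  proof (induction m rule: single_induct_3)
    case 1
    then show ?case by (simp add: alg_hom_simps[OF h])
  next
    case (2 m i)
    have "f (Poly_Mapping.single (m + Poly_Mapping.single i 1) 1) = f (X i) * f (Poly_Mapping.single m 1)"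
      unfolding X_mult_single[symmetric] by (simp add: alg_hom_simps[OF h])
    then show ?case using homog_mult[OF x 2] by (simp add: wdeg_add wdeg_single add.commute)
  qed
  have "f p = (\<Sum>m\<in>Poly_Mapping.keys p. f (Poly_Mapping.single m (Poly_Mapping.lookup p m)))"
    by (subst poly_mapping_expand) (simp add: alg_hom_sum[OF h])
  also have "\<dots> = (\<Sum>m\<in>Poly_Mapping.keys p. cst (Poly_Mapping.lookup p m) * f (Poly_Mapping.single m 1))"
    by (subst single_cst) (simp add: alg_hom_simps[OF h])
  also have "homog d \<dots>"
  proof (intro homog_sum homog_cst_mult)
    fix m' assume "m' \<in> Poly_Mapping.keys p"
    then have "wdeg (\<lambda>_. 1) m' = d" using assms(2) by (simp add: homog_whomog whomog_def)
    then show "homog d (f (Poly_Mapping.single m' 1))" using m by metis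
  qed
  finally show ?thesis .
qed

lemma lin_auto_pd_X:
  assumes "lin_auto f g" shows "\<exists>c. pd i (f (X j)) = cst c"
proof -
  have "homog (1 - 1) (pd i (f (X j)))"
    using assms by (intro homog_pd) (auto simp: lin_auto_def)
  then show ?thesis using homog_0_cst by auto
qed

text \<open>Both brackets are Jacobian determinants, and the chain rule multiplies them by the
  determinant of the linear change. It is essential that \<open>d\<close> does not depend on
  \<Omega>, \<open>a\<close> and \<open>b\<close>.\<close>

lemma lin_auto_biv_grad:
  assumes "lin_auto f g"
  obtains d where "\<And>\<Omega> a b. biv (grad (f \<Omega>)) (f a) (f b) = cst d * f (biv (grad \<Omega>) a b)"
proof -
  have h: "alg_hom f" using assms by (simp add: lin_auto_def)
  obtain M where M: "\<And>i j. pd i (f (X j)) = cst (M i j)"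
    using lin_auto_pd_X[OF assms] by metis
  define d where "d = M 1 1 * (M 2 2 * M 3 3 - M 2 3 * M 3 2) + M 1 2 * (M 2 3 * M 3 1 - M 2 1 * M 3 3)
    + M 1 3 * (M 2 1 * M 3 2 - M 2 2 * M 3 1)"
  have "biv (grad (f \<Omega>)) (f a) (f b) = cst d * f (biv (grad \<Omega>) a b)" for \<Omega> a b
    unfolding biv_expand grad_def d_def alg_hom_chain[OF h, of _ \<Omega>] alg_hom_chain[OF h, of _ a]
      alg_hom_chain[OF h, of _ b] M alg_hom_simps[OF h] cst_simps
    by algebra
  then show thesis using that by blast
qed

text \<open>The divergence is a trace, and traces are invariant under conjugation; \<open>NM\<close>
  is the product of the two mutually inverse coefficient matrices.\<close>

lemma lin_auto_dv:
  assumes "lin_auto f g"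
  shows "dv (\<lambda>i. f (vf v (g (X i)))) = f (dv v)"
proof -
  have h: "alg_hom f" "alg_hom g" using assms by (simp_all add: lin_auto_def)
  obtain M where M: "\<And>i j. pd i (f (X j)) = cst (M i j)"
    using lin_auto_pd_X[OF assms] by metis
  obtain N where N: "\<And>i j. pd i (g (X j)) = cst (N i j)"
    using lin_auto_pd_X[OF lin_auto_sym[OF assms]] by metis
  have NM: "cst (N k 1) * cst (M 1 j) + cst (N k 2) * cst (M 2 j) + cst (N k 3) * cst (M 3 j)
      = (if k = j then 1 else (0::'a poly3))" for k j
  proof -
    have "pd k (g (f (X j))) = pd k (X j)" by (simp add: lin_auto_inverse[OF assms])
    then show ?thesis
      by (simp add: alg_hom_chain[OF h(2), of k "f (X j)"] M N alg_hom_simps[OF h(2)] pd_X)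
  qed
  have "dv (\<lambda>i. f (vf v (g (X i)))) =
    (\<Sum>k\<in>UNIV. \<Sum>j\<in>UNIV. (cst (N k 1) * cst (M 1 j) + cst (N k 2) * cst (M 2 j) + cst (N k 3) * cst (M 3 j)) * f (pd j (v k)))"
    unfolding dv_def vf_def N alg_hom_simps[OF h(1)] sum_3
    by (simp add: alg_hom_chain[OF h(1), of _ "v _"] M algebra_simps)
  also have "\<dots> = f (dv v)"
    unfolding NM by (simp add: sum_3 dv_def alg_hom_simps[OF h(1)])
  finally show ?thesis .
qed

definition lin_equiv :: "'k::field poly3 \<Rightarrow> 'k poly3 \<Rightarrow> bool" where
  "lin_equiv p q \<longleftrightarrow> (\<exists>f g. lin_auto f g \<and> f p = q)"

lemma lin_equiv_trans: "lin_equiv p q \<Longrightarrow> lin_equiv q r \<Longrightarrow> lin_equiv p r"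
proof -
  assume "lin_equiv p q" "lin_equiv q r"
  then obtain f g f' g' where a: "lin_auto f g" "f p = q" "lin_auto f' g'" "f' q = r"
    by (auto simp: lin_equiv_def)
  have "lin_auto (\<lambda>p. f' (f p)) (\<lambda>p. g (g' p))"
    unfolding lin_auto_def
  proof (intro conjI allI)
    show "alg_hom (\<lambda>p. f' (f p))" "alg_hom (\<lambda>p. g (g' p))"
      using a by (simp_all add: alg_hom_comp lin_auto_def)
    show "homog 1 (f' (f (X i)))" "homog 1 (g (g' (X i)))" for i
      using lin_auto_homog[OF a(3)] lin_auto_homog[OF lin_auto_sym[OF a(1)]] a by (simp_all add: lin_auto_def)
  qed (simp_all add: lin_auto_inverse[OF a(1)] lin_auto_inverse[OF a(3)])
  then show ?thesis using a by (auto simp: lin_equiv_def)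
qed

text \<open>Column \<open>j\<close> holds the image of \<open>X j\<close>, so row \<open>i\<close>
  is the vector that replaces the \<open>i\<close>-th basis vector. With this convention
  \<open>chg\<close> below evaluates a trilinear form on rows.\<close>

definition lin_subst :: "(3 \<Rightarrow> 3 \<Rightarrow> 'k::field) \<Rightarrow> 'k poly3 \<Rightarrow> 'k poly3" where
  "lin_subst M = subst (\<lambda>j. cst (M 1 j) * X 1 + cst (M 2 j) * X 2 + cst (M 3 j) * X 3)"

lemma lin_auto_lin_subst:
  fixes M N :: "3 \<Rightarrow> 3 \<Rightarrow> 'k::field"
  assumes MN: "\<And>i j. N i 1 * M 1 j + N i 2 * M 2 j + N i 3 * M 3 j = (if i = j then 1 else 0)"
    and NM: "\<And>i j. M i 1 * N 1 j + M i 2 * N 2 j + M i 3 * N 3 j = (if i = j then 1 else 0)"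
  shows "lin_auto (lin_subst M) (lin_subst N)"
proof -
  have l: "cst a * (cst b1 * X 1 + cst b2 * X 2 + cst b3 * X 3) + cst a' * (cst c1 * X 1 + cst c2 * X 2 + cst c3 * X 3)
    + cst a'' * (cst d1 * X 1 + cst d2 * X 2 + cst d3 * X 3) =
    cst (b1 * a + c1 * a' + d1 * a'') * X 1 + cst (b2 * a + c2 * a' + d2 * a'') * X 2 + cst (b3 * a + c3 * a' + d3 * a'') * X 3"
    for a a' a'' b1 b2 b3 c1 c2 c3 d1 d2 d3 :: 'k
    by (simp add: algebra_simps)
  have h: "alg_hom (lin_subst K)" for K :: "3 \<Rightarrow> 3 \<Rightarrow> 'k" by (simp add: lin_subst_def alg_hom_subst)
  have x: "lin_subst K (X j) = cst (K 1 j) * X 1 + cst (K 2 j) * X 2 + cst (K 3 j) * X 3" for K :: "3 \<Rightarrow> 3 \<Rightarrow> 'k" and j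
    by (simp add: lin_subst_def)
  show ?thesis
    unfolding lin_auto_def
  proof (intro conjI allI h)
    fix i
    show "lin_subst M (lin_subst N (X i)) = X i"
      unfolding x alg_hom_simps[OF h] l NM using exhaust_3[of i] by auto
    show "lin_subst N (lin_subst M (X i)) = X i"
      unfolding x alg_hom_simps[OF h] l MN using exhaust_3[of i] by auto
    show "homog 1 (lin_subst M (X i))" "homog 1 (lin_subst N (X i))"
      unfolding x by (intro homog_add homog_cst_mult; simp)+
  qed
qed

section \<open>Jacobian brackets and their transport\<close>

definition div_free_hamiltonian :: "'k::field poly3 \<Rightarrow> bool" where
  "div_free_hamiltonian \<Omega> \<longleftrightarrow> (\<forall>v. vf v \<Omega> = 0 \<longrightarrow> dv v = 0 \<longrightarrow> (\<exists>a. \<forall>i. v i = cross (grad \<Omega>) (grad a) i))"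

text \<open>Zero is excluded because it is homogeneous of every degree, whereas \<open>n\<close> has
  to be a multiple of 3.\<close>

definition center_powers :: "'k::field poly3 \<Rightarrow> bool" where
  "center_powers \<Omega> \<longleftrightarrow> (\<forall>n z. homog n z \<longrightarrow> z \<noteq> 0 \<longrightarrow> (\<forall>i. cross (grad \<Omega>) (grad z) i = 0) \<longrightarrow>
     (\<exists>k c. n = 3 * int k \<and> z = cst c * \<Omega> ^ k))"

lemma cross_0_iff_biv: "(\<forall>i. cross P (grad z) i = 0) \<longleftrightarrow> (\<forall>b. biv P z b = 0)"
  using poisson_center_biv[of z P] by (simp add: poisson_center_def)

lemma vec_eq_vf_iff: "(\<forall>i. v i = cross P (grad a) i) \<longleftrightarrow> (\<forall>f. vf v f = biv P a f)"
  by (auto simp: hamiltonian_biv vf_eq_iff[symmetric] fun_eq_iff)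

text \<open>Conjugate the field by the coordinate change: \<open>lin_auto_dv\<close> keeps the
  divergence zero, and \<open>lin_auto_biv_grad\<close> carries the resulting Hamiltonian field
  back.\<close>

lemma div_free_hamiltonian_equiv:
  assumes "lin_equiv \<Omega> \<Omega>'" "div_free_hamiltonian \<Omega>'"
  shows "div_free_hamiltonian \<Omega>"
proof -
  obtain f g where fg: "lin_auto f g" "f \<Omega> = \<Omega>'" using assms(1) by (auto simp: lin_equiv_def)
  obtain d where d: "\<And>\<Omega> a b. biv (grad (f \<Omega>)) (f a) (f b) = cst d * f (biv (grad \<Omega>) a b)"
    using lin_auto_biv_grad[OF fg(1)] by blast
  have h: "alg_hom f" "alg_hom g" using fg by (simp_all add: lin_auto_def)
  show ?thesis
    unfolding div_free_hamiltonian_def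
  proof (intro allI impI)
    fix v assume v: "vf v \<Omega> = 0" "dv v = 0"
    define u where "u i = f (vf v (g (X i)))" for i
    have d': "derivation (\<lambda>p. f (vf v (g p)))"
    proof (rule derivationI)
      fix p q and c
      show "f (vf v (g (p + q))) = f (vf v (g p)) + f (vf v (g q))"
        by (simp only: alg_hom_add[OF h(1)] alg_hom_add[OF h(2)] derivation_add[OF derivation_vf])
      show "f (vf v (g (cst c * p))) = cst c * f (vf v (g p))"
        by (simp only: alg_hom_mult[OF h(1)] alg_hom_mult[OF h(2)] alg_hom_cst[OF h(1)] alg_hom_cst[OF h(2)]
            derivation_cst_mult[OF derivation_vf])
      show "f (vf v (g (p * q))) = f (vf v (g p)) * q + p * f (vf v (g q))"
        by (simp only: alg_hom_mult[OF h(1)] alg_hom_mult[OF h(2)] alg_hom_add[OF h(1)]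
            derivation_mult[OF derivation_vf] lin_auto_inverse[OF fg(1)])
    qed
    have u: "f (vf v (g p)) = vf u p" for p
      unfolding u_def[abs_def] by (rule derivation_eq_vf[OF d'])
    have "vf u \<Omega>' = 0" unfolding u[symmetric] fg(2)[symmetric]
      by (simp add: lin_auto_inverse[OF fg(1)] v alg_hom_simps[OF h(1)])
    moreover have "dv u = 0" unfolding u_def lin_auto_dv[OF fg(1)] by (simp add: v alg_hom_simps[OF h(1)])
    ultimately obtain a where "\<forall>p. vf u p = biv (grad \<Omega>') a p"
      using assms(2) unfolding div_free_hamiltonian_def vec_eq_vf_iff by blast
    then have a: "f (vf v (g p)) = biv (grad \<Omega>') a p" for p by (simp add: u)
    \<comment> \<open>The determinant \<open>d\<close> of the coordinate change is absorbed into the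
      Hamiltonian function.\<close>
    have "vf v p = biv (grad \<Omega>) (cst d * g a) p" for p
    proof -
      have "f (vf v p) = biv (grad (f \<Omega>)) (f (g a)) (f p)"
        using a[of "f p"] by (simp add: lin_auto_inverse[OF fg(1)] fg(2))
      also have "\<dots> = f (biv (grad \<Omega>) (cst d * g a) p)"
        unfolding d by (simp add: alg_hom_simps[OF h(1)] biv_expand algebra_simps)
      finally show ?thesis by (metis lin_auto_inverse(2)[OF fg(1)])
    qed
    then show "\<exists>a. \<forall>i. v i = cross (grad \<Omega>) (grad a) i"
      unfolding vec_eq_vf_iff by blast
  qed
qed

lemma center_powers_equiv:
  assumes "lin_equiv \<Omega> \<Omega>'" "center_powers \<Omega>'"
  shows "center_powers \<Omega>"
proof -
  obtain f g where fg: "lin_auto f g" "f \<Omega> = \<Omega>'" using assms(1) by (auto simp: lin_equiv_def)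
  obtain d where d: "\<And>\<Omega> a b. biv (grad (f \<Omega>)) (f a) (f b) = cst d * f (biv (grad \<Omega>) a b)"
    using lin_auto_biv_grad[OF fg(1)] by blast
  have h: "alg_hom f" "alg_hom g" using fg by (simp_all add: lin_auto_def)
  show ?thesis
    unfolding center_powers_def cross_0_iff_biv
  proof (intro allI impI)
    fix n z assume z: "homog n z" "z \<noteq> 0" "\<forall>b. biv (grad \<Omega>) z b = 0"
    have "biv (grad \<Omega>') (f z) b = 0" for b
      using d[of \<Omega> z "g b"] z(3) by (simp add: lin_auto_inverse[OF fg(1)] fg(2) alg_hom_simps[OF h(1)])
    moreover have "f z \<noteq> 0" using z(2) lin_auto_inverse(2)[OF fg(1)] alg_hom_0[OF h(2)] by metis
    moreover have "homog n (f z)" using lin_auto_homog[OF fg(1) z(1)] .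
    ultimately obtain k c where kc: "n = 3 * int k" "f z = cst c * \<Omega>' ^ k"
      using assms(2) unfolding center_powers_def cross_0_iff_biv by blast
    have "z = g (f z)" by (simp add: lin_auto_inverse[OF fg(1)])
    also have "\<dots> = cst c * g \<Omega>' ^ k" unfolding kc by (simp add: alg_hom_simps[OF h(2)])
    also have "g \<Omega>' = \<Omega>" unfolding fg(2)[symmetric] by (simp add: lin_auto_inverse[OF fg(1)])
    finally show "\<exists>k c. n = 3 * int k \<and> z = cst c * \<Omega> ^ k" using kc by blast
  qed
qed

section \<open>Leading forms and the cuspidal cubic\<close>

definition wle :: "(3 \<Rightarrow> int) \<Rightarrow> int \<Rightarrow> 'k::field poly3 \<Rightarrow> bool" where
  "wle w N p \<longleftrightarrow> (\<forall>M>N. wcomp w M p = 0)"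

lemma wle_whomog: "whomog w d p \<Longrightarrow> d \<le> N \<Longrightarrow> wle w N p"
  by (auto simp: wle_def wcomp_whomog)

lemma wle_add: "wle w N p \<Longrightarrow> wle w N q \<Longrightarrow> wle w N (p + q)"
  by (simp add: wle_def)

lemma wle_diff: "wle w N p \<Longrightarrow> wle w N q \<Longrightarrow> wle w N (p - q)"
  by (simp add: wle_def)

lemma wle_lookup: "wle w N p \<longleftrightarrow> (\<forall>m\<in>Poly_Mapping.keys p. wdeg w m \<le> N)"
proof
  assume w: "wle w N p"
  show "\<forall>m\<in>Poly_Mapping.keys p. wdeg w m \<le> N"
  proof (rule ballI, rule ccontr)
    fix m assume "m \<in> Poly_Mapping.keys p" "\<not> wdeg w m \<le> N"
    then have "wcomp w (wdeg w m) p = 0" using w by (simp add: wle_def)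
    then have "Poly_Mapping.lookup (wcomp w (wdeg w m) p) m = 0" by simp
    then show False using \<open>m \<in> Poly_Mapping.keys p\<close> by (simp add: lookup_wcomp in_keys_iff)
  qed
next
  assume k: "\<forall>m\<in>Poly_Mapping.keys p. wdeg w m \<le> N"
  have "wcomp w M p = 0" if "M > N" for M
  proof (rule poly_mapping_eqI)
    fix m show "Poly_Mapping.lookup (wcomp w M p) m = Poly_Mapping.lookup 0 m"
      using k that by (force simp: lookup_wcomp in_keys_iff)
  qed
  then show "wle w N p" by (simp add: wle_def)
qed

lemma wle_mult: "wle w N p \<Longrightarrow> wle w M q \<Longrightarrow> wle w (N + M) (p * q)"
  using keys_mult[of p q] by (fastforce simp: wle_lookup wdeg_add)

lemma wle_pd: "wle w N p \<Longrightarrow> wle w (N - w i) (pd i p)"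
  by (simp add: wle_def wcomp_pd)

lemma wle_mono: "wle w N p \<Longrightarrow> N \<le> M \<Longrightarrow> wle w M p"
  by (simp add: wle_def)

lemma wle_Suc: "wle w N p \<Longrightarrow> wle w (N - 1) (p - wcomp w N p)"
  unfolding wle_def
proof (intro allI impI)
  fix M assume "\<forall>M>N. wcomp w M p = 0" "N - 1 < M"
  then show "wcomp w M (p - wcomp w N p) = 0"
    by (cases "M = N") (auto simp: wcomp_wcomp)
qed

text \<open>Whatever lies below the top weight of one factor contributes only below weight
  \<open>N + M\<close>.\<close>

lemma wcomp_mult_top:
  assumes "wle w N p" "wle w M q"
  shows "wcomp w (N + M) (p * q) = wcomp w N p * wcomp w M q"
proof -
  let ?p = "p - wcomp w N p" and ?q = "q - wcomp w M q"
  have a: "wle w ((N - 1) + M) (?p * q)" using wle_mult[OF wle_Suc[OF assms(1)] assms(2)] .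
  have "wcomp w (N + M) (p * q) = wcomp w (N + M) (?p * q) + wcomp w (N + M) (wcomp w N p * q)"
    by (simp flip: wcomp_add distrib_right)
  also have "wcomp w (N + M) (?p * q) = 0" using a by (simp add: wle_def)
  also have "wcomp w (N + M) (wcomp w N p * q) = wcomp w N p * wcomp w M q"
    by (simp add: wcomp_mult[OF whomog_wcomp])
  finally show ?thesis by simp
qed

lemma wle_bound: "\<exists>N. wle w N p"
proof -
  have "\<forall>m\<in>Poly_Mapping.keys p. wdeg w m \<le> Max (wdeg w ` Poly_Mapping.keys p)" by simp
  then show ?thesis unfolding wle_lookup by blast
qed

lemma wle_top:
  assumes "p \<noteq> 0"
  obtains N where "wle w N p" "wcomp w N p \<noteq> 0"
proof -
  let ?S = "wdeg w ` Poly_Mapping.keys p"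
  have ne: "?S \<noteq> {}" using assms by simp
  have "wle w (Max ?S) p" by (simp add: wle_lookup)
  moreover have "wcomp w (Max ?S) p \<noteq> 0"
  proof
    assume z: "wcomp w (Max ?S) p = 0"
    obtain m where m: "m \<in> Poly_Mapping.keys p" "wdeg w m = Max ?S"
      using Max_in[OF _ ne] by (metis finite_imageI finite_keys imageE)
    then have "Poly_Mapping.lookup (wcomp w (Max ?S) p) m \<noteq> 0" by (simp add: lookup_wcomp in_keys_iff)
    then show False using z by simp
  qed
  ultimately show thesis using that by blast
qed

text \<open>The partial derivative in direction \<open>i\<close> lowers weights by
  \<open>w i\<close>, so a field that shifts weights by \<open>d\<close> has its \<open>i\<close>-th
  entry in weight \<open>d + w i\<close>.\<close>

definition vcomp :: "(3 \<Rightarrow> int) \<Rightarrow> int \<Rightarrow> (3 \<Rightarrow> 'k::field poly3) \<Rightarrow> 3 \<Rightarrow> 'k poly3" where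
  "vcomp w d v i = wcomp w (d + w i) (v i)"

lemma dv_vcomp: "dv (vcomp w d v) = wcomp w d (dv v)"
  by (simp add: dv_def vcomp_def wcomp_pd)

lemma vf_vcomp:
  assumes "whomog w e \<Omega>"
  shows "vf (vcomp w d v) \<Omega> = wcomp w (d + e) (vf v \<Omega>)"
proof -
  have "wcomp w (d + e) (v i * pd i \<Omega>) = wcomp w (d + w i) (v i) * pd i \<Omega>" for i
    using wcomp_mult[OF whomog_pd[OF assms], of "d + e" i "v i"]
    by (simp add: mult.commute)
  then show ?thesis by (simp add: vf_def vcomp_def)
qed

lemma vcomp_expand:
  "\<exists>D. finite D \<and> (\<forall>i. v i = (\<Sum>d\<in>D. vcomp w d v i))"
proof -
  define D where "D = (\<Union>i. (\<lambda>m. wdeg w m - w i) ` Poly_Mapping.keys (v i))"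
  have f: "finite D" unfolding D_def by simp
  have "v i = (\<Sum>d\<in>D. vcomp w d v i)" for i
  proof -
    have "v i = (\<Sum>e\<in>(\<lambda>d. d + w i) ` D. wcomp w e (v i))"
    proof (rule wcomp_expand)
      fix m assume "m \<in> Poly_Mapping.keys (v i)"
      then have "wdeg w m - w i \<in> D" unfolding D_def by blast
      then show "wdeg w m \<in> (\<lambda>d. d + w i) ` D" by (rule rev_image_eqI) simp
    qed (use f in simp)
    also have "\<dots> = (\<Sum>d\<in>D. vcomp w d v i)"
      unfolding vcomp_def by (subst sum.reindex) (auto simp: inj_on_def)
    finally show ?thesis .
  qed
  with f show ?thesis by blast
qed

definition ham :: "'k::field poly3 \<Rightarrow> (3 \<Rightarrow> 'k poly3) \<Rightarrow> bool" where
  "ham \<Omega> v \<longleftrightarrow> (\<exists>a. \<forall>i. v i = cross (grad \<Omega>) (grad a) i)"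

lemma ham_0: "ham \<Omega> (\<lambda>i. 0)"
  unfolding ham_def by (rule exI[of _ 0]) (simp add: cross_def grad_def)

lemma ham_add: "ham \<Omega> u \<Longrightarrow> ham \<Omega> v \<Longrightarrow> ham \<Omega> (\<lambda>i. u i + v i)"
  unfolding ham_def
proof (elim exE)
  fix a b assume "\<forall>i. u i = cross (grad \<Omega>) (grad a) i" "\<forall>i. v i = cross (grad \<Omega>) (grad b) i"
  then show "\<exists>a. \<forall>i. u i + v i = cross (grad \<Omega>) (grad a) i"
    by (intro exI[of _ "a + b"]) (simp add: cross_def grad_def algebra_simps)
qed

lemma ham_cst: "ham \<Omega> v \<Longrightarrow> ham \<Omega> (\<lambda>i. cst c * v i)"
  unfolding ham_def
proof (elim exE)
  fix a assume "\<forall>i. v i = cross (grad \<Omega>) (grad a) i"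
  then show "\<exists>a. \<forall>i. cst c * v i = cross (grad \<Omega>) (grad a) i"
    by (intro exI[of _ "cst c * a"]) (simp add: cross_def grad_def algebra_simps)
qed

lemma ham_sum: "(\<And>x. x \<in> S \<Longrightarrow> ham \<Omega> (f x)) \<Longrightarrow> ham \<Omega> (\<lambda>i. \<Sum>x\<in>S. f x i)"
  by (induction S rule: infinite_finite_induct) (auto simp: ham_0 ham_add)

lemma ham_cong: "ham \<Omega> u \<Longrightarrow> (\<And>i. v i = u i) \<Longrightarrow> ham \<Omega> v"
  by (simp add: ham_def)

lemma ham_cst_cancel:
  assumes "ham \<Omega> (\<lambda>i. cst c * v i)" "c \<noteq> 0" shows "ham \<Omega> v"
proof (rule ham_cong[OF ham_cst[OF assms(1), of "inverse c"]])
  show "v i = cst (inverse c) * (cst c * v i)" for i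
    unfolding mult.assoc[symmetric] by (simp only: cst_inverse[OF assms(2)] mult_1)
qed

lemma div_free_hamiltonian_ham:
  "div_free_hamiltonian \<Omega> \<longleftrightarrow> (\<forall>v. vf v \<Omega> = 0 \<longrightarrow> dv v = 0 \<longrightarrow> ham \<Omega> v)"
  by (simp add: div_free_hamiltonian_def ham_def)

lemma X_remainder: "\<exists>q. p = X i * q + subst (X(i := 0)) p"
proof (induction p rule: poly3_induct)
  case (const c)
  then show ?case by (intro exI[of _ 0]) (simp add: alg_hom_simps[OF alg_hom_subst])
next
  case (var j)
  then show ?case
    by (cases "i = j") (auto intro: exI[of _ 1] exI[of _ 0])
next
  case (add p q)
  then obtain a b where "p = X i * a + subst (X(i := 0)) p" "q = X i * b + subst (X(i := 0)) q" by blast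
  then show ?case
    unfolding alg_hom_add[OF alg_hom_subst] by (intro exI[of _ "a + b"]) algebra
next
  case (mult p q)
  then obtain a b where "p = X i * a + subst (X(i := 0)) p" "q = X i * b + subst (X(i := 0)) q" by blast
  \<comment> \<open>With remainders p0 and q0, the product (X a + p0) (X b + q0) equals X (a q + b
    p0) + p0 q0.\<close>
  then show ?case
    unfolding alg_hom_mult[OF alg_hom_subst] by (intro exI[of _ "a * q + b * subst (X(i := 0)) p"]) algebra
qed

text \<open>Setting \<open>X i\<close> to 0 kills the left side and leaves \<open>X j\<close> times
  the remainder of \<open>p\<close>; unique factorization is avoided.\<close>

lemma X_dvd:
  assumes "X i * a = X j * p" "i \<noteq> j"
  obtains q where "p = X i * q"
proof -
  let ?s = "subst (X(i := 0)) :: 'a poly3 \<Rightarrow> _"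
  have "?s (X i * a) = ?s (X j * p)" using assms by simp
  then have "?s p = 0"
    using assms(2) by (auto simp: alg_hom_simps[OF alg_hom_subst])
  then show thesis using X_remainder[of p i] that by auto
qed

section \<open>Cubics in flex normal form and their leading forms\<close>

lemma single_eq_powers:
  "Poly_Mapping.single m c = cst c * X 1 ^ Poly_Mapping.lookup m 1 * X 2 ^ Poly_Mapping.lookup m 2 * X 3 ^ Poly_Mapping.lookup m 3"
proof -
  have "alg_hom (\<lambda>p. p)" by (simp add: alg_hom_def)
  then have "subst X p = p" for p :: "'a poly3"
    using alg_hom_ext[OF alg_hom_subst, of "\<lambda>p. p" X] by simp
  then have "Poly_Mapping.single m c = subst X (Poly_Mapping.single m c)" by simp
  then show ?thesis unfolding subst_single UNIV_3 by (simp add: mult.assoc)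
qed

text \<open>\<open>z = X 2\<close> is the tangent line at the flex \<open>X 1 = X 2 = 0\<close>, whose tangent meets the curve
  in \<open>X 1 ^ 3 = 0\<close>.\<close>

definition flex_form :: "'k::field \<Rightarrow> 'k \<Rightarrow> 'k \<Rightarrow> 'k \<Rightarrow> 'k \<Rightarrow> 'k \<Rightarrow> 'k \<Rightarrow> 'k poly3" where
  "flex_form c1 c2 e1 e2 e3 e4 e5 = cst c1 * X 3 ^ 2 * X 2 + cst c2 * X 1 ^ 3 + cst e1 * X 1 * X 2 * X 3
     + cst e2 * X 1 ^ 2 * X 2 + cst e3 * X 2 ^ 2 * X 3 + cst e4 * X 1 * X 2 ^ 2 + cst e5 * X 2 ^ 3"

lemma whomog_monomial:
  "whomog w (int a * w 1 + int b * w 2 + int c * w 3) (cst u * X 1 ^ a * X 2 ^ b * X 3 ^ c)"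
  by (intro whomog_mult whomog_cst_mult whomog_power whomog_X)

lemma flex_form_terms:
  "flex_form c1 c2 e1 e2 e3 e4 e5 = cst c1 * X 1 ^ 0 * X 2 ^ 1 * X 3 ^ 2 + cst c2 * X 1 ^ 3 * X 2 ^ 0 * X 3 ^ 0
     + cst e1 * X 1 ^ 1 * X 2 ^ 1 * X 3 ^ 1 + cst e2 * X 1 ^ 2 * X 2 ^ 1 * X 3 ^ 0 + cst e3 * X 1 ^ 0 * X 2 ^ 2 * X 3 ^ 1
     + cst e4 * X 1 ^ 1 * X 2 ^ 2 * X 3 ^ 0 + cst e5 * X 1 ^ 0 * X 2 ^ 3 * X 3 ^ 0"
  by (simp add: flex_form_def algebra_simps)

lemma homog_flex_form: "homog 3 (flex_form c1 c2 e1 e2 e3 e4 e5)"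
  unfolding flex_form_terms homog_whomog
  using whomog_monomial[of "\<lambda>_. 1" 0 1 2] whomog_monomial[of "\<lambda>_. 1" 3 0 0] whomog_monomial[of "\<lambda>_. 1" 1 1 1]
    whomog_monomial[of "\<lambda>_. 1" 2 1 0] whomog_monomial[of "\<lambda>_. 1" 0 2 1] whomog_monomial[of "\<lambda>_. 1" 1 2 0]
    whomog_monomial[of "\<lambda>_. 1" 0 3 0]
  by (intro whomog_add) simp_all

lemma pd_power_gen: "pd i (p ^ n) = of_nat n * p ^ (n - 1) * pd i p"
  by (cases n) (simp_all only: pd_power diff_Suc_1, simp)

text \<open>Both terms of the cusp have weight 6 and the five other monomials of a flex form have
  less. The weights are nonnegative, so an induction that lowers them terminates.\<close>

definition w_cusp :: "3 \<Rightarrow> int" where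
  "w_cusp i = (if i = 1 then 2 else if i = 2 then 0 else 3)"

text \<open>Here the leading form of a flex form is the single monomial
  \<open>X 3 ^ 2 * X 2\<close>, which is enough to determine the center.\<close>

definition w_y :: "3 \<Rightarrow> int" where
  "w_y i = (if i = 3 then 1 else 0)"

text \<open>The weights of the torus that fixes the cusp: both of its terms have weight 0.\<close>

definition w_tor :: "3 \<Rightarrow> int" where
  "w_tor i = (if i = 1 then 0 else if i = 2 then -2 else 1)"

abbreviation (input) cusp :: "'k::field \<Rightarrow> 'k \<Rightarrow> 'k poly3" where
  "cusp c1 c2 \<equiv> flex_form c1 c2 0 0 0 0 0"

lemma flex_form_leading:
  "wle w_cusp 6 (flex_form c1 c2 e1 e2 e3 e4 e5)"
  "wcomp w_cusp 6 (flex_form c1 c2 e1 e2 e3 e4 e5) = cusp c1 c2"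
  "whomog w_cusp 6 (cusp c1 c2)" "whomog w_tor 0 (cusp c1 c2)"
  "wle w_y 2 (flex_form c1 c2 e1 e2 e3 e4 e5)"
  "wcomp w_y 2 (flex_form c1 c2 e1 e2 e3 e4 e5) = cst c1 * X 3 ^ 2 * X 2"
proof -
  have c: "whomog w_cusp 6 (cst c * X 1 ^ 0 * X 2 ^ 1 * X 3 ^ 2)" "whomog w_cusp 6 (cst c * X 1 ^ 3 * X 2 ^ 0 * X 3 ^ 0)"
    "whomog w_cusp 5 (cst c * X 1 ^ 1 * X 2 ^ 1 * X 3 ^ 1)" "whomog w_cusp 4 (cst c * X 1 ^ 2 * X 2 ^ 1 * X 3 ^ 0)"
    "whomog w_cusp 3 (cst c * X 1 ^ 0 * X 2 ^ 2 * X 3 ^ 1)" "whomog w_cusp 2 (cst c * X 1 ^ 1 * X 2 ^ 2 * X 3 ^ 0)"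
    "whomog w_cusp 0 (cst c * X 1 ^ 0 * X 2 ^ 3 * X 3 ^ 0)" for c :: 'a
    using whomog_monomial[of w_cusp 0 1 2 c] whomog_monomial[of w_cusp 3 0 0 c] whomog_monomial[of w_cusp 1 1 1 c]
      whomog_monomial[of w_cusp 2 1 0 c] whomog_monomial[of w_cusp 0 2 1 c] whomog_monomial[of w_cusp 1 2 0 c]
      whomog_monomial[of w_cusp 0 3 0 c] by (simp_all add: w_cusp_def)
  have y: "whomog w_y 2 (cst c * X 1 ^ 0 * X 2 ^ 1 * X 3 ^ 2)" "whomog w_y 0 (cst c * X 1 ^ 3 * X 2 ^ 0 * X 3 ^ 0)"
    "whomog w_y 1 (cst c * X 1 ^ 1 * X 2 ^ 1 * X 3 ^ 1)" "whomog w_y 0 (cst c * X 1 ^ 2 * X 2 ^ 1 * X 3 ^ 0)"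
    "whomog w_y 1 (cst c * X 1 ^ 0 * X 2 ^ 2 * X 3 ^ 1)" "whomog w_y 0 (cst c * X 1 ^ 1 * X 2 ^ 2 * X 3 ^ 0)"
    "whomog w_y 0 (cst c * X 1 ^ 0 * X 2 ^ 3 * X 3 ^ 0)" for c :: 'a
    using whomog_monomial[of w_y 0 1 2 c] whomog_monomial[of w_y 3 0 0 c] whomog_monomial[of w_y 1 1 1 c]
      whomog_monomial[of w_y 2 1 0 c] whomog_monomial[of w_y 0 2 1 c] whomog_monomial[of w_y 1 2 0 c]
      whomog_monomial[of w_y 0 3 0 c] by (simp_all add: w_y_def)
  have t: "whomog w_tor 0 (cst c * X 1 ^ 0 * X 2 ^ 1 * X 3 ^ 2)" "whomog w_tor 0 (cst c * X 1 ^ 3 * X 2 ^ 0 * X 3 ^ 0)" for c :: 'a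
    using whomog_monomial[of w_tor 0 1 2 c] whomog_monomial[of w_tor 3 0 0 c] by (simp_all add: w_tor_def)
  show "wle w_cusp 6 (flex_form c1 c2 e1 e2 e3 e4 e5)"
    unfolding flex_form_terms by (intro wle_add; rule wle_whomog[OF c(1)] wle_whomog[OF c(2)] wle_whomog[OF c(3)]
      wle_whomog[OF c(4)] wle_whomog[OF c(5)] wle_whomog[OF c(6)] wle_whomog[OF c(7)]; simp)
  show "wcomp w_cusp 6 (flex_form c1 c2 e1 e2 e3 e4 e5) = cusp c1 c2"
    unfolding flex_form_terms wcomp_add c[THEN wcomp_whomog] by simp
  show "whomog w_cusp 6 (cusp c1 c2)"
    using whomog_add[OF c(1)[of c1] c(2)[of c2]] by (simp add: flex_form_def mult_ac)
  show "whomog w_tor 0 (cusp c1 c2)"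
    using whomog_add[OF t(1)[of c1] t(2)[of c2]] by (simp add: flex_form_def mult_ac)
  show "wle w_y 2 (flex_form c1 c2 e1 e2 e3 e4 e5)"
    unfolding flex_form_terms by (intro wle_add; rule wle_whomog[OF y(1)] wle_whomog[OF y(2)] wle_whomog[OF y(3)]
      wle_whomog[OF y(4)] wle_whomog[OF y(5)] wle_whomog[OF y(6)] wle_whomog[OF y(7)]; simp)
  show "wcomp w_y 2 (flex_form c1 c2 e1 e2 e3 e4 e5) = cst c1 * X 3 ^ 2 * X 2"
    unfolding flex_form_terms wcomp_add y[THEN wcomp_whomog] by simp
qed

section \<open>The center of a bracket whose potential is a flex form\<close>

lemma pd_eq_0_lookup:
  fixes p :: "'k::field_char_0 poly3"
  assumes "pd i p = 0" "Poly_Mapping.lookup p m \<noteq> 0"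
  shows "Poly_Mapping.lookup m i = 0"
proof (rule ccontr)
  assume "Poly_Mapping.lookup m i \<noteq> 0"
  then have m: "m - Poly_Mapping.single i 1 + Poly_Mapping.single i 1 = m"
    by (intro poly_mapping_eqI) (auto simp: lookup_add lookup_minus lookup_single when_def)
  have "Poly_Mapping.lookup (pd i p) (m - Poly_Mapping.single i 1) = 0" using assms(1) by simp
  then show False using assms(2) unfolding lookup_pd m
    by (metis mult_eq_0_iff of_nat_eq_0_iff nat.distinct(1))
qed

text \<open>Parallel gradients are contracted with \<open>X\<close> and Euler's identity is applied
  to both factors. The equation is the logarithmic derivative of the statement that u^3 / \<Omega>^n
  is constant.\<close>

lemma central_euler:
  assumes "homog 3 \<Omega>" "homog n u" "\<And>i. cross (grad \<Omega>) (grad u) i = 0"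
  shows "3 * \<Omega> * pd i u = of_int n * u * pd i \<Omega>"
proof -
  have c: "pd 2 \<Omega> * pd 3 u = pd 3 \<Omega> * pd 2 u" "pd 3 \<Omega> * pd 1 u = pd 1 \<Omega> * pd 3 u" "pd 1 \<Omega> * pd 2 u = pd 2 \<Omega> * pd 1 u"
    using assms(3)[of 1] assms(3)[of 2] assms(3)[of 3] by (simp_all add: cross_def grad_def)
  have e: "3 * \<Omega> = X 1 * pd 1 \<Omega> + X 2 * pd 2 \<Omega> + X 3 * pd 3 \<Omega>"
    "of_int n * u = X 1 * pd 1 u + X 2 * pd 2 u + X 3 * pd 3 u"
    using euler_homog[OF assms(1)] euler_homog[OF assms(2)] by simp_all
  have "3 * \<Omega> * pd 1 u = of_int n * u * pd 1 \<Omega>" "3 * \<Omega> * pd 2 u = of_int n * u * pd 2 \<Omega>"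
    "3 * \<Omega> * pd 3 u = of_int n * u * pd 3 \<Omega>"
    unfolding e using c by algebra+
  then show ?thesis using exhaust_3[of i] by auto
qed

lemma homog_monomial_lookup:
  assumes "homog n p" "Poly_Mapping.lookup p m \<noteq> 0"
  shows "int (Poly_Mapping.lookup m 1) + int (Poly_Mapping.lookup m 2) + int (Poly_Mapping.lookup m 3) = n"
  using assms by (simp add: homog_def in_keys_iff mon_deg_def sum_3)

text \<open>The component of highest degree in \<open>X 3\<close> of a central element is a power of the monomial
  \<open>X 3 ^ 2 * X 2\<close>.\<close>

lemma center_top:
  fixes u :: "'k::field_char_0 poly3" and c1 c2 e1 e2 e3 e4 e5
  defines "\<Omega> \<equiv> flex_form c1 c2 e1 e2 e3 e4 e5"
  assumes c1: "c1 \<noteq> 0" and u: "homog n u" "u \<noteq> 0" "\<And>i. cross (grad \<Omega>) (grad u) i = 0"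
    and N: "wle w_y N u" "wcomp w_y N u \<noteq> 0"
  shows "\<exists>k c. n = 3 * int k \<and> N = 2 * int k \<and> wcomp w_y N u = cst c * (X 3 ^ 2 * X 2) ^ k"
proof -
  note fl = flex_form_leading(5,6)[of c1 c2 e1 e2 e3 e4 e5, folded \<Omega>_def]
  let ?u = "wcomp w_y N u" and ?T = "cst c1 * X 3 ^ 2 * X 2 :: 'k poly3"
  have ce: "3 * \<Omega> * pd i u = of_int n * u * pd i \<Omega>" for i
    by (rule central_euler) (simp_all add: u \<Omega>_def homog_flex_form u(3)[unfolded \<Omega>_def])
  have T: "?T \<noteq> 0" using c1 by simp
  have top: "wcomp w_y (2 + (N - w_y i)) (3 * \<Omega> * pd i u) = 3 * (?T * pd i ?u)" for i
    using wcomp_mult_top[OF fl(1) wle_pd[OF N(1), of i]] wcomp_cst_mult[of w_y _ 3 "\<Omega> * pd i u"]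
    by (simp add: fl(2) wcomp_pd mult.assoc)
  have top2: "wcomp w_y (N + (2 - w_y i)) (of_int n * u * pd i \<Omega>) = of_int n * (?u * pd i ?T)" for i
    using wcomp_mult_top[OF N(1) wle_pd[OF fl(1), of i]] wcomp_cst_mult[of w_y _ "of_int n" "u * pd i \<Omega>"] fl(2)
    by (simp add: wcomp_pd mult.assoc del: pd_mult pd_cst_mult)
  have eq: "3 * (?T * pd i ?u) = of_int n * (?u * pd i ?T)" for i
    using top[of i] top2[of i] ce[of i] by (simp add: algebra_simps)
  \<comment> \<open>The monomial \<open>?T\<close> does not contain \<open>X 1\<close>.\<close>
  have p1: "pd 1 ?u = 0" using eq[of 1] T by simp
  \<comment> \<open>Multiplied by \<open>X 3\<close>, the equation for \<open>i = 3\<close> compares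
    degrees in \<open>X 3\<close>: \<open>?T\<close> has degree 2 and \<open>?u\<close> has degree
    \<open>N\<close>.\<close>
  have "of_int (2 * n) * (?u * ?T) = X 3 * (of_int n * (?u * pd 3 ?T))" by (simp add: algebra_simps power2_eq_square)
  also have "\<dots> = X 3 * (3 * (?T * pd 3 ?u))" by (simp only: eq)
  also have "\<dots> = 3 * (?T * (X 3 * pd 3 ?u))" by (simp add: algebra_simps)
  also have "X 3 * pd 3 ?u = of_int N * ?u"
    using weighted_euler[OF whomog_wcomp[of w_y N u]] by (simp add: w_y_def)
  finally have "of_int (2 * n) * (?u * ?T) = of_int (3 * N) * (?u * ?T)" by (simp add: algebra_simps)
  then have "(of_int (2 * n) :: 'k poly3) = of_int (3 * N)" using N(2) T by simp
  then have nN: "2 * n = 3 * N" by (simp only: of_int_eq_iff)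
  have mon: "n = 3 * int (Poly_Mapping.lookup m 2) \<and> N = 2 * int (Poly_Mapping.lookup m 2) \<and> Poly_Mapping.lookup m 1 = 0
      \<and> Poly_Mapping.lookup m 3 = 2 * Poly_Mapping.lookup m 2" if "Poly_Mapping.lookup ?u m \<noteq> 0" for m
  proof -
    have 1: "Poly_Mapping.lookup m 1 = 0" using pd_eq_0_lookup[OF p1 that] .
    have w: "wdeg w_y m = N" and l: "Poly_Mapping.lookup u m \<noteq> 0"
      using that by (auto simp: lookup_wcomp split: if_splits)
    then have "int (Poly_Mapping.lookup m 3) = N" by (simp add: wdeg_def sum_3 w_y_def)
    moreover have "int (Poly_Mapping.lookup m 2) + int (Poly_Mapping.lookup m 3) = n"
      using homog_monomial_lookup[OF u(1) l] 1 by simp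
    ultimately show ?thesis using nN 1 by linarith
  qed
  obtain m where m: "Poly_Mapping.lookup ?u m \<noteq> 0"
    using N(2) by (metis poly_mapping_eqI lookup_zero)
  \<comment> \<open>All three exponents are determined by \<open>n\<close> and \<open>N\<close>, so
    only one monomial can occur in \<open>?u\<close>.\<close>
  have "m' = m" if "Poly_Mapping.lookup ?u m' \<noteq> 0" for m'
  proof (rule poly_mapping_eqI)
    fix i
    show "Poly_Mapping.lookup m' i = Poly_Mapping.lookup m i"
      using mon[OF m] mon[OF that] exhaust_3[of i] by auto
  qed
  then have "?u = Poly_Mapping.single m (Poly_Mapping.lookup ?u m)"
    by (intro poly_mapping_eqI) (auto simp: lookup_single when_def)
  then have "?u = cst (Poly_Mapping.lookup ?u m) * (X 3 ^ 2 * X 2) ^ Poly_Mapping.lookup m 2"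
    unfolding single_eq_powers[of m] using mon[OF m] by (simp add: power_mult power_mult_distrib mult_ac)
  then show ?thesis using mon[OF m] by blast
qed

lemma wcomp_power_top: "wle w N p \<Longrightarrow> wle w (int k * N) (p ^ k) \<and> wcomp w (int k * N) (p ^ k) = wcomp w N p ^ k"
proof (induction k)
  case 0
  then show ?case using wle_whomog[OF whomog_1[of w], of 0] by (simp add: wcomp_whomog[OF whomog_1])
next
  case (Suc k)
  then show ?case
    using wle_mult[of w N p "int k * N" "p ^ k"] wcomp_mult_top[of w N p "int k * N" "p ^ k"]
    by (simp add: algebra_simps)
qed

lemma biv_grad_power: "biv (grad \<Omega>) (\<Omega> ^ k) b = 0"
  by (simp add: biv_expand grad_def pd_power_gen algebra_simps)

text \<open>By \<open>center_top\<close> the leading form of a central element is a multiple of that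
  of a power of the potential. Subtracting this multiple of the power leaves a central element of
  the same degree, which turns out to be 0.\<close>

lemma center_powers_flex:
  fixes c1 :: "'k::field_char_0"
  assumes c1: "c1 \<noteq> 0"
  shows "center_powers (flex_form c1 c2 e1 e2 e3 e4 e5)"
  unfolding center_powers_def
proof (intro allI impI)
  let ?\<Omega> = "flex_form c1 c2 e1 e2 e3 e4 e5"
  fix n u assume u: "homog n u" "u \<noteq> 0" "\<forall>i. cross (grad ?\<Omega>) (grad u) i = 0"
  obtain N where N: "wle w_y N u" "wcomp w_y N u \<noteq> 0" using wle_top[OF u(2)] .
  obtain k c where k: "n = 3 * int k" "N = 2 * int k" "wcomp w_y N u = cst c * (X 3 ^ 2 * X 2) ^ k"
    using center_top[OF c1 u(1,2) u(3)[rule_format] N] by blast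
  define v where "v = u - cst (c / c1 ^ k) * ?\<Omega> ^ k"
  have v1: "homog n v" unfolding v_def k(1)
    using u(1) homog_power[OF homog_flex_form, of k] by (intro homog_diff homog_cst_mult) (simp_all add: k(1) mult.commute)
  have v2: "cross (grad ?\<Omega>) (grad v) i = 0" for i
  proof -
    have "biv (grad ?\<Omega>) v b = 0" for b
    proof -
      have "biv (grad ?\<Omega>) u b = 0" using u(3) unfolding cross_0_iff_biv by blast
      moreover have "biv (grad ?\<Omega>) v b = biv (grad ?\<Omega>) u b - cst (c / c1 ^ k) * biv (grad ?\<Omega>) (?\<Omega> ^ k) b"
        by (simp add: v_def biv_expand algebra_simps)
      ultimately show ?thesis by (simp add: biv_grad_power)
    qed
    then show ?thesis using cross_0_iff_biv by blast
  qed
  have pt: "wle w_y N (?\<Omega> ^ k)" "wcomp w_y N (?\<Omega> ^ k) = (cst c1 * X 3 ^ 2 * X 2) ^ k"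
    using wcomp_power_top[OF flex_form_leading(5), of k c1 c2 e1 e2 e3 e4 e5] by (simp_all add: k(2) mult.commute flex_form_leading(6))
  have v3: "wle w_y N v" unfolding v_def using N(1) pt(1) by (simp add: wle_def)
  have "cst (c / c1 ^ k) * cst c1 ^ k = cst c"
    using c1 by (simp flip: cst_simps(6,7))
  then have v4: "wcomp w_y N v = 0"
    unfolding v_def wcomp_diff wcomp_cst_mult pt(2) k(3)
    by (simp add: power_mult_distrib mult_ac)
  \<comment> \<open>The top weight of a nonzero central element is two thirds of its degree. A
    nonzero \<open>v\<close> would therefore have top weight \<open>N\<close>, where its component
    has just been removed.\<close>
  have "v = 0"
  proof (rule ccontr)
    assume nz: "v \<noteq> 0"
    obtain N' where N': "wle w_y N' v" "wcomp w_y N' v \<noteq> 0" using wle_top[OF nz] .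
    obtain k' c' where "n = 3 * int k'" "N' = 2 * int k'"
      using center_top[OF c1 v1 nz v2 N'] by blast
    then have "N' = N" using k by simp
    then show False using v4 N'(2) by simp
  qed
  then show "\<exists>k c. n = 3 * int k \<and> u = cst c * ?\<Omega> ^ k"
    using k(1) by (auto simp: v_def)
qed

text \<open>The field \<open>L = y \<partial>\<^sub>y - 2 z \<partial>\<^sub>z\<close> annihilates the cuspidal cubic and has divergence \<open>-1\<close>. If \<open>v\<close> is
  divergence free and annihilates it too, then \<open>v \<times> L = g \<nabla>\<Omega>\<close>, and taking the curl gives
  \<open>[L, v] - v = \<nabla>g \<times> \<nabla>\<Omega>\<close>. This settles every \<open>L\<close>-weight except one.\<close>

definition tor_field :: "3 \<Rightarrow> 'k::field poly3" where
  "tor_field i = of_int (w_tor i) * X i"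

lemma tor_field_simps: "tor_field 1 = 0" "tor_field 2 = - 2 * X 2" "tor_field 3 = X 3"
  by (simp_all add: tor_field_def w_tor_def)

lemma cusp_pd:
  "pd 1 (cusp c1 c2) = 3 * cst c2 * X 1 ^ 2" "pd 2 (cusp c1 c2) = cst c1 * X 3 ^ 2"
  "pd 3 (cusp c1 c2) = 2 * cst c1 * X 2 * X 3"
  by (simp_all add: flex_form_def algebra_simps)

text \<open>In the equation for annihilating the cusp, the first term has the factor
  \<open>X 1 ^ 2\<close> and the other two share the factor \<open>X 3\<close>, which must therefore
  divide \<open>v 1\<close>; \<open>X_dvd\<close> is used once for each factor
  \<open>X 1\<close>.\<close>

lemma cusp_quotient:
  fixes c1 :: "'k::field_char_0"
  assumes "c1 \<noteq> 0" "c2 \<noteq> 0" "vf v (cusp c1 c2) = 0"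
  obtains p where "v 1 = X 3 * p" "3 * cst c2 * X 1 ^ 2 * p = - cst c1 * (X 3 * v 2 + 2 * X 2 * v 3)"
proof -
  have e: "3 * cst c2 * X 1 ^ 2 * v 1 = X 3 * (- cst c1 * (X 3 * v 2 + 2 * X 2 * v 3))"
    using assms(3) unfolding vf_def cusp_pd by algebra
  have c: "3 * cst c2 = cst (3 * c2)" by simp
  have "X 3 * (cst (inverse (3 * c2)) * (- cst c1 * (X 3 * v 2 + 2 * X 2 * v 3))) = cst (inverse (3 * c2)) * (3 * cst c2 * X 1 ^ 2 * v 1)"
    unfolding e by (simp add: mult_ac)
  also have "\<dots> = (cst (inverse (3 * c2)) * cst (3 * c2)) * (X 1 * (X 1 * v 1))"
    unfolding c by (simp add: power2_eq_square mult_ac)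
  also have "\<dots> = X 1 * (X 1 * v 1)" using assms(2) by (subst cst_inverse) auto
  finally obtain q where q: "X 1 * v 1 = X 3 * q" by (metis X_dvd distinct_3(5))
  then obtain p where p: "v 1 = X 3 * p" using X_dvd[of 3 q 1 "v 1"] by auto
  have "X 3 * (3 * cst c2 * X 1 ^ 2 * p) = X 3 * (- cst c1 * (X 3 * v 2 + 2 * X 2 * v 3))"
    using e unfolding p by (simp add: algebra_simps)
  then have "3 * cst c2 * X 1 ^ 2 * p = - cst c1 * (X 3 * v 2 + 2 * X 2 * v 3)" by (simp only: mult_left_cancel[OF X_neq_0])
  with p show thesis using that by blast
qed

lemma cusp_curl:
  assumes "dv v = 0"
  shows "curl (cross v tor_field) i = vf tor_field (v i) - of_int (w_tor i) * v i - v i"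
proof -
  have d: "pd 1 (v 1) = - pd 2 (v 2) - pd 3 (v 3)" using assms by (simp add: dv_def algebra_simps eq_neg_iff_add_eq_0)
  show ?thesis using exhaust_3[of i]
    by (auto simp: curl_def cross_def tor_field_simps vf_def w_tor_def d algebra_simps)
qed

text \<open>These are the monomial multiples of \<open>tor_field\<close> in the exceptional weight.
  With V = X3^2 X2, a Hamiltonian f(X1, V) has the field (3 c2 X1^2 f_V - c1 f_X1) X3 times
  \<open>tor_field\<close>. For f = X1^(s+1) V^(j+1) this is the wanted field in exponent j+1 plus a
  multiple of one in exponent j, whence induction on \<open>j\<close> for all
  \<open>s\<close>.\<close>

lemma ham_tor_monomial:
  fixes c1 :: "'k::field_char_0"
  assumes "c1 \<noteq> 0"
  shows "ham (cusp c1 c2) (\<lambda>i. X 1 ^ s * X 3 * (X 3 ^ 2 * X 2) ^ j * tor_field i)"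
proof (induction j arbitrary: s)
  case 0
  have "ham (cusp c1 c2) (\<lambda>i. cst (- c1 * of_nat (Suc s)) * (X 1 ^ s * X 3 * (X 3 ^ 2 * X 2) ^ 0 * tor_field i))"
    unfolding ham_def
  proof (intro exI allI)
    fix i
    show "cst (- c1 * of_nat (Suc s)) * (X 1 ^ s * X 3 * (X 3 ^ 2 * X 2) ^ 0 * tor_field i)
        = cross (grad (cusp c1 c2)) (grad (X 1 ^ Suc s)) i"
      using exhaust_3[of i] unfolding cross_def grad_def cusp_pd pd_power
      by (auto simp: tor_field_simps algebra_simps power2_eq_square)
  qed
  then show ?case by (rule ham_cst_cancel) (use assms in \<open>simp del: of_nat_Suc\<close>)
next
  case (Suc j)
  let ?v = "X 3 ^ 2 * X 2 :: 'k poly3"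
  let ?m = "\<lambda>i. cst (3 * c2 * of_nat (Suc j)) * (X 1 ^ (s + 3) * X 3 * ?v ^ j * tor_field i)"
  have 1: "ham (cusp c1 c2) (\<lambda>i. cst (- c1 * of_nat (Suc s)) * (X 1 ^ s * X 3 * ?v ^ Suc j * tor_field i) + ?m i)"
    unfolding ham_def
  proof (intro exI allI)
    fix i
    have p: "pd k (X 1 ^ Suc s * ?v ^ Suc j) = of_nat (Suc s) * X 1 ^ s * pd k (X 1) * ?v ^ Suc j
       + X 1 ^ Suc s * (of_nat (Suc j) * ?v ^ j * (2 * X 3 * pd k (X 3) * X 2 + X 3 ^ 2 * pd k (X 2)))" for k
      unfolding pd_mult[of k "X 1 ^ Suc s"] pd_power by simp
    show "cst (- c1 * of_nat (Suc s)) * (X 1 ^ s * X 3 * ?v ^ Suc j * tor_field i) + ?m i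
        = cross (grad (cusp c1 c2)) (grad (X 1 ^ Suc s * ?v ^ Suc j)) i"
      using exhaust_3[of i] unfolding cross_def grad_def cusp_pd p
      by (auto simp: tor_field_simps algebra_simps power2_eq_square power3_eq_cube power_add)
  qed
  have 2: "ham (cusp c1 c2) (\<lambda>i. cst (- 1) * ?m i)" by (intro ham_cst Suc.IH)
  have "ham (cusp c1 c2) (\<lambda>i. cst (- c1 * of_nat (Suc s)) * (X 1 ^ s * X 3 * ?v ^ Suc j * tor_field i))"
    by (rule ham_cong[OF ham_add[OF 1 2]]) simp
  then show ?case by (rule ham_cst_cancel) (use assms in \<open>simp del: of_nat_Suc\<close>)
qed

lemma cross_grad_central:
  "\<forall>i. cross (grad \<Omega>) (grad z) i = 0 \<Longrightarrow> homog 3 \<Omega> \<Longrightarrow> \<forall>i. cross (grad \<Omega>) (grad (hcomp n z)) i = 0"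
proof
  fix i
  assume c: "\<forall>i. cross (grad \<Omega>) (grad z) i = 0" and h: "homog 3 \<Omega>"
  have p: "homog 2 (pd j \<Omega>)" for j using homog_pd[OF h, of j] by simp
  have *: "hcomp (n + 1) (pd j \<Omega> * pd k z) = pd j \<Omega> * pd k (hcomp n z)" for j k
    by (simp add: hcomp_mult[OF p] hcomp_pd)
  have "cross (grad \<Omega>) (grad (hcomp n z)) i = hcomp (n + 1) (cross (grad \<Omega>) (grad z) i)"
    by (simp add: cross_def grad_def *)
  then show "cross (grad \<Omega>) (grad (hcomp n z)) i = 0" using c by simp
qed

lemma div_free_hamiltonian_cusp:
  fixes c1 :: "'k::field_char_0"
  assumes c1: "c1 \<noteq> 0" and c2: "c2 \<noteq> 0"
  shows "div_free_hamiltonian (cusp c1 c2)"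
  unfolding div_free_hamiltonian_ham
proof (intro allI impI)
  let ?\<Omega> = "cusp c1 c2"
  fix v :: "3 \<Rightarrow> 'k poly3" assume v: "vf v ?\<Omega> = 0" "dv v = 0"
  have key: "ham ?\<Omega> u" if u: "vf u ?\<Omega> = 0" "dv u = 0" and w: "\<And>i. whomog w_tor (d + w_tor i) (u i)" for u d
  proof -
    obtain p where p: "u 1 = X 3 * p" "3 * cst c2 * X 1 ^ 2 * p = - cst c1 * (X 3 * u 2 + 2 * X 2 * u 3)"
      using cusp_quotient[OF c1 c2 u(1)] .
    \<comment> \<open>Both \<open>u\<close> and the torus field annihilate the cusp, so their cross
      product is parallel to its gradient. The second component, \<open>- (X 3 * p) * X 3\<close>,
      reveals the factor.\<close>
    define g where "g = - cst (inverse c1) * p"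
    have cg: "cst c1 * g = - p"
      unfolding g_def using cst_inverse(1)[OF c1] by (simp add: mult.assoc[symmetric])
    have X: "cross u tor_field i = g * pd i ?\<Omega>" for i
    proof -
      have "cst c1 * cross u tor_field i = cst c1 * (g * pd i ?\<Omega>)"
        using exhaust_3[of i]
      proof (elim disjE)
        assume i: "i = 1"
        have "cst c1 * (g * pd i ?\<Omega>) = - (3 * cst c2 * X 1 ^ 2 * p)"
          unfolding i cusp_pd using cg by algebra
        also have "\<dots> = cst c1 * cross u tor_field i"
          unfolding p(2) by (simp add: i cross_def tor_field_simps algebra_simps)
        finally show ?thesis by (rule sym)
      next
        assume i: "i = 2"
        have "cross u tor_field i = - (X 3 * p) * X 3" by (simp add: i cross_def tor_field_simps p(1))
        moreover have "g * pd i ?\<Omega> = g * (cst c1 * X 3 ^ 2)" by (simp only: i cusp_pd)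
        ultimately show ?thesis using cg by algebra
      next
        assume i: "i = 3"
        have "cross u tor_field i = - 2 * X 2 * (X 3 * p)" by (simp add: i cross_def tor_field_simps p(1))
        moreover have "g * pd i ?\<Omega> = g * (2 * cst c1 * X 2 * X 3)" by (simp only: i cusp_pd)
        ultimately show ?thesis using cg by algebra
      qed
      then show ?thesis by (metis c1 cst_simps(12) mult_left_cancel)
    qed
    \<comment> \<open>On a field of torus weight \<open>d\<close> the Lie bracket with the torus
      field is multiplication by \<open>d\<close>, so \<open>u\<close> itself is Hamiltonian up to
      the factor \<open>d - 1\<close>.\<close>
    have "of_int (d - 1) * u i = curl (cross u tor_field) i" for i
    proof -
      have "vf tor_field (u i) = of_int (d + w_tor i) * u i"
        using weighted_euler[OF w[of i]] by (simp add: vf_def tor_field_def)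
      then show ?thesis by (simp add: cusp_curl[OF u(2)] algebra_simps)
    qed
    also have "curl (cross u tor_field) i = - cross (grad ?\<Omega>) (grad g) i" for i
      unfolding curl_def X by (simp add: cross_def grad_def pd_commute_simps algebra_simps)
    finally have cu: "of_int (d - 1) * u i = - cross (grad ?\<Omega>) (grad g) i" for i .
    show ?thesis
    proof (cases "d = 1")
      case False
      have "ham ?\<Omega> (\<lambda>i. cst (of_int (d - 1)) * u i)"
        unfolding ham_def
        by (rule exI[of _ "- g"]) (use cu in \<open>simp add: cross_def grad_def\<close>)
      then show ?thesis by (rule ham_cst_cancel) (use False in \<open>simp flip: of_int_diff\<close>)
    next
      case True
      \<comment> \<open>In weight 1 the left side of \<open>cu\<close> vanishes; what survives is
        that \<open>p\<close> is central, and the known center will force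
        \<open>p = 0\<close>.\<close>
      have cen: "\<forall>i. cross (grad ?\<Omega>) (grad p) i = 0"
      proof
        fix i
        have "p = - (cst c1 * g)" using cg by simp
        moreover have "cross (grad ?\<Omega>) (grad g) i = 0" using cu[of i] True by simp
        ultimately show "cross (grad ?\<Omega>) (grad p) i = 0"
          by (simp add: cross_def grad_def right_diff_distrib[symmetric] mult.left_commute[of _ "cst c1"] split: if_splits)
      qed
      \<comment> \<open>Restriction to the axis \<open>X 2 = X 3 = 0\<close>: the right side of the
        defining equation of \<open>p\<close> vanishes there, whereas a power of the cusp becomes a
        nonzero power of \<open>X 1\<close>.\<close>
      let ?s = "subst (\<lambda>i. if i = 1 then X 1 else 0) :: 'k poly3 \<Rightarrow> _"
      have sh: "alg_hom ?s" by (rule alg_hom_subst)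
      have "hcomp n p = 0" for n
      proof (rule ccontr)
        assume nz: "hcomp n p \<noteq> 0"
        obtain k c where k: "hcomp n p = cst c * ?\<Omega> ^ k"
          using center_powers_flex[OF c1, of c2 0 0 0 0 0] nz cross_grad_central[OF cen homog_flex_form] homog_hcomp
          unfolding center_powers_def by blast
        have "hcomp (n + 2) (cst (3 * c2) * (X 1 ^ 2 * p)) = hcomp (n + 2) (- (cst c1 * (X 3 * u 2 + 2 * X 2 * u 3)))"
          using p(2) by (simp add: mult.assoc)
        then have "cst (3 * c2) * hcomp (n + 2) (X 1 ^ 2 * p)
            = - (cst c1 * (hcomp (n + 2) (X 3 * u 2) + cst 2 * hcomp (n + 2) (X 2 * u 3)))"
          unfolding wcomp_cst_mult wcomp_uminus wcomp_add
          by (simp only: wcomp_cst_mult[symmetric]) (simp add: mult.assoc)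
        moreover have "hcomp (n + 2) (X 1 ^ 2 * p) = X 1 ^ 2 * hcomp n p"
          using hcomp_mult[OF homog_power[OF homog_X[of 1], of 2], of "n + 2" p] by simp
        moreover have "hcomp (n + 2) (X i * q) = X i * hcomp (n + 1) q" for i and q :: "'k poly3"
          using hcomp_mult[OF homog_X[of i], of "n + 2" q] by (simp add: add.commute)
        ultimately have "cst (3 * c2) * (X 1 ^ 2 * hcomp n p) = - (cst c1 * (X 3 * hcomp (n + 1) (u 2) + cst 2 * (X 2 * hcomp (n + 1) (u 3))))"
          by simp
        then have "?s (cst (3 * c2) * (X 1 ^ 2 * hcomp n p)) = ?s (- (cst c1 * (X 3 * hcomp (n + 1) (u 2) + cst 2 * (X 2 * hcomp (n + 1) (u 3)))))"
          by (rule arg_cong)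
        then have "cst (3 * c2) * (X 1 ^ 2 * ?s (hcomp n p)) = 0"
          by (simp only: alg_hom_simps[OF sh] subst_X) simp
        then have "?s (hcomp n p) = 0" using c2 by simp
        then have "cst c * (cst c2 * X 1 ^ 3) ^ k = 0"
          unfolding k flex_form_def by (simp add: alg_hom_simps[OF sh])
        then have "c = 0" using c2 by simp
        then show False using nz k by simp
      qed
      then have "p = 0" using wcomp_expand_keys[of p "\<lambda>_. 1"] by simp
      \<comment> \<open>With \<open>p = 0\<close> the field is tangent to the fibres of
        \<open>X 1\<close> and kills \<open>X 3 ^ 2 * X 2\<close>, so it is a multiple
        \<open>h\<close> of the torus field.\<close>
      then have u1: "u 1 = 0" and "cst c1 * (X 3 * u 2 + 2 * X 2 * u 3) = 0" using p by auto
      then have u23: "X 3 * u 2 + 2 * X 2 * u 3 = 0" using c1 by simp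
      then have "X 3 * (- u 2) = X 2 * (2 * u 3)" by algebra
      then obtain q where "2 * u 3 = X 3 * q" using X_dvd[of 3 "- u 2" 2 "2 * u 3"] by auto
      moreover define h where "h = cst (1 / 2) * q"
      have two: "cst (1 / 2) * 2 = (1 :: 'k poly3)"
      proof -
        have "(1 / 2) * 2 = (1 :: 'k)" by simp
        then show ?thesis by (metis cst_simps(2,6,10))
      qed
      ultimately have u3: "u 3 = X 3 * h"
        unfolding h_def using two by algebra
      have "X 3 * (u 2 + 2 * X 2 * h) = 0" using u23 unfolding u3 by algebra
      then have u2: "u 2 = - 2 * X 2 * h" using X_neq_0[of 3, where 'k = 'k] by (simp add: eq_neg_iff_add_eq_0)
      have uh: "u i = h * tor_field i" for i
        using exhaust_3[of i] by (auto simp: u1 u2 u3 tor_field_simps)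
      have hw: "wdeg w_tor m = 1" if "Poly_Mapping.lookup h m \<noteq> 0" for m
      proof -
        have "Poly_Mapping.lookup (u 3) (m + Poly_Mapping.single 3 1) = Poly_Mapping.lookup h m"
        proof -
          have "Poly_Mapping.lookup (u 3) k = (\<Sum>m\<in>Poly_Mapping.keys h. (Poly_Mapping.lookup h m when m + Poly_Mapping.single 3 1 = k))" for k
            unfolding u3 by (subst (1) poly_mapping_expand[of h])
              (simp add: sum_distrib_left X_mult_single lookup_sum lookup_single)
          then show ?thesis by (simp add: when_def sum.delta in_keys_iff)
        qed
        then have "wdeg w_tor (m + Poly_Mapping.single 3 1) = d + w_tor 3"
          using w[of 3] that by (simp add: whomog_lookup)
        then show ?thesis using True by (simp add: wdeg_add wdeg_single w_tor_def)
      qed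
      \<comment> \<open>Torus weight 1 ties the exponents of \<open>X 3\<close> and
        \<open>X 2\<close>, so every monomial of \<open>h\<close> has the shape treated in
        \<open>ham_tor_monomial\<close>.\<close>
      have "ham ?\<Omega> (\<lambda>i. \<Sum>m\<in>Poly_Mapping.keys h. Poly_Mapping.single m (Poly_Mapping.lookup h m) * tor_field i)"
      proof (rule ham_sum)
        fix m assume "m \<in> Poly_Mapping.keys h"
        then have "wdeg w_tor m = 1" using hw by (simp add: in_keys_iff)
        then have "int (Poly_Mapping.lookup m 3) = 1 + 2 * int (Poly_Mapping.lookup m 2)"
          by (simp add: wdeg_def sum_3 w_tor_def)
        then have m3: "Poly_Mapping.lookup m 3 = 1 + 2 * Poly_Mapping.lookup m 2" by linarith
        show "ham ?\<Omega> (\<lambda>i. Poly_Mapping.single m (Poly_Mapping.lookup h m) * tor_field i)"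
          by (rule ham_cong[OF ham_cst[OF ham_tor_monomial[OF c1, of c2 "Poly_Mapping.lookup m 1" "Poly_Mapping.lookup m 2"],
                of "Poly_Mapping.lookup h m"]])
            (simp add: single_eq_powers[of m] m3 power_add power_mult power_mult_distrib mult_ac)
      qed
      then show ?thesis
        by (rule ham_cong) (simp add: uh flip: sum_distrib_right poly_mapping_expand)
    qed
  qed
  obtain D where D: "finite D" "\<forall>i. v i = (\<Sum>d\<in>D. vcomp w_tor d v i)"
    using vcomp_expand[of v w_tor] by blast
  have "ham ?\<Omega> (\<lambda>i. \<Sum>d\<in>D. vcomp w_tor d v i)"
  proof (rule ham_sum, rule key)
    fix d
    show "vf (vcomp w_tor d v) ?\<Omega> = 0" by (simp add: vf_vcomp[OF flex_form_leading(4)] v)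
    show "dv (vcomp w_tor d v) = 0" by (simp add: dv_vcomp v)
    show "whomog w_tor (d + w_tor i) (vcomp w_tor d v i)" for i by (simp add: vcomp_def)
  qed
  then show "ham ?\<Omega> v" by (rule ham_cong) (rule D(2)[rule_format])
qed

section \<open>Lifting from the cusp to the flex normal form\<close>

lemma vf_grad_self: "vf (cross (grad \<Omega>) (grad a)) \<Omega> = 0" "dv (cross (grad \<Omega>) (grad a)) = 0"
  by (simp_all add: vec_defs pd_commute_simps algebra_simps)

text \<open>The top part of such a field is divergence free and annihilates the cusp, hence is
  Hamiltonian for the cusp with some \<open>b\<close>. Subtracting the Hamiltonian field of the same
  \<open>b\<close> for the full potential cancels the top part and lowers the weight.\<close>

lemma div_free_hamiltonian_flex:
  fixes c1 :: "'k::field_char_0"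
  assumes c1: "c1 \<noteq> 0" and c2: "c2 \<noteq> 0"
  shows "div_free_hamiltonian (flex_form c1 c2 e1 e2 e3 e4 e5)"
  unfolding div_free_hamiltonian_ham
proof (intro allI impI)
  let ?\<Omega> = "flex_form c1 c2 e1 e2 e3 e4 e5" and ?C = "cusp c1 c2"
  note fl = flex_form_leading(1,2)[of c1 c2 e1 e2 e3 e4 e5]
  \<comment> \<open>Weights of the variables are at most 3, so the offset 4 makes every bound
    negative at \<open>n = 0\<close> and forces the field to be 0.\<close>
  have step: "ham ?\<Omega> v" if "vf v ?\<Omega> = 0" "dv v = 0" "\<And>i. wle w_cusp (int n - 4 + w_cusp i) (v i)" for n v
    using that
  proof (induction n arbitrary: v)
    case 0
    have "v i = 0" for i
    proof -
      have "Poly_Mapping.keys (v i) = {}"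
      proof (rule equals0I)
        fix m assume "m \<in> Poly_Mapping.keys (v i)"
        then have "wdeg w_cusp m \<le> int 0 - 4 + w_cusp i" using 0(3)[of i] unfolding wle_lookup by blast
        then have "wdeg w_cusp m < 0" by (simp add: w_cusp_def split: if_splits)
        moreover have "wdeg w_cusp m \<ge> 0" by (simp add: wdeg_def w_cusp_def sum_3)
        ultimately show False by simp
      qed
      then show ?thesis by simp
    qed
    then show ?case using ham_cong[OF ham_0] by blast
  next
    case (Suc n)
    define N where "N = int (Suc n) - 4"
    have w: "wle w_cusp (N + w_cusp i) (v i)" for i using Suc.prems(3)[of i] by (simp add: N_def)
    define u where "u = vcomp w_cusp N v"
    have pt: "wcomp w_cusp (N + 6) (v i * pd i ?\<Omega>) = u i * pd i ?C" for i
      using wcomp_mult_top[OF w[of i] wle_pd[OF fl(1), of i]]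
      by (simp add: u_def vcomp_def wcomp_pd fl(2))
    have "vf u ?C = wcomp w_cusp (N + 6) (vf v ?\<Omega>)" by (simp add: vf_def pt)
    then have "vf u ?C = 0" using Suc.prems(1) by simp
    moreover have "dv u = 0" unfolding u_def dv_vcomp using Suc.prems(2) by simp
    ultimately obtain a where a: "\<And>i. u i = cross (grad ?C) (grad a) i"
      using div_free_hamiltonian_cusp[OF c1 c2] unfolding div_free_hamiltonian_def by blast
    \<comment> \<open>The weights of the variables add up to 5 and the cusp has weight 6, so a
      Hamiltonian field of weight \<open>N\<close> comes from a function of weight
      \<open>N + 5 - 6\<close>.\<close>
    define b where "b = wcomp w_cusp (N - 1) a"
    have hC: "whomog w_cusp (6 - w_cusp i) (pd i ?C)" for i
      using whomog_pd[OF flex_form_leading(3)] .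
    have ub: "u i = cross (grad ?C) (grad b) i" for i
    proof -
      have "u i = wcomp w_cusp (N + w_cusp i) (u i)" by (simp add: u_def vcomp_def wcomp_wcomp)
      also have "\<dots> = wcomp w_cusp (N + w_cusp i) (cross (grad ?C) (grad a) i)" by (simp add: a)
      also have "\<dots> = cross (grad ?C) (grad b) i"
        using exhaust_3[of i]
        by (auto simp: cross_def grad_def wcomp_mult[OF hC] wcomp_pd b_def w_cusp_def)
      finally show ?thesis .
    qed
    have bw: "whomog w_cusp (N - 1) b" by (simp add: b_def)
    define v' where "v' i = v i - cross (grad ?\<Omega>) (grad b) i" for i
    have "ham ?\<Omega> v'"
    proof (rule Suc.IH)
      have "vf v' ?\<Omega> = vf v ?\<Omega> - vf (cross (grad ?\<Omega>) (grad b)) ?\<Omega>"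
        by (simp add: vf_def v'_def algebra_simps)
      then show "vf v' ?\<Omega> = 0" using Suc.prems(1) by (simp only: vf_grad_self) simp
      have "dv v' = dv v - dv (cross (grad ?\<Omega>) (grad b))"
        by (simp add: dv_def v'_def algebra_simps)
      then show "dv v' = 0" using Suc.prems(2) by (simp only: vf_grad_self) simp
      fix i
      have l: "wle w_cusp (6 - w_cusp j + (N - 1 - w_cusp k)) (pd j ?\<Omega> * pd k b)"
        "wcomp w_cusp (6 - w_cusp j + (N - 1 - w_cusp k)) (pd j ?\<Omega> * pd k b) = pd j ?C * pd k b" for j k
      proof -
        have b: "wle w_cusp (N - 1 - w_cusp k) (pd k b)" "wcomp w_cusp (N - 1 - w_cusp k) (pd k b) = pd k b"
          using wle_whomog[OF whomog_pd[OF bw]] wcomp_whomog[OF whomog_pd[OF bw]] by simp_all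
        show "wle w_cusp (6 - w_cusp j + (N - 1 - w_cusp k)) (pd j ?\<Omega> * pd k b)"
          by (rule wle_mult[OF wle_pd[OF fl(1)] b(1)])
        show "wcomp w_cusp (6 - w_cusp j + (N - 1 - w_cusp k)) (pd j ?\<Omega> * pd k b) = pd j ?C * pd k b"
        proof -
          have "wcomp w_cusp (6 - w_cusp j) (pd j ?\<Omega>) = pd j ?C" by (simp add: wcomp_pd fl(2))
          then show ?thesis by (simp only: wcomp_mult_top[OF wle_pd[OF fl(1)] b(1)] b(2))
        qed
      qed
      have l1: "wle w_cusp (N + w_cusp i) (cross (grad ?\<Omega>) (grad b) i)"
        using exhaust_3[of i] l(1)[of 1 2] l(1)[of 2 1] l(1)[of 1 3] l(1)[of 3 1] l(1)[of 2 3] l(1)[of 3 2]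
        by (auto simp: cross_def grad_def w_cusp_def add.commute intro!: wle_diff)
      have l2: "wcomp w_cusp (N + w_cusp i) (cross (grad ?\<Omega>) (grad b) i) = cross (grad ?C) (grad b) i"
        using exhaust_3[of i] l(2)[of 1 2] l(2)[of 2 1] l(2)[of 1 3] l(2)[of 3 1] l(2)[of 2 3] l(2)[of 3 2]
        by (auto simp: cross_def grad_def w_cusp_def add.commute)
      have "wcomp w_cusp (N + w_cusp i) (v' i) = 0"
        unfolding v'_def wcomp_diff l2 ub[symmetric] by (simp add: u_def vcomp_def)
      then show "wle w_cusp (int n - 4 + w_cusp i) (v' i)"
        using wle_Suc[OF wle_diff[OF w[of i] l1]] by (simp add: v'_def N_def algebra_simps)
    qed
    moreover have "ham ?\<Omega> (cross (grad ?\<Omega>) (grad b))" unfolding ham_def by blast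
    ultimately have "ham ?\<Omega> (\<lambda>i. v' i + cross (grad ?\<Omega>) (grad b) i)" by (rule ham_add)
    then show ?case by (rule ham_cong) (simp add: v'_def)
  qed
  fix v assume v: "vf v ?\<Omega> = 0" "dv v = 0"
  obtain N1 N2 N3 where N: "wle w_cusp N1 (v 1)" "wle w_cusp N2 (v 2)" "wle w_cusp N3 (v 3)"
    using wle_bound by metis
  define n where "n = nat (\<bar>N1\<bar> + \<bar>N2\<bar> + \<bar>N3\<bar> + 4)"
  have "wle w_cusp (int n - 4 + w_cusp i) (v i)" for i
    using exhaust_3[of i] by (auto simp: n_def w_cusp_def intro: wle_mono[OF N(1)] wle_mono[OF N(2)] wle_mono[OF N(3)])
  then show "ham ?\<Omega> v" using step v by blast
qed

section \<open>Irreducible cubics have a flex\<close>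

definition vec3 :: "'a \<Rightarrow> 'a \<Rightarrow> 'a \<Rightarrow> 3 \<Rightarrow> 'a" where
  "vec3 a b c i = (if i = 1 then a else if i = 2 then b else c)"

lemma vec3_simps [simp]: "vec3 a b c 1 = a" "vec3 a b c 2 = b" "vec3 a b c 3 = c"
  by (simp_all add: vec3_def)

section \<open>Cubics as symmetric tensors\<close>

type_synonym 'k tensor = "3 \<Rightarrow> 3 \<Rightarrow> 3 \<Rightarrow> 'k"

definition sym_tensor :: "'k tensor \<Rightarrow> bool" where
  "sym_tensor t \<longleftrightarrow> (\<forall>i j k. t i j k = t j i k \<and> t i j k = t i k j)"

lemma sym_tensor_simps:
  assumes "sym_tensor t"
  shows "t 1 2 1 = t 1 1 2" "t 2 1 1 = t 1 1 2" "t 1 3 1 = t 1 1 3" "t 3 1 1 = t 1 1 3"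
    "t 2 1 2 = t 1 2 2" "t 2 2 1 = t 1 2 2" "t 3 1 3 = t 1 3 3" "t 3 3 1 = t 1 3 3"
    "t 2 3 2 = t 2 2 3" "t 3 2 2 = t 2 2 3" "t 3 2 3 = t 2 3 3" "t 3 3 2 = t 2 3 3"
    "t 1 3 2 = t 1 2 3" "t 2 1 3 = t 1 2 3" "t 2 3 1 = t 1 2 3" "t 3 1 2 = t 1 2 3" "t 3 2 1 = t 1 2 3"
  using assms unfolding sym_tensor_def by metis+

definition tri :: "'k::field tensor \<Rightarrow> (3 \<Rightarrow> 'k) \<Rightarrow> (3 \<Rightarrow> 'k) \<Rightarrow> (3 \<Rightarrow> 'k) \<Rightarrow> 'k" where
  "tri t u v w = (\<Sum>i\<in>UNIV. \<Sum>j\<in>UNIV. \<Sum>k\<in>UNIV. t i j k * (u i * v j * w k))"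

definition form :: "'k::field tensor \<Rightarrow> 'k poly3" where
  "form t = (\<Sum>i\<in>UNIV. \<Sum>j\<in>UNIV. \<Sum>k\<in>UNIV. cst (t i j k) * (X i * X j * X k))"

lemma tri_expand:
  assumes "sym_tensor t"
  shows "tri t u v w = t 1 1 1 * (u 1 * v 1 * w 1) + t 2 2 2 * (u 2 * v 2 * w 2) + t 3 3 3 * (u 3 * v 3 * w 3)
    + t 1 1 2 * (u 1 * v 1 * w 2 + u 1 * v 2 * w 1 + u 2 * v 1 * w 1)
    + t 1 1 3 * (u 1 * v 1 * w 3 + u 1 * v 3 * w 1 + u 3 * v 1 * w 1)
    + t 1 2 2 * (u 1 * v 2 * w 2 + u 2 * v 1 * w 2 + u 2 * v 2 * w 1)
    + t 1 3 3 * (u 1 * v 3 * w 3 + u 3 * v 1 * w 3 + u 3 * v 3 * w 1)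
    + t 2 2 3 * (u 2 * v 2 * w 3 + u 2 * v 3 * w 2 + u 3 * v 2 * w 2)
    + t 2 3 3 * (u 2 * v 3 * w 3 + u 3 * v 2 * w 3 + u 3 * v 3 * w 2)
    + t 1 2 3 * (u 1 * v 2 * w 3 + u 1 * v 3 * w 2 + u 2 * v 1 * w 3 + u 2 * v 3 * w 1 + u 3 * v 1 * w 2 + u 3 * v 2 * w 1)"
  unfolding tri_def sum_3 sym_tensor_simps[OF assms] by (simp add: algebra_simps)

lemma form_expand:
  assumes "sym_tensor t"
  shows "form t = cst (t 1 1 1) * X 1 ^ 3 + cst (t 2 2 2) * X 2 ^ 3 + cst (t 3 3 3) * X 3 ^ 3
    + 3 * (cst (t 1 1 2) * X 1 ^ 2 * X 2 + cst (t 1 1 3) * X 1 ^ 2 * X 3 + cst (t 1 2 2) * X 1 * X 2 ^ 2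
         + cst (t 1 3 3) * X 1 * X 3 ^ 2 + cst (t 2 2 3) * X 2 ^ 2 * X 3 + cst (t 2 3 3) * X 2 * X 3 ^ 2)
    + 6 * cst (t 1 2 3) * X 1 * X 2 * X 3"
  unfolding form_def sum_3 sym_tensor_simps[OF assms] by (simp add: algebra_simps power2_eq_square power3_eq_cube)

text \<open>Coefficients after a coordinate change are values of the trilinear form on the rows of
  \<open>M\<close>. A normal form thus becomes a list of conditions on three points.\<close>

definition chg :: "(3 \<Rightarrow> 3 \<Rightarrow> 'k::field) \<Rightarrow> 'k tensor \<Rightarrow> 'k tensor" where
  "chg M t i j k = tri t (M i) (M j) (M k)"

lemma tri_sym:
  assumes "sym_tensor t" shows "tri t u v w = tri t v u w" "tri t u v w = tri t u w v"
  unfolding tri_expand[OF assms] by (simp_all add: algebra_simps)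

lemma sym_chg: "sym_tensor t \<Longrightarrow> sym_tensor (chg M t)"
  unfolding sym_tensor_def[of "chg M t"] chg_def using tri_sym by metis

lemma lin_subst_form: "lin_subst M (form t) = form (chg M t)"
proof -
  have h: "alg_hom (lin_subst M)" by (simp add: lin_subst_def alg_hom_subst)
  have x: "lin_subst M (X j) = (\<Sum>a\<in>UNIV. cst (M a j) * X a)" for j
    by (simp add: lin_subst_def sum_3)
  have "lin_subst M (form t) = (\<Sum>i\<in>UNIV. \<Sum>j\<in>UNIV. \<Sum>k\<in>UNIV. cst (t i j k) *
      ((\<Sum>a\<in>UNIV. cst (M a i) * X a) * (\<Sum>b\<in>UNIV. cst (M b j) * X b) * (\<Sum>c\<in>UNIV. cst (M c k) * X c)))"
    unfolding form_def by (simp only: alg_hom_sum[OF h] alg_hom_mult[OF h] alg_hom_cst[OF h] x)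
  also have "\<dots> = (\<Sum>i\<in>UNIV. \<Sum>j\<in>UNIV. \<Sum>k\<in>UNIV. \<Sum>a\<in>UNIV. \<Sum>b\<in>UNIV. \<Sum>c\<in>UNIV.
      cst (t i j k * (M a i * M b j * M c k)) * (X a * X b * X c))"
  proof -
    have sp: "sum A UNIV * sum B UNIV * sum C UNIV = (\<Sum>a\<in>UNIV. \<Sum>b\<in>UNIV. \<Sum>c\<in>UNIV. A a * B b * C c)"
      for A B C :: "3 \<Rightarrow> 'a poly3"
      by (simp add: sum_3 algebra_simps)
    show ?thesis by (simp only: sp) (simp only: sum_distrib_left cst_simps mult_ac)
  qed
  also have "\<dots> = (\<Sum>a\<in>UNIV. \<Sum>b\<in>UNIV. \<Sum>c\<in>UNIV. \<Sum>i\<in>UNIV. \<Sum>j\<in>UNIV. \<Sum>k\<in>UNIV.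
      cst (t i j k * (M a i * M b j * M c k)) * (X a * X b * X c))"
    unfolding sum.cartesian_product UNIV_Times_UNIV[symmetric]
    by (rule sum.reindex_bij_witness[of _ "\<lambda>(a, b, c, i, j, k). (i, j, k, a, b, c)" "\<lambda>(i, j, k, a, b, c). (a, b, c, i, j, k)"]) auto
  also have "\<dots> = form (chg M t)"
  proof -
    have c: "cst (sum f S) = (\<Sum>x\<in>S. cst (f x))" for f :: "3 \<Rightarrow> 'a" and S
      by (induction S rule: infinite_finite_induct) auto
    show ?thesis unfolding form_def chg_def tri_def c sum_distrib_right ..
  qed
  finally show ?thesis .
qed

definition det3 :: "(3 \<Rightarrow> 3 \<Rightarrow> 'k::field) \<Rightarrow> 'k" where
  "det3 M = M 1 1 * (M 2 2 * M 3 3 - M 2 3 * M 3 2) - M 1 2 * (M 2 1 * M 3 3 - M 2 3 * M 3 1)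
     + M 1 3 * (M 2 1 * M 3 2 - M 2 2 * M 3 1)"

lemma lin_auto_subst:
  assumes d: "det3 M \<noteq> 0"
  shows "\<exists>g. lin_auto (lin_subst M) g"
proof -
  \<comment> \<open>The adjugate matrix of \<open>M\<close>.\<close>
  define A where "A = vec3 (vec3 (M 2 2 * M 3 3 - M 2 3 * M 3 2) (M 1 3 * M 3 2 - M 1 2 * M 3 3) (M 1 2 * M 2 3 - M 1 3 * M 2 2))
    (vec3 (M 2 3 * M 3 1 - M 2 1 * M 3 3) (M 1 1 * M 3 3 - M 1 3 * M 3 1) (M 1 3 * M 2 1 - M 1 1 * M 2 3))
    (vec3 (M 2 1 * M 3 2 - M 2 2 * M 3 1) (M 1 2 * M 3 1 - M 1 1 * M 3 2) (M 1 1 * M 2 2 - M 1 2 * M 2 1))"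
  define N where "N i j = A i j / det3 M" for i j
  have AM: "A i 1 * M 1 j + A i 2 * M 2 j + A i 3 * M 3 j = (if i = j then det3 M else 0)" for i j
    using exhaust_3[of i] exhaust_3[of j] by (auto simp: A_def det3_def algebra_simps)
  have MA: "M i 1 * A 1 j + M i 2 * A 2 j + M i 3 * A 3 j = (if i = j then det3 M else 0)" for i j
    using exhaust_3[of i] exhaust_3[of j] by (auto simp: A_def det3_def algebra_simps)
  have "N i 1 * M 1 j + N i 2 * M 2 j + N i 3 * M 3 j = (A i 1 * M 1 j + A i 2 * M 2 j + A i 3 * M 3 j) / det3 M" for i j
    by (simp add: N_def add_divide_distrib)
  then have NM: "N i 1 * M 1 j + N i 2 * M 2 j + N i 3 * M 3 j = (if i = j then 1 else 0)" for i j using d by (simp add: AM)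
  have "M i 1 * N 1 j + M i 2 * N 2 j + M i 3 * N 3 j = (M i 1 * A 1 j + M i 2 * A 2 j + M i 3 * A 3 j) / det3 M" for i j
    by (simp add: N_def add_divide_distrib)
  then have MN: "M i 1 * N 1 j + M i 2 * N 2 j + M i 3 * N 3 j = (if i = j then 1 else 0)" for i j using d by (simp add: MA)
  show ?thesis using lin_auto_lin_subst[OF NM MN] by blast
qed

lemma lin_equiv_chg: "det3 M \<noteq> 0 \<Longrightarrow> lin_equiv (form t) (form (chg M t))"
  using lin_auto_subst lin_subst_form unfolding lin_equiv_def by blast

text \<open>The component of degree 0 of a multiple of \<open>p\<close> would need a cofactor of
  negative degree.\<close>

lemma homog_not_unit:
  assumes "homog d (p :: 'k::field poly3)" "d > 0" shows "\<not> p dvd 1"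
proof
  assume "p dvd 1"
  then obtain u where "1 = p * u" by (elim dvdE)
  then have "hcomp 0 1 = p * hcomp (- d) u" using hcomp_mult[OF assms(1), of 0 u] by simp
  also have "hcomp (- d) u = 0" by (simp add: homog_neg[OF homog_hcomp] assms(2))
  finally show False by (simp add: hcomp_homog[OF homog_simps(2)])
qed

lemma not_irreducible_X_mult:
  assumes "homog 2 q" shows "\<not> irreducible (X i * q)"
  using homog_not_unit[OF assms] homog_not_unit[of 1 "X i"] unfolding irreducible_def by auto

lemma lin_equiv_irreducible:
  assumes "lin_equiv p q" "irreducible p" shows "irreducible q"
proof -
  obtain f g where fg: "lin_auto f g" "f p = q" using assms(1) by (auto simp: lin_equiv_def)
  have h: "alg_hom f" "alg_hom g" using fg by (simp_all add: lin_auto_def)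
  have u: "a dvd 1" if d: "f a dvd 1" for a
  proof -
    obtain b where "1 = f a * b" using d unfolding dvd_def by blast
    then have "g 1 = g (f a) * g b" by (metis alg_hom_mult[OF h(2)])
    then have "1 = a * g b" by (simp add: alg_hom_1[OF h(2)] lin_auto_inverse[OF fg(1)])
    then show ?thesis by (rule dvdI)
  qed
  have u': "f a dvd 1" if d: "a dvd 1" for a
  proof -
    obtain b where "1 = a * b" using d unfolding dvd_def by blast
    then have "f 1 = f a * f b" by (metis alg_hom_mult[OF h(1)])
    then have "1 = f a * f b" by (simp add: alg_hom_1[OF h(1)])
    then show ?thesis by (rule dvdI)
  qed
  show ?thesis
    unfolding irreducible_def
  proof (intro conjI allI impI)
    show "q \<noteq> 0" using assms(2) fg lin_auto_inverse(2)[OF fg(1), of p] alg_hom_0[OF h(2)] by (auto simp: irreducible_def)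
    show "\<not> q dvd 1" using u assms(2) fg(2) by (auto simp: irreducible_def)
    fix a b assume "q = a * b"
    then have "p = g a * g b" using fg lin_auto_inverse(2)[OF fg(1), of p] by (simp add: alg_hom_mult[OF h(2)])
    then have "g a dvd 1 \<or> g b dvd 1" using assms(2) unfolding irreducible_def by blast
    then show "a dvd 1 \<or> b dvd 1" using u'[of "g a"] u'[of "g b"] by (auto simp: lin_auto_inverse[OF fg(1)])
  qed
qed

lemma irreducible_chg:
  "irreducible (form t) \<Longrightarrow> det3 M \<noteq> 0 \<Longrightarrow> irreducible (form (chg M t))"
  using lin_equiv_irreducible lin_equiv_chg by blast

text \<open>The four coefficients are those of the restriction to the line \<open>X 2 = 0\<close>;
  if they vanish, \<open>X 2\<close> splits off.\<close>

lemma irreducible_form_X2: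
  assumes "sym_tensor t" "irreducible (form t)"
  shows "\<not> (t 1 1 1 = 0 \<and> t 1 1 3 = 0 \<and> t 1 3 3 = 0 \<and> t 3 3 3 = 0)"
proof
  assume z: "t 1 1 1 = 0 \<and> t 1 1 3 = 0 \<and> t 1 3 3 = 0 \<and> t 3 3 3 = 0"
  let ?q = "cst (t 2 2 2) * (X 2 * X 2) + cst (3 * t 1 1 2) * (X 1 * X 1) + cst (3 * t 1 2 2) * (X 1 * X 2)
     + cst (3 * t 2 2 3) * (X 2 * X 3) + cst (3 * t 2 3 3) * (X 3 * X 3) + cst (6 * t 1 2 3) * (X 1 * X 3)"
  have "form t = X 2 * ?q"
    unfolding form_expand[OF assms(1)] using z by (simp add: algebra_simps power2_eq_square power3_eq_cube)
  moreover have "homog (1 + 1) (X i * X j)" for i j by (rule homog_mult) simp_all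
  then have "homog 2 ?q" by (intro homog_add homog_cst_mult) simp_all
  ultimately show False using not_irreducible_X_mult assms(2) by metis
qed

section \<open>Criteria for a flex\<close>

definition has_flex :: "'k::field poly3 \<Rightarrow> bool" where
  "has_flex p \<longleftrightarrow> (\<exists>c1 c2 e1 e2 e3 e4 e5. c1 \<noteq> 0 \<and> c2 \<noteq> 0 \<and> lin_equiv p (flex_form c1 c2 e1 e2 e3 e4 e5))"

text \<open>The third basis vector is a smooth point with tangent \<open>X 2 = 0\<close>, and
  \<open>t 1 1 3 = 0\<close> raises the contact to order three. On the tangent only
  \<open>t 1 1 1 * X 1 ^ 3\<close> survives, nonzero by irreducibility.\<close>

lemma has_flexI:
  fixes t :: "'k::field_char_0 tensor"
  assumes "sym_tensor t" "irreducible (form t)" "lin_equiv p (form t)"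
    "t 3 3 3 = 0" "t 1 3 3 = 0" "t 1 1 3 = 0" "t 2 3 3 \<noteq> 0"
  shows "has_flex p"
proof -
  have "t 1 1 1 \<noteq> 0" using irreducible_form_X2[OF assms(1,2)] assms by auto
  moreover have "form t = flex_form (3 * t 2 3 3) (t 1 1 1) (6 * t 1 2 3) (3 * t 1 1 2) (3 * t 2 2 3) (3 * t 1 2 2) (t 2 2 2)"
    unfolding form_expand[OF assms(1)] flex_form_def using assms by (simp add: algebra_simps)
  ultimately show ?thesis unfolding has_flex_def using assms(3,7) by (metis mult_eq_0_iff zero_neq_numeral)
qed

text \<open>Row 3 is the flex, row 1 a further point of its tangent, and row 2 a point off the
  tangent.\<close>

lemma has_flex_chgI:
  fixes t :: "'k::field_char_0 tensor"
  assumes t: "sym_tensor t" "irreducible (form t)" "lin_equiv p (form t)" and d: "det3 M \<noteq> 0"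
    and "tri t (M 3) (M 3) (M 3) = 0" "tri t (M 1) (M 3) (M 3) = 0" "tri t (M 1) (M 1) (M 3) = 0" "tri t (M 2) (M 3) (M 3) \<noteq> 0"
  shows "has_flex p"
  by (rule has_flexI[OF sym_chg[OF t(1), of M] irreducible_chg[OF t(2) d] lin_equiv_trans[OF t(3) lin_equiv_chg[OF d]]])
    (simp_all add: chg_def assms)

lemma cubic_root:
  fixes a :: "'k::alg_closed_field"
  assumes "a \<noteq> 0" shows "\<exists>x. a * x ^ 3 + b * x ^ 2 + c * x + d = 0"
proof -
  have "\<exists>x. poly [:d, c, b, a:] x = 0"
    using assms by (intro alg_closed_imp_poly_has_root) simp
  then show ?thesis by (auto simp: algebra_simps power2_eq_square power3_eq_cube)
qed

lemma quadratic_root: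
  fixes a :: "'k::alg_closed_field"
  assumes "a \<noteq> 0" shows "\<exists>x. a * x ^ 2 + b * x + c = 0"
proof -
  have "\<exists>x. poly [:c, b, a:] x = 0"
    using assms by (intro alg_closed_imp_poly_has_root) simp
  then show ?thesis by (auto simp: algebra_simps power2_eq_square)
qed

lemma cubic_has_point:
  fixes t :: "'k::alg_closed_field tensor"
  assumes "sym_tensor t"
  shows "\<exists>p i. p i \<noteq> 0 \<and> tri t p p p = 0"
proof (cases "t 1 1 1 = 0")
  case True
  then have "tri t (vec3 1 0 0) (vec3 1 0 0) (vec3 1 0 0) = 0" by (simp add: tri_expand[OF assms])
  then show ?thesis by (intro exI[of _ "vec3 1 0 0"] exI[of _ 1]) simp
next
  case False
  obtain x where "t 1 1 1 * x ^ 3 + (3 * t 1 1 3) * x ^ 2 + (3 * t 1 3 3) * x + t 3 3 3 = 0"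
    using cubic_root[OF False] by blast
  then have "tri t (vec3 x 0 1) (vec3 x 0 1) (vec3 x 0 1) = 0"
    by (simp add: tri_expand[OF assms] algebra_simps power2_eq_square power3_eq_cube)
  then show ?thesis by (intro exI[of _ "vec3 x 0 1"] exI[of _ 3]) simp
qed

section \<open>Nonsingular cubics: a common zero with the Hessian\<close>

definition sdot :: "(3 \<Rightarrow> 'k::field) \<Rightarrow> (3 \<Rightarrow> 'k) \<Rightarrow> 'k" where
  "sdot u v = u 1 * v 1 + u 2 * v 2 + u 3 * v 3"

text \<open>\<open>polar t p p\<close> is the gradient of the cubic at \<open>p\<close> up to the
  factor 3, and \<open>polar t p\<close> is the Hessian matrix at \<open>p\<close> up to the factor
  6. So \<open>p\<close> is singular iff the former vanishes.\<close>

definition polar :: "'k::field tensor \<Rightarrow> (3 \<Rightarrow> 'k) \<Rightarrow> (3 \<Rightarrow> 'k) \<Rightarrow> 3 \<Rightarrow> 'k" where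
  "polar t u v k = (\<Sum>i\<in>UNIV. \<Sum>j\<in>UNIV. t i j k * (u i * v j))"

lemma tri_polar: "tri t u v w = sdot (polar t u v) w"
  unfolding tri_def polar_def sdot_def sum_3 by (simp add: algebra_simps)

lemma polar_scale: "polar t u (\<lambda>i. c * v i) k = c * polar t u v k"
  unfolding polar_def sum_3 by (simp add: algebra_simps)

lemma exists_nonzero_sdot:
  assumes "g i \<noteq> 0" obtains v where "sdot g v \<noteq> 0"
  using exhaust_3[of i] assms that[of "vec3 1 0 0"] that[of "vec3 0 1 0"] that[of "vec3 0 0 1"]
  by (auto simp: sdot_def)

text \<open>Since \<open>g\<close> separates \<open>p\<close> from \<open>v\<close>, these are not
  parallel and extend to a basis. Moving the third vector along \<open>v\<close> onto the line
  \<open>g = 0\<close> does not change the determinant.\<close>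

lemma extend_basis:
  assumes "sdot g p = 0" "p i \<noteq> 0" "sdot g v \<noteq> 0"
  obtains w where "sdot g w = 0" "det3 (vec3 w v p) \<noteq> 0"
proof -
  have "\<exists>u. det3 (vec3 u v p) \<noteq> 0"
  proof (rule ccontr)
    assume n: "\<nexists>u. det3 (vec3 u v p) \<noteq> 0"
    then have "det3 (vec3 (vec3 1 0 0) v p) = 0" "det3 (vec3 (vec3 0 1 0) v p) = 0" "det3 (vec3 (vec3 0 0 1) v p) = 0"
      by blast+
    then have c: "v 2 * p 3 = v 3 * p 2" "v 1 * p 3 = v 3 * p 1" "v 1 * p 2 = v 2 * p 1"
      by (simp_all add: det3_def)
    have "p 1 * sdot g v = 0" "p 2 * sdot g v = 0" "p 3 * sdot g v = 0"
      using c assms(1) unfolding sdot_def by algebra+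
    then show False using assms(2,3) exhaust_3[of i] by auto
  qed
  then obtain u where u: "det3 (vec3 u v p) \<noteq> 0" by blast
  define k where "k = sdot g u / sdot g v"
  have k: "k * sdot g v = sdot g u" using assms(3) by (simp add: k_def)
  define w where "w i = u i - k * v i" for i
  have "sdot g w = sdot g u - k * sdot g v" by (simp add: w_def sdot_def algebra_simps)
  then have "sdot g w = 0" using k by simp
  moreover have "det3 (vec3 w v p) = det3 (vec3 u v p)" by (simp add: det3_def w_def algebra_simps)
  ultimately show thesis using u that by simp
qed

text \<open>Both \<open>p\<close> and \<open>w\<close> are orthogonal to \<open>g\<close>, so their
  cross product is parallel to \<open>g\<close>; a vanishing determinant would also make it
  orthogonal to \<open>v\<close>.\<close>

lemma independent_det3:
  assumes "sdot g p = 0" "sdot g w = 0" "sdot g v \<noteq> 0" and ind: "\<not> (p 2 * w 3 = p 3 * w 2 \<and> p 3 * w 1 = p 1 * w 3 \<and> p 1 * w 2 = p 2 * w 1)"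
  shows "det3 (vec3 w v p) \<noteq> 0"
proof
  assume d: "det3 (vec3 w v p) = 0"
  let ?n1 = "p 2 * w 3 - p 3 * w 2" and ?n2 = "p 3 * w 1 - p 1 * w 3" and ?n3 = "p 1 * w 2 - p 2 * w 1"
  have "?n1 * sdot g v = 0" "?n2 * sdot g v = 0" "?n3 * sdot g v = 0"
    using d assms(1,2) unfolding det3_def sdot_def vec3_simps by algebra+
  then show False using ind assms(3) by auto
qed

text \<open>A kernel vector \<open>w\<close> of the Hessian at a smooth point \<open>p\<close> of
  the curve gives \<open>tri t p p w = 0\<close> and \<open>tri t p w w = 0\<close>: it spans with
  \<open>p\<close> the tangent, and the contact has order three.\<close>

lemma flex_from_hessian:
  fixes t :: "'k::field_char_0 tensor"
  assumes t: "sym_tensor t" "irreducible (form t)" "lin_equiv q (form t)"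
    and nonsing: "\<And>p i. p i \<noteq> 0 \<Longrightarrow> \<exists>k. polar t p p k \<noteq> 0"
    and p: "p i \<noteq> 0" "tri t p p p = 0" and w: "w j \<noteq> 0" "\<And>k. polar t p w k = 0"
  shows "has_flex q"
proof -
  let ?g = "polar t p p"
  obtain k where k: "?g k \<noteq> 0" using nonsing p(1) by blast
  obtain v where v: "sdot ?g v \<noteq> 0" using exists_nonzero_sdot[of ?g k] k by blast
  have pp: "sdot ?g p = 0" using p(2) by (simp add: tri_polar)
  have t1: "tri t p w u = 0" for u by (simp add: tri_polar w(2) sdot_def)
  have pw: "sdot ?g w = 0" using t1[of p] tri_sym[OF t(1)] by (simp add: tri_polar[symmetric])
  \<comment> \<open>If \<open>w\<close> were parallel to \<open>p\<close>, then
    \<open>polar t p p\<close> would vanish and \<open>p\<close> would be singular.\<close>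
  have ind: "\<not> (p 2 * w 3 = p 3 * w 2 \<and> p 3 * w 1 = p 1 * w 3 \<and> p 1 * w 2 = p 2 * w 1)"
  proof
    assume "p 2 * w 3 = p 3 * w 2 \<and> p 3 * w 1 = p 1 * w 3 \<and> p 1 * w 2 = p 2 * w 1"
    then have c: "p a * w b = p b * w a" for a b
      using exhaust_3[of a] exhaust_3[of b] by (auto simp: algebra_simps)
    have "w i * ?g k = polar t p (\<lambda>b. w i * p b) k" by (simp add: polar_scale)
    also have "(\<lambda>b. w i * p b) = (\<lambda>b. p i * w b)" using c[of _ i] by (simp add: fun_eq_iff mult.commute)
    also have "polar t p (\<lambda>b. p i * w b) k = 0" by (simp add: polar_scale w(2))
    finally have "w i = 0" using k by simp
    then have "p i * w j = 0" using c[of i j] by simp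
    then show False using p(1) w(1) by simp
  qed
  have d: "det3 (vec3 w v p) \<noteq> 0" using independent_det3[OF pp pw v ind] .
  show ?thesis
  proof (rule has_flex_chgI[OF t d])
    show "tri t (vec3 w v p 1) (vec3 w v p 3) (vec3 w v p 3) = 0" using t1[of p] tri_sym(1)[OF t(1), of p w p] by simp
    show "tri t (vec3 w v p 1) (vec3 w v p 1) (vec3 w v p 3) = 0" using t1[of w] tri_sym(1)[OF t(1), of p w w] tri_sym(2)[OF t(1), of w p w] by simp
    show "tri t (vec3 w v p 2) (vec3 w v p 3) (vec3 w v p 3) \<noteq> 0"
      using v tri_sym(2)[OF t(1), of p p v] tri_sym(1)[OF t(1), of p v p] by (simp add: tri_polar[symmetric])
  qed (use p in simp)
qed

text \<open>The matrix is symmetric with last diagonal entry 1, so the last unknown can be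
  eliminated. What is left is the 2x2 matrix \<open>m11\<close>, \<open>m12\<close>,
  \<open>m22\<close> (the Schur complement), whose determinant is the given one.\<close>

lemma symmetric_kernel:
  fixes a b c d e :: "'k::field"
  assumes "a * (d - f ^ 2) - b * (b - c * f) + c * (b * f - c * d) = 0"
  shows "\<exists>w :: 3 \<Rightarrow> 'k. (\<exists>i. w i \<noteq> 0) \<and> a * w 1 + b * w 2 + c * w 3 = 0 \<and> b * w 1 + d * w 2 + f * w 3 = 0 \<and> c * w 1 + f * w 2 + w 3 = 0"
proof -
  define m11 m12 m22 where m: "m11 = a - c ^ 2" "m12 = b - c * f" "m22 = d - f ^ 2"
  have det: "m11 * m22 = m12 ^ 2" unfolding m using assms by algebra
  have k: "a * x + b * y + c * (- c * x - f * y) = m11 * x + m12 * y" "b * x + d * y + f * (- c * x - f * y) = m12 * x + m22 * y"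
    "c * x + f * y + (- c * x - f * y) = 0" for x y
    unfolding m by algebra+
  have "\<exists>x y. (x \<noteq> 0 \<or> y \<noteq> 0) \<and> m11 * x + m12 * y = 0 \<and> m12 * x + m22 * y = 0"
  proof (cases "m11 = 0 \<and> m12 = 0")
    case True
    then show ?thesis by (intro exI[of _ 1] exI[of _ 0]) simp
  next
    case False
    then show ?thesis using det by (intro exI[of _ m12] exI[of _ "- m11"]) (auto simp: power2_eq_square algebra_simps)
  qed
  then obtain x y where xy: "x \<noteq> 0 \<or> y \<noteq> 0" "m11 * x + m12 * y = 0" "m12 * x + m22 * y = 0" by blast
  show ?thesis
  proof (intro exI[of _ "vec3 x y (- c * x - f * y)"] conjI)
    show "\<exists>i. vec3 x y (- c * x - f * y) i \<noteq> 0" using xy(1) vec3_simps by metis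
  qed (use k[of x y] xy in simp_all)
qed

text \<open>For the normalised cubic \<open>y\<^sup>2 + r y + e = 0\<close> (in the chart \<open>z = 1\<close>) the Hessian reduces to \<open>A + B y\<close>
  modulo the equation, with \<open>B = 4 e - r\<^sup>2\<close>; its norm \<open>A\<^sup>2 - A B r + B\<^sup>2 e\<close> has the coefficient
  \<open>2 b c1 - c2\<close> at \<open>x ^ 9\<close>, which vanishes iff the point at infinity is a flex.\<close>

lemma hessian_norm_root:
  fixes b c1 c2 d :: "'k::{alg_closed_field, field_char_0}"
  assumes "c2 \<noteq> 2 * b * c1"
  shows "\<exists>x y. x ^ 2 * y + 2 * b * x * y + y ^ 2 + c1 * x ^ 2 + c2 * x + d = 0 \<and>
    (c1 + y) * ((c2 * x + 3 * d) - (b * x + y) ^ 2) - (c1 * x + c2 + b * y) * ((c1 * x + c2 + b * y) - (x + b) * (b * x + y))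
      + (x + b) * ((c1 * x + c2 + b * y) * (b * x + y) - (x + b) * (c2 * x + 3 * d)) = 0"
proof -
  define r e where "r = [:0, 2 * b, 1:]" and "e = [:d, c2, c1:]"
  \<comment> \<open>Parts of the Hessian matrix at the point (x, 1, y): \<open>n\<close> is its
    entry 1 3, \<open>q\<close> its entry 2 2, and \<open>m\<close> is entry 1 2 without its term in
    y.\<close>
  define n m q where "n = [:b, 1:]" and "m = [:c2, c1:]" and "q = [:3 * d, c2:]"
  define B where "B = 4 * e - r ^ 2"
  define A where "A = smult c1 (q - [:0, 0, b ^ 2:]) - m ^ 2 + [:0, 2 * b:] * m * n - q * n ^ 2 - r * e - smult (b ^ 2 - c1) e"
  define N where "N = A ^ 2 - A * B * r + B ^ 2 * e"
  have A: "A = [:c1 * (4 * d) - (c2 * c2 + b * (b * (4 * d))), - (8 * b * d), - (4 * d) - 2 * b * c2, - 2 * c2, - c1:]"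
    unfolding A_def r_def e_def n_def m_def q_def
    by (simp add: power2_eq_square algebra_simps)
  have B: "B = [:4 * d, 4 * c2, 4 * c1 - 4 * b ^ 2, - 4 * b, - 1:]"
    unfolding B_def r_def e_def by (simp add: power2_eq_square algebra_simps numeral_poly)
  have "coeff N 9 = 2 * b * c1 - c2"
    unfolding N_def A B r_def e_def
    by (simp add: power2_eq_square algebra_simps coeff_pCons numeral_eq_Suc)
  then have "degree N \<noteq> 0" using assms by (metis coeff_eq_0 eq_iff_diff_eq_0 gr0I zero_less_numeral)
  then obtain x where x: "poly N x = 0" using alg_closed_imp_poly_has_root by blast
  let ?A = "poly A x" and ?B = "poly B x" and ?r = "poly r x" and ?e = "poly e x"
  have N: "?A ^ 2 - ?A * ?B * ?r + ?B ^ 2 * ?e = 0" using x by (simp add: N_def)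
  have re: "?r = x ^ 2 + 2 * b * x" "?e = c1 * x ^ 2 + c2 * x + d"
    by (simp_all add: r_def e_def algebra_simps power2_eq_square)
  have Ax: "?A = c1 * ((c2 * x + 3 * d) - b ^ 2 * x ^ 2) - (c1 * x + c2) ^ 2 + 2 * b * x * (c1 * x + c2) * (x + b)
      - (c2 * x + 3 * d) * (x + b) ^ 2 - ?r * ?e - (b ^ 2 - c1) * ?e"
    unfolding A_def by (simp add: n_def m_def q_def algebra_simps power2_eq_square)
  have Bx: "?B = 4 * ?e - ?r ^ 2" by (simp add: B_def)
  \<comment> \<open>The norm vanishes at \<open>x\<close>. If \<open>?B\<close> vanishes, so does
    \<open>?A\<close>, and any point of the curve above \<open>x\<close> will do; otherwise y is
    forced to be \<open>- ?A / ?B\<close>.\<close>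
  have "\<exists>y. y ^ 2 + ?r * y + ?e = 0 \<and> ?A + ?B * y = 0"
  proof (cases "?B = 0")
    case True
    then have "?A = 0" using N by simp
    then show ?thesis using quadratic_root[of 1 ?r ?e] True by auto
  next
    case False
    let ?y = "- ?A / ?B"
    have y: "?B * ?y = - ?A" using False by simp
    have "?B ^ 2 * (?y ^ 2 + ?r * ?y + ?e) = 0" using N y by algebra
    then show ?thesis using False y by (intro exI[of _ ?y]) auto
  qed
  then obtain y where y: "y ^ 2 + ?r * y + ?e = 0" "?A + ?B * y = 0" by blast
  show ?thesis
  proof (intro exI conjI)
    show "x ^ 2 * y + 2 * b * x * y + y ^ 2 + c1 * x ^ 2 + c2 * x + d = 0"
      using y(1) unfolding re by algebra
    show "(c1 + y) * ((c2 * x + 3 * d) - (b * x + y) ^ 2) - (c1 * x + c2 + b * y) * ((c1 * x + c2 + b * y) - (x + b) * (b * x + y))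
      + (x + b) * ((c1 * x + c2 + b * y) * (b * x + y) - (x + b) * (c2 * x + 3 * d)) = 0"
      using y unfolding Ax Bx re by algebra
  qed
qed

text \<open>Points are sought as \<open>vec3 x 1 y\<close>, where entry 3 3 of the Hessian matrix is
  1, as \<open>symmetric_kernel\<close> requires. The only other candidate is
  \<open>vec3 1 0 0\<close>, where the tangent at \<open>vec3 0 0 1\<close> meets the curve again;
  it is taken exactly when \<open>hessian_norm_root\<close> does not apply.\<close>

lemma normalised_hessian_point:
  fixes s :: "'k::{alg_closed_field, field_char_0} tensor"
  assumes s: "sym_tensor s" and z: "s 1 1 1 = 0" "s 3 3 3 = 0" "s 1 3 3 = 0" "s 2 2 3 = 0" "s 1 1 3 = 1" "s 2 3 3 = 1"
  shows "\<exists>p w i j. p i \<noteq> 0 \<and> tri s p p p = 0 \<and> w j \<noteq> 0 \<and> (\<forall>k. polar s p w k = 0)"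
proof -
  \<comment> \<open>The division by 3 lets the common factor 3 be taken out of the cubic.\<close>
  define b c1 c2 d where c: "b = s 1 2 3" "c1 = s 1 1 2" "c2 = s 1 2 2" "d = s 2 2 2 / 3"
  have d3: "s 2 2 2 = 3 * d" by (simp add: c)
  note sc = sym_tensor_simps[OF s] z c(1-3)[symmetric] d3
  show ?thesis
  proof (cases "c2 = 2 * b * c1")
    case True
    have "tri s (vec3 1 0 0) (vec3 1 0 0) (vec3 1 0 0) = 0" by (simp add: tri_expand[OF s] sc)
    moreover have "\<forall>k. polar s (vec3 1 0 0) (vec3 (- b) 1 (- c1)) k = 0"
      unfolding forall_3 polar_def sum_3 using True by (simp add: sc)
    ultimately show ?thesis
      by (intro exI[of _ "vec3 1 0 0"] exI[of _ "vec3 (- b) 1 (- c1)"] exI[of _ 1] exI[of _ 2]) simp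
  next
    case False
    obtain x y where xy: "x ^ 2 * y + 2 * b * x * y + y ^ 2 + c1 * x ^ 2 + c2 * x + d = 0"
      "(c1 + y) * ((c2 * x + 3 * d) - (b * x + y) ^ 2) - (c1 * x + c2 + b * y) * ((c1 * x + c2 + b * y) - (x + b) * (b * x + y))
      + (x + b) * ((c1 * x + c2 + b * y) * (b * x + y) - (x + b) * (c2 * x + 3 * d)) = 0"
      using hessian_norm_root[OF False] by blast
    obtain w :: "3 \<Rightarrow> 'k" and j where w: "w j \<noteq> 0" "(c1 + y) * w 1 + (c1 * x + c2 + b * y) * w 2 + (x + b) * w 3 = 0"
      "(c1 * x + c2 + b * y) * w 1 + (c2 * x + 3 * d) * w 2 + (b * x + y) * w 3 = 0" "(x + b) * w 1 + (b * x + y) * w 2 + w 3 = 0"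
      using symmetric_kernel[OF xy(2)] by blast
    have "tri s (vec3 x 1 y) (vec3 x 1 y) (vec3 x 1 y)
        = 3 * (x ^ 2 * y + 2 * b * x * y + y ^ 2 + c1 * x ^ 2 + c2 * x + d)"
      by (simp add: tri_expand[OF s] sc algebra_simps power2_eq_square)
    then have "tri s (vec3 x 1 y) (vec3 x 1 y) (vec3 x 1 y) = 0" using xy(1) by simp
    moreover have "\<forall>k. polar s (vec3 x 1 y) w k = 0"
      unfolding forall_3 polar_def sum_3
      using w(2-4) by (simp add: sc algebra_simps)
    ultimately show ?thesis using w(1)
      by (intro exI[of _ "vec3 x 1 y"] exI[of _ w] exI[of _ 2] exI[of _ j]) simp
  qed
qed

text \<open>The transformed polar consists of the pairings of the original one with the rows of
  \<open>M\<close>, and the rows of an invertible matrix detect every vector.\<close>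

lemma polar_chg:
  assumes "\<And>k. polar (chg M t) u v k = 0" "det3 M \<noteq> 0"
  shows "polar t (\<lambda>j. u 1 * M 1 j + u 2 * M 2 j + u 3 * M 3 j) (\<lambda>j. v 1 * M 1 j + v 2 * M 2 j + v 3 * M 3 j) k = 0"
proof -
  let ?g = "polar t (\<lambda>j. u 1 * M 1 j + u 2 * M 2 j + u 3 * M 3 j) (\<lambda>j. v 1 * M 1 j + v 2 * M 2 j + v 3 * M 3 j)"
  have lin: "tri t (\<lambda>j. u 1 * M 1 j + u 2 * M 2 j + u 3 * M 3 j) (\<lambda>j. v 1 * M 1 j + v 2 * M 2 j + v 3 * M 3 j) w
     = (\<Sum>a\<in>UNIV. \<Sum>b\<in>UNIV. tri t (M a) (M b) w * (u a * v b))" for w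
  proof -
    have 1: "tri t (\<lambda>j. u 1 * M 1 j + u 2 * M 2 j + u 3 * M 3 j) z w = (\<Sum>a\<in>UNIV. u a * tri t (M a) z w)" for z
      unfolding tri_def sum_3 by (simp add: algebra_simps)
    have 2: "tri t z (\<lambda>j. v 1 * M 1 j + v 2 * M 2 j + v 3 * M 3 j) w = (\<Sum>a\<in>UNIV. v a * tri t z (M a) w)" for z
      unfolding tri_def sum_3 by (simp add: algebra_simps)
    show ?thesis unfolding 1 2 by (simp add: sum_distrib_left mult_ac)
  qed
  have "sdot ?g (M c) = polar (chg M t) u v c" for c
    unfolding tri_polar[symmetric] lin polar_def[of "chg M t"] chg_def ..
  then have g: "sdot ?g (M 1) = 0" "sdot ?g (M 2) = 0" "sdot ?g (M 3) = 0" using assms(1) by simp_all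
  have "det3 M * ?g 1 = 0" "det3 M * ?g 2 = 0" "det3 M * ?g 3 = 0"
    using g unfolding sdot_def det3_def by algebra+
  then show ?thesis using assms(2) exhaust_3[of k] by auto
qed

lemma nonsingular_chg:
  assumes "det3 M \<noteq> 0" and nonsing: "\<And>p i. p i \<noteq> 0 \<Longrightarrow> \<exists>k. polar t p p k \<noteq> 0" and p: "p i \<noteq> 0"
  shows "\<exists>k. polar (chg M t) p p k \<noteq> 0"
proof (rule ccontr)
  assume "\<nexists>k. polar (chg M t) p p k \<noteq> 0"
  then have z: "polar t (\<lambda>j. p 1 * M 1 j + p 2 * M 2 j + p 3 * M 3 j) (\<lambda>j. p 1 * M 1 j + p 2 * M 2 j + p 3 * M 3 j) k = 0" for k
    using polar_chg[of M t p p] assms(1) by blast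
  let ?q = "\<lambda>j. p 1 * M 1 j + p 2 * M 2 j + p 3 * M 3 j"
  have q: "?q j = 0" for j using nonsing[of ?q j] z by blast
  have "det3 M * p 1 = 0" "det3 M * p 2 = 0" "det3 M * p 3 = 0"
    using q[of 1] q[of 2] q[of 3] unfolding det3_def by algebra+
  then show False using assms(1) p exhaust_3[of i] by auto
qed

text \<open>Any point of the curve is moved to the third basis vector with tangent
  \<open>X 2 = 0\<close>. Either it is a flex, or \<open>s 1 1 3\<close> is nonzero and the cubic
  can be scaled to the form for which the Hessian was computed.\<close>

lemma nonsingular_flex:
  fixes t :: "'k::{alg_closed_field, field_char_0} tensor"
  assumes t: "sym_tensor t" "irreducible (form t)" "lin_equiv q (form t)"
    and nonsing: "\<And>p i. p i \<noteq> 0 \<Longrightarrow> \<exists>k. polar t p p k \<noteq> 0"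
  shows "has_flex q"
proof -
  obtain p i where p: "p i \<noteq> 0" "tri t p p p = 0" using cubic_has_point[OF t(1)] by blast
  obtain k where k: "polar t p p k \<noteq> 0" using nonsing p(1) by blast
  obtain v where v: "sdot (polar t p p) v \<noteq> 0" using exists_nonzero_sdot[of "polar t p p" k] k by blast
  have "sdot (polar t p p) p = 0" using p by (simp add: tri_polar)
  then obtain w where w: "sdot (polar t p p) w = 0" "det3 (vec3 w v p) \<noteq> 0"
    using extend_basis[of "polar t p p" p i v] p(1) v by blast
  define s where "s = chg (vec3 w v p) t"
  have ss: "sym_tensor s" unfolding s_def using sym_chg[OF t(1)] .
  have si: "irreducible (form s)" unfolding s_def using irreducible_chg[OF t(2) w(2)] .
  have sl: "lin_equiv q (form s)" unfolding s_def using lin_equiv_trans[OF t(3) lin_equiv_chg[OF w(2)]] .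
  have sn: "p i \<noteq> 0 \<Longrightarrow> \<exists>k. polar s p p k \<noteq> 0" for p i unfolding s_def using nonsingular_chg[OF w(2) nonsing] .
  have "tri t p p w = 0" "tri t p p v \<noteq> 0" using w v by (simp_all add: tri_polar)
  then have s0: "s 3 3 3 = 0" "s 1 3 3 = 0" "s 2 3 3 \<noteq> 0"
    using p(2) tri_sym[OF t(1)] by (simp_all add: s_def chg_def)
  show ?thesis
  proof (cases "s 1 1 3 = 0")
    case True
    then show ?thesis using has_flexI[OF ss si sl s0(1,2) _ s0(3)] by simp
  next
    case False
    \<comment> \<open>\<open>a\<close> and \<open>g\<close> scale two coefficients to 1;
      \<open>m\<close> moves the first basis vector to the residual intersection of the tangent,
      which clears \<open>u 1 1 1\<close>; \<open>n\<close> clears \<open>u 2 2 3\<close>.\<close>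
    define a where "a = inverse (s 1 1 3)"
    define g where "g = s 1 1 3 ^ 2 / s 2 3 3"
    define m where "m = - s 1 1 1 / (3 * s 1 1 3)"
    define n where "n = - g * s 2 2 3 / (2 * s 2 3 3)"
    have eqs: "a * s 1 1 3 = 1" "g * s 2 3 3 = s 1 1 3 ^ 2" "3 * m * s 1 1 3 = - s 1 1 1" "2 * n * s 2 3 3 = - g * s 2 2 3"
      using False s0(3) by (simp_all add: a_def g_def m_def n_def)
    have nz: "a \<noteq> 0" "g \<noteq> 0" using False s0(3) by (simp_all add: a_def g_def)
    define M where "M = vec3 (vec3 1 0 m) (vec3 0 g n) (vec3 0 0 a)"
    have d: "det3 M \<noteq> 0" using nz by (simp add: M_def det3_def)
    define u where "u = chg M s"
    have us: "sym_tensor u" unfolding u_def using sym_chg[OF ss] .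
    have ui: "irreducible (form u)" unfolding u_def using irreducible_chg[OF si d] .
    have ul: "lin_equiv q (form u)" unfolding u_def using lin_equiv_trans[OF sl lin_equiv_chg[OF d]] .
    have un: "p i \<noteq> 0 \<Longrightarrow> \<exists>k. polar u p p k \<noteq> 0" for p i unfolding u_def using nonsingular_chg[OF d sn] .
    have "u 1 1 1 = s 1 1 1 + 3 * m * s 1 1 3" "u 3 3 3 = 0" "u 1 3 3 = 0" "u 2 2 3 = a * g * (g * s 2 2 3 + 2 * n * s 2 3 3)"
      "u 1 1 3 = a * s 1 1 3" "u 2 3 3 = a ^ 2 * (g * s 2 3 3)"
      by (simp_all add: u_def chg_def M_def tri_expand[OF ss] s0 algebra_simps power2_eq_square)
    then have "u 1 1 1 = 0" "u 3 3 3 = 0" "u 1 3 3 = 0" "u 2 2 3 = 0" "u 1 1 3 = 1" "u 2 3 3 = 1"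
      using eqs by (simp_all flip: power_mult_distrib)
    from normalised_hessian_point[OF us this]
    obtain p w i j where pw: "p i \<noteq> 0" "tri u p p p = 0" "w j \<noteq> 0" "\<forall>k. polar u p w k = 0" by blast
    show ?thesis
      by (rule flex_from_hessian[OF us ui ul, of p i w j]) (use un pw in blast)+
  qed
qed

section \<open>Singular cubics\<close>

lemma binary_form_reducible:
  fixes s :: "'k::{alg_closed_field, field_char_0} tensor"
  assumes s: "sym_tensor s" "irreducible (form s)" and z: "s 1 1 3 = 0" "s 1 2 3 = 0" "s 2 2 3 = 0" "s 1 3 3 = 0" "s 2 3 3 = 0" "s 3 3 3 = 0"
  shows False
proof (cases "s 1 1 1 = 0")
  case True
  then show False using irreducible_form_X2[OF s] z by simp
next
  case False
  obtain x where x: "s 1 1 1 * x ^ 3 + (3 * s 1 1 2) * x ^ 2 + (3 * s 1 2 2) * x + s 2 2 2 = 0"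
    using cubic_root[OF False] by blast
  define M :: "3 \<Rightarrow> 3 \<Rightarrow> 'k" where "M = vec3 (vec3 x 1 0) (vec3 1 0 0) (vec3 0 0 1)"
  have d: "det3 M \<noteq> 0" by (simp add: M_def det3_def)
  have "chg M s 1 1 1 = s 1 1 1 * x ^ 3 + (3 * s 1 1 2) * x ^ 2 + (3 * s 1 2 2) * x + s 2 2 2"
    "chg M s 1 1 3 = 0" "chg M s 1 3 3 = 0" "chg M s 3 3 3 = 0"
    by (simp_all add: chg_def M_def tri_expand[OF s(1)] z algebra_simps power2_eq_square power3_eq_cube)
  then show False using irreducible_form_X2[OF sym_chg[OF s(1)] irreducible_chg[OF s(2) d]] x by simp
qed

text \<open>With the singular point as third basis vector, the cubic is \<open>X 3\<close> times the
  quadratic tangent cone plus a binary cubic. A double line as cone gives the cusp, two lines give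
  the node; in both cases a flex is written down.\<close>

lemma singular_flex:
  fixes t :: "'k::{alg_closed_field, field_char_0} tensor"
  assumes t: "sym_tensor t" "irreducible (form t)" "lin_equiv q (form t)"
    and p: "p i \<noteq> 0" "\<And>k. polar t p p k = 0"
  shows "has_flex q"
proof -
  have "\<exists>M. det3 M \<noteq> 0 \<and> M 3 = p"
  proof -
    have "det3 (vec3 (vec3 0 1 0) (vec3 0 0 1) p) = p 1" "det3 (vec3 (vec3 0 0 1) (vec3 1 0 0) p) = p 2"
      "det3 (vec3 (vec3 1 0 0) (vec3 0 1 0) p) = p 3" by (simp_all add: det3_def)
    then show ?thesis using p(1) exhaust_3[of i] by (metis vec3_simps(3))
  qed
  then obtain M where M: "det3 M \<noteq> 0" "M 3 = p" by blast
  have tz: "tri t p p w = 0" for w by (simp add: tri_polar p(2) sdot_def)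
  define s where "s = chg M t"
  have ss: "sym_tensor s" unfolding s_def using sym_chg[OF t(1)] .
  have si: "irreducible (form s)" unfolding s_def using irreducible_chg[OF t(2) M(1)] .
  have sl: "lin_equiv q (form s)" unfolding s_def using lin_equiv_trans[OF t(3) lin_equiv_chg[OF M(1)]] .
  have "s 3 3 1 = 0" "s 3 3 2 = 0" "s 3 3 3 = 0" by (simp_all add: s_def chg_def M(2) tz)
  then have s3: "s 1 3 3 = 0" "s 2 3 3 = 0" "s 3 3 3 = 0" by (simp_all add: sym_tensor_simps[OF ss])
  \<comment> \<open>A direction of the tangent cone; taken as first basis vector it clears
    \<open>u 1 1 3\<close>.\<close>
  have "\<exists>x y. (x \<noteq> 0 \<or> y \<noteq> 0) \<and> s 1 1 3 * x ^ 2 + 2 * s 1 2 3 * x * y + s 2 2 3 * y ^ 2 = 0"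
  proof (cases "s 1 1 3 = 0")
    case True
    then show ?thesis by (intro exI[of _ 1] exI[of _ 0]) simp
  next
    case False
    then obtain x where "s 1 1 3 * x ^ 2 + (2 * s 1 2 3) * x + s 2 2 3 = 0" using quadratic_root by blast
    then show ?thesis by (intro exI[of _ x] exI[of _ 1]) simp
  qed
  then obtain x y where xy: "x \<noteq> 0 \<or> y \<noteq> 0" "s 1 1 3 * x ^ 2 + 2 * s 1 2 3 * x * y + s 2 2 3 * y ^ 2 = 0" by blast
  define N :: "3 \<Rightarrow> 3 \<Rightarrow> 'k" where "N = vec3 (vec3 x y 0) (if x = 0 then vec3 1 0 0 else vec3 0 1 0) (vec3 0 0 1)"
  have dN: "det3 N \<noteq> 0" using xy(1) by (auto simp: N_def det3_def)
  define u where "u = chg N s"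
  have us: "sym_tensor u" unfolding u_def using sym_chg[OF ss] .
  have ui: "irreducible (form u)" unfolding u_def using irreducible_chg[OF si dN] .
  have ul: "lin_equiv q (form u)" unfolding u_def using lin_equiv_trans[OF sl lin_equiv_chg[OF dN]] .
  have "u 1 1 3 = s 1 1 3 * x ^ 2 + 2 * s 1 2 3 * x * y + s 2 2 3 * y ^ 2"
    by (simp add: u_def chg_def N_def tri_expand[OF ss] s3 algebra_simps power2_eq_square)
  then have u0: "u 1 1 3 = 0" "u 1 3 3 = 0" "u 2 3 3 = 0" "u 3 3 3 = 0"
    using xy(2) by (simp_all add: u_def chg_def N_def tri_expand[OF ss] s3)
  have u111: "u 1 1 1 \<noteq> 0" using irreducible_form_X2[OF us ui] u0 by simp
  show ?thesis
  proof (cases "u 1 2 3 = 0")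
    case True
    have u223: "u 2 2 3 \<noteq> 0" using binary_form_reducible[OF us ui] u0 True by blast
    \<comment> \<open>Cuspidal case: \<open>m\<close> completes the cube in the first variable,
      \<open>n\<close> and \<open>l\<close> absorb the terms x y^2 and y^3 into the third. What
      remains is a multiple of x^3 plus a multiple of y^2 z, whose flex is row 3 of
      \<open>M\<close>.\<close>
    define m where "m = - u 1 1 2 / u 1 1 1"
    define n where "n = - (u 1 2 2 + 2 * m * u 1 1 2 + m ^ 2 * u 1 1 1) / u 2 2 3"
    define l where "l = - (u 2 2 2 + 3 * m * u 1 2 2 + 3 * m ^ 2 * u 1 1 2 + m ^ 3 * u 1 1 1) / (3 * u 2 2 3)"
    define M where "M = vec3 (vec3 1 0 n) (vec3 0 0 1) (vec3 m 1 l)"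
    have d: "det3 M \<noteq> 0" by (simp add: M_def det3_def)
    have e: "m * u 1 1 1 = - u 1 1 2" "n * u 2 2 3 = - (u 1 2 2 + 2 * m * u 1 1 2 + m ^ 2 * u 1 1 1)"
      "3 * l * u 2 2 3 = - (u 2 2 2 + 3 * m * u 1 2 2 + 3 * m ^ 2 * u 1 1 2 + m ^ 3 * u 1 1 1)"
      using u111 u223 by (simp_all add: m_def n_def l_def)
    show ?thesis
    proof (rule has_flex_chgI[OF us ui ul d])
      have "tri u (M 3) (M 3) (M 3) = u 2 2 2 + 3 * m * u 1 2 2 + 3 * m ^ 2 * u 1 1 2 + m ^ 3 * u 1 1 1 + 3 * l * u 2 2 3"
        by (simp add: M_def tri_expand[OF us] u0 True algebra_simps power2_eq_square power3_eq_cube)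
      then show "tri u (M 3) (M 3) (M 3) = 0" using e(3) by simp
      have "tri u (M 1) (M 3) (M 3) = u 1 2 2 + 2 * m * u 1 1 2 + m ^ 2 * u 1 1 1 + n * u 2 2 3"
        by (simp add: M_def tri_expand[OF us] u0 True algebra_simps power2_eq_square)
      then show "tri u (M 1) (M 3) (M 3) = 0" using e(2) by simp
      have "tri u (M 1) (M 1) (M 3) = u 1 1 2 + m * u 1 1 1"
        by (simp add: M_def tri_expand[OF us] u0 True algebra_simps)
      then show "tri u (M 1) (M 1) (M 3) = 0" using e(1) by simp
      show "tri u (M 2) (M 3) (M 3) \<noteq> 0" using u223 by (simp add: M_def tri_expand[OF us] u0 True)
    qed
  next
    case False
    \<comment> \<open>Nodal case: a shear along the first branch direction moves the second basis
      vector to the other branch direction.\<close>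
    define h where "h = - u 2 2 3 / (2 * u 1 2 3)"
    have h: "2 * h * u 1 2 3 = - u 2 2 3" using False by (simp add: h_def)
    define K :: "3 \<Rightarrow> 3 \<Rightarrow> 'k" where "K = vec3 (vec3 1 0 0) (vec3 h 1 0) (vec3 0 0 1)"
    have dK: "det3 K \<noteq> 0" by (simp add: K_def det3_def)
    define r where "r = chg K u"
    have rs: "sym_tensor r" unfolding r_def using sym_chg[OF us] .
    have ri: "irreducible (form r)" unfolding r_def using irreducible_chg[OF ui dK] .
    have rl: "lin_equiv q (form r)" unfolding r_def using lin_equiv_trans[OF ul lin_equiv_chg[OF dK]] .
    have "r 2 2 3 = u 2 2 3 + 2 * h * u 1 2 3"
      by (simp add: r_def chg_def K_def tri_expand[OF us] u0 algebra_simps)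
    then have r0: "r 2 2 3 = 0" using h by simp
    have r1: "r 1 1 3 = 0" "r 1 3 3 = 0" "r 2 3 3 = 0" "r 3 3 3 = 0" "r 1 2 3 \<noteq> 0" "r 1 1 1 \<noteq> 0"
      using False u111 by (simp_all add: r_def chg_def K_def tri_expand[OF us] u0)
    \<comment> \<open>Otherwise the cubic is divisible by \<open>X 1\<close>; the swap
      \<open>S\<close> reduces this to divisibility by \<open>X 2\<close>.\<close>
    have r222: "r 2 2 2 \<noteq> 0"
    proof
      assume r222: "r 2 2 2 = 0"
      define S :: "3 \<Rightarrow> 3 \<Rightarrow> 'k" where "S = vec3 (vec3 0 1 0) (vec3 1 0 0) (vec3 0 0 1)"
      have dS: "det3 S \<noteq> 0" by (simp add: S_def det3_def)
      show False using irreducible_form_X2[OF sym_chg[OF rs] irreducible_chg[OF ri dS]]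
        by (simp add: chg_def S_def tri_expand[OF rs] r0 r1 r222)
    qed
    obtain al be where ab: "al ^ 3 = r 1 1 1" "be ^ 3 = r 2 2 2"
      using nth_root_exists[of 3 "r 1 1 1"] nth_root_exists[of 3 "r 2 2 2"] by auto
    have nz: "al \<noteq> 0" "be \<noteq> 0" using ab r1 r222 by auto
    define ka where "ka = r 1 2 3"
    have ka: "ka \<noteq> 0" using r1 by (simp add: ka_def)
    \<comment> \<open>These make the cubic equal to 6 ka x y (z + e1 x + e2 y) + (al x + be y)^3.
      The line z + e1 x + e2 y = 0 therefore has triple contact, at the point that forms row 3 of
      \<open>M\<close>.\<close>
    define e1 e2 where "e1 = (r 1 1 2 - al ^ 2 * be) / (2 * ka)" and "e2 = (r 1 2 2 - al * be ^ 2) / (2 * ka)"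
    have e: "2 * ka * e1 = r 1 1 2 - al ^ 2 * be" "2 * ka * e2 = r 1 2 2 - al * be ^ 2"
      using ka by (simp_all add: e1_def e2_def)
    define M where "M = vec3 (vec3 1 0 (- e1)) (vec3 0 0 1) (vec3 be (- al) (- e1 * be + e2 * al))"
    have d: "det3 M \<noteq> 0" using nz by (simp add: M_def det3_def)
    have rr: "r 1 1 1 = al ^ 3" "r 2 2 2 = be ^ 3" "r 1 1 2 = 2 * ka * e1 + al ^ 2 * be" "r 1 2 2 = 2 * ka * e2 + al * be ^ 2"
      using ab e by simp_all
    note rt = tri_expand[OF rs] r0 r1(1-4) rr ka_def[symmetric]
    show ?thesis
    proof (rule has_flex_chgI[OF rs ri rl d])
      show "tri r (M 3) (M 3) (M 3) = 0"
        unfolding M_def vec3_simps rt by algebra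
      show "tri r (M 1) (M 3) (M 3) = 0"
        unfolding M_def vec3_simps rt by algebra
      show "tri r (M 1) (M 1) (M 3) = 0"
        unfolding M_def vec3_simps rt by algebra
      show "tri r (M 2) (M 3) (M 3) \<noteq> 0" using nz ka by (simp add: M_def rt)
    qed
  qed
qed

text \<open>The tensor consists of the third partial derivatives divided by 6; three applications of
  Euler's identity rebuild the cubic.\<close>

lemma cubic_eq_form:
  fixes \<Omega> :: "'k::field_char_0 poly3"
  assumes "homog 3 \<Omega>"
  shows "\<exists>t. sym_tensor t \<and> \<Omega> = form t"
proof -
  have h2: "homog 2 (pd i \<Omega>)" for i using homog_pd[OF assms, of i] by simp
  have h1: "homog 1 (pd j (pd i \<Omega>))" for i j using homog_pd[OF h2, of j i] by simp
  have h0: "homog 0 (pd k (pd j (pd i \<Omega>)))" for i j k using homog_pd[OF h1, of k j i] by simp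
  define c where "c i j k = Poly_Mapping.lookup (pd k (pd j (pd i \<Omega>))) 0" for i j k
  have c: "pd k (pd j (pd i \<Omega>)) = cst (c i j k)" for i j k
    unfolding c_def using homog_0_cst[OF h0] .
  define t where "t i j k = c i j k / 6" for i j k
  have t6: "6 * cst (t i j k) = cst (c i j k)" for i j k
  proof -
    have "6 * (c i j k / 6) = c i j k" by simp
    then show ?thesis unfolding t_def by (metis cst_simps(6,10))
  qed
  have "sym_tensor t"
    unfolding sym_tensor_def
  proof (intro allI)
    fix i j k
    have "cst (c i j k) = cst (c j i k)" "cst (c i j k) = cst (c i k j)"
      unfolding c[symmetric] by (metis pd_commute)+
    then show "t i j k = t j i k \<and> t i j k = t i k j" by (simp add: t_def)
  qed
  have e2: "2 * pd i \<Omega> = X 1 * pd 1 (pd i \<Omega>) + X 2 * pd 2 (pd i \<Omega>) + X 3 * pd 3 (pd i \<Omega>)" for i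
    using euler_homog[OF h2[of i]] by simp
  have e3: "pd j (pd i \<Omega>) = X 1 * (6 * cst (t i j 1)) + X 2 * (6 * cst (t i j 2)) + X 3 * (6 * cst (t i j 3))" for i j
    using euler_homog[OF h1[of j i]] unfolding c t6 by simp
  have "3 * \<Omega> = X 1 * pd 1 \<Omega> + X 2 * pd 2 \<Omega> + X 3 * pd 3 \<Omega>"
    using euler_homog[OF assms] by simp
  then have "6 * \<Omega> = X 1 * (2 * pd 1 \<Omega>) + X 2 * (2 * pd 2 \<Omega>) + X 3 * (2 * pd 3 \<Omega>)"
    by algebra
  also have "\<dots> = 6 * form t"
    unfolding e2 e3 form_def sum_3 by (simp add: algebra_simps)
  finally have "6 * \<Omega> = 6 * form t" .
  then have "\<Omega> = form t" by simp
  with \<open>sym_tensor t\<close> show ?thesis by blast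
qed

lemma lin_equiv_refl: "lin_equiv p p"
proof -
  have "lin_auto (\<lambda>p. p) (\<lambda>p. p)" by (simp add: lin_auto_def alg_hom_def)
  then show ?thesis unfolding lin_equiv_def by blast
qed

theorem irreducible_cubic_has_flex:
  fixes \<Omega> :: "'k::{alg_closed_field, field_char_0} poly3"
  assumes "homog 3 \<Omega>" "irreducible \<Omega>"
  shows "has_flex \<Omega>"
proof -
  obtain t where t: "sym_tensor t" "\<Omega> = form t" using cubic_eq_form[OF assms(1)] by blast
  have "lin_equiv \<Omega> (form t)" using lin_equiv_refl t by simp
  moreover have "irreducible (form t)" using assms t by simp
  ultimately show ?thesis using singular_flex nonsingular_flex t(1) by metis
qed

lemma irreducible_cubic:
  fixes \<Omega> :: "'k::{alg_closed_field, field_char_0} poly3"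
  assumes "homog 3 \<Omega>" "irreducible \<Omega>"
  shows "div_free_hamiltonian \<Omega>" "center_powers \<Omega>"
proof -
  obtain c1 c2 e1 e2 e3 e4 e5 where f: "c1 \<noteq> 0" "c2 \<noteq> 0" "lin_equiv \<Omega> (flex_form c1 c2 e1 e2 e3 e4 e5)"
    using irreducible_cubic_has_flex[OF assms] unfolding has_flex_def by blast
  show "div_free_hamiltonian \<Omega>" using div_free_hamiltonian_equiv[OF f(3) div_free_hamiltonian_flex[OF f(1,2)]] .
  show "center_powers \<Omega>" using center_powers_equiv[OF f(3) center_powers_flex[OF f(1)]] .
qed

section \<open>Poisson derivations of a unimodular bracket with irreducible potential\<close>

definition decomposes :: "(3 \<Rightarrow> 'k::field poly3) \<Rightarrow> bool" where
  "decomposes P \<longleftrightarrow> (\<forall>v. (\<forall>k. lie v P k = 0) \<longrightarrow>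
     (\<exists>z\<in>poisson_center (biv P). \<exists>a. \<forall>i. v i = z * X i + cross P (grad a) i))"

lemma poisson_center_sum:
  "(\<And>x. x \<in> S \<Longrightarrow> f x \<in> poisson_center (biv P)) \<Longrightarrow> sum f S \<in> poisson_center (biv P)"
proof (induction S rule: infinite_finite_induct)
  case (insert x S)
  then show ?case by (simp add: poisson_center_def biv_expand algebra_simps)
qed (simp_all add: poisson_center_def biv_expand)

lemma poisson_center_cst_mult: "z \<in> poisson_center (biv P) \<Longrightarrow> cst c * z \<in> poisson_center (biv P)"
proof -
  assume z: "z \<in> poisson_center (biv P)"
  have "biv P (cst c * z) b = cst c * biv P z b" for b
    by (simp add: biv_expand algebra_simps)
  then show ?thesis using z by (simp add: poisson_center_def)
qed

lemma power_in_center: "\<Omega> ^ k \<in> poisson_center (biv (grad \<Omega>))"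
  by (simp add: poisson_center_def biv_grad_power)

text \<open>Each homogeneous component of \<open>g\<close> is a multiple of a power of \<Omega>, and
  without a constant term the exponent is positive.\<close>

lemma center_divide:
  assumes h: "homog 3 \<Omega>" and c: "center_powers \<Omega>" and g: "g \<in> poisson_center (biv (grad \<Omega>))" and g0: "hcomp 0 g = 0"
  shows "\<exists>z\<in>poisson_center (biv (grad \<Omega>)). g = \<Omega> * z"
proof -
  have "\<exists>z\<in>poisson_center (biv (grad \<Omega>)). hcomp d g = \<Omega> * z" for d
  proof (cases "hcomp d g = 0")
    case True
    then show ?thesis by (intro bexI[of _ 0]) (simp_all add: poisson_center_def biv_expand)
  next
    case False
    have "\<forall>i. cross (grad \<Omega>) (grad (hcomp d g)) i = 0"
      using g cross_grad_central[OF _ h] by (simp add: poisson_center_biv)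
    then obtain k e where k: "d = 3 * int k" "hcomp d g = cst e * \<Omega> ^ k"
      using c False homog_hcomp unfolding center_powers_def by blast
    have "k \<noteq> 0"
    proof
      assume "k = 0"
      then have "d = 0" using k(1) by simp
      then show False using g0 False by simp
    qed
    then obtain l where "k = Suc l" by (cases k) auto
    then show ?thesis using k poisson_center_cst_mult[OF power_in_center]
      by (intro bexI[of _ "cst e * \<Omega> ^ l"]) (simp_all add: algebra_simps)
  qed
  then obtain z where z: "\<And>d. z d \<in> poisson_center (biv (grad \<Omega>))" "\<And>d. hcomp d g = \<Omega> * z d" by metis
  have "g = \<Omega> * (\<Sum>d\<in>wdeg (\<lambda>_. 1) ` Poly_Mapping.keys g. z d)"
    by (subst wcomp_expand_keys[of g "\<lambda>_. 1"]) (simp only: z(2) sum_distrib_left)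
  then show ?thesis by (rule bexI) (rule poisson_center_sum, rule z(1))
qed

text \<open>By \<open>lie_grad\<close>, \<open>g = vf v \<Omega>\<close> has a gradient parallel to
  that of \<Omega>, so it is central and, by \<open>center_divide\<close>, equals 3 z \<Omega> with
  \<open>z\<close> central. After subtraction of \<open>z\<close> times the Euler field, the rest
  annihilates \<Omega> and has no divergence, hence is Hamiltonian.\<close>

lemma decomposes_irreducible:
  fixes \<Omega> :: "'k::{alg_closed_field, field_char_0} poly3"
  assumes h: "homog 3 \<Omega>" and irr: "irreducible \<Omega>"
  shows "decomposes (grad \<Omega>)"
  unfolding decomposes_def
proof (intro allI impI)
  fix v assume L: "\<forall>k. lie v (grad \<Omega>) k = 0"
  have h2: "homog 2 (pd i \<Omega>)" for i using homog_pd[OF h, of i] by simp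
  have O0: "\<Omega> \<noteq> 0" using irr by (simp add: irreducible_def)
  then obtain l where l: "pd l \<Omega> \<noteq> 0" using pd_homog_zero[OF h] by auto
  define g where "g = vf v \<Omega>"
  have gk: "pd k g = dv v * pd k \<Omega>" for k using L by (simp add: lie_grad g_def)
  have "g \<in> poisson_center (biv (grad \<Omega>))"
    unfolding poisson_center_biv by (simp add: cross_def grad_def gk)
  \<comment> \<open>The partials of \<Omega> are quadratic, so \<open>g\<close> has no constant
    term.\<close>
  moreover have "hcomp 0 g = 0"
  proof -
    have "hcomp 0 (v i * pd i \<Omega>) = 0" for i
      using hcomp_mult[OF h2, of 0 i "v i"] homog_neg[OF homog_hcomp, of "-2" "v i"] by (simp add: mult.commute)
    then show ?thesis by (simp add: g_def vf_def)
  qed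
  ultimately obtain z0 where z0: "z0 \<in> poisson_center (biv (grad \<Omega>))" "g = \<Omega> * z0"
    using center_divide[OF h irreducible_cubic(2)[OF h irr]] by blast
  define z where "z = cst (1 / 3) * z0"
  have z: "z \<in> poisson_center (biv (grad \<Omega>))" unfolding z_def using poisson_center_cst_mult[OF z0(1)] .
  have z3: "3 * z = z0" unfolding z_def mult.assoc[symmetric] third by simp
  have eu: "X 1 * pd 1 \<Omega> + X 2 * pd 2 \<Omega> + X 3 * pd 3 \<Omega> = 3 * \<Omega>" using euler_homog[OF h] by simp
  define u where "u i = v i - z * X i" for i
  have "vf u \<Omega> = g - z * (X 1 * pd 1 \<Omega> + X 2 * pd 2 \<Omega> + X 3 * pd 3 \<Omega>)"
    by (simp add: vf_def u_def g_def algebra_simps)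
  then have u0: "vf u \<Omega> = 0" unfolding eu z0(2) z3[symmetric] by (simp add: algebra_simps)
  \<comment> \<open>The divergence of \<open>u\<close> is that of \<open>v\<close> minus 3 z minus
    the Euler derivative of \<open>z\<close>. Parallel gradients turn the latter, times
    \<open>pd l \<Omega>\<close>, into \<open>3 * \<Omega> * pd l z\<close>, and \<open>gk\<close>
    accounts for the rest.\<close>
  have "pd l \<Omega> * dv u = 0"
  proof -
    have "cross (grad \<Omega>) (grad z) i = 0" for i using z by (simp add: poisson_center_biv)
    from this[of 1] this[of 2] this[of 3] have c: "pd 2 \<Omega> * pd 3 z = pd 3 \<Omega> * pd 2 z"
      "pd 3 \<Omega> * pd 1 z = pd 1 \<Omega> * pd 3 z" "pd 1 \<Omega> * pd 2 z = pd 2 \<Omega> * pd 1 z"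
      by (simp_all add: cross_def grad_def)
    have e: "pd l \<Omega> * pd i z = pd i \<Omega> * pd l z" for i
      using c exhaust_3[of i] exhaust_3[of l] by (auto simp: algebra_simps)
    have gl: "dv v * pd l \<Omega> = 3 * (pd l \<Omega> * z + \<Omega> * pd l z)"
      using gk[of l] unfolding z0(2) z3[symmetric] by (simp add: algebra_simps)
    have "pd l \<Omega> * dv u = dv v * pd l \<Omega> - 3 * (pd l \<Omega> * z)
        - (X 1 * (pd l \<Omega> * pd 1 z) + X 2 * (pd l \<Omega> * pd 2 z) + X 3 * (pd l \<Omega> * pd 3 z))"
      by (simp add: dv_def u_def algebra_simps)
    also have "X 1 * (pd l \<Omega> * pd 1 z) + X 2 * (pd l \<Omega> * pd 2 z) + X 3 * (pd l \<Omega> * pd 3 z)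
        = (X 1 * pd 1 \<Omega> + X 2 * pd 2 \<Omega> + X 3 * pd 3 \<Omega>) * pd l z"
      unfolding e by (simp add: algebra_simps)
    finally show ?thesis unfolding gl eu by (simp add: algebra_simps)
  qed
  then have "dv u = 0" using l by simp
  then obtain a where "\<forall>i. u i = cross (grad \<Omega>) (grad a) i"
    using irreducible_cubic(1)[OF h irr] u0 unfolding div_free_hamiltonian_def by blast
  then have "\<forall>i. v i = z * X i + cross (grad \<Omega>) (grad a) i" by (simp add: u_def algebra_simps)
  then show "\<exists>z\<in>poisson_center (biv (grad \<Omega>)). \<exists>a. \<forall>i. v i = z * X i + cross (grad \<Omega>) (grad a) i"
    using z by blast
qed

lemma decomposes_deg0_scalar:
  assumes h: "\<And>i. homog 2 (P i)" and "decomposes P"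
  shows "deg0_scalar P"
  unfolding deg0_scalar_def
proof (intro allI impI)
  fix v assume v: "\<forall>i. homog 1 (v i)" "\<forall>k. lie v P k = 0"
  then obtain z a where za: "\<forall>i. v i = z * X i + cross P (grad a) i"
    using assms(2) unfolding decomposes_def by blast
  have "v i = cst (Poly_Mapping.lookup (hcomp 0 z) 0) * X i" for i
  proof -
    have "v i = hcomp 1 (v i)" by (simp add: hcomp_homog[OF v(1)[rule_format]])
    also have "\<dots> = hcomp 1 (X i * z) + hcomp 1 (cross P (grad a) i)"
      using za by (simp add: mult.commute)
    also have "hcomp 1 (cross P (grad a) i) = 0"
      unfolding cross_def grad_def
      by (simp add: hcomp_mult[OF h] homog_neg[OF homog_hcomp[of "-1"]])
    also have "hcomp 1 (X i * z) = X i * hcomp 0 z"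
      using hcomp_mult[OF homog_X[of i], of 1 z] by simp
    also have "hcomp 0 z = cst (Poly_Mapping.lookup (hcomp 0 z) 0)"
      using homog_0_cst[OF homog_hcomp] .
    finally show ?thesis by (simp add: mult.commute)
  qed
  then show "\<exists>c. \<forall>i. v i = cst c * X i" by blast
qed

section \<open>Rigidity forces an irreducible potential\<close>

text \<open>The linear field \<open>cross (grad A) (grad B)\<close> annihilates both factors, so
  rigidity makes the gradients parallel. Then, for every constant vector e, \<open>A\<close> times
  the cross product of \<open>grad A\<close> with e is linear, divergence free and annihilates
  \<open>A * B\<close>; its vanishing for all e forces \<open>grad A = 0\<close>.\<close>

lemma not_rigid_product:
  fixes P :: "3 \<Rightarrow> 'k::field_char_0 poly3"
  assumes "pot P = A * B" "homog 1 A" "homog 2 B" "A \<noteq> 0"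
  shows "\<not> rigid P"
proof
  assume r: "rigid P"
  have hA: "homog 0 (pd i A)" and hB: "homog 1 (pd i B)" for i
    using homog_pd[OF assms(2), of i] homog_pd[OF assms(3), of i] by simp_all
  have hAB: "homog 1 (pd i A * pd j B)" for i j using homog_mult[OF hA hB, of i j] by simp
  have "cross (grad A) (grad B) i = 0" for i
  proof -
    have "\<forall>i. homog 1 (cross (grad A) (grad B) i)"
      unfolding cross_def grad_def by (auto intro!: homog_diff hAB)
    moreover have "dv (cross (grad A) (grad B)) = 0" by (rule vf_grad_self(2))
    moreover have "vf (cross (grad A) (grad B)) (pot P) = 0"
      unfolding assms(1) by (simp add: vec_defs algebra_simps)
    ultimately show ?thesis using r unfolding rigid_def by blast
  qed
  from this[of 1] this[of 2] this[of 3]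
  have c: "pd 2 A * pd 3 B = pd 3 A * pd 2 B" "pd 3 A * pd 1 B = pd 1 A * pd 3 B" "pd 1 A * pd 2 B = pd 2 A * pd 1 B"
    by (simp_all add: cross_def grad_def)
  define a where "a i = Poly_Mapping.lookup (pd i A) 0" for i
  have a: "pd i A = cst (a i)" for i unfolding a_def by (rule homog_0_cst[OF hA])
  have z: "cross (grad A) (\<lambda>j. cst (e j)) i = 0" for e i
  proof -
    let ?v = "\<lambda>i. A * cross (grad A) (\<lambda>j. cst (e j)) i"
    have "homog (1 + 0) (A * (pd i A * cst (e j)))" for i j
      unfolding a by (rule homog_mult[OF assms(2)]) (simp flip: cst_simps(6))
    then have "\<forall>i. homog 1 (?v i)"
      unfolding cross_def grad_def by (auto simp: right_diff_distrib intro!: homog_diff)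
    moreover have "dv ?v = 0"
      unfolding dv_def cross_def grad_def by (simp add: a algebra_simps)
    moreover have "vf ?v (A * B) = 0"
      using c unfolding vf_def cross_def grad_def pd_mult by (simp add: a) algebra
    ultimately have "?v i = 0"
      by (rule r[unfolded rigid_def assms(1), THEN spec, THEN mp, THEN mp, THEN mp, THEN spec])
    then show ?thesis using assms(4) by simp
  qed
  have "pd i A = 0" for i
    using z[of "vec3 1 0 0" 2] z[of "vec3 1 0 0" 3] z[of "vec3 0 1 0" 3] exhaust_3[of i]
    by (auto simp: cross_def grad_def)
  then show False using pd_homog_zero[OF assms(2)] assms(4) by simp
qed

lemma wle_0_cst: "wle (\<lambda>_. 1) 0 p \<Longrightarrow> \<exists>c. p = cst c"
proof -
  assume w: "wle (\<lambda>_. 1) 0 p"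
  have "homog 0 p"
    unfolding homog_def
  proof
    fix m assume "m \<in> Poly_Mapping.keys p"
    then have "wdeg (\<lambda>_. 1) m \<le> 0" using w by (simp add: wle_lookup)
    moreover have "wdeg (\<lambda>_. 1) m = int (mon_deg m)" by (simp add: wdeg_def mon_deg_def)
    ultimately show "int (mon_deg m) = 0" by simp
  qed
  then show ?thesis using homog_0_cst by blast
qed

lemma rigid_irreducible:
  fixes P :: "3 \<Rightarrow> 'k::field_char_0 poly3"
  assumes h: "\<And>i. homog 2 (P i)" and r: "rigid P"
  shows "irreducible (pot P)"
  unfolding irreducible_def
proof (intro conjI allI impI)
  have h3: "homog 3 (pot P)" using homog_pot[of P] h by blast
  show nz: "pot P \<noteq> 0"
  proof
    assume z: "pot P = 0"
    \<comment> \<open>For the zero potential any divergence-free linear field violates rigidity,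
      here the shear with first entry \<open>X 2\<close>.\<close>
    have "\<forall>i. homog 1 (vec3 (X 2) 0 0 i)" by (simp add: vec3_def)
    moreover have "dv (vec3 (X 2) 0 0) = 0" by (simp add: dv_def)
    moreover have "vf (vec3 (X 2) 0 0) (pot P) = 0" by (simp add: z vf_def)
    ultimately have "vec3 (X 2) 0 0 1 = (0 :: 'k poly3)" using r unfolding rigid_def by blast
    then show False by simp
  qed
  show "\<not> pot P dvd 1" using homog_not_unit[OF h3] by simp
  fix a b assume ab: "pot P = a * b"
  then have "a \<noteq> 0" "b \<noteq> 0" using nz by auto
  \<comment> \<open>A factorization into arbitrary polynomials is replaced by that of the top forms,
    whose product is already the homogeneous \<open>pot P\<close>.\<close>
  obtain i where i: "wle (\<lambda>_. 1) i a" "hcomp i a \<noteq> 0" using wle_top[OF \<open>a \<noteq> 0\<close>] .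
  obtain j where j: "wle (\<lambda>_. 1) j b" "hcomp j b \<noteq> 0" using wle_top[OF \<open>b \<noteq> 0\<close>] .
  have t: "hcomp (i + j) (pot P) = hcomp i a * hcomp j b" unfolding ab by (rule wcomp_mult_top[OF i(1) j(1)])
  then have "hcomp (i + j) (pot P) \<noteq> 0" using i(2) j(2) by simp
  then have ij: "i + j = 3" using hcomp_homog[OF h3] by (auto split: if_splits)
  have P: "pot P = hcomp i a * hcomp j b" using t unfolding ij by (simp add: hcomp_homog[OF h3])
  have "i \<ge> 0" "j \<ge> 0" using homog_neg[OF homog_hcomp] i(2) j(2) by (metis not_less)+
  then consider "i = 0" | "j = 0" | "i = 1" "j = 2" | "i = 2" "j = 1" using ij by linarith
  then show "a dvd 1 \<or> b dvd 1"
  proof cases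
    case 1
    then obtain c where c: "a = cst c" using wle_0_cst i(1) by blast
    then have "1 = a * cst (inverse c)" using \<open>a \<noteq> 0\<close> cst_inverse(1)[of c] by auto
    then show ?thesis by (metis dvdI)
  next
    case 2
    then obtain c where c: "b = cst c" using wle_0_cst j(1) by blast
    then have "1 = b * cst (inverse c)" using \<open>b \<noteq> 0\<close> cst_inverse(1)[of c] by auto
    then show ?thesis by (metis dvdI)
  next
    case 3
    then show ?thesis using not_rigid_product[OF P] i(2) homog_hcomp r by blast
  next
    case 4
    have "pot P = hcomp j b * hcomp i a" using P by (simp add: mult.commute)
    then show ?thesis using not_rigid_product[of P "hcomp j b" "hcomp i a"] 4 j(2) homog_hcomp r by blast
  qed
qed

lemma rigid_grad:
  fixes P :: "3 \<Rightarrow> 'k::field_char_0 poly3"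
  assumes h: "\<And>i. homog 2 (P i)" and j: "dot P (curl P) = 0" and r: "rigid P"
  shows "P = grad (pot P)"
  using pot_unimodular[of P, OF h] rigid_curl[of P, OF h j r] by (simp add: grad_def fun_eq_iff)

lemma rigid_iff_decomposes:
  fixes P :: "3 \<Rightarrow> 'k::{alg_closed_field, field_char_0} poly3"
  assumes h: "\<And>i. homog 2 (P i)" and j: "dot P (curl P) = 0"
  shows "rigid P \<longleftrightarrow> decomposes P"
proof
  assume r: "rigid P"
  show "decomposes P"
    using decomposes_irreducible[OF homog_pot[of P, OF h] rigid_irreducible[OF h r]]
    unfolding rigid_grad[OF h j r, symmetric] .
next
  assume "decomposes P"
  then show "rigid P" using decomposes_deg0_scalar[of P] deg0_scalar_iff_rigid[of P] h j by blast
qed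

lemma rigid_iff_unimodular:
  fixes P :: "3 \<Rightarrow> 'k::{alg_closed_field, field_char_0} poly3"
  assumes h: "\<And>i. homog 2 (P i)" and j: "dot P (curl P) = 0"
  shows "rigid P \<longleftrightarrow> unimodular (biv P) \<and> (\<exists>\<Omega>. is_potential (biv P) \<Omega> \<and> irreducible \<Omega>)"
proof
  assume r: "rigid P"
  have "is_potential (biv P) (pot P)"
    using pot_unimodular[of P, OF h rigid_curl[OF h j r]] homog_pot[of P, OF h]
    by (simp add: is_potential_def biv_expand)
  then show "unimodular (biv P) \<and> (\<exists>\<Omega>. is_potential (biv P) \<Omega> \<and> irreducible \<Omega>)"
    using rigid_irreducible[OF h r] rigid_curl[OF h j r] by (auto simp: unimodular_biv)
next
  assume "unimodular (biv P) \<and> (\<exists>\<Omega>. is_potential (biv P) \<Omega> \<and> irreducible \<Omega>)"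
  then obtain \<Omega> where O: "is_potential (biv P) \<Omega>" "irreducible \<Omega>" by blast
  have "P = grad \<Omega>"
    using O(1) by (simp add: is_potential_def biv_expand grad_def fun_eq_3)
  moreover have "homog 3 \<Omega>" using O(1) by (simp add: is_potential_def)
  ultimately have "decomposes P" using decomposes_irreducible O(2) by blast
  then show "rigid P" using rigid_iff_decomposes[of P] h j by blast
qed

lemma decomposition_form:
  "vf v = (\<lambda>f. z * euler f + hamiltonian (biv P) a f) \<longleftrightarrow> (\<forall>i. v i = z * X i + cross P (grad a) i)"
proof -
  have "(\<lambda>f. z * euler f + hamiltonian (biv P) a f) = vf (\<lambda>i. z * X i + cross P (grad a) i)"
    by (simp add: fun_eq_iff hamiltonian_def hamiltonian_biv euler_eq_vf vf_def algebra_simps)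
  then show ?thesis by (simp add: vf_eq_iff)
qed

text \<open>Apply both decompositions to \<Omega>: Hamiltonian fields annihilate it and the Euler
  field multiplies it by 3.\<close>

lemma decomposition_unique:
  fixes \<Omega> :: "'k::field_char_0 poly3"
  assumes h: "homog 3 \<Omega>" and "\<Omega> \<noteq> 0"
    and "\<forall>i. v i = z * X i + cross (grad \<Omega>) (grad a) i" "\<forall>i. v i = z' * X i + cross (grad \<Omega>) (grad a') i"
  shows "z = z' \<and> a - a' \<in> poisson_center (biv (grad \<Omega>))"
proof -
  have eu: "X 1 * pd 1 \<Omega> + X 2 * pd 2 \<Omega> + X 3 * pd 3 \<Omega> = 3 * \<Omega>" using euler_homog[OF h] by simp
  have v: "vf v \<Omega> = z * (3 * \<Omega>)" if "\<forall>i. v i = z * X i + cross (grad \<Omega>) (grad a) i" for z a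
    using that unfolding eu[symmetric] by (simp add: vec_defs algebra_simps)
  have zz: "z = z'" using v[OF assms(3)] v[OF assms(4)] assms(2) by simp
  have "cross (grad \<Omega>) (grad (a - a')) i = cross (grad \<Omega>) (grad a) i - cross (grad \<Omega>) (grad a') i" for i
    by (simp add: cross_def grad_def algebra_simps)
  also have "\<dots> i = 0" for i
    using assms(3,4) zz by (metis add_left_cancel eq_iff_diff_eq_0)
  finally show ?thesis using zz by (simp add: poisson_center_biv)
qed

lemma poisson_derivation_iff_vf:
  "(\<forall>\<phi>. poisson_derivation (biv P) \<phi> \<longrightarrow> Q \<phi>) \<longleftrightarrow> (\<forall>v. (\<forall>k. lie v P k = 0) \<longrightarrow> Q (vf v))"
proof -
  have "\<exists>v. \<phi> = vf v" if "derivation \<phi>" for \<phi> :: "'a poly3 \<Rightarrow> 'a poly3"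
    using derivation_eq_vf[OF that] by blast
  then show ?thesis
    by (metis poisson_derivation_def poisson_derivation_vf)
qed

lemma rigid_iff_decomposition:
  fixes P :: "3 \<Rightarrow> 'k::{alg_closed_field, field_char_0} poly3"
  assumes h: "\<And>i. homog 2 (P i)" and j: "dot P (curl P) = 0"
  shows "rigid P \<longleftrightarrow>
        (\<forall>\<phi>. poisson_derivation (biv P) \<phi> \<longrightarrow>
          (\<exists>z\<in>poisson_center (biv P). \<exists>a. \<phi> = (\<lambda>f. z * euler f + hamiltonian (biv P) a f)) \<and>
          (\<forall>z\<in>poisson_center (biv P). \<forall>z'\<in>poisson_center (biv P). \<forall>a a'.
             \<phi> = (\<lambda>f. z * euler f + hamiltonian (biv P) a f) \<longrightarrow>
             \<phi> = (\<lambda>f. z' * euler f + hamiltonian (biv P) a' f) \<longrightarrow>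
             z = z' \<and> a - a' \<in> poisson_center (biv P)))"
    (is "_ \<longleftrightarrow> ?R")
proof
  assume r: "rigid P"
  have nz: "pot P \<noteq> 0" using rigid_irreducible[OF h r] by (auto simp: irreducible_def)
  have d: "decomposes P" using rigid_iff_decomposes[of P, OF h j] r by blast
  show ?R
    unfolding poisson_derivation_iff_vf decomposition_form
    using d decomposition_unique[OF homog_pot[of P, OF h] nz] rigid_grad[OF h j r]
    unfolding decomposes_def by metis
next
  assume ?R
  then have "decomposes P"
    unfolding poisson_derivation_iff_vf decomposition_form decomposes_def by blast
  then show "rigid P" using rigid_iff_decomposes[of P, OF h j] by blast
qed

text \<open>Applied to the central \<open>pot P\<close>, an ozone derivation shows that the
  coefficient of the Euler field is 0. The assumption \<open>nz\<close> is essential: for the zero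
  bracket 0 is the only ozone derivation, yet rigidity fails.\<close>

lemma rigid_iff_ozone:
  fixes P :: "3 \<Rightarrow> 'k::{alg_closed_field, field_char_0} poly3"
  assumes h: "\<And>i. homog 2 (P i)" and j: "dot P (curl P) = 0" and nz: "biv P \<noteq> (\<lambda>a b. 0)"
  shows "rigid P \<longleftrightarrow> (\<forall>\<phi>. ozone_derivation (biv P) \<phi> \<longrightarrow> (\<exists>a. \<phi> = hamiltonian (biv P) a))"
proof
  assume oz: "\<forall>\<phi>. ozone_derivation (biv P) \<phi> \<longrightarrow> (\<exists>a. \<phi> = hamiltonian (biv P) a)"
  obtain l where "P l \<noteq> 0" using nz biv_eq_0_iff[of P] by (auto simp: fun_eq_iff)
  then show "rigid P" using ozone_rigid[of P l] h j oz by blast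
next
  assume r: "rigid P"
  have irr: "irreducible (pot P)" using rigid_irreducible[OF h r] .
  have P: "P = grad (pot P)" by (rule rigid_grad[OF h j r])
  have cen: "pot P \<in> poisson_center (biv P)" using power_in_center[of "pot P" 1] P by simp
  show "\<forall>\<phi>. ozone_derivation (biv P) \<phi> \<longrightarrow> (\<exists>a. \<phi> = hamiltonian (biv P) a)"
  proof (intro allI impI)
    fix \<phi> assume oz: "ozone_derivation (biv P) \<phi>"
    then obtain z a where za: "z \<in> poisson_center (biv P)" "\<phi> = (\<lambda>f. z * euler f + hamiltonian (biv P) a f)"
      using rigid_iff_decomposition[of P, OF h j] r unfolding ozone_derivation_def by blast
    have "\<phi> (pot P) = 0" using oz cen by (simp add: ozone_derivation_def)
    moreover have "hamiltonian (biv P) a (pot P) = 0"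
      using cen biderivation_skew[OF biderivation_biv, of P a "pot P"]
      by (simp add: hamiltonian_def poisson_center_def)
    moreover have "euler (pot P) = 3 * pot P" using euler_of_homog[OF homog_pot[of P, OF h]] by simp
    ultimately have "z = 0" using za(2) irr by (auto simp: irreducible_def)
    then show "\<exists>a. \<phi> = hamiltonian (biv P) a" using za(2) by auto
  qed
qed

section \<open>Isomorphisms of quadratic brackets\<close>

lemma hcomp_times:
  "hcomp n (p * q) = (\<Sum>i\<in>{0..n}. hcomp i p * hcomp (n - i) q)"
proof -
  define D where "D = wdeg (\<lambda>_. 1) ` Poly_Mapping.keys p \<union> {0..n}"
  have f: "finite D" by (simp add: D_def)
  have "p = (\<Sum>i\<in>D. hcomp i p)" by (rule wcomp_expand) (auto simp: D_def)
  then have "hcomp n (p * q) = hcomp n ((\<Sum>i\<in>D. hcomp i p) * q)" by simp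
  also have "\<dots> = (\<Sum>i\<in>D. hcomp i p * hcomp (n - i) q)"
    by (simp add: sum_distrib_right wcomp_sum hcomp_mult[OF homog_hcomp])
  also have "\<dots> = (\<Sum>i\<in>{0..n}. hcomp i p * hcomp (n - i) q)"
  proof (rule sum.mono_neutral_right[OF f])
    show "\<forall>i\<in>D - {0..n}. hcomp i p * hcomp (n - i) q = 0"
    proof
      fix i assume "i \<in> D - {0..n}"
      then have "i < 0 \<or> n - i < 0" by auto
      then show "hcomp i p * hcomp (n - i) q = 0" using homog_neg[OF homog_hcomp] by (metis mult_eq_0_iff)
    qed
  qed (simp add: D_def)
  finally show ?thesis .
qed

lemma hcomp_times_low:
  "hcomp 0 (p * q) = hcomp 0 p * hcomp 0 q"
  "hcomp 1 (p * q) = hcomp 0 p * hcomp 1 q + hcomp 1 p * hcomp 0 q"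
  "hcomp 2 (p * q) = hcomp 0 p * hcomp 2 q + hcomp 1 p * hcomp 1 q + hcomp 2 p * hcomp 0 q"
proof -
  have "{0..1::int} = {0, 1}" "{0..2::int} = {0, 1, 2}" by auto
  then show "hcomp 0 (p * q) = hcomp 0 p * hcomp 0 q"
    "hcomp 1 (p * q) = hcomp 0 p * hcomp 1 q + hcomp 1 p * hcomp 0 q"
    "hcomp 2 (p * q) = hcomp 0 p * hcomp 2 q + hcomp 1 p * hcomp 1 q + hcomp 2 p * hcomp 0 q"
    by (simp_all add: hcomp_times add.assoc)
qed

lemma hcomp_X: "hcomp n (X i) = (if n = 1 then X i else 0)"
  by (simp add: hcomp_homog)

lemma linear_form: "homog 1 p \<Longrightarrow> \<exists>a. p = cst (a 1) * X 1 + cst (a 2) * X 2 + cst (a (3::3)) * X 3"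
proof -
  assume h: "homog 1 p"
  define a where "a i = Poly_Mapping.lookup (pd i p) 0" for i
  have "homog (1 - 1) (pd i p)" for i by (rule homog_pd[OF h])
  then have "pd i p = cst (a i)" for i unfolding a_def by (intro homog_0_cst) simp
  then show ?thesis using euler_homog[OF h] by (intro exI[of _ a]) (simp add: mult.commute)
qed

lemma linear_form_eq_iff:
  "cst a * X 1 + cst b * X 2 + cst c * X 3 = cst a' * X 1 + cst b' * X 2 + cst c' * X 3 \<longleftrightarrow> a = a' \<and> b = b' \<and> c = c'"
proof
  assume e: "cst a * X 1 + cst b * X 2 + cst c * X 3 = cst a' * X 1 + cst b' * X 2 + cst c' * X 3"
  have "pd i (cst a * X 1 + cst b * X 2 + cst c * X 3) = pd i (cst a' * X 1 + cst b' * X 2 + cst c' * X 3)" for i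
    using e by simp
  from this[of 1] this[of 2] this[of 3] show "a = a' \<and> b = b' \<and> c = c'" by simp
qed simp

lemma det3_mult:
  "det3 (\<lambda>i j. M i 1 * N 1 j + M i 2 * N 2 j + M i 3 * N 3 j) = det3 M * det3 N"
  by (simp add: det3_def algebra_simps)

lemma poisson_isomorphic_sym:
  assumes "poisson_isomorphic br br'" shows "poisson_isomorphic br' br"
proof -
  obtain f where f: "bij f" "Vector_Spaces.linear smult3 smult3 f" "f 1 = 1" "\<forall>a b. f (a * b) = f a * f b"
    "\<forall>a b. f (br a b) = br' (f a) (f b)" using assms unfolding poisson_isomorphic_def by blast
  let ?g = "inv f"
  have fg: "f (?g a) = a" "?g (f a) = a" for a
    using f(1) by (simp_all add: bij_is_surj surj_f_inv_f bij_is_inj)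
  have "?g (a + b) = ?g a + ?g b" "?g (cst c * a) = cst c * ?g a" "?g (a * b) = ?g a * ?g b"
    "?g (br' a b) = br (?g a) (?g b)" for a b c
    using f(2,4,5) fg unfolding linear_smult3_iff by metis+
  moreover have "?g 1 = 1" using f(3) fg by metis
  moreover have "bij ?g" using f(1) by (rule bij_imp_bij_inv)
  ultimately show ?thesis unfolding poisson_isomorphic_def linear_smult3_iff by (intro exI[of _ ?g]) blast
qed

lemma iso_alg_hom:
  assumes "Vector_Spaces.linear smult3 smult3 f" "f 1 = 1" "\<forall>a b. f (a * b) = f a * f b"
  shows "alg_hom f"
  unfolding alg_hom_def
proof (intro conjI allI)
  show "f (cst c) = cst c" for c
    using assms unfolding linear_smult3_iff by (metis mult.right_neutral)
qed (use assms in \<open>auto simp: linear_smult3_iff\<close>)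

lemma unimodular_linear_iso:
  assumes fg: "lin_auto f g" and br: "\<And>a b. f (biv P a b) = biv P' (f a) (f b)" and u: "unimodular (biv P')"
  shows "unimodular (biv P)"
proof -
  have "divergence (hamiltonian (biv P) a) = 0" for a
  proof -
    have "0 = divergence (hamiltonian (biv P') (f a))" using u by (simp add: unimodular_def modular_derivation_def)
    also have "\<dots> = dv (\<lambda>i. f (vf (cross P (grad a)) (g (X i))))"
      by (simp add: divergence_dv hamiltonian_def hamiltonian_biv[symmetric] br lin_auto_inverse[OF fg] del: vf_X)
    also have "\<dots> = f (dv (cross P (grad a)))" by (rule lin_auto_dv[OF fg])
    also have "dv (cross P (grad a)) = divergence (hamiltonian (biv P) a)"
      by (simp add: divergence_dv hamiltonian_def hamiltonian_biv)
    finally show ?thesis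
      using fg lin_auto_inverse(2)[OF fg] alg_hom_0[of g] unfolding lin_auto_def by metis
  qed
  then show ?thesis by (simp add: unimodular_def modular_derivation_def)
qed

lemma biv_hom_extend:
  assumes h: "alg_hom f" and X: "\<And>i j. f (biv P (X i) (X j)) = biv P' (f (X i)) (f (X j))"
  shows "f (biv P a b) = biv P' (f a) (f b)"
proof -
  have l: "derivation (biv P u)" "derivation (\<lambda>a. biv P a u)" "derivation (biv P' u)" "derivation (\<lambda>a. biv P' a u)" for u
    using biderivation_biv[of P] biderivation_biv[of P'] by (auto simp: biderivation_def)
  have 1: "f (biv P a (X j)) = biv P' (f a) (f (X j))" for a j
    by (induction a rule: poly3_induct)
      (simp_all add: alg_hom_simps[OF h] X derivation_cst[OF l(2)] derivation_cst[OF l(4)]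
        derivation_add[OF l(2)] derivation_add[OF l(4)] derivation_mult[OF l(2)] derivation_mult[OF l(4)])
  show ?thesis
    by (induction b rule: poly3_induct)
      (simp_all add: alg_hom_simps[OF h] 1 derivation_cst[OF l(1)] derivation_cst[OF l(3)]
        derivation_add[OF l(1)] derivation_add[OF l(3)] derivation_mult[OF l(1)] derivation_mult[OF l(3)])
qed

text \<open>The linear part of an isomorphism \<open>f\<close> of quadratic brackets is again an isomorphism: comparing
  components of degree one in \<open>f {x\<^sub>i, x\<^sub>j} = {f x\<^sub>i, f x\<^sub>j}\<close> kills the contribution of the
  constant terms \<open>c\<close> of \<open>f\<close> to the components of degree two.\<close>

lemma unimodular_isomorphic:
  fixes P P' :: "3 \<Rightarrow> 'k::field_char_0 poly3"
  assumes h: "\<And>i. homog 2 (P i)" and h': "\<And>i. homog 2 (P' i)"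
    and iso: "poisson_isomorphic (biv P) (biv P')" and u: "unimodular (biv P')"
  shows "unimodular (biv P)"
proof -
  obtain f where f: "bij f" "Vector_Spaces.linear smult3 smult3 f" "f 1 = 1" "\<forall>a b. f (a * b) = f a * f b"
    "\<forall>a b. f (biv P a b) = biv P' (f a) (f b)" using iso unfolding poisson_isomorphic_def by blast
  have fh: "alg_hom f" using iso_alg_hom f by blast
  define l where "l i = hcomp 1 (f (X i))" for i
  define c where "c i = Poly_Mapping.lookup (hcomp 0 (f (X i))) 0" for i
  have c: "hcomp 0 (f (X i)) = cst (c i)" for i unfolding c_def by (rule homog_0_cst[OF homog_hcomp])
  \<comment> \<open>Modulo degree 2, the image of \<open>f\<close> is spanned by constants and the
    linear parts \<open>l i\<close>.\<close>
  have low: "\<exists>e. \<exists>d :: 3 \<Rightarrow> 'k. hcomp 0 (f p) = cst e \<and> hcomp 1 (f p) = cst (d 1) * l 1 + cst (d 2) * l 2 + cst (d 3) * l 3" for p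
  proof (induction p rule: poly3_induct)
    case (const b)
    show ?case by (intro exI[of _ b] exI[of _ "\<lambda>_. 0"]) (simp add: alg_hom_simps[OF fh] hcomp_homog[OF homog_simps(3)])
  next
    case (var i)
    show ?case using c exhaust_3[of i]
      by (intro exI[of _ "c i"] exI[of _ "\<lambda>j. if j = i then 1 else 0"]) (auto simp: l_def)
  next
    case (add p q)
    then obtain e and d :: "3 \<Rightarrow> 'k" and e' and d' :: "3 \<Rightarrow> 'k" where "hcomp 0 (f p) = cst e" "hcomp 1 (f p) = cst (d 1) * l 1 + cst (d 2) * l 2 + cst (d 3) * l 3"
      "hcomp 0 (f q) = cst e'" "hcomp 1 (f q) = cst (d' 1) * l 1 + cst (d' 2) * l 2 + cst (d' (3::3)) * l 3" by blast
    then show ?case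
      by (intro exI[of _ "e + e'"] exI[of _ "\<lambda>j. d j + d' j"]) (simp add: alg_hom_simps[OF fh] algebra_simps)
  next
    case (mult p q)
    then obtain e and d :: "3 \<Rightarrow> 'k" and e' and d' :: "3 \<Rightarrow> 'k" where "hcomp 0 (f p) = cst e" "hcomp 1 (f p) = cst (d 1) * l 1 + cst (d 2) * l 2 + cst (d 3) * l 3"
      "hcomp 0 (f q) = cst e'" "hcomp 1 (f q) = cst (d' 1) * l 1 + cst (d' 2) * l 2 + cst (d' (3::3)) * l 3" by blast
    then show ?case
      by (intro exI[of _ "e * e'"] exI[of _ "\<lambda>j. e * d' j + e' * d j"]) (simp add: alg_hom_simps[OF fh] hcomp_times_low algebra_simps)
  qed
  have hl: "homog 1 (l i)" for i by (simp add: l_def)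
  then have "\<forall>i. \<exists>a :: 3 \<Rightarrow> 'k. l i = cst (a 1) * X 1 + cst (a 2) * X 2 + cst (a 3) * X 3"
    using linear_form by blast
  then obtain M' where M': "\<And>i. l i = cst (M' i 1) * X 1 + cst (M' i 2) * X 2 + cst (M' i (3::3)) * X 3"
    by metis
  define M where "M i j = M' j i" for i j
  have M: "l j = cst (M 1 j) * X 1 + cst (M 2 j) * X 2 + cst (M 3 j) * X 3" for j using M' by (simp add: M_def)
  \<comment> \<open>Surjectivity of \<open>f\<close>: the variables are images, so the
    \<open>l i\<close> span the linear forms and \<open>M\<close> is invertible.\<close>
  have "\<exists>d :: 3 \<Rightarrow> 'k. X j = cst (d 1) * l 1 + cst (d 2) * l 2 + cst (d 3) * l 3" for j
  proof -
    obtain p where "f p = X j" using f(1) by (metis bij_pointE)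
    then show ?thesis using low[of p] by (auto simp: hcomp_X)
  qed
  then obtain N' where N': "\<And>j. X j = cst (N' j 1) * l 1 + cst (N' j 2) * l 2 + cst (N' j (3::3)) * l 3" by metis
  define N where "N i j = N' j i" for i j
  have MN: "M i 1 * N 1 j + M i 2 * N 2 j + M i 3 * N 3 j = (if i = j then 1 else 0)" for i j
  proof -
    have e1: "X j = cst (M 1 1 * N 1 j + M 1 2 * N 2 j + M 1 3 * N 3 j) * X 1 + cst (M 2 1 * N 1 j + M 2 2 * N 2 j + M 2 3 * N 3 j) * X 2
      + cst (M 3 1 * N 1 j + M 3 2 * N 2 j + M 3 3 * N 3 j) * X 3"
      by (subst N') (simp add: N_def M algebra_simps)
    have e2: "X j = cst (if 1 = j then 1 else 0) * X 1 + cst (if 2 = j then 1 else 0) * X 2 + cst (if 3 = j then 1 else 0) * X 3"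
      using exhaust_3[of j] by auto
    show ?thesis
      using e1[unfolded e2] exhaust_3[of i] unfolding linear_form_eq_iff by auto
  qed
  have "det3 M * det3 N = 1" unfolding det3_mult[symmetric] MN by (simp add: det3_def)
  then have d: "det3 M \<noteq> 0" by auto
  obtain g where fg: "lin_auto (lin_subst M) g" using lin_auto_subst[OF d] by blast
  let ?f = "lin_subst M"
  have lh: "alg_hom ?f" using fg by (simp add: lin_auto_def)
  have lX: "?f (X i) = l i" for i by (simp add: lin_subst_def M)
  have indep: "s 1 = 0 \<and> s 2 = 0 \<and> s 3 = 0" if "cst (s 1) * l 1 + cst (s 2) * l 2 + cst (s (3::3)) * l 3 = 0" for s
  proof -
    have "?f (cst (s 1) * X 1 + cst (s 2) * X 2 + cst (s 3) * X 3) = ?f 0"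
      using that by (simp add: alg_hom_simps[OF lh] lX)
    then have "cst (s 1) * X 1 + cst (s 2) * X 2 + cst (s 3) * X 3 = 0" using lin_auto_inverse(2)[OF fg] by metis
    then show ?thesis using linear_form_eq_iff[of "s 1" "s 2" "s 3" 0 0 0] by simp
  qed
  have hcb: "hcomp 1 (biv P' p q) = 0" "hcomp 2 (biv P' p q) = biv P' (hcomp 1 p) (hcomp 1 q)" for p q
    by (simp_all add: biv_expand hcomp_mult[OF h'] homog_neg[OF homog_hcomp[of "-1"]] hcomp_times_low(1) hcomp_pd)
  have quad: "?f (P k) = hcomp 2 (f (P k))" if z: "hcomp 1 (f (P k)) = 0" for k
  proof -
    have h1: "homog 1 (pd i (P k))" for i using homog_pd[OF h, of i k] by simp
    have h0: "homog 0 (pd j (pd i (P k)))" for i j using homog_pd[OF h1, of j i] by simp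
    define s where "s i j = Poly_Mapping.lookup (pd j (pd i (P k))) 0" for i j
    have s: "pd j (pd i (P k)) = cst (s i j)" for i j unfolding s_def by (rule homog_0_cst[OF h0])
    have sym: "s i j = s j i" for i j unfolding s_def by (simp add: pd_commute)
    have e: "2 * P k = X 1 * pd 1 (P k) + X 2 * pd 2 (P k) + X 3 * pd 3 (P k)" using euler_homog[OF h] by simp
    have ei: "pd i (P k) = cst (s i 1) * X 1 + cst (s i 2) * X 2 + cst (s i 3) * X 3" for i
      using euler_homog[OF h1[of i]] unfolding s by (simp add: mult.commute)
    have P2: "2 * P k = X 1 * (cst (s 1 1) * X 1 + cst (s 1 2) * X 2 + cst (s 1 3) * X 3)
      + X 2 * (cst (s 1 2) * X 1 + cst (s 2 2) * X 2 + cst (s 2 3) * X 3)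
      + X 3 * (cst (s 1 3) * X 1 + cst (s 2 3) * X 2 + cst (s 3 3) * X 3)"
      unfolding e ei by (simp only: sym[of 2 1] sym[of 3 1] sym[of 3 2])
    let ?u = "\<lambda>i. f (X i)"
    have f2: "2 * f (P k) = ?u 1 * (cst (s 1 1) * ?u 1 + cst (s 1 2) * ?u 2 + cst (s 1 3) * ?u 3)
      + ?u 2 * (cst (s 1 2) * ?u 1 + cst (s 2 2) * ?u 2 + cst (s 2 3) * ?u 3)
      + ?u 3 * (cst (s 1 3) * ?u 1 + cst (s 2 3) * ?u 2 + cst (s 3 3) * ?u 3)"
      using arg_cong[OF P2, of f] by (simp add: alg_hom_simps[OF fh])
    have m2: "2 * ?f (P k) = l 1 * (cst (s 1 1) * l 1 + cst (s 1 2) * l 2 + cst (s 1 3) * l 3)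
      + l 2 * (cst (s 1 2) * l 1 + cst (s 2 2) * l 2 + cst (s 2 3) * l 3)
      + l 3 * (cst (s 1 3) * l 1 + cst (s 2 3) * l 2 + cst (s 3 3) * l 3)"
      using arg_cong[OF P2, of ?f] by (simp add: alg_hom_simps[OF lh] lX)
    have hc2: "hcomp n (2 * p) = 2 * hcomp n p" for n and p :: "'k poly3"
      using wcomp_cst_mult[of "\<lambda>_. 1" n 2 p] by simp
    \<comment> \<open>The matrix \<open>s\<close> of second derivatives of \<open>P k\<close>
      applied to the constant terms. The same numbers are the coefficients of the linear part of
      \<open>f (P k)\<close> and of the unwanted contribution to its quadratic part.\<close>
    let ?e = "vec3 (s 1 1 * c 1 + s 1 2 * c 2 + s 1 3 * c 3) (s 1 2 * c 1 + s 2 2 * c 2 + s 2 3 * c 3) (s 1 3 * c 1 + s 2 3 * c 2 + s 3 3 * c 3)"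
    have "2 * hcomp 1 (f (P k)) = 2 * (cst (?e 1) * l 1 + cst (?e 2) * l 2 + cst (?e 3) * l 3)"
      unfolding hc2[symmetric] f2 wcomp_add hcomp_times_low wcomp_cst_mult c l_def[symmetric] by (simp add: algebra_simps)
    then have "cst (?e 1) * l 1 + cst (?e 2) * l 2 + cst (?e 3) * l 3 = 0"
      unfolding z by (metis mult_zero_right mult_eq_0_iff zero_neq_numeral)
    then have "?e 1 = 0 \<and> ?e 2 = 0 \<and> ?e 3 = 0" by (rule indep)
    then have e': "?e 1 = 0" "?e 2 = 0" "?e 3 = 0" by blast+
    have "2 * hcomp 2 (f (P k)) = 2 * ?f (P k) + 2 * (cst (?e 1) * hcomp 2 (?u 1) + cst (?e 2) * hcomp 2 (?u 2) + cst (?e 3) * hcomp 2 (?u 3))"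
      unfolding hc2[symmetric] f2 m2 wcomp_add hcomp_times_low wcomp_cst_mult c l_def[symmetric] by (simp add: algebra_simps)
    then have "2 * hcomp 2 (f (P k)) = 2 * ?f (P k)" unfolding e' by simp
    then show ?thesis by simp
  qed
  have gen: "?f (P k) = biv P' (l i) (l j)" if "P k = biv P (X i) (X j)" for i j k
  proof -
    have e: "f (P k) = biv P' (f (X i)) (f (X j))" using f(5) that by simp
    have "?f (P k) = hcomp 2 (f (P k))" by (rule quad) (simp add: e hcb)
    then show ?thesis unfolding e hcb l_def .
  qed
  have g: "?f (P 1) = biv P' (l 2) (l 3)" "?f (P 2) = biv P' (l 3) (l 1)" "?f (P 3) = biv P' (l 1) (l 2)"
    by (rule gen; simp add: biv_expand)+
  have sk: "biv Q a b = - biv Q b a" "biv Q a a = 0" for Q :: "3 \<Rightarrow> 'k poly3" and a b by (simp_all add: biv_expand algebra_simps)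
  have PX: "biv P (X 2) (X 3) = P 1" "biv P (X 3) (X 1) = P 2" "biv P (X 1) (X 2) = P 3"
    "biv P (X 3) (X 2) = - P 1" "biv P (X 1) (X 3) = - P 2" "biv P (X 2) (X 1) = - P 3" by (simp_all add: biv_expand)
  have "?f (biv P (X i) (X j)) = biv P' (?f (X i)) (?f (X j))" for i j
    using exhaust_3[of i] exhaust_3[of j] sk(1)[of P' "l 3" "l 2"] sk(1)[of P' "l 1" "l 3"] sk(1)[of P' "l 2" "l 1"]
    by (auto simp: PX sk(2) g lX alg_hom_simps[OF lh])
  then have "?f (biv P a b) = biv P' (?f a) (?f b)" for a b by (rule biv_hom_extend[OF lh])
  then show ?thesis by (rule unimodular_linear_iso[OF fg _ u])
qed

section \<open>Graded twists\<close>

lemma graded_twist_biv: "graded_twist (biv P) (vf v) = biv (\<lambda>k. P k + cross X v k)"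
  by (simp add: fun_eq_iff graded_twist_def euler_eq_vf biv_expand vec_defs algebra_simps)

lemma poisson_isomorphic_refl: "poisson_isomorphic br br"
  unfolding poisson_isomorphic_def by (intro exI[of _ id]) (simp add: linear_smult3_iff)

text \<open>The identity for the curl of a cross product: with \<open>dv v = 0\<close> and
  \<open>v\<close> linear, the Lie bracket of \<open>v\<close> with the Euler field vanishes, and
  minus the divergence 3 of the Euler field remains as factor.\<close>

lemma curl_cross_X:
  assumes "\<And>i. homog 1 (v i)" "dv v = 0"
  shows "curl (cross X v) i = - 3 * v i"
proof -
  have e: "X 1 * pd 1 (v i) + X 2 * pd 2 (v i) + X 3 * pd 3 (v i) = v i"
    using euler_homog[OF assms(1)] by simp
  have d: "pd 1 (v 1) = - pd 2 (v 2) - pd 3 (v 3)" using assms(2) by (simp add: dv_def algebra_simps eq_neg_iff_add_eq_0)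
  have "curl (cross X v) i = - 2 * v i - (X 1 * pd 1 (v i) + X 2 * pd 2 (v i) + X 3 * pd 3 (v i))"
    using exhaust_3[of i] by (auto simp: curl_def cross_def d algebra_simps)
  then show ?thesis unfolding e by simp
qed

text \<open>A twist adds \<open>cross X v\<close> to \<open>P\<close>. One particular twist is
  always unimodular, so if all twists are isomorphic then the bracket and all its twists are
  unimodular; by \<open>curl_cross_X\<close> each divergence-free \<open>v\<close> is then
  0.\<close>

lemma rigid_iff_twists:
  fixes P :: "3 \<Rightarrow> 'k::field_char_0 poly3"
  assumes h: "\<And>i. homog 2 (P i)" and j: "dot P (curl P) = 0"
  shows "rigid P \<longleftrightarrow> (\<forall>\<delta>\<in>Gspd (biv P). poisson_isomorphic (graded_twist (biv P) \<delta>) (biv P))"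
proof
  assume r: "rigid P"
  show "\<forall>\<delta>\<in>Gspd (biv P). poisson_isomorphic (graded_twist (biv P) \<delta>) (biv P)"
  proof
    fix \<delta> assume "\<delta> \<in> Gspd (biv P)"
    then obtain v where v: "\<delta> = vf v" "\<forall>i. homog 1 (v i)" "vf v (pot P) = dv v * pot P" unfolding Gspd_biv by blast
    then obtain c where "\<forall>i. v i = cst c * X i" using rigid_Gspd[OF h r] by blast
    then have "cross X v k = 0" for k by (simp add: cross_def algebra_simps)
    then have "graded_twist (biv P) \<delta> = biv P" by (simp add: v(1) graded_twist_biv)
    then show "poisson_isomorphic (graded_twist (biv P) \<delta>) (biv P)" by (simp add: poisson_isomorphic_refl)
  qed
next
  assume t: "\<forall>\<delta>\<in>Gspd (biv P). poisson_isomorphic (graded_twist (biv P) \<delta>) (biv P)"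
  have hX: "homog 2 (cross X v i)" if "\<And>i. homog 1 (v i)" for v i
  proof -
    have "homog (1 + 1) (X i * v j)" for i j by (intro homog_mult that) simp
    then show ?thesis unfolding cross_def by (auto intro!: homog_diff)
  qed
  have tw: "poisson_isomorphic (biv (\<lambda>k. P k + cross X v k)) (biv P)" and ht: "homog 2 (P k + cross X v k)"
    if "\<forall>i. homog 1 (v i)" "dv v = 0" "vf v (pot P) = 0" for v k
  proof -
    have "vf v \<in> Gspd (biv P)" unfolding Gspd_biv using that by auto
    then show "poisson_isomorphic (biv (\<lambda>k. P k + cross X v k)) (biv P)" using t graded_twist_biv by metis
    show "homog 2 (P k + cross X v k)" using h hX that(1) by (intro homog_add) auto
  qed
  have un: "unimodular (biv P)"
  proof -
    \<comment> \<open>This choice cancels the curl term in \<open>pd_pot\<close>, so the twisted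
      vector is the gradient of \<open>pot P\<close>.\<close>
    define v where "v i = cst (1 / 3) * curl P i" for i
    have hc: "homog 1 (curl P i)" for i using h homog_curl[of 1 P] by simp
    have v: "\<forall>i. homog 1 (v i)" "dv v = 0" "vf v (pot P) = 0"
      using hc dv_curl[of P] vf_curl_pot[of P, OF h j]
      by (auto simp: v_def homog_cst_mult dv_def vf_def mult.assoc distrib_left[symmetric])
    have "P k + cross X v k = pd k (pot P)" for k
    proof -
      have "3 * cross X v k = (3 * cst (1 / 3)) * cross X (curl P) k"
        by (simp add: cross_def v_def algebra_simps)
      then have "3 * (P k + cross X v k) = 3 * pd k (pot P)"
        using pd_pot[of P k, OF h] by (simp add: third distrib_left)
      then show ?thesis unfolding mult3_eq_iff .
    qed
    then have "(\<lambda>k. P k + cross X v k) = grad (pot P)" by (simp add: fun_eq_iff grad_def)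
    then have "unimodular (biv (\<lambda>k. P k + cross X v k))" by (simp add: unimodular_biv curl_grad)
    then show ?thesis
      using unimodular_isomorphic[of P "\<lambda>k. P k + cross X v k", OF h ht[OF v] poisson_isomorphic_sym[OF tw[OF v]]] by blast
  qed
  show "rigid P"
    unfolding rigid_def
  proof (intro allI impI)
    fix v i assume v: "\<forall>i. homog 1 (v i)" "dv v = 0" "vf v (pot P) = 0"
    have "unimodular (biv (\<lambda>k. P k + cross X v k))"
      using unimodular_isomorphic[of "\<lambda>k. P k + cross X v k" P, OF ht[OF v] h tw[OF v] un] .
    then have "curl (\<lambda>k. P k + cross X v k) i = 0" by (simp add: unimodular_biv)
    moreover have "curl (\<lambda>k. P k + cross X v k) i = curl P i + curl (cross X v) i" by (simp add: curl_def algebra_simps)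
    moreover have "curl P i = 0" using un by (simp add: unimodular_biv)
    ultimately show "v i = 0" using curl_cross_X[of v i] v by simp
  qed
qed

section \<open>Dimensions of subspaces and quotients\<close>

text \<open>The finite set spans a space containing \<open>V\<close> without having to lie in
  \<open>V\<close>, so the property passes to smaller subspaces at once.\<close>

definition fin_sub :: "('k::field \<Rightarrow> 'v::ab_group_add \<Rightarrow> 'v) \<Rightarrow> 'v set \<Rightarrow> bool" where
  "fin_sub s V \<longleftrightarrow> module.subspace s V \<and> (\<exists>B. finite B \<and> V \<subseteq> module.span s B)"

context vector_space
begin

text \<open>Representatives of a basis of the quotient, joined to a basis of \<open>W\<close>, form
  a basis of \<open>V\<close>.\<close>

lemma quotient_basis_card:
  assumes W: "fin_sub scale W" and V: "subspace V" "W \<subseteq> V" and B: "quotient_basis scale V W B"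
  shows "card B + dim W = dim V"
proof -
  have fB: "finite B" and BV: "B \<subseteq> V"
    and u: "\<And>v. v \<in> V \<Longrightarrow> \<exists>!c. (\<forall>b. b \<notin> B \<longrightarrow> c b = 0) \<and> v - (\<Sum>b\<in>B. scale (c b) b) \<in> W"
    using B unfolding quotient_basis_def by blast+
  have Ws: "subspace W" using W by (simp add: fin_sub_def)
  obtain BW where BW: "BW \<subseteq> W" "independent BW" "W \<subseteq> span BW" "card BW = dim W" using basis_exists[of W] .
  have fBW: "finite BW" using W BW(1,2) independent_span_bound unfolding fin_sub_def by (meson order_trans)
  have zero: "c b = 0" if "(\<Sum>b\<in>B. scale (c b) b) \<in> W" "b \<in> B" for c b
  proof -
    define c' where "c' b = (if b \<in> B then c b else 0)" for b
    have "(\<Sum>b\<in>B. scale (c' b) b) = (\<Sum>b\<in>B. scale (c b) b)" by (simp add: c'_def)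
    then have "0 - (\<Sum>b\<in>B. scale (c' b) b) \<in> W" using that(1) subspace_neg[OF Ws] by simp
    moreover have "0 - (\<Sum>b\<in>B. scale ((\<lambda>_. 0) b) b) \<in> W" using subspace_0[OF Ws] by simp
    ultimately have "c' = (\<lambda>_. 0)" using u[OF subspace_0[OF V(1)]] by (auto simp: c'_def)
    then show ?thesis using that(2) by (metis c'_def)
  qed
  have disj: "B \<inter> BW = {}"
  proof (rule equals0I)
    fix b assume b: "b \<in> B \<inter> BW"
    have "(\<Sum>x\<in>B. scale (if x = b then 1 else 0) x) = (\<Sum>x\<in>B. if x = b then b else 0)"
      by (intro sum.cong) auto
    also have "\<dots> = b" using b fB by (simp add: sum.delta')
    finally have "(\<Sum>x\<in>B. scale (if x = b then 1 else 0) x) \<in> W" using b BW(1) by auto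
    from zero[OF this, of b] b show False by simp
  qed
  have ind: "independent (B \<union> BW)"
  proof (rule independent_if_scalars_zero)
    fix f x assume s: "(\<Sum>x\<in>B \<union> BW. scale (f x) x) = 0" and x: "x \<in> B \<union> BW"
    have e: "(\<Sum>x\<in>B. scale (f x) x) + (\<Sum>x\<in>BW. scale (f x) x) = 0"
      using s fB fBW disj by (simp add: sum.union_disjoint)
    have w: "(\<Sum>x\<in>BW. scale (f x) x) \<in> W" using BW(1) by (intro subspace_sum[OF Ws] subspace_scale[OF Ws]) auto
    have "(\<Sum>x\<in>B. scale (f x) x) = - (\<Sum>x\<in>BW. scale (f x) x)" using e by (simp add: eq_neg_iff_add_eq_0)
    then have "(\<Sum>x\<in>B. scale (f x) x) \<in> W" using subspace_neg[OF Ws w] by simp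
    then have z: "f b = 0" if "b \<in> B" for b using zero that by blast
    then have "(\<Sum>x\<in>BW. scale (f x) x) = 0" using e by simp
    then have "f b = 0" if "b \<in> BW" for b using independentD[OF BW(2) fBW subset_refl] that by blast
    then show "f x = 0" using z x by blast
  qed (use fB fBW in simp)
  have "V \<subseteq> span (B \<union> BW)"
  proof
    fix v assume "v \<in> V"
    then obtain c where "v - (\<Sum>b\<in>B. scale (c b) b) \<in> W" using u by blast
    then have "v - (\<Sum>b\<in>B. scale (c b) b) \<in> span (B \<union> BW)" using BW(3) span_mono[of BW "B \<union> BW"] by blast
    moreover have "(\<Sum>b\<in>B. scale (c b) b) \<in> span (B \<union> BW)" by (intro span_sum span_scale span_base) simp
    ultimately show "v \<in> span (B \<union> BW)" using span_add by fastforce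
  qed
  then have "dim V = card (B \<union> BW)" using dim_unique[of "B \<union> BW" V] BV BW(1) V(2) ind by auto
  then show ?thesis using card_Un_disjoint[OF fB fBW disj] BW(4) by simp
qed

lemma quotient_basis_exists:
  assumes V: "fin_sub scale V" and W: "subspace W" "W \<subseteq> V"
  shows "\<exists>B. quotient_basis scale V W B"
proof -
  have Vs: "subspace V" using V by (simp add: fin_sub_def)
  obtain BW where BW: "BW \<subseteq> W" "independent BW" "W \<subseteq> span BW" using basis_exists[of W] by metis
  obtain BV where BV: "BW \<subseteq> BV" "BV \<subseteq> V" "independent BV" "V \<subseteq> span BV"
    using maximal_independent_subset_extend[of BW V] BW(1,2) W(2) by (metis order_trans)
  have f: "finite BV" using V BV independent_span_bound unfolding fin_sub_def by (meson order_trans)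
  have fw: "finite BW" using finite_subset[OF BV(1) f] .
  let ?B = "BV - BW"
  have "\<exists>!c. (\<forall>b. b \<notin> ?B \<longrightarrow> c b = 0) \<and> v - (\<Sum>b\<in>?B. scale (c b) b) \<in> W" if v: "v \<in> V" for v
  proof (rule ex_ex1I)
    obtain r where r: "v = (\<Sum>b\<in>BV. scale (r b) b)" using v BV(4) span_finite[OF f] by auto
    define c where "c b = (if b \<in> ?B then r b else 0)" for b
    have "v = (\<Sum>b\<in>?B. scale (r b) b) + (\<Sum>b\<in>BW. scale (r b) b)"
      unfolding r using sum.subset_diff[OF BV(1) f] .
    also have "(\<Sum>b\<in>?B. scale (r b) b) = (\<Sum>b\<in>?B. scale (c b) b)" by (simp add: c_def)
    finally have "v - (\<Sum>b\<in>?B. scale (c b) b) = (\<Sum>b\<in>BW. scale (r b) b)" by simp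
    moreover have "(\<Sum>b\<in>BW. scale (r b) b) \<in> W" using BW(1) by (intro subspace_sum[OF W(1)] subspace_scale[OF W(1)]) auto
    ultimately show "\<exists>c. (\<forall>b. b \<notin> ?B \<longrightarrow> c b = 0) \<and> v - (\<Sum>b\<in>?B. scale (c b) b) \<in> W"
      by (intro exI[of _ c]) (simp add: c_def)
  next
    fix c d assume c: "(\<forall>b. b \<notin> ?B \<longrightarrow> c b = 0) \<and> v - (\<Sum>b\<in>?B. scale (c b) b) \<in> W"
      and d: "(\<forall>b. b \<notin> ?B \<longrightarrow> d b = 0) \<and> v - (\<Sum>b\<in>?B. scale (d b) b) \<in> W"
    have "(v - (\<Sum>b\<in>?B. scale (d b) b)) - (v - (\<Sum>b\<in>?B. scale (c b) b)) \<in> W"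
      using subspace_diff[OF W(1)] c d by blast
    then have "(\<Sum>b\<in>?B. scale (c b - d b) b) \<in> W" by (simp add: scale_left_diff_distrib sum_subtractf)
    then obtain r where r: "(\<Sum>b\<in>?B. scale (c b - d b) b) = (\<Sum>b\<in>BW. scale (r b) b)"
      using BW(3) span_finite[OF fw] by auto
    define e where "e b = (if b \<in> BW then - r b else c b - d b)" for b
    have "(\<Sum>b\<in>BV. scale (e b) b) = (\<Sum>b\<in>?B. scale (e b) b) + (\<Sum>b\<in>BW. scale (e b) b)"
      using sum.subset_diff[OF BV(1) f] .
    also have "(\<Sum>b\<in>BW. scale (e b) b) = - (\<Sum>b\<in>BW. scale (r b) b)" by (simp add: e_def sum_negf)
    also have "(\<Sum>b\<in>?B. scale (e b) b) = (\<Sum>b\<in>?B. scale (c b - d b) b)" by (intro sum.cong) (auto simp: e_def)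
    finally have "(\<Sum>b\<in>BV. scale (e b) b) = 0" using r by simp
    then have e0: "e b = 0" if "b \<in> BV" for b using independentD[OF BV(3) f subset_refl] that by blast
    have "c b = d b" for b
    proof (cases "b \<in> ?B")
      case True
      then show ?thesis using e0[of b] by (simp add: e_def)
    qed (use c d in simp)
    then show "c = d" by blast
  qed
  then have "quotient_basis scale V W ?B" unfolding quotient_basis_def using f BV(2) by auto
  then show ?thesis by blast
qed

lemma fin_sub_subset: "fin_sub scale V \<Longrightarrow> subspace W \<Longrightarrow> W \<subseteq> V \<Longrightarrow> fin_sub scale W"
  unfolding fin_sub_def by blast

text \<open>All quotient bases have the same size, so the choice hidden in
  \<open>quotient_dim\<close> is immaterial.\<close>

lemma quotient_dim_eq:
  assumes V: "fin_sub scale V" and W: "subspace W" "W \<subseteq> V"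
  shows "quotient_dim scale V W + dim W = dim V"
proof -
  have Vs: "subspace V" using V by (simp add: fin_sub_def)
  have ex: "\<exists>B. quotient_basis scale V W B" using quotient_basis_exists[OF assms] .
  then have "quotient_basis scale V W (SOME B. quotient_basis scale V W B)" by (rule someI_ex)
  then show ?thesis
    unfolding quotient_dim_def
    using ex quotient_basis_card[OF fin_sub_subset[OF V W] Vs W(2)] by simp
qed

end

lemma
  assumes f: "Vector_Spaces.linear s1 s2 f" and V: "fin_sub s1 V"
  shows fin_sub_kernel: "fin_sub s1 {v \<in> V. f v = 0}"
    and fin_sub_image: "fin_sub s2 (f ` V)"
    and rank_nullity: "vector_space.dim s1 V = vector_space.dim s1 {v \<in> V. f v = 0} + vector_space.dim s2 (f ` V)"
proof -
  interpret f: Vector_Spaces.linear s1 s2 f by (rule f)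
  have Vs: "f.vs1.subspace V" using V by (simp add: fin_sub_def)
  let ?K = "{v \<in> V. f v = 0}"
  have Ks: "f.vs1.subspace ?K"
    by (rule f.vs1.subspaceI)
      (auto simp: f.zero f.add f.scale f.vs1.subspace_0[OF Vs] f.vs1.subspace_add[OF Vs] f.vs1.subspace_scale[OF Vs])
  show K: "fin_sub s1 ?K" using f.vs1.fin_sub_subset[OF V Ks] by blast
  obtain B where B: "finite B" "V \<subseteq> f.vs1.span B" using V by (auto simp: fin_sub_def)
  have "f ` V \<subseteq> f.vs2.span (f ` B)" using B(2) f.span_image[of B] by blast
  then show "fin_sub s2 (f ` V)" using f.subspace_image[OF Vs] B(1) unfolding fin_sub_def by blast
  obtain C where C: "quotient_basis s1 V ?K C" using f.vs1.quotient_basis_exists[OF V Ks] by blast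
  then have fC: "finite C" and CV: "C \<subseteq> V"
    and u: "\<And>v. v \<in> V \<Longrightarrow> \<exists>!c. (\<forall>b. b \<notin> C \<longrightarrow> c b = 0) \<and> v - (\<Sum>b\<in>C. s1 (c b) b) \<in> ?K"
    unfolding quotient_basis_def by blast+
  have cd: "card C + f.vs1.dim ?K = f.vs1.dim V" using f.vs1.quotient_basis_card[OF K Vs _ C] by blast
  have sV: "(\<Sum>b\<in>C. s1 (c b) b) \<in> V" for c using CV by (intro f.vs1.subspace_sum[OF Vs] f.vs1.subspace_scale[OF Vs]) auto
  have fs: "f (\<Sum>b\<in>C. s1 (c b) b) = (\<Sum>b\<in>C. s2 (c b) (f b))" for c by (simp add: f.sum f.scale)
  have zero: "c b = 0" if "(\<Sum>b\<in>C. s2 (c b) (f b)) = 0" "b \<in> C" for c b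
  proof -
    define c' where "c' b = (if b \<in> C then c b else 0)" for b
    have "(\<Sum>b\<in>C. s1 (c' b) b) = (\<Sum>b\<in>C. s1 (c b) b)" by (simp add: c'_def)
    then have "0 - (\<Sum>b\<in>C. s1 (c' b) b) \<in> ?K"
      using that(1) sV[of c] fs[of c] f.vs1.subspace_neg[OF Vs] by (simp add: f.neg)
    moreover have "0 - (\<Sum>b\<in>C. s1 ((\<lambda>_. 0) b) b) \<in> ?K" using f.vs1.subspace_0[OF Ks] by simp
    ultimately have "c' = (\<lambda>_. 0)" using u[OF f.vs1.subspace_0[OF Vs]] by (auto simp: c'_def)
    then show ?thesis using that(2) by (metis c'_def)
  qed
  have inj: "inj_on f C"
  proof (rule inj_onI, rule ccontr)
    fix x y assume xy: "x \<in> C" "y \<in> C" "f x = f y" "x \<noteq> y"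
    define c where "c b = (if b = x then 1 else if b = y then -1 else (0::'a))" for b
    have "(\<Sum>b\<in>C. s2 (c b) (f b)) = (\<Sum>b\<in>{x, y}. s2 (c b) (f b))"
      using xy fC by (intro sum.mono_neutral_right) (auto simp: c_def)
    also have "\<dots> = 0" using xy by (simp add: c_def)
    finally show False using zero[of c x] xy(1) by (simp add: c_def)
  qed
  have ind: "f.vs2.independent (f ` C)"
  proof (rule f.vs2.independent_if_scalars_zero)
    fix c x assume s: "(\<Sum>x\<in>f ` C. s2 (c x) x) = 0" and x: "x \<in> f ` C"
    then have "(\<Sum>b\<in>C. s2 (c (f b)) (f b)) = 0" by (simp add: sum.reindex[OF inj])
    then show "c x = 0" using zero[of "\<lambda>b. c (f b)"] x by blast
  qed (use fC in simp)
  have "f ` V \<subseteq> f.vs2.span (f ` C)"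
  proof
    fix y assume "y \<in> f ` V"
    then obtain v where v: "v \<in> V" "y = f v" by blast
    obtain c where "v - (\<Sum>b\<in>C. s1 (c b) b) \<in> ?K" using u[OF v(1)] by blast
    then have "y = (\<Sum>b\<in>C. s2 (c b) (f b))" using v(2) fs[of c] by (simp add: f.diff)
    then show "y \<in> f.vs2.span (f ` C)"
      by (simp only:) (intro f.vs2.span_sum f.vs2.span_scale f.vs2.span_base imageI)
  qed
  then have "f.vs2.dim (f ` V) = card (f ` C)" by (rule f.vs2.dim_unique[OF image_mono[OF CV] _ ind refl])
  then show "f.vs1.dim V = f.vs1.dim ?K + f.vs2.dim (f ` V)" using cd card_image[OF inj] by simp
qed

lemma dim_0:
  assumes "vector_space s" shows "vector_space.dim s {0} = 0"
proof -
  interpret vector_space s by fact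
  show ?thesis using dim_unique[of "{}" "{0}" 0] by (simp add: independent_empty)
qed

lemma dim_image_injective:
  assumes f: "Vector_Spaces.linear s1 s2 f" and V: "fin_sub s1 V" and inj: "\<And>v. v \<in> V \<Longrightarrow> f v = 0 \<Longrightarrow> v = 0"
  shows "vector_space.dim s2 (f ` V) = vector_space.dim s1 V"
proof -
  interpret f: Vector_Spaces.linear s1 s2 f by (rule f)
  have "f.vs1.subspace V" using V by (simp add: fin_sub_def)
  then have "{v \<in> V. f v = 0} = {0}" using inj f.vs1.subspace_0 f.zero by blast
  then show ?thesis using rank_nullity[OF f V] dim_0[OF f.vs1.vector_space_axioms] by simp
qed

section \<open>Dimensions of the homogeneous components\<close>

interpretation V3: vector_space "smult3 :: 'k::field \<Rightarrow> 'k poly3 \<Rightarrow> _"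
  by (rule vector_space_smult3)

interpretation VF: vector_space "smult_fun :: 'k::field \<Rightarrow> ('b \<Rightarrow> 'k poly3) \<Rightarrow> _"
  by (rule vector_space_smult_fun)

definition mons :: "int \<Rightarrow> (3 \<Rightarrow>\<^sub>0 nat) set" where
  "mons n = {m. int (mon_deg m) = n}"

text \<open>The number of monomials of degree \<open>n\<close>. Negative arguments do occur, because
  the Poisson complex starts in degree -3.\<close>

definition adim :: "int \<Rightarrow> nat" where
  "adim n = (if n < 0 then 0 else nat ((n + 1) * (n + 2) div 2))"

lemma mons_image:
  "mons (int n) = (\<lambda>(i, j). Poly_Mapping.single 1 i + Poly_Mapping.single 2 j + Poly_Mapping.single 3 (n - i - j)) ` (SIGMA i:{..n}. {..n - i})"
    (is "_ = ?f ` ?S")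
proof (intro set_eqI iffI)
  fix m assume "m \<in> mons (int n)"
  then have s: "Poly_Mapping.lookup m 1 + Poly_Mapping.lookup m 2 + Poly_Mapping.lookup m 3 = n"
    by (simp add: mons_def mon_deg_def sum_3)
  have "m = ?f (Poly_Mapping.lookup m 1, Poly_Mapping.lookup m 2)"
  proof (rule poly_mapping_eqI)
    fix i
    show "Poly_Mapping.lookup m i = Poly_Mapping.lookup (?f (Poly_Mapping.lookup m 1, Poly_Mapping.lookup m 2)) i"
      using s exhaust_3[of i] by (auto simp: lookup_add lookup_single)
  qed
  then show "m \<in> ?f ` ?S" by (rule image_eqI) (use s in auto)
next
  fix m assume "m \<in> ?f ` ?S"
  then show "m \<in> mons (int n)"
    by (auto simp: mons_def mon_deg_def sum_3 lookup_add lookup_single)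
qed

lemma card_mons: "finite (mons n) \<and> card (mons n) = adim n"
proof (cases "n < 0")
  case True
  then have "mons n = {}" by (auto simp: mons_def)
  then show ?thesis using True by (simp add: adim_def)
next
  case False
  then obtain k where k: "n = int k" by (metis nat_0_le not_less)
  let ?f = "\<lambda>(i, j). Poly_Mapping.single 1 i + Poly_Mapping.single 2 j + Poly_Mapping.single (3::3) (k - i - j)"
  have "inj_on ?f (SIGMA i:{..k}. {..k - i})"
  proof (rule inj_onI)
    fix x y assume "?f x = ?f y"
    then have "Poly_Mapping.lookup (?f x) 1 = Poly_Mapping.lookup (?f y) 1" "Poly_Mapping.lookup (?f x) 2 = Poly_Mapping.lookup (?f y) 2"
      by simp_all
    then show "x = y" by (auto simp: lookup_add lookup_single split: prod.splits)
  qed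
  then have "card (mons n) = card (SIGMA i:{..k}. {..k - i})" unfolding k mons_image by (rule card_image)
  also have "\<dots> = (\<Sum>i\<le>k. Suc (k - i))" by simp
  also have "\<dots> = (\<Sum>i\<le>k. Suc i)" by (rule sum.reindex_bij_witness[of _ "\<lambda>i. k - i" "\<lambda>i. k - i"]) auto
  also have "\<dots> = (k + 1) * (k + 2) div 2"
    by (induction k) simp_all
  finally have "card (mons n) = (k + 1) * (k + 2) div 2" .
  moreover have "adim n = (k + 1) * (k + 2) div 2"
    unfolding adim_def k by (simp add: nat_div_distrib nat_mult_distrib nat_add_distrib)
  moreover have "finite (mons n)" unfolding k mons_image by simp
  ultimately show ?thesis by simp
qed

definition hspace :: "int \<Rightarrow> 'k::field poly3 set" where
  "hspace n = {p. homog n p}"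

lemma
  shows fin_sub_hspace: "fin_sub smult3 (hspace n :: 'k::field poly3 set)"
    and dim_hspace: "vector_space.dim smult3 (hspace n :: 'k poly3 set) = adim n"
proof -
  let ?B = "(\<lambda>m. Poly_Mapping.single m (1::'k)) ` mons n"
  have inj: "inj_on (\<lambda>m. Poly_Mapping.single m (1::'k)) (mons n)"
    by (rule inj_onI) (metis lookup_single_eq lookup_single_not_eq one_neq_zero)
  have f: "finite ?B" and c: "card ?B = adim n" using card_mons[of n] by (simp_all add: card_image[OF inj])
  have sub: "V3.subspace (hspace n :: 'k poly3 set)"
    by (rule V3.subspaceI) (simp_all add: hspace_def homog_add smult3_cst homog_cst_mult)
  have sp: "hspace n \<subseteq> V3.span ?B"
  proof
    fix p :: "'k poly3" assume p: "p \<in> hspace n"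
    have "p = (\<Sum>m\<in>Poly_Mapping.keys p. smult3 (Poly_Mapping.lookup p m) (Poly_Mapping.single m 1))"
      unfolding smult3_cst single_cst[symmetric] by (rule poly_mapping_expand)
    also have "\<dots> \<in> V3.span ?B"
      using p by (intro V3.span_sum V3.span_scale V3.span_base) (auto simp: hspace_def homog_def mons_def)
    finally show "p \<in> V3.span ?B" .
  qed
  show "fin_sub smult3 (hspace n :: 'k poly3 set)" unfolding fin_sub_def using sub sp f by blast
  have "V3.independent ?B"
  proof (rule V3.independent_if_scalars_zero[OF f])
    fix g x assume s: "(\<Sum>x\<in>?B. smult3 (g x) x) = 0" and x: "x \<in> ?B"
    obtain m where m: "m \<in> mons n" "x = Poly_Mapping.single m 1" using x by blast
    have "(\<Sum>k\<in>mons n. smult3 (g (Poly_Mapping.single k 1)) (Poly_Mapping.single k 1)) = 0"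
      using s by (simp add: sum.reindex[OF inj])
    then have "Poly_Mapping.lookup (\<Sum>k\<in>mons n. smult3 (g (Poly_Mapping.single k 1)) (Poly_Mapping.single k 1)) m = 0" by simp
    then have "(\<Sum>k\<in>mons n. if k = m then g (Poly_Mapping.single k 1) else 0) = 0"
      by (simp add: lookup_sum smult3_cst single_cst[symmetric] lookup_single when_def)
    then show "g x = 0" using m card_mons[of n] by (simp add: sum.delta)
  qed
  moreover have "?B \<subseteq> hspace n" by (auto simp: hspace_def homog_def mons_def)
  ultimately show "vector_space.dim smult3 (hspace n :: 'k poly3 set) = adim n"
    using V3.dim_unique[OF _ sp _ c] by blast
qed

definition vspace :: "int \<Rightarrow> (3 \<Rightarrow> 'k::field poly3) set" where
  "vspace n = {v. \<forall>i. homog n (v i)}"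

lemma linear_smult_fun_iff:
  "Vector_Spaces.linear smult_fun smult_fun f \<longleftrightarrow> (\<forall>u v. f (u + v) = f u + f v) \<and> (\<forall>c v. f (smult_fun c v) = smult_fun c (f v))"
  by (simp add: Vector_Spaces.linear_iff vector_space_smult_fun)

lemma linear_smult3_fun_iff:
  "Vector_Spaces.linear smult3 smult_fun f \<longleftrightarrow> (\<forall>u v. f (u + v) = f u + f v) \<and> (\<forall>c v. f (smult3 c v) = smult_fun c (f v))"
  by (simp add: Vector_Spaces.linear_iff vector_space_smult_fun vector_space_smult3)

lemma linear_fun_smult3_iff:
  "Vector_Spaces.linear smult_fun smult3 f \<longleftrightarrow> (\<forall>u v. f (u + v) = f u + f v) \<and> (\<forall>c v. f (smult_fun c v) = smult3 c (f v))"
  by (simp add: Vector_Spaces.linear_iff vector_space_smult_fun vector_space_smult3)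

lemma
  shows fin_sub_vspace: "fin_sub smult_fun (vspace n :: (3 \<Rightarrow> 'k::field poly3) set)"
    and dim_vspace: "vector_space.dim smult_fun (vspace n :: (3 \<Rightarrow> 'k poly3) set) = 3 * adim n"
proof -
  let ?V = "vspace n :: (3 \<Rightarrow> 'k poly3) set"
  obtain B where B: "finite B" "hspace n \<subseteq> V3.span (B :: 'k poly3 set)" using fin_sub_hspace[of n] by (auto simp: fin_sub_def)
  define inj :: "3 \<Rightarrow> 'k poly3 \<Rightarrow> 3 \<Rightarrow> 'k poly3" where "inj i p j = (if j = i then p else 0)" for i p j
  have li: "Vector_Spaces.linear smult3 smult_fun (inj i)" for i
    by (simp add: linear_smult3_fun_iff fun_eq_iff inj_def smult_fun_def smult3_cst)
  have sub: "VF.subspace ?V"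
    by (rule VF.subspaceI) (simp_all add: vspace_def homog_add smult_fun_cst homog_cst_mult)
  have sp: "?V \<subseteq> VF.span (\<Union>i. inj i ` B)"
  proof
    fix v assume v: "v \<in> ?V"
    have e: "inj 1 (v 1) + inj 2 (v 2) + inj 3 (v 3) = v" by (simp add: fun_eq_3 inj_def)
    have "inj i (v i) \<in> VF.span (\<Union>i. inj i ` B)" for i
    proof -
      interpret l: Vector_Spaces.linear smult3 smult_fun "inj i" by (rule li)
      have "inj i (v i) \<in> inj i ` V3.span B" using v B(2) by (auto simp: vspace_def hspace_def)
      also have "\<dots> = VF.span (inj i ` B)" by (rule l.span_image[symmetric])
      also have "\<dots> \<subseteq> VF.span (\<Union>i. inj i ` B)" by (rule VF.span_mono) blast
      finally show ?thesis .
    qed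
    then have "inj 1 (v 1) + inj 2 (v 2) + inj 3 (v 3) \<in> VF.span (\<Union>i. inj i ` B)" by (intro VF.span_add)
    then show "v \<in> VF.span (\<Union>i. inj i ` B)" unfolding e .
  qed
  have "finite (\<Union>i. inj i ` B)" using B(1) by simp
  then show fV: "fin_sub smult_fun ?V" unfolding fin_sub_def using sub sp by blast
  have lp: "Vector_Spaces.linear smult_fun smult3 (\<lambda>v. v i)" for i :: 3
    by (simp add: linear_fun_smult3_iff smult_fun_def)
  let ?V1 = "{v \<in> ?V. v 1 = 0}" and ?V2 = "{v \<in> {v \<in> ?V. v 1 = 0}. v 2 = 0}"
  have f1: "fin_sub smult_fun ?V1" by (rule fin_sub_kernel[OF lp fV])
  have f2: "fin_sub smult_fun ?V2" by (rule fin_sub_kernel[OF lp f1])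
  have mem: "inj i p \<in> ?V" if "p \<in> hspace n" for i p using that by (simp add: vspace_def hspace_def inj_def)
  have i1: "(\<lambda>v. v 1) ` ?V = hspace n"
  proof (intro set_eqI iffI)
    fix p :: "'k poly3" assume "p \<in> hspace n" then show "p \<in> (\<lambda>v. v 1) ` ?V" using mem by (intro image_eqI[of _ _ "inj 1 p"]) (simp_all add: inj_def)
  qed (auto simp: vspace_def hspace_def)
  have i2: "(\<lambda>v. v 2) ` ?V1 = hspace n"
  proof (intro set_eqI iffI)
    fix p :: "'k poly3" assume "p \<in> hspace n" then show "p \<in> (\<lambda>v. v 2) ` ?V1" using mem by (intro image_eqI[of _ _ "inj 2 p"]) (simp_all add: inj_def)
  qed (auto simp: vspace_def hspace_def)
  have i3: "(\<lambda>v. v 3) ` ?V2 = hspace n"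
  proof (intro set_eqI iffI)
    fix p :: "'k poly3" assume "p \<in> hspace n" then show "p \<in> (\<lambda>v. v 3) ` ?V2" using mem by (intro image_eqI[of _ _ "inj 3 p"]) (simp_all add: inj_def)
  qed (auto simp: vspace_def hspace_def)
  have "VF.dim ?V = VF.dim ?V1 + adim n" using rank_nullity[OF lp fV, of 1] by (simp add: i1 dim_hspace)
  moreover have "VF.dim ?V1 = VF.dim ?V2 + adim n" using rank_nullity[OF lp f1, of 2] by (simp add: i2 dim_hspace)
  moreover have "VF.dim ?V2 = adim n"
    using dim_image_injective[OF lp f2, of 3] unfolding i3 by (simp add: dim_hspace fun_eq_3)
  ultimately show "VF.dim ?V = 3 * adim n" by simp
qed

section \<open>Cochains in coordinates\<close>

definition jac :: "'k::field poly3 \<Rightarrow> 'k poly3 \<Rightarrow> 'k poly3 \<Rightarrow> 'k poly3" where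
  "jac a b c = dot (grad a) (cross (grad b) (grad c))"

definition coc1 :: "(3 \<Rightarrow> 'k::field poly3) \<Rightarrow> 'k poly3 list \<Rightarrow> 'k poly3" where
  "coc1 v xs = (if length xs = 1 then vf v (xs ! 0) else 0)"

definition coc2 :: "(3 \<Rightarrow> 'k::field poly3) \<Rightarrow> 'k poly3 list \<Rightarrow> 'k poly3" where
  "coc2 v xs = (if length xs = 2 then biv v (xs ! 0) (xs ! 1) else 0)"

definition coc3 :: "'k::field poly3 \<Rightarrow> 'k poly3 list \<Rightarrow> 'k poly3" where
  "coc3 p xs = (if length xs = 3 then p * jac (xs ! 0) (xs ! 1) (xs ! 2) else 0)"

lemma length_lists:
  "length xs = 1 \<longleftrightarrow> (\<exists>a. xs = [a])" "length xs = 2 \<longleftrightarrow> (\<exists>a b. xs = [a, b])"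
  "length xs = 3 \<longleftrightarrow> (\<exists>a b c. xs = [a, b, c])" "length xs = 4 \<longleftrightarrow> (\<exists>a b c d. xs = [a, b, c, d])"
  by (auto simp: numeral_eq_Suc length_Suc_conv)

lemma coc_simps [simp]: "coc1 v [a] = vf v a" "coc2 v [a, b] = biv v a b" "coc3 p [a, b, c] = p * jac a b c"
  by (simp_all add: coc1_def coc2_def coc3_def)

lemma jac_X: "jac (X 1) (X 2) (X 3) = 1"
  by (simp add: jac_def vec_defs)

text \<open>Expanding all arguments leaves the values on triples of variables. Skew-symmetry kills
  those with a repeated variable, after division by 2, and ties the remaining six together by
  signs.\<close>

lemma triderivation_eq_jac:
  fixes T :: "'k::field_char_0 poly3 \<Rightarrow> 'k poly3 \<Rightarrow> 'k poly3 \<Rightarrow> 'k poly3"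
  assumes d: "\<And>b c. derivation (\<lambda>a. T a b c)" "\<And>a c. derivation (\<lambda>b. T a b c)" "\<And>a b. derivation (\<lambda>c. T a b c)"
    and s: "\<And>a b c. T b a c = - T a b c" "\<And>a b c. T a c b = - T a b c"
  shows "T a b c = T (X 1) (X 2) (X 3) * jac a b c"
proof -
  have z: "T a a c = 0" "T a c c = 0" for a c
  proof -
    have "2 * T a a c = 0" "2 * T a c c = 0" using s(1)[of a a c] s(2)[of a c c] by simp_all
    then show "T a a c = 0" "T a c c = 0" by simp_all
  qed
  have z': "T a c a = 0" for a c using s(1)[of a c a] z by (metis neg_equal_0_iff_equal)
  have v: "T (X 2) (X 1) (X 3) = - T (X 1) (X 2) (X 3)" "T (X 1) (X 3) (X 2) = - T (X 1) (X 2) (X 3)"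
    "T (X 2) (X 3) (X 1) = T (X 1) (X 2) (X 3)" "T (X 3) (X 1) (X 2) = T (X 1) (X 2) (X 3)" "T (X 3) (X 2) (X 1) = - T (X 1) (X 2) (X 3)"
    using s by (metis minus_minus)+
  have 3: "T a b c = vf (\<lambda>k. T a b (X k)) c" for a b c using derivation_eq_vf[OF d(3)] .
  have 2: "T a b c = vf (\<lambda>k. T a (X k) c) b" for a b c using derivation_eq_vf[OF d(2)] .
  have 1: "T a b c = vf (\<lambda>k. T (X k) b c) a" for a b c using derivation_eq_vf[OF d(1)] .
  have e1: "T (X i) (X j) c = vf (\<lambda>k. T (X i) (X j) (X k)) c" for i j c using 3 .
  have e2: "T (X i) b c = vf (\<lambda>j. vf (\<lambda>k. T (X i) (X j) (X k)) c) b" for i b c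
    using 2[of "X i" b c] by (simp only: e1[of i _ c])
  have "T a b c = vf (\<lambda>i. vf (\<lambda>j. vf (\<lambda>k. T (X i) (X j) (X k)) c) b) a"
    using 1[of a b c] by (simp only: e2[of _ b c])
  then show ?thesis
    by (simp add: vf_def jac_def dot_def cross_def grad_def z z' v algebra_simps)
qed

lemma multiderivation_1: "multiderivation 1 Q \<longleftrightarrow> (\<exists>v. Q = coc1 v)"
proof
  assume Q: "multiderivation 1 Q"
  have d: "derivation (\<lambda>a. Q (xs[i := a]))" if "length xs = 1" "i < 1" for xs i
    using Q that unfolding multiderivation_def by blast
  have "derivation (\<lambda>a. Q [a])" using d[of "[0]" 0] by simp
  from derivation_eq_vf[OF this] have q: "Q [a] = vf (\<lambda>i. Q [X i]) a" for a .
  have "Q xs = coc1 (\<lambda>i. Q [X i]) xs" for xs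
  proof (cases "length xs = 1")
    case True
    then obtain a where "xs = [a]" unfolding length_lists by blast
    then show ?thesis using q[of a] by (simp only: coc_simps)
  next
    case False
    then have "Q xs = 0" using Q unfolding multiderivation_def by blast
    then show ?thesis using False by (simp add: coc1_def)
  qed
  then show "\<exists>v. Q = coc1 v" by blast
next
  assume "\<exists>v. Q = coc1 v"
  then obtain v where v: "Q = coc1 v" by blast
  show "multiderivation 1 Q"
    unfolding multiderivation_def v
  proof (intro conjI allI impI)
    fix xs :: "'a poly3 list" and i j :: nat
    show "length xs \<noteq> 1 \<Longrightarrow> coc1 v xs = 0" by (simp add: coc1_def)
    show "derivation (\<lambda>a. coc1 v (xs[i := a]))" if l: "length xs = 1" and i: "i < 1"
    proof -
      obtain b where "xs = [b]" using l unfolding length_lists by blast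
      then show ?thesis using i derivation_vf[of v] by simp
    qed
  qed auto
qed

lemma multiderivation_2:
  fixes Q :: "'k::field_char_0 poly3 list \<Rightarrow> 'k poly3"
  shows "multiderivation 2 Q \<longleftrightarrow> (\<exists>v. Q = coc2 v)"
proof
  assume Q: "multiderivation 2 Q"
  have d: "derivation (\<lambda>a. Q (xs[i := a]))" if "length xs = 2" "i < 2" for xs i
    using Q that unfolding multiderivation_def by blast
  have s: "Q (xs[i := xs ! j, j := xs ! i]) = - Q xs" if "length xs = 2" "i < j" "j < 2" for xs i j
    using Q that unfolding multiderivation_def by blast
  have "Q [a, a] = 0" for a
  proof -
    have "2 * Q [a, a] = 0" using s[of "[a, a]" 0 1] by simp
    then show ?thesis by simp
  qed
  then have "biderivation (\<lambda>a b. Q [a, b])"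
    unfolding biderivation_def using d[of "[0, _]" 0] d[of "[_, 0]" 1] by simp
  from biderivation_eq_biv[OF this] obtain v where v: "(\<lambda>a b. Q [a, b]) = biv v" by blast
  have "Q xs = coc2 v xs" for xs
  proof (cases "length xs = 2")
    case True
    then obtain a b where "xs = [a, b]" unfolding length_lists by blast
    then show ?thesis using fun_cong[OF fun_cong[OF v], of a b] by (simp only: coc_simps)
  next
    case False
    then have "Q xs = 0" using Q unfolding multiderivation_def by blast
    then show ?thesis using False by (simp add: coc2_def)
  qed
  then show "\<exists>v. Q = coc2 v" by blast
next
  assume "\<exists>v. Q = coc2 v"
  then obtain v where v: "Q = coc2 v" by blast
  have b: "derivation (biv v a)" "derivation (\<lambda>b. biv v b a)" "biv v b a = - biv v a b" for a b
    using biderivation_biv[of v] biderivation_skew[OF biderivation_biv, of v b a] unfolding biderivation_def by blast+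
  show "multiderivation 2 Q"
    unfolding multiderivation_def v
  proof (intro conjI allI impI)
    fix xs :: "'k poly3 list" and i j :: nat
    show "length xs \<noteq> 2 \<Longrightarrow> coc2 v xs = 0" by (simp add: coc2_def)
    show "derivation (\<lambda>a. coc2 v (xs[i := a]))" if l: "length xs = 2" and i: "i < 2"
    proof -
      obtain a b where xs: "xs = [a, b]" using l unfolding length_lists by blast
      show ?thesis using i b(1,2) unfolding xs less_2_cases_iff by auto
    qed
    show "coc2 v (xs[i := xs ! j, j := xs ! i]) = - coc2 v xs" if l: "length xs = 2" and i: "i < j" "j < 2"
    proof -
      obtain a b where xs: "xs = [a, b]" using l unfolding length_lists by blast
      have "xs[i := xs ! j, j := xs ! i] = [b, a]" using i by (auto simp: xs less_2_cases_iff)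
      then show ?thesis unfolding xs by (simp only: coc_simps b(3)[of b a])
    qed
  qed
qed

lemma jac_expand:
  "jac a b c = pd 1 a * (pd 2 b * pd 3 c - pd 3 b * pd 2 c) + pd 2 a * (pd 3 b * pd 1 c - pd 1 b * pd 3 c)
     + pd 3 a * (pd 1 b * pd 2 c - pd 2 b * pd 1 c)"
  by (simp add: jac_def vec_defs)

lemma jac_rules:
  "derivation (\<lambda>a. p * jac a b c)" "derivation (\<lambda>b. p * jac a b c)" "derivation (\<lambda>c. p * jac a b c)"
  "jac b a c = - jac a b c" "jac a c b = - jac a b c" "jac c b a = - jac a b c"
  by (rule derivationI; simp add: jac_expand algebra_simps)+ (simp_all add: jac_expand algebra_simps)

lemma less_3_cases: "i < (3::nat) \<longleftrightarrow> i = 0 \<or> i = 1 \<or> i = 2"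
  by auto

lemma multiderivation_3:
  fixes Q :: "'k::field_char_0 poly3 list \<Rightarrow> 'k poly3"
  shows "multiderivation 3 Q \<longleftrightarrow> (\<exists>p. Q = coc3 p)"
proof
  assume Q: "multiderivation 3 Q"
  have d: "derivation (\<lambda>a. Q (xs[i := a]))" if "length xs = 3" "i < 3" for xs i
    using Q that unfolding multiderivation_def by blast
  have s: "Q (xs[i := xs ! j, j := xs ! i]) = - Q xs" if "length xs = 3" "i < j" "j < 3" for xs i j
    using Q that unfolding multiderivation_def by blast
  have q: "Q [a, b, c] = Q [X 1, X 2, X 3] * jac a b c" for a b c
  proof (rule triderivation_eq_jac[of "\<lambda>a b c. Q [a, b, c]"])
    fix a b c
    show "derivation (\<lambda>a. Q [a, b, c])" using d[of "[0, b, c]" 0] by simp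
    show "derivation (\<lambda>b. Q [a, b, c])" using d[of "[a, 0, c]" 1] by simp
    show "derivation (\<lambda>c. Q [a, b, c])" using d[of "[a, b, 0]" 2] by (simp add: numeral_2_eq_2)
    show "Q [b, a, c] = - Q [a, b, c]" using s[of "[a, b, c]" 0 1] by simp
    show "Q [a, c, b] = - Q [a, b, c]" using s[of "[a, b, c]" 1 2] by (simp add: numeral_2_eq_2)
  qed
  have "Q xs = coc3 (Q [X 1, X 2, X 3]) xs" for xs
  proof (cases "length xs = 3")
    case True
    then obtain a b c where "xs = [a, b, c]" unfolding length_lists by blast
    then show ?thesis using q[of a b c] by (simp only: coc_simps)
  next
    case False
    then have "Q xs = 0" using Q unfolding multiderivation_def by blast
    then show ?thesis using False by (simp add: coc3_def)
  qed
  then show "\<exists>p. Q = coc3 p" by blast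
next
  assume "\<exists>p. Q = coc3 p"
  then obtain p where v: "Q = coc3 p" by blast
  show "multiderivation 3 Q"
    unfolding multiderivation_def v
  proof (intro conjI allI impI)
    fix xs :: "'k poly3 list" and i j :: nat
    show "length xs \<noteq> 3 \<Longrightarrow> coc3 p xs = 0" by (simp add: coc3_def)
    show "derivation (\<lambda>a. coc3 p (xs[i := a]))" if l: "length xs = 3" and i: "i < 3"
    proof -
      obtain a b c where xs: "xs = [a, b, c]" using l unfolding length_lists by blast
      show ?thesis using i jac_rules(1-3) unfolding xs less_3_cases by (auto simp: numeral_2_eq_2)
    qed
    show "coc3 p (xs[i := xs ! j, j := xs ! i]) = - coc3 p xs" if l: "length xs = 3" and i: "i < j" "j < 3"
    proof -
      obtain a b c where xs: "xs = [a, b, c]" using l unfolding length_lists by blast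
      have e: "p * jac b a c = - (p * jac a b c)" "p * jac a c b = - (p * jac a b c)" "p * jac c b a = - (p * jac a b c)"
        using jac_rules(4)[of b a c] jac_rules(5)[of a c b] jac_rules(6)[of c b a] by simp_all
      have "xs[i := xs ! j, j := xs ! i] \<in> {[b, a, c], [c, b, a], [a, c, b]}"
      proof -
        have "i = 0 \<and> j = 1 \<or> i = 0 \<and> j = 2 \<or> i = 1 \<and> j = 2" using i by arith
        then show ?thesis by (auto simp: xs numeral_2_eq_2)
      qed
      then show ?thesis unfolding xs using e by (elim insertE emptyE) (simp_all only: coc_simps)
    qed
  qed
qed

lemma multiderivation_0: "multiderivation 0 Q \<longleftrightarrow> (\<exists>p. Q = (\<lambda>xs. if xs = [] then p else 0))"
proof
  assume "multiderivation 0 Q"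
  then have "Q xs = (if xs = [] then Q [] else 0)" for xs by (auto simp: multiderivation_def)
  then show "\<exists>p. Q = (\<lambda>xs. if xs = [] then p else 0)" by blast
qed (auto simp: multiderivation_def)

lemma homog_biv:
  assumes "\<And>i. homog (n + 2) (v i)" "homog i a" "homog j b"
  shows "homog (i + j + n) (biv v a b)"
proof -
  have "homog ((n + 2) + ((i - 1) + (j - 1))) (v k * (pd l a * pd m b))" for k l m
    by (intro homog_mult homog_pd assms)
  then have "homog (i + j + n) (v k * (pd l a * pd m b))" for k l m by (simp add: algebra_simps)
  then show ?thesis unfolding biv_expand right_diff_distrib by (intro homog_add homog_diff)
qed

lemma homog_jac:
  assumes "homog (n + 3) p" "homog i a" "homog j b" "homog k c"
  shows "homog (i + j + k + n) (p * jac a b c)"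
proof -
  have "homog ((n + 3) + ((i - 1) + ((j - 1) + (k - 1)))) (p * (pd l a * (pd m b * pd s c)))" for l m s
    by (intro homog_mult homog_pd assms)
  then have "homog (i + j + k + n) (p * (pd l a * (pd m b * pd s c)))" for l m s by (simp add: algebra_simps)
  then show ?thesis unfolding jac_expand right_diff_distrib distrib_left by (intro homog_add homog_diff)
qed

text \<open>Each argument is differentiated once, so a \<open>q\<close>-cochain of degree
  \<open>n\<close> has coefficients of degree \<open>n + q\<close>.\<close>

lemma multi_degree_coc:
  fixes v :: "3 \<Rightarrow> 'a::field poly3" and p :: "'a poly3"
  shows "multi_degree n (coc1 v) \<longleftrightarrow> v \<in> vspace (n + 1)"
  "multi_degree n (coc2 v) \<longleftrightarrow> v \<in> vspace (n + 2)"
  "multi_degree n (coc3 p) \<longleftrightarrow> p \<in> hspace (n + 3)"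
proof -
  have m: "homog (sum_list ds + n) (Q xs)" if "multi_degree n Q" "list_all2 homog ds xs" for Q :: "'a poly3 list \<Rightarrow> 'a poly3" and ds xs
    using that unfolding multi_degree_def by blast
  show "multi_degree n (coc1 v) \<longleftrightarrow> v \<in> vspace (n + 1)"
  proof
    assume "multi_degree n (coc1 v)"
    from m[OF this, of "[1]" "[X _]"] show "v \<in> vspace (n + 1)" by (simp add: vspace_def add.commute)
  next
    assume "v \<in> vspace (n + 1)"
    then have "map_degree n (vf v)" by (simp add: map_degree_vf vspace_def)
    then have h: "homog (i + n) (vf v a)" if "homog i a" for i a using that by (simp add: map_degree_def)
    show "multi_degree n (coc1 v)"
      unfolding multi_degree_def
    proof (intro allI impI)
      fix ds and xs :: "'a poly3 list" assume l: "list_all2 homog ds xs"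
      show "homog (sum_list ds + n) (coc1 v xs)"
      proof (cases "length xs = 1")
        case True
        then obtain a where "xs = [a]" unfolding length_lists by blast
        then show ?thesis using l h by (auto simp: list_all2_Cons2)
      qed (simp add: coc1_def)
    qed
  qed
  show "multi_degree n (coc2 v) \<longleftrightarrow> v \<in> vspace (n + 2)"
  proof
    assume "multi_degree n (coc2 v)"
    from m[OF this, of "[1, 1]" "[X _, X _]"] have "homog (2 + n) (biv v (X i) (X j))" for i j by simp
    from this[of 2 3] this[of 3 1] this[of 1 2] show "v \<in> vspace (n + 2)"
      by (simp add: vspace_def forall_3 biv_expand add.commute)
  next
    assume "v \<in> vspace (n + 2)"
    then show "multi_degree n (coc2 v)"
      using homog_biv[of n v] by (auto simp: multi_degree_def coc2_def length_lists(2) list_all2_Cons2 vspace_def)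
  qed
  show "multi_degree n (coc3 p) \<longleftrightarrow> p \<in> hspace (n + 3)"
  proof
    assume "multi_degree n (coc3 p)"
    from m[OF this, of "[1, 1, 1]" "[X 1, X 2, X 3]"] show "p \<in> hspace (n + 3)" by (simp add: jac_X hspace_def add.commute)
  next
    assume "p \<in> hspace (n + 3)"
    then show "multi_degree n (coc3 p)"
      using homog_jac[of n p] by (auto simp: multi_degree_def coc3_def length_lists(3) list_all2_Cons2 hspace_def add.assoc)
  qed
qed

section \<open>The differential in coordinates\<close>

definition d0 :: "(3 \<Rightarrow> 'k::field poly3) \<Rightarrow> 'k poly3 \<Rightarrow> 3 \<Rightarrow> 'k poly3" where
  "d0 P p i = - cross P (grad p) i"

definition d1 :: "(3 \<Rightarrow> 'k::field poly3) \<Rightarrow> (3 \<Rightarrow> 'k poly3) \<Rightarrow> 3 \<Rightarrow> 'k poly3" where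
  "d1 P v i = - lie v P i"

text \<open>Minus the polarization of the Jacobi expression \<open>dot P (curl P)\<close>.\<close>

definition d2 :: "(3 \<Rightarrow> 'k::field poly3) \<Rightarrow> (3 \<Rightarrow> 'k poly3) \<Rightarrow> 'k poly3" where
  "d2 P u = - (dot P (curl u) + dot u (curl P))"

lemma poisson_diff_explicit:
  "poisson_diff br 0 Q [a] = br a (Q [])"
  "poisson_diff br 1 Q [a, b] = br a (Q [b]) - br b (Q [a]) - Q [br a b]"
  "poisson_diff br 2 Q [a, b, c] = br a (Q [b, c]) - br b (Q [a, c]) + br c (Q [a, b])
     - Q [br a b, c] + Q [br a c, b] - Q [br b c, a]"
  "poisson_diff br 3 Q [a, b, c, d] = br a (Q [b, c, d]) - br b (Q [a, c, d]) + br c (Q [a, b, d]) - br d (Q [a, b, c])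
     - Q [br a b, c, d] + Q [br a c, b, d] - Q [br b c, a, d] - Q [br a d, b, c] + Q [br b d, a, c] - Q [br c d, a, b]"
  by (simp_all add: poisson_diff_def nths_Cons numeral_eq_Suc)

lemma poisson_diff_length: "length xs \<noteq> Suc q \<Longrightarrow> poisson_diff br q Q xs = 0"
  by (simp add: poisson_diff_def)

lemma derivation_neg: "derivation \<delta> \<Longrightarrow> derivation (\<lambda>a. - \<delta> a)"
  by (rule derivationI) (simp_all add: derivation_add derivation_cst_mult derivation_mult)

text \<open>The differential of a biderivation is a skew-symmetric triderivation, hence a multiple
  of the Jacobian, and the factor is its value on the variables. Only the first argument is checked
  to be a derivation; skew-symmetry gives the others.\<close>

lemma biv_diff:
  fixes P :: "3 \<Rightarrow> 'k::field_char_0 poly3"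
  shows "biv P a (biv u b c) - biv P b (biv u a c) + biv P c (biv u a b)
     - biv u (biv P a b) c + biv u (biv P a c) b - biv u (biv P b c) a = d2 P u * jac a b c"
proof -
  define B where "B = biv P"
  define Q where "Q = biv u"
  define T where "T a b c = B a (Q b c) - B b (Q a c) + B c (Q a b) - Q (B a b) c + Q (B a c) b - Q (B b c) a" for a b c
  have B: "derivation (B u)" "derivation (\<lambda>a. B a u)" for u
    using biderivation_biv[of P] unfolding B_def biderivation_def by blast+
  have Q: "derivation (Q v)" "derivation (\<lambda>a. Q a v)" for v
    using biderivation_biv[of u] unfolding Q_def biderivation_def by blast+
  have Bs: "B a b = - B b a" and Qs: "Q a b = - Q b a" for a b
    unfolding B_def Q_def by (rule biderivation_skew[OF biderivation_biv])+
  note der = derivation_add[OF B(1)] derivation_add[OF B(2)] derivation_add[OF Q(1)] derivation_add[OF Q(2)]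
  note dec = derivation_cst_mult[OF B(1)] derivation_cst_mult[OF B(2)] derivation_cst_mult[OF Q(1)] derivation_cst_mult[OF Q(2)]
  note dem = derivation_mult[OF B(1)] derivation_mult[OF B(2)] derivation_mult[OF Q(1)] derivation_mult[OF Q(2)]
  note deu = derivation_uminus[OF B(1)] derivation_uminus[OF B(2)] derivation_uminus[OF Q(1)] derivation_uminus[OF Q(2)]
  have D1: "derivation (\<lambda>a. T a b c)" for b c
  proof (rule derivationI)
    fix x y e
    show "T (x + y) b c = T x b c + T y b c" unfolding T_def der by simp
    show "T (cst e * x) b c = cst e * T x b c" unfolding T_def dec by (simp add: algebra_simps)
    show "T (x * y) b c = T x b c * y + x * T y b c" unfolding T_def dem der
      by (simp add: Bs[of x b] Bs[of x c] Bs[of y b] Bs[of y c] Qs[of x b] Qs[of x c] Qs[of y b] Qs[of y c] deu algebra_simps)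
  qed
  have S: "T b a c = - T a b c" "T a c b = - T a b c" for a b c
    unfolding T_def by (simp_all add: Bs[of b a] Bs[of c b] Qs[of b a] Qs[of c b] deu)
  have D2: "derivation (\<lambda>b. T a b c)" for a c using derivation_neg[OF D1[of a c]] unfolding S(1)[of a] by simp
  have D3: "derivation (\<lambda>c. T a b c)" for a b using derivation_neg[OF D2[of a b]] unfolding S(2)[of a b] by simp
  have "T a b c = T (X 1) (X 2) (X 3) * jac a b c" by (rule triderivation_eq_jac[OF D1 D2 D3 S])
  also have "T (X 1) (X 2) (X 3) = d2 P u"
    unfolding T_def B_def Q_def d2_def by (simp add: biv_expand vec_defs algebra_simps)
  finally show ?thesis unfolding T_def B_def Q_def .
qed

lemma poisson_diff_coc:
  fixes P :: "3 \<Rightarrow> 'k::field_char_0 poly3"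
  shows "poisson_diff (biv P) 0 (\<lambda>xs. if xs = [] then p else 0) = coc1 (d0 P p)"
  "poisson_diff (biv P) 1 (coc1 v) = coc2 (d1 P v)"
  "poisson_diff (biv P) 2 (coc2 u) = coc3 (d2 P u)"
proof -
  show "poisson_diff (biv P) 0 (\<lambda>xs. if xs = [] then p else 0) = coc1 (d0 P p)"
  proof
    fix xs show "poisson_diff (biv P) 0 (\<lambda>xs. if xs = [] then p else 0) xs = coc1 (d0 P p) xs"
    proof (cases "length xs = 1")
      case True
      then obtain a where "xs = [a]" unfolding length_lists by blast
      then show ?thesis by (simp add: poisson_diff_explicit d0_def biv_expand vec_defs algebra_simps)
    qed (simp add: poisson_diff_length coc1_def)
  qed
  show "poisson_diff (biv P) 1 (coc1 v) = coc2 (d1 P v)"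
  proof
    fix xs show "poisson_diff (biv P) 1 (coc1 v) xs = coc2 (d1 P v) xs"
    proof (cases "length xs = 2")
      case True
      then obtain a b where xs: "xs = [a, b]" by (auto simp: length_lists(2))
      have "biv (d1 P v) a b = - biv (lie v P) a b" by (simp add: d1_def biv_expand algebra_simps)
      also have "\<dots> = biv P a (vf v b) - biv P b (vf v a) - vf v (biv P a b)"
        using biderivation_skew[OF biderivation_biv, of P b "vf v a"] unfolding lie_biv[symmetric] by simp
      finally show ?thesis unfolding xs by (simp only: poisson_diff_explicit coc_simps)
    qed (simp add: poisson_diff_length coc2_def)
  qed
  show "poisson_diff (biv P) 2 (coc2 u) = coc3 (d2 P u)"
  proof
    fix xs show "poisson_diff (biv P) 2 (coc2 u) xs = coc3 (d2 P u) xs"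
    proof (cases "length xs = 3")
      case True
      then obtain a b c where xs: "xs = [a, b, c]" by (auto simp: length_lists(3))
      show ?thesis unfolding xs poisson_diff_explicit coc_simps by (rule biv_diff)
    qed (simp add: poisson_diff_length coc3_def)
  qed
qed

text \<open>The differential is a skew-symmetric derivation in four arguments, and among four of the
  three variables two coincide.\<close>

lemma poisson_diff_3:
  fixes P :: "3 \<Rightarrow> 'a::field_char_0 poly3"
  shows "poisson_diff (biv P) 3 (coc3 p) = 0"
proof -
  define B where "B = biv P"
  define J where "J a b c = p * jac a b c" for a b c
  define T where "T a b c d = B a (J b c d) - B b (J a c d) + B c (J a b d) - B d (J a b c)
     - J (B a b) c d + J (B a c) b d - J (B b c) a d - J (B a d) b c + J (B b d) a c - J (B c d) a b" for a b c d
  have B: "derivation (B u)" "derivation (\<lambda>a. B a u)" for u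
    using biderivation_biv[of P] unfolding B_def biderivation_def by blast+
  have Bs: "B a b = - B b a" for a b
    unfolding B_def by (rule biderivation_skew[OF biderivation_biv])
  have J: "derivation (\<lambda>a. J a b c)" "derivation (\<lambda>b. J a b c)" "derivation (\<lambda>c. J a b c)" for a b c
    unfolding J_def by (rule jac_rules)+
  have Js: "J b a c = - J a b c" "J a c b = - J a b c" for a b c
    unfolding J_def using jac_rules(4)[of b a c] jac_rules(5)[of a c b] by simp_all
  note der = derivation_add[OF B(1)] derivation_add[OF B(2)] derivation_add[OF J(1)] derivation_add[OF J(2)] derivation_add[OF J(3)]
  note dec = derivation_cst_mult[OF B(1)] derivation_cst_mult[OF B(2)] derivation_cst_mult[OF J(1)] derivation_cst_mult[OF J(2)] derivation_cst_mult[OF J(3)]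
  note dem = derivation_mult[OF B(1)] derivation_mult[OF B(2)] derivation_mult[OF J(1)] derivation_mult[OF J(2)] derivation_mult[OF J(3)]
  note deu = derivation_uminus[OF B(1)] derivation_uminus[OF B(2)] derivation_uminus[OF J(1)] derivation_uminus[OF J(2)] derivation_uminus[OF J(3)]
  have D1: "derivation (\<lambda>a. T a b c d)" for b c d
  proof (rule derivationI)
    fix x y e
    show "T (x + y) b c d = T x b c d + T y b c d" unfolding T_def der by simp
    show "T (cst e * x) b c d = cst e * T x b c d" unfolding T_def dec by (simp add: algebra_simps)
    show "T (x * y) b c d = T x b c d * y + x * T y b c d" unfolding T_def dem der
      by (simp add: Bs[of x b] Bs[of x c] Bs[of x d] Bs[of y b] Bs[of y c] Bs[of y d] deu algebra_simps)
  qed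
  have S: "T b a c d = - T a b c d" "T a c b d = - T a b c d" "T a b d c = - T a b c d" for a b c d
    unfolding T_def
    by (simp_all add: Bs[of b a] Bs[of c b] Bs[of d c] Js(1)[of b a] Js(1)[of c b d] Js(1)[of d c] Js(2)[of _ b a]
      Js(2)[of _ c b] Js(2)[of _ d c] deu)
  have D2: "derivation (\<lambda>b. T a b c d)" for a c d using derivation_neg[OF D1[of a c d]] unfolding S(1)[of a] by simp
  have D3: "derivation (\<lambda>c. T a b c d)" for a b d using derivation_neg[OF D2[of a b d]] unfolding S(2)[of a b] by simp
  have D4: "derivation (\<lambda>d. T a b c d)" for a b c using derivation_neg[OF D3[of a b c]] unfolding S(3)[of a b c] by simp
  have z: "T a a c d = 0" "T c a a d = 0" "T c d a a = 0" for a c d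
    using S(1)[of a a c d] S(2)[of c a a d] S(3)[of c d a a] by simp_all
  have z': "T a b a d = 0" "T b a d a = 0" "T a b c a = 0" for a b c d
  proof -
    show 1: "T a b a d = 0" for b d using S(2)[of a a b d] z by simp
    show "T b a d a = 0" using S(3)[of b a a d] z by simp
    show "T a b c a = 0" using S(3)[of a b a c] 1 by simp
  qed
  have X: "T (X i) (X j) (X k) (X l) = 0" for i j k l
    using exhaust_3[of i] exhaust_3[of j] exhaust_3[of k] exhaust_3[of l] by (elim disjE) (simp_all add: z z')
  have v0: "vf (\<lambda>i. 0) f = 0" for f :: "'a poly3" by (simp add: vf_def)
  have X1: "T (X i) (X j) (X k) d = 0" for i j k d using derivation_eq_vf[OF D4, of "X i" "X j" "X k" d] by (simp add: X v0)
  have X2: "T (X i) (X j) c d = 0" for i j c d using derivation_eq_vf[OF D3, of "X i" "X j" c d] by (simp add: X1 v0)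
  have X3: "T (X i) b c d = 0" for i b c d using derivation_eq_vf[OF D2, of "X i" b c d] by (simp add: X2 v0)
  have T0: "T a b c d = 0" for a b c d using derivation_eq_vf[OF D1, of a b c d] by (simp add: X3 v0)
  show ?thesis
  proof
    fix xs show "poisson_diff (biv P) 3 (coc3 p) xs = 0 xs"
    proof (cases "length xs = 4")
      case True
      then obtain a b c d where "xs = [a, b, c, d]" unfolding length_lists by blast
      then show ?thesis using T0[of a b c d] unfolding T_def B_def J_def by (simp only: poisson_diff_explicit coc_simps zero_fun_apply)
    qed (simp add: poisson_diff_length)
  qed
qed

section \<open>Hilbert series of the cohomology\<close>

lemma d_linear:
  "Vector_Spaces.linear smult3 smult_fun (d0 P)"
  "Vector_Spaces.linear smult_fun smult_fun (d1 P)"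
  "Vector_Spaces.linear smult_fun smult3 (d2 P)"
  "Vector_Spaces.linear smult_fun smult_fun coc1"
  "Vector_Spaces.linear smult_fun smult_fun coc2"
  "Vector_Spaces.linear smult3 smult_fun coc3"
  "Vector_Spaces.linear smult_fun smult_fun vf"
proof -
  show "Vector_Spaces.linear smult3 smult_fun (d0 P)"
    by (auto simp: linear_smult3_fun_iff fun_eq_iff d0_def cross_def grad_def smult_fun_cst smult3_cst algebra_simps)
  show "Vector_Spaces.linear smult_fun smult_fun (d1 P)"
    by (auto simp: linear_smult_fun_iff fun_eq_iff d1_def lie_def vec_defs smult_fun_cst algebra_simps)
  show "Vector_Spaces.linear smult_fun smult3 (d2 P)"
    by (auto simp: linear_fun_smult3_iff d2_def vec_defs smult_fun_cst smult3_cst algebra_simps)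
  show "Vector_Spaces.linear smult_fun smult_fun coc1"
    by (auto simp: linear_smult_fun_iff fun_eq_iff coc1_def vec_defs smult_fun_cst algebra_simps)
  show "Vector_Spaces.linear smult_fun smult_fun coc2"
    by (auto simp: linear_smult_fun_iff fun_eq_iff coc2_def biv_expand smult_fun_cst algebra_simps)
  show "Vector_Spaces.linear smult3 smult_fun coc3"
    by (auto simp: linear_smult3_fun_iff fun_eq_iff coc3_def smult_fun_cst smult3_cst algebra_simps)
  show "Vector_Spaces.linear smult_fun smult_fun vf"
    by (auto simp: linear_smult_fun_iff fun_eq_iff vec_defs smult_fun_cst algebra_simps)
qed

lemma coc_injective:
  "coc1 v = 0 \<Longrightarrow> v = 0" "coc2 v = 0 \<Longrightarrow> v = 0" "coc3 p = 0 \<Longrightarrow> p = 0" "vf v = 0 \<Longrightarrow> v = 0"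
proof -
  assume "coc1 v = 0"
  then have "coc1 v [X i] = 0" for i by simp
  then show "v = 0" by (simp add: fun_eq_iff)
next
  assume "coc2 v = 0"
  then have "coc2 v [X i, X j] = 0" for i j by simp
  from this[of 2 3] this[of 3 1] this[of 1 2] show "v = 0" by (simp add: fun_eq_3 biv_expand)
next
  assume "coc3 p = 0"
  then have "coc3 p [X 1, X 2, X 3] = 0" by simp
  then show "p = 0" by (simp add: jac_X)
next
  assume "vf v = 0"
  then have "vf v (X i) = 0" for i by (simp del: vf_X)
  then show "v = 0" by (simp add: fun_eq_iff)
qed

lemma lie_hamiltonian: "lie (cross P (grad p)) P k = - (pd k p * dot P (curl P))"
  using exhaust_3[of k] by (auto simp: lie_def vec_defs pd_commute_simps algebra_simps)

lemma d1_d0: "dot P (curl P) = 0 \<Longrightarrow> d1 P (d0 P p) = 0"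
proof -
  assume "dot P (curl P) = 0"
  moreover have "lie (d0 P p) P k = - lie (cross P (grad p)) P k" for k
    by (simp add: lie_def d0_def vec_defs algebra_simps)
  ultimately show ?thesis by (simp add: fun_eq_iff d1_def lie_hamiltonian)
qed

lemma d2_d1:
  assumes j: "dot P (curl P) = 0"
  shows "d2 P (d1 P v) = 0"
proof -
  have "d2 P (d1 P v) = vf v (dot P (curl P)) - dv v * dot P (curl P)"
    by (simp add: d2_def d1_def lie_def vec_defs pd_commute_simps algebra_simps)
  then show ?thesis using j by (simp add: vf_def)
qed

lemma hcomp_self: "homog n p \<Longrightarrow> hcomp n p = p"
  by (simp add: hcomp_homog)

text \<open>The coefficients of (1 - t)^3 times the series of the polynomial ring, shifted by 3. At
  the same time it is the alternating sum of the dimensions of the cochain spaces in degree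
  \<open>n\<close>.\<close>

lemma adim_third_difference:
  "int (adim (n + 3)) - 3 * int (adim (n + 2)) + 3 * int (adim (n + 1)) - int (adim n) = (if n = - 3 then 1 else 0)"
proof -
  have a: "2 * int (adim m) = (if m < - 2 then 0 else (m + 1) * (m + 2))" for m
  proof (cases "m < 0")
    case True
    then consider "m < - 2" | "m = - 1" | "m = - 2" by linarith
    then show ?thesis by cases (simp_all add: adim_def)
  next
    case False
    have "even ((m + 1) * (m + 2))" by simp
    then show ?thesis using False by (simp add: adim_def)
  qed
  have "2 * (int (adim (n + 3)) - 3 * int (adim (n + 2)) + 3 * int (adim (n + 1)) - int (adim n))
      = 2 * int (adim (n + 3)) - 3 * (2 * int (adim (n + 2))) + 3 * (2 * int (adim (n + 1))) - 2 * int (adim n)"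
    by simp
  also have "\<dots> = (if n = - 3 then 2 else 0)"
  proof -
    consider "n < - 5" | "n = - 5" | "n = - 4" | "n = - 3" | "n \<ge> - 2" by linarith
    then show ?thesis unfolding a by cases (simp_all add: algebra_simps)
  qed
  finally show ?thesis by (auto split: if_splits)
qed

section \<open>Ranks in the Poisson complex\<close>

context
  fixes P :: "3 \<Rightarrow> 'k::field_char_0 poly3"
  assumes h: "\<And>i. homog 2 (P i)" and jacobi: "dot P (curl P) = 0"
begin

lemma h1: "homog 1 (pd i (P k))"
  using homog_pd[OF h, of i k] by simp

lemma hcomp_rules:
  "hcomp (n + 1) (P i * pd j q) = P i * pd j (hcomp n q)"
  "hcomp (n + 1) (q * pd j (P i)) = hcomp n q * pd j (P i)"
  "hcomp (n + 1) (pd j q * P i) = pd j (hcomp n q) * P i"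
  using hcomp_mult[OF h, of "n + 1" i "pd j q"] hcomp_mult[OF h1, of "n + 1" j i q]
  by (simp_all add: hcomp_pd mult.commute)

lemma hcomp_d:
  "hcomp (n + 1) (d0 P p i) = d0 P (hcomp n p) i"
  "hcomp (n + 1) (d1 P v i) = d1 P (\<lambda>i. hcomp n (v i)) i"
  "hcomp (n + 1) (d2 P v) = d2 P (\<lambda>i. hcomp n (v i))"
  unfolding d0_def d1_def d2_def lie_def vec_defs
  by (simp_all add: hcomp_rules right_diff_distrib left_diff_distrib distrib_left distrib_right)

lemma d_maps:
  "p \<in> hspace n \<Longrightarrow> d0 P p \<in> vspace (n + 1)"
  "v \<in> vspace n \<Longrightarrow> d1 P v \<in> vspace (n + 1)"
  "v \<in> vspace n \<Longrightarrow> d2 P v \<in> hspace (n + 1)"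
proof -
  show "d0 P p \<in> vspace (n + 1)" if "p \<in> hspace n"
  proof -
    have "hcomp n p = p" using that by (simp add: hspace_def hcomp_self)
    then have "homog (n + 1) (d0 P p i)" for i using homog_hcomp[of "n + 1" "d0 P p i"] unfolding hcomp_d by simp
    then show ?thesis by (simp add: vspace_def)
  qed
  have e: "(\<lambda>i. hcomp n (v i)) = v" if "v \<in> vspace n" for v
    using that by (simp add: vspace_def fun_eq_iff hcomp_self)
  show "d1 P v \<in> vspace (n + 1)" if "v \<in> vspace n"
  proof -
    have "homog (n + 1) (d1 P v i)" for i using homog_hcomp[of "n + 1" "d1 P v i"] unfolding hcomp_d e[OF that] .
    then show ?thesis by (simp add: vspace_def)
  qed
  show "d2 P v \<in> hspace (n + 1)" if "v \<in> vspace n"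
  proof -
    show ?thesis using homog_hcomp[of "n + 1" "d2 P v"] unfolding hcomp_d e[OF that] hspace_def by simp
  qed
qed

text \<open>A coboundary of given degree may come from an inhomogeneous cochain; the differentials
  respect components, so the homogeneous component has the same image.\<close>

lemma d_images:
  "{d0 P p | p. d0 P p \<in> vspace (n + 1)} = d0 P ` hspace n"
  "{d1 P v | v. d1 P v \<in> vspace (n + 1)} = d1 P ` vspace n"
  "{d2 P v | v. d2 P v \<in> hspace (n + 1)} = d2 P ` vspace n"
proof -
  have "d0 P p = d0 P (hcomp n p)" if "d0 P p \<in> vspace (n + 1)" for p
    using that hcomp_self[of "n + 1" "d0 P p _"] by (simp add: vspace_def hcomp_d fun_eq_iff)
  moreover have "hcomp n p \<in> hspace n" for p :: "'k poly3" by (simp add: hspace_def)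
  ultimately show "{d0 P p | p. d0 P p \<in> vspace (n + 1)} = d0 P ` hspace n"
    using d_maps(1) by blast
  have "d1 P v = d1 P (\<lambda>i. hcomp n (v i))" if "d1 P v \<in> vspace (n + 1)" for v
    using that hcomp_self[of "n + 1" "d1 P v _"] by (simp add: vspace_def hcomp_d fun_eq_iff)
  moreover have "(\<lambda>i. hcomp n (v i)) \<in> vspace n" for v :: "3 \<Rightarrow> 'k poly3" by (simp add: vspace_def)
  ultimately show "{d1 P v | v. d1 P v \<in> vspace (n + 1)} = d1 P ` vspace n"
    using d_maps(2) by blast
  have "d2 P v = d2 P (\<lambda>i. hcomp n (v i))" if "d2 P v \<in> hspace (n + 1)" for v
    using that hcomp_self[of "n + 1" "d2 P v"] by (simp add: hspace_def hcomp_d)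
  moreover have "(\<lambda>i. hcomp n (v i)) \<in> vspace n" for v :: "3 \<Rightarrow> 'k poly3" by (simp add: vspace_def)
  ultimately show "{d2 P v | v. d2 P v \<in> hspace (n + 1)} = d2 P ` vspace n"
    using d_maps(3) by blast
qed

lemma cocycles_eq:
  "cocycles (biv P) 1 n = coc1 ` {v \<in> vspace (n + 1). d1 P v = 0}"
  "cocycles (biv P) 2 n = coc2 ` {v \<in> vspace (n + 2). d2 P v = 0}"
  "cocycles (biv P) 3 n = coc3 ` hspace (n + 3)"
proof -
  have "coc2 0 = (0 :: 'k poly3 list \<Rightarrow> _)" "coc3 0 = (0 :: 'k poly3 list \<Rightarrow> _)"
    by (simp_all add: fun_eq_iff coc2_def coc3_def biv_expand)
  then have z: "coc2 v = 0 \<longleftrightarrow> v = 0" "coc3 p = 0 \<longleftrightarrow> p = 0" for v :: "3 \<Rightarrow> 'k poly3" and p :: "'k poly3"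
    using coc_injective(2)[of v] coc_injective(3)[of p] by auto
  show "cocycles (biv P) 1 n = coc1 ` {v \<in> vspace (n + 1). d1 P v = 0}"
    unfolding cocycles_def multiderivation_1
    by (auto simp: z poisson_diff_coc[unfolded One_nat_def] poisson_diff_coc multi_degree_coc simp del: One_nat_def)
  show "cocycles (biv P) 2 n = coc2 ` {v \<in> vspace (n + 2). d2 P v = 0}"
    unfolding cocycles_def multiderivation_2
    by (auto simp: z poisson_diff_coc multi_degree_coc)
  show "cocycles (biv P) 3 n = coc3 ` hspace (n + 3)"
    unfolding cocycles_def multiderivation_3
    by (auto simp: poisson_diff_3 multi_degree_coc)
qed

lemma coboundaries_eq:
  "coboundaries (biv P) 1 n = coc1 ` d0 P ` hspace n"
  "coboundaries (biv P) 2 n = coc2 ` d1 P ` vspace (n + 1)"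
  "coboundaries (biv P) 3 n = coc3 ` d2 P ` vspace (n + 2)"
proof -
  have S: "coboundaries (biv P) 1 n = {poisson_diff (biv P) 0 R | R. multiderivation 0 R} \<inter> {Q. multi_degree n Q}"
    "coboundaries (biv P) 2 n = {poisson_diff (biv P) 1 R | R. multiderivation 1 R} \<inter> {Q. multi_degree n Q}"
    "coboundaries (biv P) 3 n = {poisson_diff (biv P) 2 R | R. multiderivation 2 R} \<inter> {Q. multi_degree n Q}"
    using coboundaries.simps(2)[of "biv P" 0 n] coboundaries.simps(2)[of "biv P" 1 n] coboundaries.simps(2)[of "biv P" 2 n]
    by (simp_all add: numeral_eq_Suc)
  have img: "{f R | R. \<exists>p. R = g p} \<inter> {Q. multi_degree n Q} = c ` {d p | p. d p \<in> V}"
    if e: "\<And>p. f (g p) = c (d p)" "\<And>v. multi_degree n (c v) \<longleftrightarrow> v \<in> V"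
    for f :: "('k poly3 list \<Rightarrow> 'k poly3) \<Rightarrow> 'k poly3 list \<Rightarrow> 'k poly3" and g c d V
  proof (intro set_eqI iffI)
    fix Q assume "Q \<in> {f R | R. \<exists>p. R = g p} \<inter> {Q. multi_degree n Q}"
    then obtain p where "Q = c (d p)" "multi_degree n Q" using e(1) by auto
    then show "Q \<in> c ` {d p | p. d p \<in> V}" using e(2) by auto
  next
    fix Q assume "Q \<in> c ` {d p | p. d p \<in> V}"
    then obtain p where "Q = f (g p)" "multi_degree n Q" using e by auto
    then show "Q \<in> {f R | R. \<exists>p. R = g p} \<inter> {Q. multi_degree n Q}" by blast
  qed
  show "coboundaries (biv P) 1 n = coc1 ` d0 P ` hspace n"
    unfolding S multiderivation_0 by (subst d_images[symmetric], rule img) (rule poisson_diff_coc multi_degree_coc)+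
  show "coboundaries (biv P) 2 n = coc2 ` d1 P ` vspace (n + 1)"
    unfolding S multiderivation_1
    by (subst d_images[symmetric], rule img) (simp_all only: poisson_diff_coc multi_degree_coc add.assoc one_add_one)
  show "coboundaries (biv P) 3 n = coc3 ` d2 P ` vspace (n + 2)"
    unfolding S multiderivation_2
    by (subst d_images[symmetric], rule img) (simp_all add: poisson_diff_coc multi_degree_coc add.assoc)
qed

definition zdim :: "int \<Rightarrow> nat" where
  "zdim n = vector_space.dim smult3 {z \<in> poisson_center (biv P). homog n z}"

definition kdim :: "int \<Rightarrow> nat" where
  "kdim n = vector_space.dim smult_fun {v \<in> vspace (n + 1). d1 P v = 0}"

definition ph :: "nat \<Rightarrow> int \<Rightarrow> nat" where
  "ph q n = quotient_dim smult_fun (cocycles (biv P) q n) (coboundaries (biv P) q n)"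

lemma center_kernel: "{z \<in> poisson_center (biv P). homog n z} = {p \<in> hspace n. d0 P p = 0}"
  by (auto simp: poisson_center_biv hspace_def d0_def fun_eq_iff)

lemma dim_d0: "adim n = zdim n + vector_space.dim smult_fun (d0 P ` hspace n)"
  using rank_nullity[OF d_linear(1)[of P] fin_sub_hspace[of n]] by (simp add: dim_hspace zdim_def center_kernel)

lemma fin_sub_kernel1: "fin_sub smult_fun {v \<in> vspace n. d1 P v = 0}"
  by (rule fin_sub_kernel[OF d_linear(2) fin_sub_vspace])

lemma fin_sub_kernel2: "fin_sub smult_fun {v \<in> vspace n. d2 P v = 0}"
  by (rule fin_sub_kernel[OF d_linear(3) fin_sub_vspace])

lemma fin_sub_subspace: "fin_sub smult_fun V \<Longrightarrow> module.subspace smult_fun V"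
  by (simp add: fin_sub_def)

lemma ph1: "ph 1 n + adim n = kdim n + zdim n"
proof -
  let ?K = "{v \<in> vspace (n + 1). d1 P v = 0}" and ?I = "d0 P ` hspace n"
  have K: "fin_sub smult_fun (coc1 ` ?K)" by (rule fin_sub_image[OF d_linear(4) fin_sub_kernel1])
  have I: "fin_sub smult_fun ?I" by (rule fin_sub_image[OF d_linear(1) fin_sub_hspace])
  have sub: "coc1 ` ?I \<subseteq> coc1 ` ?K" using d_maps(1) d1_d0[OF jacobi] by auto
  have "ph 1 n + VF.dim (coc1 ` ?I) = VF.dim (coc1 ` ?K)"
    unfolding ph_def cocycles_eq coboundaries_eq
    by (rule VF.quotient_dim_eq[OF K fin_sub_subspace[OF fin_sub_image[OF d_linear(4) I]] sub])
  moreover have "VF.dim (coc1 ` ?I) = VF.dim ?I" by (rule dim_image_injective[OF d_linear(4) I coc_injective(1)])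
  moreover have "VF.dim (coc1 ` ?K) = VF.dim ?K" by (rule dim_image_injective[OF d_linear(4) fin_sub_kernel1 coc_injective(1)])
  ultimately show ?thesis using dim_d0[of n] by (simp add: kdim_def)
qed

lemma ph2: "ph 2 n + VF.dim (d1 P ` vspace (n + 1)) = VF.dim {v \<in> vspace (n + 2). d2 P v = 0}"
proof -
  let ?K = "{v \<in> vspace (n + 2). d2 P v = 0}" and ?I = "d1 P ` vspace (n + 1)"
  have K: "fin_sub smult_fun (coc2 ` ?K)" by (rule fin_sub_image[OF d_linear(5) fin_sub_kernel2])
  have I: "fin_sub smult_fun ?I" by (rule fin_sub_image[OF d_linear(2) fin_sub_vspace])
  have "?I \<subseteq> ?K" using d_maps(2)[of _ "n + 1"] d2_d1[OF jacobi] by (auto simp: add.assoc)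
  then have sub: "coc2 ` ?I \<subseteq> coc2 ` ?K" by (rule image_mono)
  have "ph 2 n + VF.dim (coc2 ` ?I) = VF.dim (coc2 ` ?K)"
    unfolding ph_def cocycles_eq coboundaries_eq
    by (rule VF.quotient_dim_eq[OF K fin_sub_subspace[OF fin_sub_image[OF d_linear(5) I]] sub])
  moreover have "VF.dim (coc2 ` ?I) = VF.dim ?I" by (rule dim_image_injective[OF d_linear(5) I coc_injective(2)])
  moreover have "VF.dim (coc2 ` ?K) = VF.dim ?K" by (rule dim_image_injective[OF d_linear(5) fin_sub_kernel2 coc_injective(2)])
  ultimately show ?thesis by simp
qed

lemma ph3: "ph 3 n + V3.dim (d2 P ` vspace (n + 2)) = adim (n + 3)"
proof -
  let ?K = "hspace (n + 3) :: 'k poly3 set" and ?I = "d2 P ` vspace (n + 2)"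
  have K: "fin_sub smult_fun (coc3 ` ?K)" by (rule fin_sub_image[OF d_linear(6) fin_sub_hspace])
  have I: "fin_sub smult3 ?I" by (rule fin_sub_image[OF d_linear(3) fin_sub_vspace])
  have "?I \<subseteq> ?K" using d_maps(3)[of _ "n + 2"] by (auto simp: add.assoc)
  then have sub: "coc3 ` ?I \<subseteq> coc3 ` ?K" by (rule image_mono)
  have "ph 3 n + VF.dim (coc3 ` ?I) = VF.dim (coc3 ` ?K)"
    unfolding ph_def cocycles_eq coboundaries_eq
    by (rule VF.quotient_dim_eq[OF K fin_sub_subspace[OF fin_sub_image[OF d_linear(6) I]] sub])
  moreover have "VF.dim (coc3 ` ?I) = V3.dim ?I" by (rule dim_image_injective[OF d_linear(6) I coc_injective(3)])
  moreover have "VF.dim (coc3 ` ?K) = V3.dim ?K" by (rule dim_image_injective[OF d_linear(6) fin_sub_hspace coc_injective(3)])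
  ultimately show ?thesis by (simp add: dim_hspace)
qed

lemma euler_characteristic:
  "int (ph 3 n) - int (ph 2 n) = (if n = - 3 then 1 else 0) + int (zdim n) - int (ph 1 n)"
proof -
  have "3 * adim (n + 2) = VF.dim {v \<in> vspace (n + 2). d2 P v = 0} + V3.dim (d2 P ` vspace (n + 2))"
    using rank_nullity[OF d_linear(3)[of P] fin_sub_vspace[of "n + 2"]] by (simp add: dim_vspace)
  moreover have "3 * adim (n + 1) = kdim n + VF.dim (d1 P ` vspace (n + 1))"
    using rank_nullity[OF d_linear(2)[of P] fin_sub_vspace[of "n + 1"]] by (simp add: dim_vspace kdim_def)
  ultimately show ?thesis
    using ph1[of n] ph2[of n] ph3[of n] adim_third_difference[of n] by linarith
qed

lemma dim_poisson_derivations: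
  "vector_space.dim smult_fun {\<phi>. poisson_derivation (biv P) \<phi> \<and> map_degree n \<phi>} = kdim n"
proof -
  have "{\<phi>. poisson_derivation (biv P) \<phi> \<and> map_degree n \<phi>} = vf ` {v \<in> vspace (n + 1). d1 P v = 0}"
  proof (intro set_eqI iffI)
    fix \<phi> assume p: "\<phi> \<in> {\<phi>. poisson_derivation (biv P) \<phi> \<and> map_degree n \<phi>}"
    then have d: "derivation \<phi>" by (simp add: poisson_derivation_def)
    obtain v where v: "\<phi> = vf v" using derivation_eq_vf[OF d] by blast
    have "v \<in> {v \<in> vspace (n + 1). d1 P v = 0}"
      using p unfolding v by (simp add: poisson_derivation_vf map_degree_vf vspace_def d1_def fun_eq_iff)
    then show "\<phi> \<in> vf ` {v \<in> vspace (n + 1). d1 P v = 0}" unfolding v by (rule imageI)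
  next
    fix \<phi> assume "\<phi> \<in> vf ` {v \<in> vspace (n + 1). d1 P v = 0}"
    then show "\<phi> \<in> {\<phi>. poisson_derivation (biv P) \<phi> \<and> map_degree n \<phi>}"
      by (auto simp: poisson_derivation_vf map_degree_vf vspace_def d1_def fun_eq_iff)
  qed
  then show ?thesis
    unfolding kdim_def using dim_image_injective[OF d_linear(7) fin_sub_kernel1 coc_injective(4)] by simp
qed

lemma zdim_0: "zdim 0 = 1"
proof -
  have "d0 P p = 0" if "p \<in> hspace 0" for p
    using homog_0_cst[of p] that by (simp add: hspace_def fun_eq_iff d0_def cross_def grad_def) (metis pd_cst mult_zero_right)
  then have "{p \<in> hspace 0. d0 P p = 0} = (hspace 0 :: 'k poly3 set)" by blast
  then show ?thesis by (simp add: zdim_def center_kernel dim_hspace adim_def)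
qed

text \<open>The bracket is quadratic, so the Euler field is a Poisson derivation of degree 0, and a
  one-dimensional space containing it consists of its multiples.\<close>

lemma kdim_0_imp_deg0_scalar:
  assumes "kdim 0 = 1" shows "deg0_scalar P"
proof -
  let ?K = "{v \<in> vspace 1. d1 P v = 0}"
  obtain B where B: "B \<subseteq> ?K" "VF.independent B" "?K \<subseteq> VF.span B" "card B = VF.dim ?K"
    using VF.basis_exists[of ?K] .
  moreover have "VF.dim ?K = 1" using assms by (simp add: kdim_def)
  ultimately have "card B = 1" by simp
  then obtain b where b: "B = {b}" by (metis card_1_singletonE)
  have sp: "\<exists>c. v = smult_fun c b" if "v \<in> ?K" for v
    using that B(3) b by (auto simp: VF.span_singleton)
  have "lie X P k = 0" for k
  proof -
    have "X 1 * pd 1 (P k) + X 2 * pd 2 (P k) + X 3 * pd 3 (P k) = 2 * P k" using euler_homog[OF h] by simp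
    then show ?thesis using exhaust_3[of k] by (auto simp: lie_def vf_def dv_def dot_def algebra_simps)
  qed
  then have "X \<in> ?K" by (simp add: vspace_def d1_def fun_eq_iff)
  then obtain c where c: "X = smult_fun c b" using sp by blast
  have "c \<noteq> 0"
  proof
    assume "c = 0"
    then have "X 1 = (0 :: 'k poly3)" using fun_cong[OF c, of 1] by (simp add: smult_fun_cst)
    then show False by simp
  qed
  show ?thesis
    unfolding deg0_scalar_def
  proof (intro allI impI)
    fix v assume "\<forall>i. homog 1 (v i)" "\<forall>k. lie v P k = 0"
    then have "v \<in> ?K" by (simp add: vspace_def d1_def fun_eq_iff)
    then obtain c' where c': "v = smult_fun c' b" using sp by blast
    have "v i = cst (c' / c) * X i" for i
    proof -
      have "X i = cst c * b i" using fun_cong[OF c, of i] by (simp add: smult_fun_cst)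
      moreover have "cst (c' / c) * cst c = cst c'" using \<open>c \<noteq> 0\<close> by (simp flip: cst_simps(6))
      ultimately show ?thesis using c' by (simp add: smult_fun_cst mult.assoc[symmetric])
    qed
    then show "\<exists>c. \<forall>i. v i = cst c * X i" by blast
  qed
qed

text \<open>In degree 0 the constants are the center and no Hamiltonian field is nonzero, so
  \<open>ph 1 0\<close> is the dimension of the Poisson derivations of degree 0.\<close>

lemma ph1_0_imp_rigid: "ph 1 0 = 1 \<Longrightarrow> rigid P"
  using ph1[of 0] zdim_0 kdim_0_imp_deg0_scalar deg0_scalar_iff_rigid[of P] h jacobi by (simp add: adim_def)

end

text \<open>The Euler field is a Poisson derivation, and the terms in the derivatives of
  \<open>z\<close> cancel since \<open>grad z\<close> is parallel to \<open>P\<close>.\<close>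

lemma lie_central_euler:
  fixes P :: "3 \<Rightarrow> 'k::field_char_0 poly3"
  assumes h: "\<And>i. homog 2 (P i)" and z: "d0 P z = 0"
  shows "lie (\<lambda>i. z * X i) P k = 0"
proof -
  have e: "z * (X 1 * pd 1 (P k) + X 2 * pd 2 (P k) + X 3 * pd 3 (P k)) = z * (2 * P k)"
    using euler_homog[OF h, of k] by simp
  have c: "P 2 * pd 3 z = P 3 * pd 2 z" "P 3 * pd 1 z = P 1 * pd 3 z" "P 1 * pd 2 z = P 2 * pd 1 z"
    using fun_cong[OF z, of 1] fun_cong[OF z, of 2] fun_cong[OF z, of 3] by (simp_all add: d0_def vec_defs)
  have x: "X j * (P i * pd l z) = X j * (P l * pd i z)" for i j l
    using exhaust_3[of i] exhaust_3[of l] c by (elim disjE) (simp_all add: c)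
  have "lie (\<lambda>i. z * X i) P k = z * (X 1 * pd 1 (P k) + X 2 * pd 2 (P k) + X 3 * pd 3 (P k)) - z * (2 * P k)
      + (X 1 * (P 1 * pd k z) - X 1 * (P k * pd 1 z)) + (X 2 * (P 2 * pd k z) - X 2 * (P k * pd 2 z))
      + (X 3 * (P 3 * pd k z) - X 3 * (P k * pd 3 z))"
    using exhaust_3[of k] by (elim disjE) (simp_all add: lie_def vec_defs algebra_simps)
  also have "\<dots> = 0" unfolding e x[of _ k 1] x[of _ k 2] x[of _ k 3] by simp
  finally show ?thesis .
qed

section \<open>Dimensions for a rigid bracket\<close>

context
  fixes P :: "3 \<Rightarrow> 'k::{alg_closed_field, field_char_0} poly3"
  assumes h: "\<And>i. homog 2 (P i)" and jacobi: "dot P (curl P) = 0" and rigid: "rigid P"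
begin

lemma potential: "homog 3 (pot P)" "pot P \<noteq> 0" "P = grad (pot P)"
  using homog_pot[of P, OF h] rigid_irreducible[OF h rigid] rigid_grad[OF h jacobi rigid] by (auto simp: irreducible_def)

lemma homog_decomposition:
  assumes v: "v \<in> vspace (n + 1)" "d1 P v = 0"
  obtains z a where "homog n z" "d0 P z = 0" "v = (\<lambda>i. z * X i + d0 P a i)"
proof -
  have "\<forall>k. lie v P k = 0" using fun_cong[OF v(2)] by (simp add: d1_def)
  then obtain z a where z: "z \<in> poisson_center (biv P)" and va: "\<forall>i. v i = z * X i + cross P (grad a) i"
    using rigid rigid_iff_decomposes[OF h jacobi] unfolding decomposes_def by blast
  have "d0 P z = 0" using z by (simp add: poisson_center_biv d0_def fun_eq_iff)
  moreover have "d0 P (hcomp n z) i = hcomp (n + 1) (d0 P z i)" for i using hcomp_d(1)[OF h jacobi] by simp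
  ultimately have 1: "d0 P (hcomp n z) = 0" by (simp add: fun_eq_iff)
  have "v i = hcomp n z * X i + d0 P (hcomp n (- a)) i" for i
  proof -
    have "v i = z * X i + d0 P (- a) i" using va by (simp add: d0_def vec_defs algebra_simps)
    then have "hcomp (n + 1) (v i) = hcomp (n + 1) (z * X i) + d0 P (hcomp n (- a)) i"
      using hcomp_d(1)[OF h jacobi, of n "- a" i] by simp
    moreover have "hcomp (n + 1) (z * X i) = hcomp n z * X i"
      using hcomp_mult[OF homog_X, of "n + 1" i z] by (simp add: mult.commute)
    ultimately show ?thesis using v(1) by (simp add: vspace_def hcomp_self)
  qed
  then show ?thesis using that[of "hcomp n z" "hcomp n (- a)"] 1 by (simp add: fun_eq_iff)
qed

lemma vf_decomposition: "vf (\<lambda>i. z * X i + d0 P a i) (pot P) = 3 * pot P * z"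
proof -
  have "z * (X 1 * pd 1 (pot P) + X 2 * pd 2 (pot P) + X 3 * pd 3 (pot P)) = z * (3 * pot P)"
    using euler_homog[OF potential(1)] by simp
  moreover have "P i = pd i (pot P)" for i using fun_cong[OF potential(3), of i] by (simp add: grad_def)
  ultimately show ?thesis by (simp add: d0_def vec_defs algebra_simps)
qed

text \<open>Evaluate Poisson derivations of degree \<open>n\<close> on \<open>pot P\<close>. The
  kernel consists of the Hamiltonian ones, of dimension \<open>adim n\<close> minus that of the
  center, and the image is \<open>3 * pot P\<close> times the center, so the center cancels.\<close>

lemma kdim_rigid: "kdim P n = adim n"
proof -
  let ?K = "{v \<in> vspace (n + 1). d1 P v = 0}" and ?Z = "{p \<in> hspace n. d0 P p = 0}"
  let ?f = "\<lambda>v. vf v (pot P)" and ?g = "\<lambda>z. 3 * pot P * z"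
  have lf: "Vector_Spaces.linear smult_fun smult3 ?f"
    by (simp add: linear_fun_smult3_iff vf_def smult_fun_cst smult3_cst algebra_simps)
  have lg: "Vector_Spaces.linear smult3 smult3 ?g"
    by (simp add: Vector_Spaces.linear_iff vector_space_smult3 smult3_cst algebra_simps)
  have "{v \<in> ?K. ?f v = 0} = d0 P ` hspace n"
  proof (intro set_eqI iffI)
    fix v assume v: "v \<in> {v \<in> ?K. ?f v = 0}"
    then obtain z a where za: "v = (\<lambda>i. z * X i + d0 P a i)" using homog_decomposition[of v n] by blast
    have "?f v = 0" using v by blast
    then have "3 * pot P * z = 0" unfolding za vf_decomposition .
    then have "v = d0 P a" using potential(2) za by simp
    then show "v \<in> d0 P ` hspace n" using v unfolding d_images(1)[OF h jacobi, of n, symmetric] by blast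
  next
    fix v assume "v \<in> d0 P ` hspace n"
    then obtain a where a: "a \<in> hspace n" "v = d0 P a" by blast
    then show "v \<in> {v \<in> ?K. ?f v = 0}"
      using d_maps(1)[OF h jacobi a(1)] d1_d0[OF jacobi, of a] vf_decomposition[of 0 a] by simp
  qed
  moreover have "?f ` ?K = ?g ` ?Z"
  proof (intro set_eqI iffI)
    fix p assume "p \<in> ?f ` ?K"
    then obtain v where v: "v \<in> ?K" "p = ?f v" by blast
    then obtain z a where za: "homog n z" "d0 P z = 0" "v = (\<lambda>i. z * X i + d0 P a i)"
      using homog_decomposition[of v n] by blast
    then show "p \<in> ?g ` ?Z" using vf_decomposition[of z a] v(2) by (auto simp: hspace_def)
  next
    fix p assume "p \<in> ?g ` ?Z"
    then obtain z where z: "homog n z" "d0 P z = 0" "p = 3 * pot P * z" by (auto simp: hspace_def)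
    have "d0 P 0 = 0" by (simp add: fun_eq_iff d0_def vec_defs)
    then have "p = ?f (\<lambda>i. z * X i)" using vf_decomposition[of z 0] z(3) by simp
    moreover have "(\<lambda>i. z * X i) \<in> ?K"
      using lie_central_euler[OF h z(2)] homog_mult[OF z(1) homog_X] by (simp add: vspace_def d1_def fun_eq_iff)
    ultimately show "p \<in> ?f ` ?K" by blast
  qed
  moreover have "V3.dim (?g ` ?Z) = V3.dim ?Z"
    by (rule dim_image_injective[OF lg fin_sub_kernel[OF d_linear(1) fin_sub_hspace]]) (simp add: potential(2))
  ultimately show ?thesis
    using rank_nullity[OF lf fin_sub_kernel1[OF h jacobi, of "n + 1"]] dim_d0[OF h jacobi, of n]
    by (simp add: kdim_def[OF h jacobi] zdim_def[OF h jacobi] center_kernel[OF h jacobi])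
qed

lemma central_power:
  assumes "homog n p" "d0 P p = 0" "p \<noteq> 0"
  obtains k c where "n = 3 * int k" "p = cst c * pot P ^ k"
proof -
  have "\<forall>i. cross P (grad p) i = 0" using assms(2) by (simp add: d0_def fun_eq_iff)
  then have "\<forall>i. cross (grad (pot P)) (grad p) i = 0" unfolding potential(3)[symmetric] .
  then show ?thesis
    using that assms(1,3) irreducible_cubic(2)[OF potential(1) rigid_irreducible[OF h rigid]]
    unfolding center_powers_def by blast
qed

lemma zdim_rigid: "zdim P n = (if 0 \<le> n \<and> 3 dvd n then 1 else 0)"
proof (cases "0 \<le> n \<and> 3 dvd n")
  case True
  then obtain k where n: "n = 3 * int k" by (metis dvd_def nat_0_le zero_le_mult_iff zero_less_numeral not_less order_less_imp_le)
  have "{p \<in> hspace n. d0 P p = 0} = V3.span {pot P ^ k}"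
    unfolding V3.span_singleton smult3_cst
  proof (intro set_eqI iffI)
    fix p assume p: "p \<in> {p \<in> hspace n. d0 P p = 0}"
    show "p \<in> range (\<lambda>c. cst c * pot P ^ k)"
    proof (cases "p = 0")
      case True
      then have "p = cst 0 * pot P ^ k" by simp
      then show ?thesis by blast
    next
      case False
      then obtain l c where l: "n = 3 * int l" "p = cst c * pot P ^ l" using central_power[of n p] p by (auto simp: hspace_def)
      then show ?thesis using n by auto
    qed
  next
    fix p assume "p \<in> range (\<lambda>c. cst c * pot P ^ k)"
    then obtain c where c: "p = cst c * pot P ^ k" by blast
    have "pot P ^ k \<in> poisson_center (biv P)" using power_in_center[of "pot P" k] potential(3) by simp
    then have "p \<in> poisson_center (biv P)" unfolding c by (rule poisson_center_cst_mult)
    moreover have "homog n p" unfolding c n using homog_cst_mult[OF homog_power[OF potential(1), of k]] by (simp add: mult.commute)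
    ultimately show "p \<in> {p \<in> hspace n. d0 P p = 0}" by (simp add: hspace_def poisson_center_biv d0_def fun_eq_iff)
  qed
  then show ?thesis using True potential(2) V3.dim_unique[of "{pot P ^ k}" "V3.span {pot P ^ k}" 1]
    by (simp add: zdim_def[OF h jacobi] center_kernel[OF h jacobi] V3.span_superset)
next
  case False
  have "p = 0" if p: "p \<in> {p \<in> hspace n. d0 P p = 0}" for p
  proof (rule ccontr)
    assume "p \<noteq> 0"
    then obtain l where "n = 3 * int l" using central_power[of n p] p by (auto simp: hspace_def)
    then show False using False by simp
  qed
  moreover have "0 \<in> {p \<in> hspace n. d0 P p = 0}" by (simp add: hspace_def fun_eq_iff d0_def vec_defs)
  ultimately have "{p \<in> hspace n. d0 P p = 0} = {0}" by blast
  then show ?thesis using False dim_0[OF vector_space_smult3]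
    by (auto simp: zdim_def[OF h jacobi] center_kernel[OF h jacobi])
qed

end

section \<open>From dimensions to Hilbert series\<close>

text \<open>The bound -3 is the degree of a trivector with constant coefficient, the lowest in the
  complex; \<open>Abs_fls\<close> needs such a bound.\<close>

lemma nth_hilbert_series: "(\<And>n. n < - 3 \<Longrightarrow> d n = 0) \<Longrightarrow> fls_nth (hilbert_series d) n = of_nat (d n)"
  unfolding hilbert_series_def by (rule nth_Abs_fls_lower_bound[of "- 3"]) simp

lemma hilbert_series_eq_iff:
  assumes "\<And>n. n < - 3 \<Longrightarrow> d n = 0" "\<And>n. n < - 3 \<Longrightarrow> e n = 0"
  shows "hilbert_series d = hilbert_series e \<longleftrightarrow> (\<forall>n. d n = e n)"
  using nth_hilbert_series[of d, OF assms(1)] nth_hilbert_series[of e, OF assms(2)]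
  by (auto simp: fls_eq_iff)

lemma one_minus_fls_X_power: "1 - fls_X ^ Suc n \<noteq> (0 :: rat fls)"
proof
  assume "1 - fls_X ^ Suc n = (0 :: rat fls)"
  then have "fls_nth (1 - fls_X ^ Suc n) 0 = (0 :: rat)" by simp
  then show False by (simp del: power_Suc)
qed

lemma hilbert_series_adim: "hilbert_series adim = 1 / (1 - fls_X) ^ 3"
proof -
  have s: "fls_nth ((1 - fls_X) * f) n = fls_nth f n - fls_nth f (n - 1)" for f :: "rat fls" and n
    by (simp add: left_diff_distrib fls_X_times_conv_shift)
  have a: "fls_nth (hilbert_series adim) n = of_int (int (adim n))" for n
    by (subst nth_hilbert_series) (simp_all add: adim_def)
  have "(1 - fls_X) ^ 3 * hilbert_series adim = 1"
  proof (rule fls_eqI)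
    fix n
    have "fls_nth ((1 - fls_X) ^ 3 * hilbert_series adim) n
        = of_int (int (adim (n - 3 + 3)) - 3 * int (adim (n - 3 + 2)) + 3 * int (adim (n - 3 + 1)) - int (adim (n - 3)))"
      by (simp add: power3_eq_cube mult.assoc s a)
    also have "\<dots> = of_int (if n = 0 then 1 else 0)" unfolding adim_third_difference by simp
    finally show "fls_nth ((1 - fls_X) ^ 3 * hilbert_series adim) n = fls_nth 1 n" by simp
  qed
  then show ?thesis using one_minus_fls_X_power[of 0] by (simp add: field_simps)
qed

lemma hilbert_series_multiples:
  "hilbert_series (\<lambda>n. if 0 \<le> n \<and> 3 dvd n then 1 else 0) = 1 / (1 - fls_X ^ 3)"
    (is "?h = _")
proof -
  have a: "fls_nth ?h n = (if 0 \<le> n \<and> 3 dvd n then 1 else 0)" for n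
    by (subst nth_hilbert_series) simp_all
  have "(1 - fls_X ^ 3) * ?h = 1"
  proof (rule fls_eqI)
    fix n :: int
    have "fls_nth ((1 - fls_X ^ 3) * ?h) n = fls_nth ?h n - fls_nth ?h (n - 3)"
      by (simp add: left_diff_distrib fls_X_power_conv_shift_1 fls_shifted_times_simps)
    also have "\<dots> = fls_nth 1 n"
      unfolding a using dvd_imp_le_int[of n 3] by (auto; presburger)
    finally show "fls_nth ((1 - fls_X ^ 3) * ?h) n = fls_nth 1 n" .
  qed
  then show ?thesis using one_minus_fls_X_power[of 2] by (simp add: field_simps)
qed

context
  fixes P :: "3 \<Rightarrow> 'k::{alg_closed_field, field_char_0} poly3"
  assumes h: "\<And>i. homog 2 (P i)" and jacobi: "dot P (curl P) = 0"
begin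

lemma dims_vanish:
  assumes "n < - 3"
  shows "zdim P n = 0" "kdim P n = 0" "ph P 1 n = 0" "ph P 2 n = 0" "ph P 3 n = 0"
proof -
  show "zdim P n = 0" using dim_d0[OF h jacobi, of n] assms by (simp add: adim_def)
  moreover show k: "kdim P n = 0"
    using rank_nullity[OF d_linear(2)[of P] fin_sub_vspace[of "n + 1"]] assms
    by (simp add: dim_vspace kdim_def[OF h jacobi] adim_def)
  ultimately show "ph P 1 n = 0" using ph1[OF h jacobi, of n] by simp
  show "ph P 2 n = 0"
    using rank_nullity[OF d_linear(3)[of P] fin_sub_vspace[of "n + 2"]] ph2[OF h jacobi, of n] assms
    by (simp add: dim_vspace adim_def)
  show "ph P 3 n = 0" using ph3[OF h jacobi, of n] assms by (simp add: adim_def)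
qed

lemma hilbert_biv:
  "hilbert_PH (biv P) q = hilbert_series (ph P q)"
  "hilbert_center (biv P) = hilbert_series (zdim P)"
  "hilbert_poisson_derivations (biv P) = hilbert_series (kdim P)"
  unfolding hilbert_PH_def hilbert_center_def hilbert_poisson_derivations_def
  using dim_poisson_derivations[OF h jacobi] by (simp_all add: ph_def[OF h jacobi, abs_def] zdim_def[OF h jacobi, abs_def])

text \<open>By \<open>ph1\<close> the condition says that the Poisson derivations have the
  dimensions of the polynomial ring. Its case \<open>n = 0\<close> already gives rigidity.\<close>

lemma rigid_iff_ph1: "rigid P \<longleftrightarrow> (\<forall>n. ph P 1 n = zdim P n)"
proof
  assume "rigid P"
  then show "\<forall>n. ph P 1 n = zdim P n" using ph1[OF h jacobi] kdim_rigid[OF h jacobi] by simp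
next
  assume "\<forall>n. ph P 1 n = zdim P n"
  then show "rigid P" using ph1_0_imp_rigid[OF h jacobi] zdim_0[OF h jacobi] by simp
qed

lemma rigid_iff_hilbert_center: "rigid P \<longleftrightarrow> hilbert_PH (biv P) 1 = hilbert_center (biv P)"
  unfolding rigid_iff_ph1 hilbert_biv by (rule hilbert_series_eq_iff[symmetric]) (simp_all only: dims_vanish)

lemma rigid_iff_hilbert_derivations: "rigid P \<longleftrightarrow> hilbert_poisson_derivations (biv P) = 1 / (1 - fls_X) ^ 3"
proof -
  have "rigid P \<longleftrightarrow> (\<forall>n. kdim P n = adim n)"
    unfolding rigid_iff_ph1 using ph1[OF h jacobi] by (metis add.commute add_left_cancel)
  also have "\<dots> \<longleftrightarrow> hilbert_series (kdim P) = hilbert_series adim"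
    by (rule hilbert_series_eq_iff[symmetric]) (simp_all add: dims_vanish adim_def)
  finally show ?thesis unfolding hilbert_biv hilbert_series_adim .
qed

lemma rigid_iff_hilbert_PH1: "rigid P \<longleftrightarrow> hilbert_PH (biv P) 1 = 1 / (1 - fls_X ^ 3)"
proof -
  have e: "hilbert_PH (biv P) 1 = 1 / (1 - fls_X ^ 3) \<longleftrightarrow> (\<forall>n. ph P 1 n = (if 0 \<le> n \<and> 3 dvd n then 1 else 0))"
    unfolding hilbert_biv hilbert_series_multiples[symmetric]
    by (rule hilbert_series_eq_iff) (simp_all add: dims_vanish del: One_nat_def)
  show ?thesis
  proof
    assume "rigid P"
    then show "hilbert_PH (biv P) 1 = 1 / (1 - fls_X ^ 3)"
      unfolding e using zdim_rigid[OF h jacobi] rigid_iff_ph1 by simp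
  next
    assume "hilbert_PH (biv P) 1 = 1 / (1 - fls_X ^ 3)"
    then have "ph P 1 0 = 1" unfolding e by simp
    then show "rigid P" by (rule ph1_0_imp_rigid[OF h jacobi])
  qed
qed

text \<open>By the Euler characteristic, each coefficient of the left side differs from that of t^-3
  by \<open>zdim P n - ph P 1 n\<close>.\<close>

lemma rigid_iff_hilbert_PH32: "rigid P \<longleftrightarrow> hilbert_PH (biv P) 3 - hilbert_PH (biv P) 2 = 1 / fls_X ^ 3"
proof -
  have n: "fls_nth (hilbert_PH (biv P) 3) n = of_nat (ph P 3 n)" "fls_nth (hilbert_PH (biv P) 2) n = of_nat (ph P 2 n)" for n
    unfolding hilbert_biv by (simp_all add: nth_hilbert_series dims_vanish)
  have "1 / fls_X ^ 3 = (fls_X_inv ^ 3 :: rat fls)"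
    by (simp add: fls_X_inv_conv_shift_1 field_simps fls_X_power_conv_shift_1 fls_shifted_pow fls_shifted_times_simps)
  then have "hilbert_PH (biv P) 3 - hilbert_PH (biv P) 2 = 1 / fls_X ^ 3 \<longleftrightarrow>
      (\<forall>n. (of_int (int (ph P 3 n) - int (ph P 2 n)) :: rat) = of_int (if n = - 3 then 1 else 0))"
    by (simp add: fls_eq_iff n)
  also have "\<dots> \<longleftrightarrow> (\<forall>n. int (ph P 3 n) - int (ph P 2 n) = (if n = - 3 then 1 else 0))"
    unfolding of_int_eq_iff ..
  also have "\<dots> \<longleftrightarrow> rigid P"
    unfolding rigid_iff_ph1 euler_characteristic[OF h jacobi] by auto
  finally show ?thesis ..
qed

end

text \<open>The ozone condition is compared for nonzero brackets only. If the bracket is 0, every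
  element is central and 0 is the only ozone derivation, while all linear fields are semi-Poisson
  and \<open>rgt\<close> is 1 - 9.\<close>

theorem theorem0p6:
  fixes br :: "'k::{alg_closed_field, field_char_0} bracket"
  assumes "graded_poisson br"
  shows
    "(rgt br = 0 \<longleftrightarrow> (\<forall>\<delta>\<in>Gspd br. poisson_isomorphic (graded_twist br \<delta>) br))
   \<and> (rgt br = 0 \<longleftrightarrow> hilbert_poisson_derivations br = 1 / (1 - fls_X) ^ 3)
   \<and> (rgt br = 0 \<longleftrightarrow> hilbert_PH br 1 = 1 / (1 - fls_X ^ 3))
   \<and> (rgt br = 0 \<longleftrightarrow> hilbert_PH br 1 = hilbert_center br)
   \<and> (rgt br = 0 \<longleftrightarrow>
        (\<forall>\<phi>. poisson_derivation br \<phi> \<longrightarrow>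
          (\<exists>z\<in>poisson_center br. \<exists>a. \<phi> = (\<lambda>f. z * euler f + hamiltonian br a f)) \<and>
          (\<forall>z\<in>poisson_center br. \<forall>z'\<in>poisson_center br. \<forall>a a'.
             \<phi> = (\<lambda>f. z * euler f + hamiltonian br a f) \<longrightarrow>
             \<phi> = (\<lambda>f. z' * euler f + hamiltonian br a' f) \<longrightarrow>
             z = z' \<and> a - a' \<in> poisson_center br)))
   \<and> (br \<noteq> (\<lambda>a b. 0) \<longrightarrow>
        (rgt br = 0 \<longleftrightarrow> (\<forall>\<phi>. ozone_derivation br \<phi> \<longrightarrow> (\<exists>a. \<phi> = hamiltonian br a))))
   \<and> (rgt br = 0 \<longleftrightarrow> unimodular br \<and> (\<exists>\<Omega>. is_potential br \<Omega> \<and> irreducible \<Omega>))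
   \<and> (rgt br = 0 \<longleftrightarrow> hilbert_PH br 3 - hilbert_PH br 2 = 1 / fls_X ^ 3)"
proof -
  obtain P where br: "br = biv P" and h: "\<And>i. homog 2 (P i)" and j: "dot P (curl P) = 0"
    using graded_poisson_biv[OF assms] by blast
  show ?thesis
    unfolding br rgt_0_iff_rigid[of P, OF h]
    by (intro conjI impI rigid_iff_twists[OF h j] rigid_iff_hilbert_derivations[OF h j] rigid_iff_hilbert_PH1[OF h j]
      rigid_iff_hilbert_center[OF h j] rigid_iff_decomposition[OF h j] rigid_iff_ozone[OF h j]
      rigid_iff_unimodular[OF h j] rigid_iff_hilbert_PH32[OF h j])
qed

end
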